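(* Let $\textsc{Input}$ be one of the ten matroid input types. Consider the decision problem MATROID ISOMORPHISM: given $(M,\, \textsc{Input})$ and $(M',\, \textsc{Input})$, are the matroids $M$ and $M'$ isomorphic? If SPANNING SETS $\leq \textsc{Input}$ or INDEPENDENT SETS $\leq \textsc{Input}$, then MATROID ISOMORPHISM is isomorphism-complete, i.e. polynomially equivalent (each polynomially reducible to the other) to GRAPH ISOMORPHISM (given two simple graphs $G$, $G'$, are they isomorphic?).
   Context: All matroids are finite. A matroid $M$ on a ground set $E$ with $|E| = n$ is described to a Turing machine by a word $(M,\, \textsc{Input})$ over a finite alphabet, where $\textsc{Input}$ is one of ten input types. RANK: a list of every subset of $E$ together with its rank. INDEPENDENT SETS, SPANNING SETS, BASES, FLATS, CIRCUITS, HYPERPLANES: a list of all independent sets, spanning sets, bases, flats, circuits, respectively hyperplanes of $M$. NON-SPANNING CIRCUITS: the rank $r(M)$ together with a list of all non-spanning circuits (only the rank if there are none). DEPENDENT HYPERPLANES: the rank $r(M)$ together with a list of all dependent hyperplanes (only the rank if there are none). CYCLIC FLATS: a list of all cyclic flats (flats that are a possibly empty union of circuits), each together with its rank. Subsets of $E$ are encoded by characteristic vectors and encodings are reasonable (no padding), so a description listing $i$ subsets has length $\Theta(ni)$. For input types $I_1, I_2$, we write $I_1 \leq I_2$ if there is a Turing machine running in time polynomial in the length of its input which, for every matroid $M$, given $(M, I_1)$ produces $(M, I_2)$. *)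

theory Defs
  imports Main "HOL-Computational_Algebra.Polynomial"
begin

section \<open>Matroids\<close>

record 'a matroid =
  ground :: "'a set"
  indep :: "'a set set"

definition is_matroid :: "'a matroid \<Rightarrow> bool" where
  "is_matroid M \<longleftrightarrow>
     finite (ground M) \<and>
     indep M \<subseteq> Pow (ground M) \<and>
     {} \<in> indep M \<and>
     (\<forall>X \<in> indep M. \<forall>Y. Y \<subseteq> X \<longrightarrow> Y \<in> indep M) \<and>
     (\<forall>X \<in> indep M. \<forall>Y \<in> indep M. card X < card Y \<longrightarrow>
        (\<exists>e \<in> Y - X. insert e X \<in> indep M))"

definition rank :: "'a matroid \<Rightarrow> 'a set \<Rightarrow> nat" where
  "rank M X = Max (card ` {Y \<in> indep M. Y \<subseteq> X})"

definition rk :: "'a matroid \<Rightarrow> nat" where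
  "rk M = rank M (ground M)"

definition bases :: "'a matroid \<Rightarrow> 'a set set" where
  "bases M = {B \<in> indep M. \<forall>X \<in> indep M. B \<subseteq> X \<longrightarrow> X = B}"

definition spanning_sets :: "'a matroid \<Rightarrow> 'a set set" where
  "spanning_sets M = {X. X \<subseteq> ground M \<and> (\<exists>B \<in> bases M. B \<subseteq> X)}"

definition circuits :: "'a matroid \<Rightarrow> 'a set set" where
  "circuits M = {C. C \<subseteq> ground M \<and> C \<notin> indep M \<and> (\<forall>D. D \<subset> C \<longrightarrow> D \<in> indep M)}"

definition cl :: "'a matroid \<Rightarrow> 'a set \<Rightarrow> 'a set" where
  "cl M X = {e \<in> ground M. rank M (insert e X) = rank M X}"

definition flats :: "'a matroid \<Rightarrow> 'a set set" where
  "flats M = {F. F \<subseteq> ground M \<and> cl M F = F}"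

definition hyperplanes :: "'a matroid \<Rightarrow> 'a set set" where
  "hyperplanes M = {H \<in> flats M. rank M H + 1 = rk M}"

definition non_spanning_circuits :: "'a matroid \<Rightarrow> 'a set set" where
  "non_spanning_circuits M = circuits M - spanning_sets M"

definition dependent_hyperplanes :: "'a matroid \<Rightarrow> 'a set set" where
  "dependent_hyperplanes M = hyperplanes M - indep M"

definition cyclic_flats :: "'a matroid \<Rightarrow> 'a set set" where
  "cyclic_flats M = {F \<in> flats M. \<exists>\<C> \<subseteq> circuits M. F = \<Union>\<C>}"

definition matroid_isomorphic :: "'a matroid \<Rightarrow> 'b matroid \<Rightarrow> bool" where
  "matroid_isomorphic M N \<longleftrightarrow>
     (\<exists>f. bij_betw f (ground M) (ground N) \<and>
          (\<forall>X. X \<subseteq> ground M \<longrightarrow> (X \<in> indep M \<longleftrightarrow> f ` X \<in> indep N)))"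


section \<open>Simple graphs\<close>

record 'a graph =
  verts :: "'a set"
  edges :: "'a set set"

definition is_simple_graph :: "'a graph \<Rightarrow> bool" where
  "is_simple_graph G \<longleftrightarrow>
     finite (verts G) \<and> (\<forall>e \<in> edges G. e \<subseteq> verts G \<and> card e = 2)"

definition graph_isomorphic :: "'a graph \<Rightarrow> 'b graph \<Rightarrow> bool" where
  "graph_isomorphic G H \<longleftrightarrow>
     (\<exists>f. bij_betw f (verts G) (verts H) \<and>
          (\<forall>u \<in> verts G. \<forall>v \<in> verts G. {u, v} \<in> edges G \<longleftrightarrow> {f u, f v} \<in> edges H))"


section \<open>Polynomial-time Turing machines\<close>

datatype sym = Zero | One | Tick | Comma | Amp

type_synonym word = "sym list"

text \<open>Tape cells hold a blank, an input letter, or one of finitely many auxiliary symbols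
  of the machine.\<close>

datatype cell = Blank | Letter sym | Aux nat

datatype move = MoveLeft | Stay | MoveRight

text \<open>Deterministic machines with a fixed number of two-way infinite tapes. Only the values of
  \<open>delta\<close> on states of the machine and lists of \<open>tapes\<close> many of its symbols matter, so that a
  machine satisfying \<open>is_tm\<close> is a finite object.\<close>

record tm =
  tapes :: nat
  states :: "nat set"
  symbols :: "cell set"
  start :: nat
  halt :: nat
  delta :: "nat \<Rightarrow> cell list \<Rightarrow> nat \<times> (cell \<times> move) list"

definition is_tm :: "tm \<Rightarrow> bool" where
  "is_tm T \<longleftrightarrow>
     0 < tapes T \<and>
     finite (states T) \<and> start T \<in> states T \<and> halt T \<in> states T \<and>
     finite (symbols T) \<and> Blank \<in> symbols T \<and> range Letter \<subseteq> symbols T \<and>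
     (\<forall>q \<in> states T. \<forall>xs. length xs = tapes T \<and> set xs \<subseteq> symbols T \<longrightarrow>
        fst (delta T q xs) \<in> states T \<and>
        length (snd (delta T q xs)) = tapes T \<and>
        fst ` set (snd (delta T q xs)) \<subseteq> symbols T)"

text \<open>A tape is its contents together with the position of the head.\<close>

type_synonym tape = "(int \<Rightarrow> cell) \<times> int"

type_synonym config = "nat \<times> tape list"

fun scanned :: "tape \<Rightarrow> cell" where
  "scanned (t, h) = t h"

fun shift :: "move \<Rightarrow> int \<Rightarrow> int" where
  "shift MoveLeft h = h - 1"
| "shift Stay h = h"
| "shift MoveRight h = h + 1"

fun act :: "cell \<times> move \<Rightarrow> tape \<Rightarrow> tape" where
  "act (c, m) (t, h) = (t(h := c), shift m h)"

fun step :: "tm \<Rightarrow> config \<Rightarrow> config" where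
  "step T (q, ts) =
     (if q = halt T then (q, ts)
      else let (q', as) = delta T q (map scanned ts) in (q', map2 act as ts))"

definition blank_tape :: tape where
  "blank_tape = (\<lambda>_. Blank, 0)"

definition word_tape :: "word \<Rightarrow> tape" where
  "word_tape w =
     (\<lambda>i. if 0 \<le> i \<and> i < int (length w) then Letter (w ! nat i) else Blank, 0)"

definition initial :: "tm \<Rightarrow> word \<Rightarrow> config" where
  "initial T w = (start T, word_tape w # replicate (tapes T - 1) blank_tape)"

text \<open>The output is the maximal word of letters that starts at the head of the first tape.\<close>

fun has_output :: "tape \<Rightarrow> word \<Rightarrow> bool" where
  "has_output (t, h) w \<longleftrightarrow>
     (\<forall>i < length w. t (h + int i) = Letter (w ! i)) \<and>
     t (h + int (length w)) \<notin> range Letter"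

definition computes_within :: "tm \<Rightarrow> word \<Rightarrow> word \<Rightarrow> nat \<Rightarrow> bool" where
  "computes_within T w v t \<longleftrightarrow>
     (\<exists>s \<le> t. case (step T ^^ s) (initial T w) of
        (q, ts) \<Rightarrow> q = halt T \<and> has_output (hd ts) v)"

definition poly_time :: "(word \<Rightarrow> word) \<Rightarrow> bool" where
  "poly_time f \<longleftrightarrow>
     (\<exists>T. \<exists>p :: nat poly. is_tm T \<and> (\<forall>w. computes_within T w (f w) (poly p (length w))))"


section \<open>Descriptions of matroids\<close>

datatype input_type =
    RANK
  | INDEPENDENT_SETS
  | SPANNING_SETS
  | BASES
  | FLATS
  | CIRCUITS
  | HYPERPLANES
  | NON_SPANNING_CIRCUITS
  | DEPENDENT_HYPERPLANES
  | CYCLIC_FLATS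

text \<open>The matroids presented to a machine have their elements numbered, that is, they have a
  ground set of the form \<open>{..<n}\<close>, and element \<open>i\<close> is position \<open>i\<close> of a characteristic vector.\<close>

definition numbered_matroid :: "nat matroid \<Rightarrow> bool" where
  "numbered_matroid M \<longleftrightarrow> is_matroid M \<and> ground M = {..<card (ground M)}"

definition char_vector :: "nat \<Rightarrow> nat set \<Rightarrow> word" where
  "char_vector n X = map (\<lambda>i. if i \<in> X then One else Zero) [0..<n]"

text \<open>Ranks are written in unary; being at most \<open>n\<close>, they are no longer than a characteristic
  vector.\<close>

definition rank_word :: "nat \<Rightarrow> word" where
  "rank_word r = replicate r Tick"

text \<open>Every description begins with the characteristic vector of the ground set: a list of subsets
  may be empty (such as the circuits of a free matroid) and then does not reveal \<open>n\<close>.\<close>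

definition list_word :: "nat matroid \<Rightarrow> nat set list \<Rightarrow> word" where
  "list_word M Xs =
     (let n = card (ground M) in
        char_vector n (ground M) @ concat (map (\<lambda>X. Comma # char_vector n X) Xs))"

definition rank_and_list_word :: "nat matroid \<Rightarrow> nat set list \<Rightarrow> word" where
  "rank_and_list_word M Xs =
     (let n = card (ground M) in
        char_vector n (ground M) @ rank_word (rk M) @
        concat (map (\<lambda>X. Comma # char_vector n X) Xs))"

definition list_with_ranks_word :: "nat matroid \<Rightarrow> nat set list \<Rightarrow> word" where
  "list_with_ranks_word M Xs =
     (let n = card (ground M) in
        char_vector n (ground M) @
        concat (map (\<lambda>X. Comma # char_vector n X @ rank_word (rank M X)) Xs))"

definition listings :: "'a set \<Rightarrow> 'a list set" where
  "listings A = {xs. distinct xs \<and> set xs = A}"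

text \<open>The sets may be listed in any order, so a matroid has several descriptions of each type.\<close>

fun descriptions :: "input_type \<Rightarrow> nat matroid \<Rightarrow> word set" where
  "descriptions RANK M = list_with_ranks_word M ` listings (Pow (ground M))"
| "descriptions INDEPENDENT_SETS M = list_word M ` listings (indep M)"
| "descriptions SPANNING_SETS M = list_word M ` listings (spanning_sets M)"
| "descriptions BASES M = list_word M ` listings (bases M)"
| "descriptions FLATS M = list_word M ` listings (flats M)"
| "descriptions CIRCUITS M = list_word M ` listings (circuits M)"
| "descriptions HYPERPLANES M = list_word M ` listings (hyperplanes M)"
| "descriptions NON_SPANNING_CIRCUITS M =
     rank_and_list_word M ` listings (non_spanning_circuits M)"
| "descriptions DEPENDENT_HYPERPLANES M =
     rank_and_list_word M ` listings (dependent_hyperplanes M)"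
| "descriptions CYCLIC_FLATS M = list_with_ranks_word M ` listings (cyclic_flats M)"

definition input_le :: "input_type \<Rightarrow> input_type \<Rightarrow> bool" (infix \<open>\<preceq>\<close> 50) where
  "I \<preceq> J \<longleftrightarrow>
     (\<exists>f. poly_time f \<and>
          (\<forall>M. numbered_matroid M \<longrightarrow> (\<forall>w \<in> descriptions I M. f w \<in> descriptions J M)))"


section \<open>Decision problems\<close>

text \<open>Reductions are required to be correct on the words that encode instances; on all other words
  they only have to respect the time bound.\<close>

record problem =
  instances :: "word set"
  yes_instances :: "word set"

definition poly_reducible :: "problem \<Rightarrow> problem \<Rightarrow> bool" (infix \<open>\<le>\<^sub>p\<close> 50) where
  "P \<le>\<^sub>p Q \<longleftrightarrow>
     (\<exists>f. poly_time f \<and>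
          (\<forall>w \<in> instances P.
             f w \<in> instances Q \<and> (w \<in> yes_instances P \<longleftrightarrow> f w \<in> yes_instances Q)))"

definition matroid_isomorphism :: "input_type \<Rightarrow> problem" where
  "matroid_isomorphism I =
     \<lparr> instances = {w @ Amp # w' | w w' M M'.
         numbered_matroid M \<and> w \<in> descriptions I M \<and>
         numbered_matroid M' \<and> w' \<in> descriptions I M'},
       yes_instances = {w @ Amp # w' | w w' M M'.
         numbered_matroid M \<and> w \<in> descriptions I M \<and>
         numbered_matroid M' \<and> w' \<in> descriptions I M' \<and>
         matroid_isomorphic M M'} \<rparr>"

definition numbered_graph :: "nat graph \<Rightarrow> bool" where
  "numbered_graph G \<longleftrightarrow> is_simple_graph G \<and> verts G = {..<card (verts G)}"

text \<open>Graphs are encoded by their adjacency matrices.\<close>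

definition graph_word :: "nat graph \<Rightarrow> word" where
  "graph_word G =
     (let n = card (verts G) in
        concat (map (\<lambda>u. Comma # char_vector n {v. {u, v} \<in> edges G}) [0..<n]))"

definition graph_isomorphism :: problem where
  "graph_isomorphism =
     \<lparr> instances = {graph_word G @ Amp # graph_word G' | G G'.
         numbered_graph G \<and> numbered_graph G'},
       yes_instances = {graph_word G @ Amp # graph_word G' | G G'.
         numbered_graph G \<and> numbered_graph G' \<and> graph_isomorphic G G'} \<rparr>"

definition isomorphism_complete :: "problem \<Rightarrow> bool" where
  "isomorphism_complete P \<longleftrightarrow> P \<le>\<^sub>p graph_isomorphism \<and> graph_isomorphism \<le>\<^sub>p P"

end

theory Submission imports Defs begin

text \<open>From matroids to graphs: in each of the ten input types a matroid is described by a family of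
  sets with labels (ranks) that determines it. This labelled family is encoded by an incidence graph
  whose only triangle marks the side of the elements and in which labels are numbers of pendant
  vertices. Its vertices can be taken to be the positions of the description, so that the graph is
  computable from any listing of the family.

  From graphs to matroids: add a universal and an isolated vertex to a graph and replace each vertex
  by two elements; the doubled edges are 4-element sets any two of which share at most two
  elements, hence they are the circuit-hyperplanes of a sparse paving matroid of rank 4. It
  determines the graph, and its independent sets, of size at most 4, can be listed in polynomial time. The
  dual matroid serves for spanning sets.

  Polynomial time: programs on stacks compile to Turing machines. The functions they compute in
  polynomial time are closed under bounded recursion on words, and also under composition with any
  polynomial-time function, because a program can simulate its machine with two stacks per tape.\<close>

section \<open>Stack programs\<close>

text \<open>The hypothesis on \<open>I\<close> provides nothing but some machine, and the reduction
  from graphs has to run it after its own computation. Programs must therefore be able to simulate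
  arbitrary machines and not only be compiled into machines. In the opposite direction, an empty set
  in the family and the rank in a header produce isolated vertices only; they are told apart by
  counting, because no type has both. Doubling the vertices is forced: two edges with a common
  vertex are 2-sets that meet in 2 - 1 elements, which a sparse paving matroid forbids, whereas
  doubled edges meet in 2 = 4 - 2 elements. A bijection of the ground sets need not respect the
  doubling. The universal vertex makes it do so, since the pairs become intersections and
  differences of doubled edges. The isolated vertex keeps at least 4 elements in the ground set, and
  more than 4 as soon as there is a doubled edge; hence the complements of doubled edges are
  nonempty and define a dual of the same kind.\<close>

type_synonym regs = "nat \<Rightarrow> cell list"

definition top_cell :: "cell list \<Rightarrow> cell" where
  "top_cell xs = (case xs of [] \<Rightarrow> Blank | x # _ \<Rightarrow> x)"

lemma top_cell_simps [simp]: "top_cell [] = Blank" "top_cell (x # xs) = x"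
  by (simp_all add: top_cell_def)

abbreviation tops :: "nat list \<Rightarrow> regs \<Rightarrow> cell list" where
  "tops rs s \<equiv> map (\<lambda>r. top_cell (s r)) rs"

text \<open>Tests may be arbitrary predicates: they see one cell of each listed stack, and a machine
  has finitely many symbols, so every test becomes a finite table. An empty stack shows
  \<open>Blank\<close>, hence a stack with a blank on top looks empty.\<close>

datatype com =
    Skip
  | Push nat cell
  | Pop nat
  | Dup nat nat
  | Seq com com (infixr \<open>;;\<close> 60)
  | If "nat list" "cell list \<Rightarrow> bool" com com
  | While "nat list" "cell list \<Rightarrow> bool" com

text \<open>The number is an upper bound of the running time, so estimates may be rounded up freely.
  The constants are steps of the compiled machine: a push moves and then writes, and each transfer
  of control costs one step. \<open>Dup\<close> needs two different stacks, since the head that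
  writes has by then left the cell on top of its own stack.\<close>

inductive exec :: "com \<Rightarrow> regs \<Rightarrow> nat \<Rightarrow> regs \<Rightarrow> bool" where
  Skip: "exec Skip s t s"
| Push: "2 \<le> t \<Longrightarrow> exec (Push r c) s t (s(r := c # s r))"
| Pop: "1 \<le> t \<Longrightarrow> exec (Pop r) s t (s(r := tl (s r)))"
| Dup: "2 \<le> t \<Longrightarrow> r \<noteq> r' \<Longrightarrow> exec (Dup r r') s t (s(r' := top_cell (s r) # s r'))"
| Seq: "exec c s t s' \<Longrightarrow> exec d s' t' s'' \<Longrightarrow> t + t' + 3 \<le> u \<Longrightarrow> exec (c ;; d) s u s''"
| IfTrue: "P (tops rs s) \<Longrightarrow> exec c s t s' \<Longrightarrow> t + 2 \<le> u \<Longrightarrow> exec (If rs P c d) s u s'"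
| IfFalse: "\<not> P (tops rs s) \<Longrightarrow> exec d s t s' \<Longrightarrow> t + 2 \<le> u \<Longrightarrow> exec (If rs P c d) s u s'"
| WhileFalse: "\<not> P (tops rs s) \<Longrightarrow> 1 \<le> t \<Longrightarrow> exec (While rs P c) s t s"
| WhileTrue: "P (tops rs s) \<Longrightarrow> exec c s t s' \<Longrightarrow> exec (While rs P c) s' t' s'' \<Longrightarrow> t + t' + 2 \<le> u \<Longrightarrow>
    exec (While rs P c) s u s''"

lemma exec_mono: "exec c s t s' \<Longrightarrow> t \<le> u \<Longrightarrow> exec c s u s'"
proof (induction arbitrary: u rule: exec.induct)
  case (Seq c s t s' d t' s'' u')
  show ?case by (rule exec.Seq[OF Seq.IH(1)[OF le_refl] Seq.IH(2)[OF le_refl]]) (use Seq in linarith)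
next
  case (IfTrue P rs s c t s' u' d)
  show ?case by (rule exec.IfTrue[where P = P, OF IfTrue.hyps(1) IfTrue.IH[OF le_refl]]) (use IfTrue in linarith)
next
  case (IfFalse P rs s d t s' u' c)
  show ?case by (rule exec.IfFalse[where P = P, OF IfFalse.hyps(1) IfFalse.IH[OF le_refl]]) (use IfFalse in linarith)
next
  case (WhileTrue P rs s c t s' t' s'' u')
  show ?case
    by (rule exec.WhileTrue[where P = P, OF WhileTrue.hyps(1) WhileTrue.IH(1)[OF le_refl] WhileTrue.IH(2)[OF le_refl]])
      (use WhileTrue in linarith)
qed (auto intro: exec.intros)

text \<open>One unit of time adds at most one cell. Time bounds thus yield the length bounds on
  which compositions depend.\<close>

lemma exec_length: "exec c s t s' \<Longrightarrow> length (s' r) \<le> length (s r) + t"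
  by (induction arbitrary: rule: exec.induct) auto

text \<open>Register \<open>r\<close> becomes tape \<open>r\<close>. \<open>Skip\<close> counts as
  one register so that the compiled machine always has a tape.\<close>

fun reg_bound :: "com \<Rightarrow> nat" where
  "reg_bound Skip = 1"
| "reg_bound (Push r c) = Suc r"
| "reg_bound (Pop r) = Suc r"
| "reg_bound (Dup r r') = Suc (max r r')"
| "reg_bound (c ;; d) = max (reg_bound c) (reg_bound d)"
| "reg_bound (If rs P c d) = Max (set (map Suc rs) \<union> {reg_bound c, reg_bound d})"
| "reg_bound (While rs P c) = Max (set (map Suc rs) \<union> {reg_bound c})"

fun cells :: "com \<Rightarrow> cell set" where
  "cells (Push r c) = {c}"
| "cells (c ;; d) = cells c \<union> cells d"
| "cells (If rs P c d) = cells c \<union> cells d"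
| "cells (While rs P c) = cells c"
| "cells _ = {}"

lemma finite_cells: "finite (cells c)"
  by (induction c) auto

lemma reg_bound_pos: "0 < reg_bound c"
  by (induction c) (auto simp: Max_gr_iff)

subsection \<open>Compilation to Turing machines\<close>

text \<open>Only positions relative to the head are fixed. Pushes and pops let the stack drift along
  the two-way infinite tape, and its contents never have to be shifted.\<close>

definition stack_tape :: "tape \<Rightarrow> cell list \<Rightarrow> bool" where
  "stack_tape th xs \<longleftrightarrow>
     (\<forall>p. fst th p =
        (if snd th \<le> p \<and> p < snd th + int (length xs) then xs ! nat (p - snd th) else Blank))"

lemma stack_tape_scanned: "stack_tape th xs \<Longrightarrow> scanned th = top_cell xs"
  by (cases th; cases xs) (simp_all add: stack_tape_def)

lemma act_stay [simp]: "act (scanned th, Stay) th = th"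
  by (cases th) simp

lemma stack_tape_pop:
  assumes "stack_tape th xs"
  shows "stack_tape (act (Blank, MoveRight) th) (tl xs)"
proof (cases th)
  case (Pair t h)
  have "nat (p - h) = Suc (nat (p - h - 1))" if "h + 1 \<le> p" for p using that by auto
  with assms Pair show ?thesis by (cases xs) (auto simp: stack_tape_def algebra_simps)
qed

lemma stack_tape_push:
  assumes "stack_tape th xs"
  shows "stack_tape (act (x, Stay) (act (scanned th, MoveLeft) th)) (x # xs)"
proof (cases th)
  case (Pair t h)
  have "nat (p + 1 - h) = Suc (nat (p - h))" if "h \<le> p" for p using that by auto
  with assms Pair show ?thesis by (auto simp: stack_tape_def algebra_simps)
qed

text \<open>The tapes \<open>ts\<close> are arbitrary up to the stacks that they hold, because a
  machine has to start wherever another one has stopped.\<close>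

definition realises :: "tm \<Rightarrow> com \<Rightarrow> bool" where
  "realises T c \<longleftrightarrow>
     (\<forall>s t s' ts. exec c s t s' \<longrightarrow> list_all2 stack_tape ts (map s [0..<tapes T]) \<longrightarrow>
        (\<exists>u \<le> t. \<exists>ts'. (step T ^^ u) (start T, ts) = (halt T, ts') \<and>
           list_all2 stack_tape ts' (map s' [0..<tapes T])))"

definition idle :: "cell list \<Rightarrow> (cell \<times> move) list" where
  "idle xs = map (\<lambda>x. (x, Stay)) xs"

lemma map2_act_idle: "map2 act (idle (map scanned ts)) ts = ts"
  by (induction ts) (simp_all add: idle_def)

lemma list_all2_stack_scanned:
  "list_all2 stack_tape ts (map s [0..<k]) \<Longrightarrow> i < k \<Longrightarrow> map scanned ts ! i = top_cell (s i)"
  by (auto simp: list_all2_conv_all_nth stack_tape_scanned)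

lemma list_all2_stack_tops:
  assumes "list_all2 stack_tape ts (map s [0..<k])" "\<forall>r \<in> set rs. r < k"
  shows "map (\<lambda>r. map scanned ts ! r) rs = tops rs s"
  using assms list_all2_stack_scanned by (intro map_cong) auto

text \<open>The new states are 0 (start) and 1 (halt); a state \<open>q\<close> of \<open>T\<close> becomes \<open>2 * q + 2\<close> and a state
  \<open>q\<close> of \<open>T'\<close> becomes \<open>2 * q + 3\<close>. The tests \<open>enter\<close> and \<open>leave\<close> give the successors of the start
  state and of the halting state of \<open>T\<close>. Sequential composition, branching and loops are all special
  cases.\<close>

definition join :: "tm \<Rightarrow> tm \<Rightarrow> (cell list \<Rightarrow> nat) \<Rightarrow> nat \<Rightarrow> tm" where
  "join T T' enter leave =
     \<lparr>tapes = tapes T,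
      states = {0, 1} \<union> (\<lambda>q. 2 * q + 2) ` states T \<union> (\<lambda>q. 2 * q + 3) ` states T',
      symbols = symbols T,
      start = 0,
      halt = 1,
      delta = (\<lambda>q xs.
        if q = 0 then (enter xs, idle xs)
        else if q = 1 then (1, idle xs)
        else if even q then
          (let p = (q - 2) div 2 in
            if p = halt T then (leave, idle xs)
            else (2 * fst (delta T p xs) + 2, snd (delta T p xs)))
        else
          (let p = (q - 3) div 2 in
            if p = halt T' then (1, idle xs)
            else (2 * fst (delta T' p xs) + 3, snd (delta T' p xs))))\<rparr>"

lemma join_sel [simp]:
  "tapes (join T T' e l) = tapes T" "symbols (join T T' e l) = symbols T"
  "start (join T T' e l) = 0" "halt (join T T' e l) = 1"
  by (simp_all add: join_def)

lemma is_tm_join: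
  assumes "is_tm T" "is_tm T'" "tapes T = tapes T'" "symbols T = symbols T'"
    and "\<And>xs. e xs \<in> {1, 2 * start T + 2, 2 * start T' + 3}" "l \<in> {0, 1, 2 * start T' + 3}"
  shows "is_tm (join T T' e l)"
proof -
  let ?J = "join T T' e l"
  have *: "fst (delta ?J q xs) \<in> states ?J \<and> length (snd (delta ?J q xs)) = tapes ?J \<and>
      fst ` set (snd (delta ?J q xs)) \<subseteq> symbols ?J"
    if q: "q \<in> states ?J" and xs: "length xs = tapes ?J" "set xs \<subseteq> symbols ?J" for q xs
  proof -
    have st: "start T \<in> states T" "start T' \<in> states T'" using assms(1,2) by (auto simp: is_tm_def)
    have idle: "length (idle xs) = tapes ?J" "fst ` set (idle xs) \<subseteq> symbols ?J"
      using xs by (auto simp: idle_def)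
    consider "q = 0" | "q = 1" | p where "q = 2 * p + 2" "p \<in> states T"
      | p where "q = 2 * p + 3" "p \<in> states T'"
      using q by (auto simp: join_def)
    then show ?thesis
    proof cases
      case 1
      then show ?thesis using idle assms(5)[of xs] st by (auto simp: join_def)
    next
      case 2
      then show ?thesis using idle by (auto simp: join_def)
    next
      case (3 p)
      then have "fst (delta T p xs) \<in> states T \<and> length (snd (delta T p xs)) = tapes T \<and>
          fst ` set (snd (delta T p xs)) \<subseteq> symbols T"
        using assms(1) xs by (auto simp: is_tm_def)
      with 3 idle assms(6) st show ?thesis by (auto simp: join_def Let_def)
    next
      case (4 p)
      then have "fst (delta T' p xs) \<in> states T' \<and> length (snd (delta T' p xs)) = tapes T' \<and>
          fst ` set (snd (delta T' p xs)) \<subseteq> symbols T'"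
        using assms xs by (auto simp: is_tm_def)
      with 4 idle assms(3,4) show ?thesis by (auto simp: join_def Let_def)
    qed
  qed
  show ?thesis
    using assms(1,2) * unfolding is_tm_def by (simp add: join_def)
qed

lemma step_halt: "(step T ^^ t) (halt T, ts) = (halt T, ts)"
  by (induction t) auto

lemma step_join_start:
  "step (join T T' e l) (0, ts) = (e (map scanned ts), ts)"
  by (simp add: map2_act_idle) (simp add: join_def map2_act_idle)

lemma step_join_leave:
  "step (join T T' e l) (2 * halt T + 2, ts) = (l, ts)"
  "step (join T T' e l) (2 * halt T' + 3, ts) = (1, ts)"
  by (simp_all add: join_def map2_act_idle)

text \<open>The bound is an inequality because \<open>T\<close> idles once it has halted, whereas
  the joined machine can leave at once.\<close>

lemma steps_join_left:
  assumes "(step T ^^ t) (q, ts) = (halt T, ts')"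
  shows "\<exists>u \<le> t. (step (join T T' e l) ^^ u) (2 * q + 2, ts) = (2 * halt T + 2, ts')"
  using assms
proof (induction t arbitrary: q ts)
  case (Suc t)
  show ?case
  proof (cases "q = halt T")
    case True
    then have "ts' = ts" using Suc.prems step_halt[of "Suc t" T ts] by (simp only: prod.inject)
    with True show ?thesis by (intro exI[of _ 0]) simp
  next
    case False
    obtain q1 ts1 where 1: "step T (q, ts) = (q1, ts1)" by (cases "step T (q, ts)")
    then have J: "step (join T T' e l) (2 * q + 2, ts) = (2 * q1 + 2, ts1)"
      using False by (auto simp: join_def split: prod.splits)
    have "(step T ^^ t) (q1, ts1) = (halt T, ts')"
      using Suc.prems 1 by (simp only: funpow_Suc_right comp_apply)
    then obtain u where "u \<le> t" "(step (join T T' e l) ^^ u) (2 * q1 + 2, ts1) = (2 * halt T + 2, ts')"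
      using Suc.IH by blast
    then show ?thesis
      by (intro exI[of _ "Suc u"]) (simp only: funpow_Suc_right comp_apply J Suc_le_mono simp_thms)
  qed
qed auto

lemma steps_join_right:
  assumes "(step T' ^^ t) (q, ts) = (halt T', ts')"
  shows "\<exists>u \<le> t. (step (join T T' e l) ^^ u) (2 * q + 3, ts) = (2 * halt T' + 3, ts')"
  using assms
proof (induction t arbitrary: q ts)
  case (Suc t)
  show ?case
  proof (cases "q = halt T'")
    case True
    then have "ts' = ts" using Suc.prems step_halt[of "Suc t" T' ts] by (simp only: prod.inject)
    with True show ?thesis by (intro exI[of _ 0]) simp
  next
    case False
    obtain q1 ts1 where 1: "step T' (q, ts) = (q1, ts1)" by (cases "step T' (q, ts)")
    then have J: "step (join T T' e l) (2 * q + 3, ts) = (2 * q1 + 3, ts1)"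
      using False by (auto simp: join_def split: prod.splits)
    have "(step T' ^^ t) (q1, ts1) = (halt T', ts')"
      using Suc.prems 1 by (simp only: funpow_Suc_right comp_apply)
    then obtain u where "u \<le> t" "(step (join T T' e l) ^^ u) (2 * q1 + 3, ts1) = (2 * halt T' + 3, ts')"
      using Suc.IH by blast
    then show ?thesis
      by (intro exI[of _ "Suc u"]) (simp only: funpow_Suc_right comp_apply J Suc_le_mono simp_thms)
  qed
qed auto

lemma funpow_one: "((f :: 'a \<Rightarrow> 'a) ^^ 1) x = f x"
  by simp

lemma funpow_step_append:
  "(step T ^^ a) x = y \<Longrightarrow> (step T ^^ b) y = z \<Longrightarrow> (step T ^^ (b + a)) x = z"
  by (simp add: funpow_add)

lemma realises_Seq:
  assumes "realises T c" "realises T' d" "tapes T = tapes T'"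
  shows "realises (join T T' (\<lambda>_. 2 * start T + 2) (2 * start T' + 3)) (c ;; d)"
  unfolding realises_def
proof (intro allI impI)
  let ?J = "join T T' (\<lambda>_. 2 * start T + 2) (2 * start T' + 3)"
  fix s t s' ts
  assume "exec (c ;; d) s t s'" and ts: "list_all2 stack_tape ts (map s [0..<tapes ?J])"
  then obtain s1 t1 t2 where 1: "exec c s t1 s1" "exec d s1 t2 s'" "t1 + t2 + 3 \<le> t"
    by (auto elim: exec.cases)
  obtain u1 ts1 where u1: "u1 \<le> t1" "(step T ^^ u1) (start T, ts) = (halt T, ts1)"
      "list_all2 stack_tape ts1 (map s1 [0..<tapes T])"
    using assms(1) 1 ts unfolding realises_def by fastforce
  obtain u2 ts2 where u2: "u2 \<le> t2" "(step T' ^^ u2) (start T', ts1) = (halt T', ts2)"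
      "list_all2 stack_tape ts2 (map s' [0..<tapes T])"
    using assms(2,3) 1 u1(3) unfolding realises_def by fastforce
  obtain v1 where v1: "v1 \<le> u1" "(step ?J ^^ v1) (2 * start T + 2, ts) = (2 * halt T + 2, ts1)"
    using steps_join_left[OF u1(2)] by blast
  obtain v2 where v2: "v2 \<le> u2" "(step ?J ^^ v2) (2 * start T' + 3, ts1) = (2 * halt T' + 3, ts2)"
    using steps_join_right[OF u2(2)] by blast
  have A: "(step ?J ^^ 1) (0, ts) = (2 * start T + 2, ts)" by (simp only: funpow_one step_join_start)
  have B: "(step ?J ^^ 1) (2 * halt T + 2, ts1) = (2 * start T' + 3, ts1)"
    by (simp only: funpow_one step_join_leave)
  have C: "(step ?J ^^ 1) (2 * halt T' + 3, ts2) = (1, ts2)"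
    by (simp only: funpow_one step_join_leave)
  note funpow_step_append[OF funpow_step_append[OF funpow_step_append[OF
        funpow_step_append[OF A v1(2)] B] v2(2)] C]
  then show "\<exists>u \<le> t. \<exists>ts'. (step ?J ^^ u) (start ?J, ts) = (halt ?J, ts') \<and>
      list_all2 stack_tape ts' (map s' [0..<tapes ?J])"
    using u2(3) v1(1) v2(1) u1(1) u2(1) 1(3)
    by (intro exI[of _ "1 + (v2 + (1 + (v1 + 1)))"]) auto
qed

lemma realises_If:
  assumes "realises T c" "realises T' d" "tapes T = tapes T'" "\<forall>r \<in> set rs. r < tapes T"
  shows "realises (join T T'
    (\<lambda>xs. if P (map (\<lambda>r. xs ! r) rs) then 2 * start T + 2 else 2 * start T' + 3) 1) (If rs P c d)"
  (is "realises ?J _")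
  unfolding realises_def
proof (intro allI impI)
  fix s t s' ts
  assume ex: "exec (If rs P c d) s t s'" and ts: "list_all2 stack_tape ts (map s [0..<tapes ?J])"
  have tops: "map (\<lambda>r. map scanned ts ! r) rs = tops rs s"
    using list_all2_stack_tops ts assms(4) by simp
  show "\<exists>u \<le> t. \<exists>ts'. (step ?J ^^ u) (start ?J, ts) = (halt ?J, ts') \<and>
      list_all2 stack_tape ts' (map s' [0..<tapes ?J])"
  proof (cases "P (tops rs s)")
    case True
    then obtain t1 where 1: "exec c s t1 s'" "t1 + 2 \<le> t" using ex by (auto elim: exec.cases)
    obtain u1 ts1 where u1: "u1 \<le> t1" "(step T ^^ u1) (start T, ts) = (halt T, ts1)"
        "list_all2 stack_tape ts1 (map s' [0..<tapes T])"
      using assms(1) 1 ts unfolding realises_def by fastforce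
    obtain v1 where v1: "v1 \<le> u1" "(step ?J ^^ v1) (2 * start T + 2, ts) = (2 * halt T + 2, ts1)"
      using steps_join_left[OF u1(2)] by blast
    have A: "(step ?J ^^ 1) (0, ts) = (2 * start T + 2, ts)"
      using True by (simp only: funpow_one step_join_start tops if_True)
    have B: "(step ?J ^^ 1) (2 * halt T + 2, ts1) = (1, ts1)"
      by (simp only: funpow_one step_join_leave)
    note funpow_step_append[OF funpow_step_append[OF A v1(2)] B]
    then show ?thesis using u1 v1(1) 1(2) by (intro exI[of _ "1 + (v1 + 1)"]) auto
  next
    case False
    then obtain t1 where 1: "exec d s t1 s'" "t1 + 2 \<le> t" using ex by (auto elim: exec.cases)
    obtain u1 ts1 where u1: "u1 \<le> t1" "(step T' ^^ u1) (start T', ts) = (halt T', ts1)"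
        "list_all2 stack_tape ts1 (map s' [0..<tapes T])"
      using assms(2,3) 1 ts unfolding realises_def by fastforce
    obtain v1 where v1: "v1 \<le> u1" "(step ?J ^^ v1) (2 * start T' + 3, ts) = (2 * halt T' + 3, ts1)"
      using steps_join_right[OF u1(2)] by blast
    have A: "(step ?J ^^ 1) (0, ts) = (2 * start T' + 3, ts)"
      using False by (simp only: funpow_one step_join_start tops if_False)
    have B: "(step ?J ^^ 1) (2 * halt T' + 3, ts1) = (1, ts1)"
      by (simp only: funpow_one step_join_leave)
    note funpow_step_append[OF funpow_step_append[OF A v1(2)] B]
    then show ?thesis using u1 v1(1) 1(2) by (intro exI[of _ "1 + (v1 + 1)"]) auto
  qed
qed

text \<open>A loop is a join in which the body is left towards the start state 0, where the test is
  made again.\<close>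

lemma realises_While:
  assumes "realises T c" "\<forall>r \<in> set rs. r < tapes T"
  shows "realises (join T T' (\<lambda>xs. if P (map (\<lambda>r. xs ! r) rs) then 2 * start T + 2 else 1) 0)
    (While rs P c)"
  (is "realises ?J _")
  unfolding realises_def
proof (intro allI impI)
  fix s t s' ts
  assume "exec (While rs P c) s t s'" "list_all2 stack_tape ts (map s [0..<tapes ?J])"
  then show "\<exists>u \<le> t. \<exists>ts'. (step ?J ^^ u) (start ?J, ts) = (halt ?J, ts') \<and>
      list_all2 stack_tape ts' (map s' [0..<tapes ?J])"
  proof (induction "While rs P c" s t s' arbitrary: ts rule: exec.induct)
    case (WhileFalse s t)
    then have "map (\<lambda>r. map scanned ts ! r) rs = tops rs s"
      using list_all2_stack_tops[of ts s "tapes ?J" rs] assms(2) by (simp only: join_sel)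
    then have "(step ?J ^^ 1) (0, ts) = (1, ts)"
      using WhileFalse.hyps(1) by (simp only: funpow_one step_join_start if_False)
    then show ?case using WhileFalse by (intro exI[of _ 1]) auto
  next
    case (WhileTrue s t s1 t' s2 u)
    have tops: "map (\<lambda>r. map scanned ts ! r) rs = tops rs s"
      using list_all2_stack_tops WhileTrue.prems assms(2) by simp
    obtain u1 ts1 where u1: "u1 \<le> t" "(step T ^^ u1) (start T, ts) = (halt T, ts1)"
        "list_all2 stack_tape ts1 (map s1 [0..<tapes T])"
      using assms(1) WhileTrue.hyps(2) WhileTrue.prems unfolding realises_def by fastforce
    obtain v1 where v1: "v1 \<le> u1" "(step ?J ^^ v1) (2 * start T + 2, ts) = (2 * halt T + 2, ts1)"
      using steps_join_left[OF u1(2)] by blast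
    obtain v2 ts2 where v2: "v2 \<le> t'" "(step ?J ^^ v2) (0, ts1) = (1, ts2)"
        "list_all2 stack_tape ts2 (map s2 [0..<tapes T])"
      using WhileTrue.hyps(5)[of ts1] u1(3) by auto
    have A: "(step ?J ^^ 1) (0, ts) = (2 * start T + 2, ts)"
      using WhileTrue.hyps(1) by (simp only: funpow_one step_join_start tops if_True)
    have B: "(step ?J ^^ 1) (2 * halt T + 2, ts1) = (0, ts1)"
      by (simp only: funpow_one step_join_leave)
    note funpow_step_append[OF funpow_step_append[OF funpow_step_append[OF A v1(2)] B] v2(2)]
    then show ?case using u1 v1(1) v2 WhileTrue.hyps
      by (intro exI[of _ "v2 + (1 + (v1 + 1))"]) auto
  qed
qed

text \<open>A machine without branching: the state merely counts the steps, and \<open>f\<close>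
  prescribes the action on each tape.\<close>

definition line_tm :: "nat \<Rightarrow> cell set \<Rightarrow> nat \<Rightarrow> (nat \<Rightarrow> cell list \<Rightarrow> nat \<Rightarrow> cell \<times> move) \<Rightarrow> tm" where
  "line_tm k S n f =
     \<lparr>tapes = k, states = {..n}, symbols = S, start = 0, halt = n,
      delta = (\<lambda>q xs. (min n (Suc q), map (f q xs) [0..<k]))\<rparr>"

lemma line_tm_sel [simp]:
  "tapes (line_tm k S n f) = k" "symbols (line_tm k S n f) = S"
  "start (line_tm k S n f) = 0" "halt (line_tm k S n f) = n"
  by (simp_all add: line_tm_def)

lemma is_tm_line_tm:
  assumes "0 < k" "finite S" "Blank \<in> S" "range Letter \<subseteq> S"
    and "\<And>q xs i. length xs = k \<Longrightarrow> set xs \<subseteq> S \<Longrightarrow> i < k \<Longrightarrow> fst (f q xs i) \<in> S"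
  shows "is_tm (line_tm k S n f)"
  using assms by (auto simp: is_tm_def line_tm_def)

lemma step_line_tm:
  assumes "q < n" "length ts = k"
  shows "step (line_tm k S n f) (q, ts) =
    (Suc q, map (\<lambda>i. act (f q (map scanned ts) i) (ts ! i)) [0..<k])"
  using assms by (auto simp: line_tm_def intro!: nth_equalityI)

lemma realises_line1:
  assumes "\<And>s t s'. exec c s t s' \<Longrightarrow> 1 \<le> t"
    and "\<And>s t s' ts i. exec c s t s' \<Longrightarrow> list_all2 stack_tape ts (map s [0..<k]) \<Longrightarrow> i < k \<Longrightarrow>
      stack_tape (act (f 0 (map scanned ts) i) (ts ! i)) (s' i)"
  shows "realises (line_tm k S 1 f) c"
  unfolding realises_def
proof (intro allI impI)
  let ?T = "line_tm k S 1 f"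
  fix s t s' ts
  assume *: "exec c s t s'" "list_all2 stack_tape ts (map s [0..<tapes ?T])"
  let ?ts = "map (\<lambda>i. act (f 0 (map scanned ts) i) (ts ! i)) [0..<k]"
  have "length ts = k" using *(2) by (auto dest: list_all2_lengthD)
  then have "(step ?T ^^ 1) (start ?T, ts) = (halt ?T, ?ts)"
    by (simp only: funpow_one line_tm_sel step_line_tm) simp
  moreover have "list_all2 stack_tape ?ts (map s' [0..<tapes ?T])"
    using assms(2)[OF *(1)] *(2) by (auto simp: list_all2_conv_all_nth)
  ultimately show "\<exists>u \<le> t. \<exists>ts'. (step ?T ^^ u) (start ?T, ts) = (halt ?T, ts') \<and>
      list_all2 stack_tape ts' (map s' [0..<tapes ?T])"
    using assms(1)[OF *(1)] by blast
qed

text \<open>The head of tape \<open>r\<close> first moves left and writes one step later, when it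
  scans a cell outside the old stack. So the symbol \<open>h xs\<close> must not depend on what tape
  \<open>r\<close> shows; this is the third assumption.\<close>

lemma realises_push:
  assumes "\<And>s t s'. exec c s t s' \<Longrightarrow> 2 \<le> t \<and> s' = s(r := g s # s r)"
    and "\<And>s ts. list_all2 stack_tape ts (map s [0..<k]) \<Longrightarrow> g s = h (map scanned ts)"
    and "\<And>xs x. h (xs[r := x]) = h xs"
  shows "realises (line_tm k S 2 (\<lambda>q xs i. if i = r then if q = 0 then (xs ! i, MoveLeft) else (h xs, Stay)
      else (xs ! i, Stay))) c"
  (is "realises ?T c")
  unfolding realises_def
proof (intro allI impI)
  fix s t s' ts
  assume *: "exec c s t s'" "list_all2 stack_tape ts (map s [0..<tapes ?T])"
  have len: "length ts = k" using *(2) by (auto dest: list_all2_lengthD)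
  have s': "2 \<le> t" "s' = s(r := g s # s r)" using assms(1)[OF *(1)] by auto
  let ?f = "\<lambda>q xs i. if i = r then if q = (0::nat) then (xs ! i, MoveLeft) else (h xs, Stay)
      else (xs ! i, Stay)"
  let ?ts1 = "map (\<lambda>i. act (?f 0 (map scanned ts) i) (ts ! i)) [0..<k]"
  let ?ts2 = "map (\<lambda>i. act (?f 1 (map scanned ?ts1) i) (?ts1 ! i)) [0..<k]"
  have ts1: "?ts1 = ts[r := act (scanned (ts ! r), MoveLeft) (ts ! r)]"
    by (rule nth_equalityI) (auto simp: len nth_list_update)
  have "step ?T (0, ts) = (Suc 0, ?ts1)"
    by (rule step_line_tm) (use len in auto)
  moreover have "step ?T (Suc 0, ?ts1) = (Suc (Suc 0), ?ts2)"
    by (subst step_line_tm) (use len in auto)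
  ultimately have run: "(step ?T ^^ 2) (start ?T, ts) = (halt ?T, ?ts2)"
    unfolding numeral_2_eq_2 by simp
  have "map scanned ?ts1 = (map scanned ts)[r := scanned (act (scanned (ts ! r), MoveLeft) (ts ! r))]"
    by (simp only: ts1 map_update)
  then have h: "h (map scanned ?ts1) = g s" using assms(2)[of ts s] assms(3) *(2) by simp
  have "stack_tape (?ts2 ! i) (s' i)" if "i < k" for i
  proof (cases "i = r")
    case True
    then show ?thesis using that *(2) stack_tape_push[of "ts ! i" "s i" "g s"] h s'(2)
      by (auto simp: list_all2_conv_all_nth simp del: act.simps)
  next
    case False
    then have "?ts2 ! i = ts ! i" using that len by simp
    then show ?thesis using that *(2) False s'(2) by (auto simp: list_all2_conv_all_nth)
  qed
  then have "list_all2 stack_tape ?ts2 (map s' [0..<tapes ?T])"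
    by (auto simp: list_all2_conv_all_nth)
  with run s'(1) show "\<exists>u \<le> t. \<exists>ts'. (step ?T ^^ u) (start ?T, ts) = (halt ?T, ts') \<and>
      list_all2 stack_tape ts' (map s' [0..<tapes ?T])"
    by blast
qed

text \<open>The number of tapes and the alphabet are fixed in advance so that the machines of
  subprograms fit together in \<open>join\<close>.\<close>

theorem compile:
  assumes "reg_bound c \<le> k" "cells c \<subseteq> S" "finite S" "Blank \<in> S" "range Letter \<subseteq> S"
  shows "\<exists>T. is_tm T \<and> tapes T = k \<and> symbols T = S \<and> realises T c"
  using assms(1,2)
proof (induction c)
  case Skip
  let ?T = "line_tm k S 0 (\<lambda>q xs i. (xs ! i, Stay))"
  have "is_tm ?T" using Skip assms(3-5) by (intro is_tm_line_tm) (auto simp: subset_iff)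
  moreover have "realises ?T Skip"
    unfolding realises_def by (auto elim!: exec.cases intro!: exI[of _ 0])
  ultimately show ?case by (intro exI[of _ ?T]) auto
next
  case (Push r c)
  let ?T = "line_tm k S 2 (\<lambda>q xs i. if i = r then if q = 0 then (xs ! i, MoveLeft) else (c, Stay)
      else (xs ! i, Stay))"
  have "is_tm ?T" using Push assms(3-5) by (intro is_tm_line_tm) (auto simp: subset_iff)
  moreover have "realises ?T (Push r c)"
    by (rule realises_push[where g = "\<lambda>_. c" and h = "\<lambda>_. c"]) (auto elim: exec.cases)
  ultimately show ?case by (intro exI[of _ ?T]) auto
next
  case (Pop r)
  let ?f = "\<lambda>(q::nat) xs i. if i = r then (Blank, MoveRight) else (xs ! i, Stay)"
  let ?T = "line_tm k S 1 ?f"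
  have "is_tm ?T" using Pop assms(3-5) by (intro is_tm_line_tm) (auto simp: subset_iff)
  moreover have "realises ?T (Pop r)"
  proof (rule realises_line1)
    fix s t s' ts i
    assume *: "exec (Pop r) s t s'" "list_all2 stack_tape ts (map s [0..<k])" "i < k"
    then have "s' = s(r := tl (s r))" by (auto elim: exec.cases)
    moreover have "stack_tape (ts ! i) (s i)" using *(2,3) by (auto simp: list_all2_conv_all_nth)
    moreover have "map scanned ts ! i = scanned (ts ! i)"
      using *(2,3) by (auto simp: list_all2_conv_all_nth)
    ultimately show "stack_tape (act (?f 0 (map scanned ts) i) (ts ! i)) (s' i)"
      using stack_tape_pop[of "ts ! r" "s r"] by (auto simp del: act.simps)
  qed (auto elim: exec.cases)
  ultimately show ?case by (intro exI[of _ ?T]) auto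
next
  case (Dup r' r)
  show ?case
  proof (cases "r = r'")
    \<comment> \<open>No execution exists when source and target coincide, so any machine realises
      the command.\<close>
    case True
    let ?T = "line_tm k S 0 (\<lambda>q xs i. (xs ! i, Stay))"
    have "is_tm ?T" using Dup assms(3-5) by (intro is_tm_line_tm) (auto simp: subset_iff)
    moreover have "realises ?T (Dup r' r)"
      unfolding realises_def using True by (auto elim!: exec.cases intro!: exI[of _ 0])
    ultimately show ?thesis by (intro exI[of _ ?T]) auto
  next
    case False
    let ?T = "line_tm k S 2 (\<lambda>q xs i. if i = r then if q = 0 then (xs ! i, MoveLeft) else (xs ! r', Stay)
      else (xs ! i, Stay))"
    have "is_tm ?T" using Dup assms(3-5) by (intro is_tm_line_tm) (auto simp: subset_iff)
    moreover have "realises ?T (Dup r' r)"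
      by (rule realises_push[where g = "\<lambda>s. top_cell (s r')" and h = "\<lambda>xs. xs ! r'"])
        (use Dup False list_all2_stack_scanned in \<open>auto elim!: exec.cases\<close>)
    ultimately show ?thesis by (intro exI[of _ ?T]) auto
  qed
next
  case (Seq c d)
  then obtain T T' where "is_tm T \<and> tapes T = k \<and> symbols T = S \<and> realises T c"
    "is_tm T' \<and> tapes T' = k \<and> symbols T' = S \<and> realises T' d" by auto
  then show ?case
    by (intro exI[of _ "join T T' (\<lambda>_. 2 * start T + 2) (2 * start T' + 3)"])
      (intro conjI is_tm_join realises_Seq; simp)
next
  case (If rs P c d)
  then obtain T T' where "is_tm T \<and> tapes T = k \<and> symbols T = S \<and> realises T c"
    "is_tm T' \<and> tapes T' = k \<and> symbols T' = S \<and> realises T' d" by auto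
  moreover have "\<forall>r \<in> set rs. r < k" using If.prems by auto
  ultimately show ?case
    by (intro exI[of _ "join T T'
          (\<lambda>xs. if P (map (\<lambda>r. xs ! r) rs) then 2 * start T + 2 else 2 * start T' + 3) 1"])
      (intro conjI is_tm_join realises_If; simp)
next
  case (While rs P c)
  then obtain T where "is_tm T \<and> tapes T = k \<and> symbols T = S \<and> realises T c" by auto
  moreover have "\<forall>r \<in> set rs. r < k" using While.prems by auto
  ultimately show ?case
    by (intro exI[of _ "join T T
          (\<lambda>xs. if P (map (\<lambda>r. xs ! r) rs) then 2 * start T + 2 else 1) 0"])
      (intro conjI is_tm_join realises_While; simp)
qed

text \<open>Register 0 is the first tape. An input word is already in the form of a stack, and a
  stack of letters surrounded by blanks has the form of an output.\<close>

lemma poly_time_exec: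
  assumes "\<And>w. \<exists>s. exec c ((\<lambda>_. [])(0 := map Letter w)) (poly p (length w)) s \<and> s 0 = map Letter (f w)"
  shows "poly_time f"
proof -
  let ?S = "cells c \<union> {Blank} \<union> range Letter"
  have "UNIV = {Zero, One, Tick, Comma, Amp}" using sym.exhaust by auto
  then have "finite (UNIV :: sym set)" by (metis finite.emptyI finite.insertI)
  then have "finite ?S" by (simp add: finite_cells)
  then obtain T where T: "is_tm T" "tapes T = reg_bound c" "realises T c"
    using compile[of c "reg_bound c" ?S] by auto
  have "computes_within T w (f w) (poly p (length w))" for w
  proof -
    let ?s = "(\<lambda>_. [])(0 := map Letter w)" and ?ts = "snd (initial T w)"
    obtain s where s: "exec c ?s (poly p (length w)) s" "s 0 = map Letter (f w)"
      using assms by blast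
    have k: "0 < tapes T" using T(2) reg_bound_pos by simp
    have "stack_tape (word_tape w) (map Letter w)"
      by (auto simp: stack_tape_def word_tape_def fun_eq_iff)
    moreover have "stack_tape blank_tape []"
      by (auto simp: stack_tape_def blank_tape_def fun_eq_iff)
    ultimately have "list_all2 stack_tape ?ts (map ?s [0..<tapes T])"
      using k by (auto simp: initial_def list_all2_conv_all_nth nth_Cons')
    then obtain u ts' where u: "u \<le> poly p (length w)"
        "(step T ^^ u) (start T, ?ts) = (halt T, ts')" "list_all2 stack_tape ts' (map s [0..<tapes T])"
      using T(3) s(1) unfolding realises_def by blast
    have ne: "ts' \<noteq> []" using u(3) k by auto
    then have "stack_tape (ts' ! 0) (s 0)" using u(3) k by (auto simp: list_all2_conv_all_nth)
    then have "stack_tape (hd ts') (map Letter (f w))" using s(2) ne by (simp add: hd_conv_nth)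
    then have "has_output (hd ts') (f w)"
      by (cases "hd ts'") (auto simp: stack_tape_def)
    moreover have "(start T, ?ts) = initial T w" by (simp add: initial_def)
    ultimately show ?thesis using u unfolding computes_within_def by auto
  qed
  with T(1) show ?thesis unfolding poly_time_def by blast
qed

subsection \<open>Basic programs\<close>

text \<open>A blank top is taken for the end of the stack, so these loops are correct only for
  stacks without blanks. The simulation of machines renames blanks for this reason.\<close>

definition clear :: "nat \<Rightarrow> com" where
  "clear r = While [r] (\<lambda>v. v \<noteq> [Blank]) (Pop r)"

definition pour :: "nat \<Rightarrow> nat \<Rightarrow> com" where
  "pour r r' = While [r] (\<lambda>v. v \<noteq> [Blank]) (Dup r r' ;; Pop r)"

definition pour2 :: "nat \<Rightarrow> nat \<Rightarrow> nat \<Rightarrow> com" where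
  "pour2 r r1 r2 = While [r] (\<lambda>v. v \<noteq> [Blank]) (Dup r r1 ;; Dup r r2 ;; Pop r)"

text \<open>Pouring reverses a stack; the detour through \<open>tmp\<close> restores the
  order.\<close>

definition copy_reg :: "nat \<Rightarrow> nat \<Rightarrow> nat \<Rightarrow> com" where
  "copy_reg r r' tmp = pour r tmp ;; pour2 tmp r r'"

definition move_reg :: "nat \<Rightarrow> nat \<Rightarrow> nat \<Rightarrow> com" where
  "move_reg r r' tmp = pour r tmp ;; pour tmp r'"

lemma exec_clear:
  assumes "Blank \<notin> set (s r)" "3 * length (s r) + 1 \<le> t"
  shows "exec (clear r) s t (s(r := []))"
  using assms
proof (induction "s r" arbitrary: s t)
  case Nil
  then have "s(r := []) = s" by auto
  then show ?case using Nil by (auto simp: clear_def intro!: exec.WhileFalse)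
next
  case (Cons x xs)
  have 1: "exec (Pop r) s 1 (s(r := xs))"
    using exec.Pop[of 1 r s] Cons.hyps(2)[symmetric] by simp
  have 2: "exec (clear r) (s(r := xs)) (3 * length xs + 1) (s(r := []))"
    using Cons.hyps(1)[of "s(r := xs)" "3 * length xs + 1"] Cons.prems Cons.hyps(2)[symmetric]
    by simp
  show ?case unfolding clear_def
    by (rule exec.WhileTrue[OF _ 1 2[unfolded clear_def]])
      (use Cons.prems Cons.hyps(2)[symmetric] in auto)
qed

text \<open>A round costs 6 for \<open>Dup\<close> and \<open>Pop\<close> in sequence and 2 for the
  loop; leaving the loop costs 1.\<close>

lemma exec_pour:
  assumes "Blank \<notin> set (s r)" "r \<noteq> r'" "8 * length (s r) + 1 \<le> t"
  shows "exec (pour r r') s t (s(r := [], r' := rev (s r) @ s r'))"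
  using assms
proof (induction "s r" arbitrary: s t)
  case Nil
  then have "s(r := [], r' := rev (s r) @ s r') = s" by (auto simp: fun_eq_iff)
  moreover have "exec (pour r r') s t s" using Nil by (auto simp: pour_def intro!: exec.WhileFalse)
  ultimately show ?case by (simp only:)
next
  case (Cons x xs)
  let ?s = "s(r' := x # s r', r := xs)"
  have 1: "exec (Dup r r') s 2 (s(r' := x # s r'))"
    using exec.Dup[of 2 r r' s] Cons.hyps(2)[symmetric] Cons.prems by simp
  have 2: "exec (Pop r) (s(r' := x # s r')) 1 ?s"
    using exec.Pop[of 1 r "s(r' := x # s r')"] Cons.hyps(2)[symmetric] Cons.prems by simp
  have 3: "exec (pour r r') ?s (8 * length xs + 1) (?s(r := [], r' := rev xs @ x # s r'))"
    using Cons.hyps(1)[of ?s "8 * length xs + 1"] Cons.prems Cons.hyps(2)[symmetric]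
    by simp
  have 4: "?s(r := [], r' := rev xs @ x # s r') = s(r := [], r' := rev (s r) @ s r')"
    using Cons.hyps(2)[symmetric] by (auto simp: fun_eq_iff)
  have "exec (Dup r r' ;; Pop r) s 6 ?s" by (rule exec.Seq[OF 1 2]) simp
  then show ?case unfolding pour_def
    by (rule exec.WhileTrue[rotated, OF _ 3[unfolded pour_def 4]])
      (use Cons.prems Cons.hyps(2)[symmetric] in auto)
qed

lemma exec_pour2:
  assumes "Blank \<notin> set (s r)" "r \<noteq> r1" "r \<noteq> r2" "r1 \<noteq> r2" "13 * length (s r) + 1 \<le> t"
  shows "exec (pour2 r r1 r2) s t (s(r := [], r1 := rev (s r) @ s r1, r2 := rev (s r) @ s r2))"
  using assms
proof (induction "s r" arbitrary: s t)
  case Nil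
  then have "s(r := [], r1 := rev (s r) @ s r1, r2 := rev (s r) @ s r2) = s" by (auto simp: fun_eq_iff)
  moreover have "exec (pour2 r r1 r2) s t s" using Nil by (auto simp: pour2_def intro!: exec.WhileFalse)
  ultimately show ?case by (simp only:)
next
  case (Cons x xs)
  let ?s1 = "s(r1 := x # s r1)"
  let ?s2 = "?s1(r2 := x # s r2)"
  let ?s = "?s2(r := xs)"
  have 1: "exec (Dup r r1) s 2 ?s1"
    using exec.Dup[of 2 r r1 s] Cons.hyps(2)[symmetric] Cons.prems by simp
  have 2: "exec (Dup r r2) ?s1 2 ?s2"
    using exec.Dup[of 2 r r2 ?s1] Cons.hyps(2)[symmetric] Cons.prems by simp
  have 3: "exec (Pop r) ?s2 1 ?s"
    using exec.Pop[of 1 r ?s2] Cons.hyps(2)[symmetric] Cons.prems by simp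
  let ?s' = "?s(r := [], r1 := rev xs @ x # s r1, r2 := rev xs @ x # s r2)"
  have 4: "exec (pour2 r r1 r2) ?s (13 * length xs + 1) ?s'"
    using Cons.hyps(1)[of ?s "13 * length xs + 1"] Cons.prems Cons.hyps(2)[symmetric]
    by simp
  have 5: "?s' = s(r := [], r1 := rev (s r) @ s r1, r2 := rev (s r) @ s r2)"
    using Cons.hyps(2)[symmetric] by (auto simp: fun_eq_iff)
  have "exec (Dup r r2 ;; Pop r) ?s1 6 ?s" by (rule exec.Seq[OF 2 3]) simp
  then have "exec (Dup r r1 ;; Dup r r2 ;; Pop r) s 11 ?s" by (rule exec.Seq[OF 1]) simp
  then show ?case unfolding pour2_def
    by (rule exec.WhileTrue[rotated, OF _ 4[unfolded pour2_def 5]])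
      (use Cons.prems Cons.hyps(2)[symmetric] in auto)
qed

lemma exec_move_reg:
  assumes "Blank \<notin> set (s r)" "r \<noteq> r'" "r \<noteq> tmp" "r' \<noteq> tmp" "s tmp = []" "16 * length (s r) + 5 \<le> t"
  shows "exec (move_reg r r' tmp) s t (s(r := [], r' := s r @ s r'))"
proof -
  let ?s = "s(r := [], tmp := rev (s r))"
  have 1: "exec (pour r tmp) s (8 * length (s r) + 1) ?s"
    using exec_pour[of s r tmp] assms by simp
  have 2: "exec (pour tmp r') ?s (8 * length (s r) + 1) (?s(tmp := [], r' := s r @ s r'))"
    using exec_pour[of ?s tmp r'] assms by (simp add: fun_upd_twist)
  have "?s(tmp := [], r' := s r @ s r') = s(r := [], r' := s r @ s r')"
    using assms by (auto simp: fun_eq_iff)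
  with exec.Seq[OF 1 2, of t] assms(6) show ?thesis by (simp add: move_reg_def)
qed

lemma exec_copy_reg:
  assumes "Blank \<notin> set (s r)" "r \<noteq> r'" "r \<noteq> tmp" "r' \<noteq> tmp" "s tmp = []" "21 * length (s r) + 5 \<le> t"
  shows "exec (copy_reg r r' tmp) s t (s(r' := s r @ s r'))"
proof -
  let ?s = "s(r := [], tmp := rev (s r))"
  have 1: "exec (pour r tmp) s (8 * length (s r) + 1) ?s"
    using exec_pour[of s r tmp] assms by simp
  have 2: "exec (pour2 tmp r r') ?s (13 * length (s r) + 1) (?s(tmp := [], r := s r, r' := s r @ s r'))"
    using exec_pour2[of ?s tmp r r'] assms by (simp add: fun_upd_twist)
  have "?s(tmp := [], r := s r, r' := s r @ s r') = s(r' := s r @ s r')"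
    using assms by (auto simp: fun_eq_iff)
  with exec.Seq[OF 1 2, of t] assms(6) show ?thesis by (simp add: copy_reg_def)
qed

text \<open>A cascade of tests, one for each value and with cost 2 each. As there are infinitely
  many cells, the distinction is made by a function \<open>f\<close> of the tops whose values of
  interest form a finite set.\<close>

lemma switch_ex:
  assumes "finite A"
  shows "\<exists>c. \<forall>s t s'. f (tops rs s) \<in> A \<longrightarrow> exec (C (f (tops rs s))) s t s' \<longrightarrow>
    exec c s (t + 2 * card A) s'"
  using assms
proof (induction A rule: finite_induct)
  case (insert v A)
  then obtain c where c: "\<And>s t s'. f (tops rs s) \<in> A \<Longrightarrow> exec (C (f (tops rs s))) s t s' \<Longrightarrow>
    exec c s (t + 2 * card A) s'" by blast
  show ?case
  proof (intro exI[of _ "If rs (\<lambda>x. f x = v) (C v) c"] allI impI)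
    fix s t s'
    assume *: "f (tops rs s) \<in> insert v A" "exec (C (f (tops rs s))) s t s'"
    show "exec (If rs (\<lambda>x. f x = v) (C v) c) s (t + 2 * card (insert v A)) s'"
    proof (cases "f (tops rs s) = v")
      case True
      with * have "exec (C v) s t s'" by simp
      then show ?thesis by (rule exec.IfTrue[where P = "\<lambda>x. f x = v", OF True]) (use insert in simp)
    next
      case False
      with * c have "exec c s (t + 2 * card A) s'" by simp
      then show ?thesis
        by (rule exec.IfFalse[where P = "\<lambda>x. f x = v", OF False]) (use insert in simp)
    qed
  qed
qed auto

section \<open>Polynomial-time functions of several words\<close>

text \<open>\<open>'a\<close> is an abstract environment, and \<open>gs\<close> are the words that a
  program sees of it. In this way functions of several words are treated without coding tuples as
  words.\<close>

definition isize :: "('a \<Rightarrow> word) list \<Rightarrow> 'a \<Rightarrow> nat" where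
  "isize gs a = (\<Sum>g\<leftarrow>gs. length (g a))"

lemma isize_Nil [simp]: "isize [] = (\<lambda>_. 0)"
  by (simp add: isize_def fun_eq_iff)

lemma isize_Cons [simp]: "isize (g # gs) = (\<lambda>a. length (g a) + isize gs a)"
  by (simp add: isize_def fun_eq_iff)

definition polyb :: "('a \<Rightarrow> word) list \<Rightarrow> ('a \<Rightarrow> nat) \<Rightarrow> bool" where
  "polyb gs B \<longleftrightarrow> (\<exists>p :: nat poly. \<forall>a. B a \<le> poly p (isize gs a))"

lemma poly_nat_mono: "x \<le> y \<Longrightarrow> poly (p :: nat poly) x \<le> poly p y"
  by (induction p) (auto intro!: add_mono mult_mono)

lemma polyb_const: "polyb gs (\<lambda>_. c)"
  unfolding polyb_def by (rule exI[of _ "[:c:]"]) simp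

lemma polyb_isize: "polyb gs (isize gs)"
  unfolding polyb_def by (rule exI[of _ "[:0, 1:]"]) simp

lemma polyb_add: "polyb gs A \<Longrightarrow> polyb gs B \<Longrightarrow> polyb gs (\<lambda>a. A a + B a)"
  unfolding polyb_def by (metis add_mono poly_add)

lemma polyb_mult: "polyb gs A \<Longrightarrow> polyb gs B \<Longrightarrow> polyb gs (\<lambda>a. A a * B a)"
  unfolding polyb_def by (metis mult_mono poly_mult zero_le)

lemma polyb_le: "polyb gs A \<Longrightarrow> (\<And>a. B a \<le> A a) \<Longrightarrow> polyb gs B"
  unfolding polyb_def by (meson le_trans)

lemma polyb_poly:
  assumes "polyb gs N"
  shows "polyb gs (\<lambda>a. poly p (N a))"
proof -
  obtain q where q: "\<And>a. N a \<le> poly q (isize gs a)" using assms by (auto simp: polyb_def)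
  have "poly p (N a) \<le> poly (pcompose p q) (isize gs a)" for a
    using poly_nat_mono[OF q] by (simp add: poly_pcompose)
  then show ?thesis unfolding polyb_def by blast
qed

lemma polyb_sum: "(\<And>c. polyb gs (B c)) \<Longrightarrow> polyb gs (\<lambda>a. \<Sum>c\<in>A. B c a)"
  by (induction A rule: infinite_finite_induct) (auto intro!: polyb_const polyb_add)

lemma polyb_power: "polyb gs B \<Longrightarrow> polyb gs (\<lambda>a. B a ^ k)"
  by (induction k) (auto intro!: polyb_const polyb_mult)

lemma polyb_trans:
  assumes "polyb gs' B" "polyb gs (isize gs')"
  shows "polyb gs B"
proof -
  obtain p where "\<And>a. B a \<le> poly p (isize gs' a)" using assms(1) by (auto simp: polyb_def)
  then show ?thesis using polyb_le[OF polyb_poly[OF assms(2)]] by blast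
qed

lemma polyb_isizeI:
  "(\<And>g. g \<in> set gs' \<Longrightarrow> polyb gs (\<lambda>a. length (g a))) \<Longrightarrow> polyb gs (isize gs')"
  by (induction gs') (auto intro!: polyb_const polyb_add)

lemma length_le_isize: "g \<in> set gs \<Longrightarrow> length (g a) \<le> isize gs a"
  by (induction gs) auto

lemma polyb_length: "g \<in> set gs \<Longrightarrow> polyb gs (\<lambda>a. length (g a))"
  by (rule polyb_le[OF polyb_isize]) (rule length_le_isize)

abbreviation letters :: "word \<Rightarrow> cell list" where
  "letters \<equiv> map Letter"

text \<open>\<open>pt gs f\<close>: a program can compute \<open>f a\<close> from the words \<open>g a\<close>, \<open>g \<in> gs\<close>, in polynomial time,
  wherever inputs and output are placed; the registers from \<open>m\<close> on are its work space.\<close>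

definition pt :: "('a \<Rightarrow> word) list \<Rightarrow> ('a \<Rightarrow> word) \<Rightarrow> bool" where
  "pt gs f \<longleftrightarrow>
     (\<forall>ins out m. length ins = length gs \<longrightarrow> (\<forall>r \<in> set ins. r < m) \<longrightarrow> out < m \<longrightarrow> out \<notin> set ins \<longrightarrow>
        (\<exists>c B. polyb gs B \<and>
           (\<forall>a s. map s ins = map (\<lambda>g. letters (g a)) gs \<longrightarrow> s out = [] \<longrightarrow> (\<forall>i\<ge>m. s i = []) \<longrightarrow>
              exec c s (B a) (s(out := letters (f a))))))"

lemma ptI:
  assumes "\<And>ins out m. length ins = length gs \<Longrightarrow> (\<And>r. r \<in> set ins \<Longrightarrow> r < m) \<Longrightarrow> out < m \<Longrightarrow>
      out \<notin> set ins \<Longrightarrow>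
      \<exists>c B. polyb gs B \<and>
        (\<forall>a s. map s ins = map (\<lambda>g. letters (g a)) gs \<longrightarrow> s out = [] \<longrightarrow> (\<forall>i\<ge>m. s i = []) \<longrightarrow>
          exec c s (B a) (s(out := letters (f a))))"
  shows "pt gs f"
  unfolding pt_def by (intro allI impI, rule assms) simp_all

lemma ptE:
  assumes "pt gs f" "length ins = length gs" "\<And>r. r \<in> set ins \<Longrightarrow> r < m" "out < m" "out \<notin> set ins"
  obtains c B where "polyb gs B"
    "\<And>a s. map s ins = map (\<lambda>g. letters (g a)) gs \<Longrightarrow> s out = [] \<Longrightarrow> (\<And>i. i \<ge> m \<Longrightarrow> s i = []) \<Longrightarrow>
        exec c s (B a) (s(out := letters (f a)))"
proof -
  define Q where "Q ins out m \<longleftrightarrow> (\<exists>c B. polyb gs B \<and>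
      (\<forall>a s. map s ins = map (\<lambda>g. letters (g a)) gs \<longrightarrow> s out = [] \<longrightarrow> (\<forall>i\<ge>m. s i = []) \<longrightarrow>
        exec c s (B a) (s(out := letters (f a)))))" for ins out m
  have "\<forall>ins out m. length ins = length gs \<longrightarrow> (\<forall>r \<in> set ins. r < m) \<longrightarrow> out < m \<longrightarrow> out \<notin> set ins \<longrightarrow>
      Q ins out m"
    using assms(1) unfolding pt_def Q_def .
  then have "Q ins out m" using assms(2-) by blast
  then obtain c B where B: "polyb gs B" and
    c: "\<forall>a s. map s ins = map (\<lambda>g. letters (g a)) gs \<longrightarrow> s out = [] \<longrightarrow> (\<forall>i\<ge>m. s i = []) \<longrightarrow>
        exec c s (B a) (s(out := letters (f a)))"
    unfolding Q_def by (elim exE conjE)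
  have e: "exec c s (B a) (s(out := letters (f a)))"
    if "map s ins = map (\<lambda>g. letters (g a)) gs" "s out = []" "\<And>i. i \<ge> m \<Longrightarrow> s i = []" for a s
    using c[THEN spec, THEN spec, THEN mp, THEN mp, THEN mp, OF that(1,2)] that(3) by simp
  show thesis by (rule that[OF B e])
qed

text \<open>The output has to be pushed within the time bound, and \<open>exec_length\<close>
  applies.\<close>

lemma pt_length:
  assumes "pt gs f"
  shows "polyb gs (\<lambda>a. length (f a))"
proof -
  let ?k = "length gs"
  obtain c B where B: "polyb gs B" and c: "\<And>a s. map s [0..<?k] = map (\<lambda>g. letters (g a)) gs \<Longrightarrow>
      s ?k = [] \<Longrightarrow> (\<And>i. i \<ge> Suc ?k \<Longrightarrow> s i = []) \<Longrightarrow> exec c s (B a) (s(?k := letters (f a)))"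
    by (rule ptE[OF assms, of "[0..<?k]" "Suc ?k" ?k]) auto
  have "length (f a) \<le> B a" for a
  proof -
    let ?s = "\<lambda>i. if i < ?k then letters ((gs ! i) a) else []"
    have "map ?s [0..<?k] = map (\<lambda>g. letters (g a)) gs" by (auto intro!: nth_equalityI)
    then have "exec c ?s (B a) (?s(?k := letters (f a)))" by (rule c) auto
    from exec_length[OF this, of ?k] show ?thesis by simp
  qed
  with B show ?thesis by (rule polyb_le)
qed

text \<open>The same program serves, for it sees only words and not the environment from which they
  come.\<close>

lemma pt_reparam:
  assumes "pt gs f"
  shows "pt (map (\<lambda>g. g \<circ> h) gs) (f \<circ> h)"
proof (rule ptI)
  fix ins :: "nat list" and out m :: nat
  assume *: "length ins = length (map (\<lambda>g. g \<circ> h) gs)" "\<And>r. r \<in> set ins \<Longrightarrow> r < m" "out < m" "out \<notin> set ins"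
  obtain c B where B: "polyb gs B" and c:
    "\<And>a s. map s ins = map (\<lambda>g. letters (g a)) gs \<Longrightarrow> s out = [] \<Longrightarrow> (\<And>i. i \<ge> m \<Longrightarrow> s i = []) \<Longrightarrow>
        exec c s (B a) (s(out := letters (f a)))"
    by (rule ptE[OF assms, of ins m out]) (use * in auto)
  have "isize (map (\<lambda>g. g \<circ> h) gs) a = isize gs (h a)" for a by (simp add: isize_def comp_def)
  then have "polyb (map (\<lambda>g. g \<circ> h) gs) (B \<circ> h)" using B by (auto simp: polyb_def)
  then show "\<exists>c B. polyb (map (\<lambda>g. g \<circ> h) gs) B \<and>
      (\<forall>a s. map s ins = map (\<lambda>g. letters (g a)) (map (\<lambda>g. g \<circ> h) gs) \<longrightarrow> s out = [] \<longrightarrow>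
        (\<forall>i\<ge>m. s i = []) \<longrightarrow> exec c s (B a) (s(out := letters ((f \<circ> h) a))))"
    by (intro exI[of _ c] exI[of _ "B \<circ> h"]) (use c in \<open>auto simp: comp_def\<close>)
qed

text \<open>Inputs may be permuted, repeated or ignored: the program is placed on those registers
  that hold the words in \<open>gs\<close>.\<close>

lemma pt_weaken:
  assumes "pt gs f" "set gs \<subseteq> set gs'"
  shows "pt gs' f"
proof (rule ptI)
  fix ins :: "nat list" and out m :: nat
  assume *: "length ins = length gs'" "\<And>r. r \<in> set ins \<Longrightarrow> r < m" "out < m" "out \<notin> set ins"
  have "\<exists>i. i < length gs' \<and> gs' ! i = g" if "g \<in> set gs" for g
    using that assms(2) by (metis in_mono in_set_conv_nth)
  then obtain i where i: "\<And>g. g \<in> set gs \<Longrightarrow> i g < length gs' \<and> gs' ! i g = g" by metis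
  let ?ins = "map (\<lambda>g. ins ! i g) gs"
  have sub: "set ?ins \<subseteq> set ins" using i *(1) by auto
  obtain c B where B: "polyb gs B" and c:
    "\<And>a s. map s ?ins = map (\<lambda>g. letters (g a)) gs \<Longrightarrow> s out = [] \<Longrightarrow> (\<And>i. i \<ge> m \<Longrightarrow> s i = []) \<Longrightarrow>
        exec c s (B a) (s(out := letters (f a)))"
    by (rule ptE[OF assms(1), of ?ins m out]) (use * sub in auto)
  have poly: "polyb gs' B"
    using B assms(2) by (auto intro!: polyb_trans[OF B] polyb_isizeI polyb_length)
  have ins: "map s ?ins = map (\<lambda>g. letters (g a)) gs"
    if "map s ins = map (\<lambda>g. letters (g a)) gs'" for a s
  proof -
    have "s (ins ! j) = letters ((gs' ! j) a)" if "j < length gs'" for j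
      using \<open>map s ins = _\<close> that *(1) by (metis nth_map)
    then show ?thesis using i by auto
  qed
  show "\<exists>c B. polyb gs' B \<and> (\<forall>a s. map s ins = map (\<lambda>g. letters (g a)) gs' \<longrightarrow> s out = [] \<longrightarrow>
      (\<forall>i\<ge>m. s i = []) \<longrightarrow> exec c s (B a) (s(out := letters (f a))))"
    by (rule exI[of _ c], rule exI[of _ B], intro conjI allI impI poly c ins) simp_all
qed

lemma pt_proj: "g \<in> set gs \<Longrightarrow> pt gs g"
proof -
  have "pt [g] g"
  proof (rule ptI)
    fix ins :: "nat list" and out m :: nat
    assume *: "length ins = length [g]" "\<And>r. r \<in> set ins \<Longrightarrow> r < m" "out < m" "out \<notin> set ins"
    then obtain r where r: "ins = [r]" by (cases ins) auto
    show "\<exists>c B. polyb [g] B \<and> (\<forall>a s. map s ins = map (\<lambda>g. letters (g a)) [g] \<longrightarrow> s out = [] \<longrightarrow>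
      (\<forall>i\<ge>m. s i = []) \<longrightarrow> exec c s (B a) (s(out := letters (g a))))"
    proof (intro exI[of _ "copy_reg r out m"] exI[of _ "\<lambda>a. 21 * length (g a) + 5"] conjI allI impI)
      show "polyb [g] (\<lambda>a. 21 * length (g a) + 5)"
        by (intro polyb_add polyb_mult polyb_const polyb_length) auto
    next
      fix a s
      assume s: "map s ins = map (\<lambda>g. letters (g a)) [g]" "s out = []" "\<forall>i\<ge>m. s i = []"
      have "exec (copy_reg r out m) s (21 * length (g a) + 5) (s(out := s r @ s out))"
        by (rule exec_copy_reg) (use s r * in auto)
      then show "exec (copy_reg r out m) s (21 * length (g a) + 5) (s(out := letters (g a)))"
        using s r by simp
    qed
  qed
  then show "g \<in> set gs \<Longrightarrow> pt gs g" by (rule pt_weaken) auto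
qed

lemma pt_Nil: "pt gs (\<lambda>_. [])"
proof (rule ptI)
  fix ins :: "nat list" and out m :: nat
  have "s out = [] \<Longrightarrow> s(out := letters []) = s" for s :: regs by auto
  then show "\<exists>c B. polyb gs B \<and> (\<forall>a s. map s ins = map (\<lambda>g. letters (g a)) gs \<longrightarrow> s out = [] \<longrightarrow>
      (\<forall>i\<ge>m. s i = []) \<longrightarrow> exec c s (B a) (s(out := letters [])))"
    by (intro exI[of _ Skip] exI[of _ "\<lambda>_. 0"]) (auto intro!: polyb_const exec.Skip simp del: list.map)
qed

lemma pt_Cons:
  assumes "pt gs f"
  shows "pt gs (\<lambda>a. x # f a)"
proof (rule ptI)
  fix ins :: "nat list" and out m :: nat
  assume *: "length ins = length gs" "\<And>r. r \<in> set ins \<Longrightarrow> r < m" "out < m" "out \<notin> set ins"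
  obtain c B where B: "polyb gs B" and c:
    "\<And>a s. map s ins = map (\<lambda>g. letters (g a)) gs \<Longrightarrow> s out = [] \<Longrightarrow> (\<And>i. i \<ge> m \<Longrightarrow> s i = []) \<Longrightarrow>
        exec c s (B a) (s(out := letters (f a)))"
    by (rule ptE[OF assms, of ins m out]) (use * in auto)
  show "\<exists>c B. polyb gs B \<and> (\<forall>a s. map s ins = map (\<lambda>g. letters (g a)) gs \<longrightarrow> s out = [] \<longrightarrow>
      (\<forall>i\<ge>m. s i = []) \<longrightarrow> exec c s (B a) (s(out := letters (x # f a))))"
  proof (intro exI[of _ "c ;; Push out (Letter x)"] exI[of _ "\<lambda>a. B a + 5"] conjI allI impI)
    show "polyb gs (\<lambda>a. B a + 5)" by (intro polyb_add polyb_const B)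
  next
    fix a s
    assume s: "map s ins = map (\<lambda>g. letters (g a)) gs" "s out = []" "\<forall>i\<ge>m. s i = []"
    have 1: "exec c s (B a) (s(out := letters (f a)))" using c s by auto
    have 2: "exec (Push out (Letter x)) (s(out := letters (f a))) 2 (s(out := letters (x # f a)))"
      using exec.Push[of 2 out "Letter x" "s(out := letters (f a))"] by simp
    show "exec (c ;; Push out (Letter x)) s (B a + 5) (s(out := letters (x # f a)))"
      by (rule exec.Seq[OF 1 2]) simp
  qed
qed

text \<open>Composition: \<open>g\<close> is stored in the first work register, becomes an
  additional input for \<open>f\<close>, and is cleared in the end so that the work space is empty
  again.\<close>

lemma pt_cut:
  assumes "pt gs g" "pt (g # gs) f"
  shows "pt gs f"
proof (rule ptI)
  fix ins :: "nat list" and out m :: nat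
  assume *: "length ins = length gs" "\<And>r. r \<in> set ins \<Longrightarrow> r < m" "out < m" "out \<notin> set ins"
  have **: "\<And>r. r \<in> set ins \<Longrightarrow> r < Suc m" using *(2) by force
  obtain c B where B: "polyb gs B" and c:
    "\<And>a s. map s ins = map (\<lambda>g. letters (g a)) gs \<Longrightarrow> s m = [] \<Longrightarrow> (\<And>i. i \<ge> Suc m \<Longrightarrow> s i = []) \<Longrightarrow>
        exec c s (B a) (s(m := letters (g a)))"
    by (rule ptE[OF assms(1), of ins "Suc m" m]) (use * ** in auto)
  obtain d B' where B': "polyb (g # gs) B'" and d:
    "\<And>a s. map s (m # ins) = map (\<lambda>g. letters (g a)) (g # gs) \<Longrightarrow> s out = [] \<Longrightarrow> (\<And>i. i \<ge> Suc m \<Longrightarrow> s i = []) \<Longrightarrow>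
        exec d s (B' a) (s(out := letters (f a)))"
    by (rule ptE[OF assms(2), of "m # ins" "Suc m" out]) (use * ** in auto)
  have "polyb gs B'"
    by (rule polyb_trans[OF B']) (auto intro!: polyb_add polyb_isize pt_length assms(1))
  then have poly: "polyb gs (\<lambda>a. (B a + 3) + (B' a + 3 + (3 * length (g a) + 1)))"
    by (intro polyb_add polyb_mult polyb_const B pt_length assms(1))
  have "exec (c ;; d ;; clear m) s ((B a + 3) + (B' a + 3 + (3 * length (g a) + 1))) (s(out := letters (f a)))"
    if s: "map s ins = map (\<lambda>g. letters (g a)) gs" "s out = []" "\<forall>i\<ge>m. s i = []" for a s
  proof -
    let ?s1 = "s(m := letters (g a))"
    let ?s2 = "?s1(out := letters (f a))"
    have 1: "exec c s (B a) ?s1" using c s by auto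
    have "map ?s1 ins = map s ins" using *(2) by force
    then have 2: "exec d ?s1 (B' a) ?s2"
      by (intro d) (use s * in auto)
    have 3: "exec (clear m) ?s2 (3 * length (g a) + 1) (?s2(m := []))"
      by (rule exec_clear) (use * in auto)
    have eq: "?s2(m := []) = s(out := letters (f a))" using s * by (auto simp: fun_eq_iff)
    have 4: "exec (d ;; clear m) ?s1 (B' a + 3 + (3 * length (g a) + 1)) (?s2(m := []))"
      by (rule exec.Seq[OF 2 3]) simp
    show ?thesis by (rule exec.Seq[OF 1 4[unfolded eq]]) simp
  qed
  note run = this
  show "\<exists>c B. polyb gs B \<and> (\<forall>a s. map s ins = map (\<lambda>g. letters (g a)) gs \<longrightarrow> s out = [] \<longrightarrow>
      (\<forall>i\<ge>m. s i = []) \<longrightarrow> exec c s (B a) (s(out := letters (f a))))"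
    by (rule exI, rule exI, intro conjI allI impI, rule poly, rule run)
qed

lemma UNIV_sym: "UNIV = {Zero, One, Tick, Comma, Amp}"
  using sym.exhaust by auto

lemma finite_sym: "finite (UNIV :: sym set)"
  by (simp add: UNIV_sym)

text \<open>Bounded recursion on words, from which all loops below are derived. The bound
  \<open>N\<close> on the intermediate values is essential, since repeated doubling would lead out
  of polynomial time. It is required only at the suffixes of \<open>xf a\<close>, the arguments that
  actually occur.\<close>

lemma pt_rec:
  fixes h :: "sym \<Rightarrow> word \<times> word \<times> 'a \<Rightarrow> word" and xf b :: "'a \<Rightarrow> word"
  defines "R \<equiv> \<lambda>a. rec_list (b a) (\<lambda>c x r. h c (x, r, a))"
  assumes "pt gs xf" "pt gs b"
    and "\<And>c. pt (fst # (\<lambda>e. fst (snd e)) # map (\<lambda>g e. g (snd (snd e))) gs) (h c)"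
    and "polyb gs N" and N: "\<And>a u x. xf a = u @ x \<Longrightarrow> length (R a x) \<le> N a"
  shows "pt gs (\<lambda>a. R a (xf a))"
proof (rule ptI)
  fix ins :: "nat list" and out m :: nat
  assume *: "length ins = length gs" "\<And>r. r \<in> set ins \<Longrightarrow> r < m" "out < m" "out \<notin> set ins"
  let ?gs = "fst # (\<lambda>e. fst (snd e)) # map (\<lambda>g e. g (snd (snd e))) gs :: (word \<times> word \<times> 'a \<Rightarrow> word) list"
  \<comment> \<open>\<open>X\<close> receives the recursion word and \<open>Y\<close> its reversal,
    so that letters come off at its end. \<open>D\<close> holds the suffix processed so far,
    \<open>A\<close> the value at this suffix, \<open>W\<close> the next value, and \<open>V\<close>
    is scratch space. The work space of the subprograms starts at \<open>M\<close>.\<close>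
  define X Y D A W V M where "X = m" "Y = m + 1" "D = m + 2" "A = m + 3" "W = m + 4" "V = m + 5" "M = m + 6"
  note regs = this
  have ins: "r < M" "r \<notin> {X, Y, D, A, W, V}" if "r \<in> set ins" for r
    using *(2)[OF that] by (auto simp: regs)
  have out: "out < M" "out \<notin> {X, Y, D, A, W, V}" using *(3) by (auto simp: regs)
  have nin: "X \<notin> set ins" "A \<notin> set ins" "W \<notin> set ins" using ins(2) by blast+
  have WA: "W \<noteq> A" by (simp add: regs)
  have dist: "distinct [X, Y, D, A, W, V]" "X < M" "Y < M" "D < M" "A < M" "W < M" "V < M"
    by (auto simp: regs)
  obtain cx Bx where Bx: "polyb gs Bx" and cx:
    "\<And>a s. map s ins = map (\<lambda>g. letters (g a)) gs \<Longrightarrow> s X = [] \<Longrightarrow> (\<And>i. i \<ge> M \<Longrightarrow> s i = []) \<Longrightarrow>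
        exec cx s (Bx a) (s(X := letters (xf a)))"
    by (rule ptE[OF assms(2), of ins M X]) (use * ins(1) nin dist in auto)
  obtain cb Bb where Bb: "polyb gs Bb" and cb:
    "\<And>a s. map s ins = map (\<lambda>g. letters (g a)) gs \<Longrightarrow> s A = [] \<Longrightarrow> (\<And>i. i \<ge> M \<Longrightarrow> s i = []) \<Longrightarrow>
        exec cb s (Bb a) (s(A := letters (b a)))"
    by (rule ptE[OF assms(3), of ins M A]) (use * ins(1) nin dist in auto)
  \<comment> \<open>The bound of each case is replaced by a polynomial: being monotone, it can be
    evaluated at one common size for all rounds.\<close>
  define Q where "Q c d p \<longleftrightarrow> (\<forall>e s. map s (D # A # ins) = map (\<lambda>g. letters (g e)) ?gs \<longrightarrow> s W = [] \<longrightarrow>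
      (\<forall>i\<ge>M. s i = []) \<longrightarrow> exec d s (poly p (isize ?gs e)) (s(W := letters (h c e))))" for c d p
  have "\<exists>d p. Q c d p" for c
  proof (rule ptE[OF assms(4)[of c], of "D # A # ins" M W])
    fix d B
    assume B: "polyb ?gs B" and d: "\<And>e s. map s (D # A # ins) = map (\<lambda>g. letters (g e)) ?gs \<Longrightarrow>
      s W = [] \<Longrightarrow> (\<And>i. i \<ge> M \<Longrightarrow> s i = []) \<Longrightarrow> exec d s (B e) (s(W := letters (h c e)))"
    obtain p where p: "\<And>e. B e \<le> poly p (isize ?gs e)"
      using B unfolding polyb_def by blast
    have "Q c d p"
      unfolding Q_def by (intro allI impI, rule exec_mono[OF d p]) simp_all
    then show ?thesis by blast
  qed (use * ins(1) nin dist in auto)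
  then obtain d p where Q: "\<And>c. Q c (d c) (p c)" by metis
  have d: "exec (d c) s (poly (p c) (isize ?gs e)) (s(W := letters (h c e)))"
    if "map s (D # A # ins) = map (\<lambda>g. letters (g e)) ?gs" "s W = []" "\<forall>i\<ge>M. s i = []" for c e s
    using Q[of c, unfolded Q_def, THEN spec, THEN spec, THEN mp, THEN mp, THEN mp, OF that] .
  define body where "body c = d c ;; clear A ;; move_reg W A V ;; Dup Y D ;; Pop Y" for c
  obtain sw where sw: "\<And>s t s' c. top_cell (s Y) = Letter c \<Longrightarrow> exec (body c) s t s' \<Longrightarrow> exec sw s (t + 10) s'"
  proof -
    let ?f = "\<lambda>v. case hd v of Letter c \<Rightarrow> c | _ \<Rightarrow> Zero"
    obtain sw where "\<forall>s t s'. ?f (tops [Y] s) \<in> UNIV \<longrightarrow> exec (body (?f (tops [Y] s))) s t s' \<longrightarrow>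
        exec sw s (t + 2 * card (UNIV :: sym set)) s'"
      using switch_ex[OF finite_sym, of ?f "[Y]" body] by blast
    moreover have "card (UNIV :: sym set) = 5" by (simp add: UNIV_sym)
    ultimately have "top_cell (s Y) = Letter c \<Longrightarrow> exec (body c) s t s' \<Longrightarrow> exec sw s (t + 10) s'" for s t s' c
      by simp
    then show ?thesis by (rule that)
  qed
  define loop where "loop = While [Y] (\<lambda>v. v \<noteq> [Blank]) sw"
  \<comment> \<open>Cost of one round. The sum over all letters covers whichever case occurs, 19 = 3
    + 16 stems from clearing \<open>A\<close> and moving \<open>W\<close> there, and 40 exceeds all
    remaining constants.\<close>
  define K where "K a = (\<Sum>c\<in>UNIV. poly (p c) (length (xf a) + N a + isize gs a)) + 19 * N a + 40" for a
  let ?B = "\<lambda>a. (Bx a + 3) + ((8 * length (xf a) + 1 + 3) + ((Bb a + 3) + ((length (xf a) * K a + 1 + 3) +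
      ((3 * length (xf a) + 1 + 3) + (16 * N a + 5)))))"
  have px: "polyb gs (\<lambda>a. length (xf a))" by (rule pt_length[OF assms(2)])
  have pK: "polyb gs K" unfolding K_def
    by (intro polyb_add polyb_mult polyb_const polyb_sum polyb_poly px assms(5) polyb_isize)
  have pB: "polyb gs ?B"
    by (intro polyb_add polyb_mult polyb_const Bx Bb px pK assms(5))
  have run: "exec (cx ;; pour X Y ;; cb ;; loop ;; clear D ;; move_reg A out V) s (?B a) (s(out := letters (R a (xf a))))"
    if s: "map s ins = map (\<lambda>g. letters (g a)) gs" "s out = []" "\<forall>i\<ge>m. s i = []" for a s
  proof -
    have emp: "s X = []" "s Y = []" "s D = []" "s A = []" "s W = []" "s V = []" "\<And>i. i \<ge> M \<Longrightarrow> s i = []"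
      using s(3) by (auto simp: regs)
    have frame: "map s' ins = map s ins" if "\<And>i. i \<notin> {X, Y, D, A, W, V} \<Longrightarrow> s' i = s i" for s'
      using ins that by (intro map_cong) auto
    \<comment> \<open>The loop invariant for \<open>xf a = pre @ x\<close>: the letters of
      \<open>pre\<close> still wait in \<open>Y\<close>, the last one on top.\<close>
    define st where "st pre x = s(Y := letters (rev pre), D := letters x, A := letters (R a x))" for pre x
    have loop: "xf a = pre @ x \<Longrightarrow> exec loop (st pre x) (length pre * K a + 1) (st [] (xf a))" for pre x
    proof (induction pre arbitrary: x rule: rev_induct)
      case Nil
      then have "xf a = x" by simp
      moreover have "top_cell (st [] x Y) = Blank" using dist by (simp add: st_def)
      ultimately show ?case unfolding loop_def by (auto intro!: exec.WhileFalse)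
    next
      case (snoc c pre)
      let ?s = "st (pre @ [c]) x"
      have top: "top_cell (?s Y) = Letter c" using dist by (simp add: st_def)
      have fr: "map ?s ins = map s ins" by (rule frame) (auto simp: st_def)
      have lenR: "length (R a x) \<le> N a" "length (R a (c # x)) \<le> N a"
        using N[of a "pre @ [c]" x] N[of a pre "c # x"] snoc.prems by auto
      have "isize ?gs (x, R a x, a) = length x + length (R a x) + isize gs a"
        by (simp add: isize_def comp_def)
      also have "\<dots> \<le> length (xf a) + N a + isize gs a" using lenR snoc.prems by simp
      finally have "poly (p c) (isize ?gs (x, R a x, a)) \<le> poly (p c) (length (xf a) + N a + isize gs a)"
        by (rule poly_nat_mono)
      also have "\<dots> \<le> (\<Sum>c\<in>UNIV. poly (p c) (length (xf a) + N a + isize gs a))"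
        by (rule member_le_sum) (auto simp: finite_sym)
      finally have pK: "poly (p c) (isize ?gs (x, R a x, a)) + 19 * N a + 40 \<le> K a" by (simp add: K_def)
      let ?s1 = "?s(W := letters (R a (c # x)))"
      have "exec (d c) ?s (poly (p c) (isize ?gs (x, R a x, a))) (?s(W := letters (h c (x, R a x, a))))"
        using fr s(1) emp dist by (intro d) (auto simp: st_def comp_def)
      then have 1: "exec (d c) ?s (poly (p c) (isize ?gs (x, R a x, a))) ?s1"
        by (simp add: R_def)
      let ?s2 = "?s1(A := [])"
      have 2: "exec (clear A) ?s1 (3 * N a + 1) ?s2"
        by (rule exec_clear) (use dist lenR in \<open>auto simp: st_def\<close>)
      let ?s3 = "?s2(W := [], A := letters (R a (c # x)))"
      have "exec (move_reg W A V) ?s2 (16 * N a + 5) (?s2(W := [], A := ?s2 W @ ?s2 A))"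
        by (rule exec_move_reg) (use dist lenR emp in \<open>auto simp: st_def\<close>)
      then have 3: "exec (move_reg W A V) ?s2 (16 * N a + 5) ?s3" using WA by simp
      let ?s4 = "?s3(D := letters (c # x))"
      have "exec (Dup Y D) ?s3 2 (?s3(D := top_cell (?s3 Y) # ?s3 D))"
        by (rule exec.Dup) (use dist in auto)
      then have 4: "exec (Dup Y D) ?s3 2 ?s4" using dist by (simp add: st_def)
      have "exec (Pop Y) ?s4 1 (?s4(Y := tl (?s4 Y)))" by (rule exec.Pop) simp
      moreover have "?s4(Y := tl (?s4 Y)) = st pre (c # x)"
        using dist emp by (auto simp: st_def fun_eq_iff)
      ultimately have 5: "exec (Pop Y) ?s4 1 (st pre (c # x))" by simp
      have 6: "exec (Dup Y D ;; Pop Y) ?s3 6 (st pre (c # x))" by (rule exec.Seq[OF 4 5]) simp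
      have 7: "exec (move_reg W A V ;; Dup Y D ;; Pop Y) ?s2 (16 * N a + 14) (st pre (c # x))"
        by (rule exec.Seq[OF 3 6]) simp
      have 8: "exec (clear A ;; move_reg W A V ;; Dup Y D ;; Pop Y) ?s1 (19 * N a + 18) (st pre (c # x))"
        by (rule exec.Seq[OF 2 7]) simp
      have "exec (body c) ?s (poly (p c) (isize ?gs (x, R a x, a)) + 19 * N a + 21) (st pre (c # x))"
        unfolding body_def by (rule exec.Seq[OF 1 8]) simp
      note 9 = sw[OF top this]
      have 10: "exec loop (st pre (c # x)) (length pre * K a + 1) (st [] (xf a))"
        using snoc by simp
      show ?case unfolding loop_def
        by (rule exec.WhileTrue[OF _ 9 10[unfolded loop_def]]) (use pK top in \<open>auto simp: algebra_simps\<close>)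
    qed
    let ?x = "letters (xf a)"
    let ?s1 = "s(X := ?x)"
    have 1: "exec cx s (Bx a) ?s1" using cx s(1) emp by auto
    let ?s2 = "s(Y := rev ?x)"
    have "exec (pour X Y) ?s1 (8 * length (xf a) + 1) (?s1(X := [], Y := rev (?s1 X) @ ?s1 Y))"
      by (rule exec_pour) (use dist in auto)
    moreover have "?s1(X := [], Y := rev (?s1 X) @ ?s1 Y) = ?s2"
      using dist emp by (auto simp: fun_eq_iff)
    ultimately have 2: "exec (pour X Y) ?s1 (8 * length (xf a) + 1) ?s2" by simp
    have "map ?s2 ins = map s ins" by (rule frame) auto
    then have "exec cb ?s2 (Bb a) (?s2(A := letters (b a)))"
      using s(1) emp dist by (intro cb) auto
    moreover have "?s2(A := letters (b a)) = st (xf a) []"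
      using dist emp by (auto simp: st_def fun_eq_iff R_def rev_map)
    ultimately have 3: "exec cb ?s2 (Bb a) (st (xf a) [])" by simp
    have 4: "exec loop (st (xf a) []) (length (xf a) * K a + 1) (st [] (xf a))" by (rule loop) simp
    let ?s5 = "s(A := letters (R a (xf a)))"
    have "exec (clear D) (st [] (xf a)) (3 * length (xf a) + 1) ((st [] (xf a))(D := []))"
      by (rule exec_clear) (use dist in \<open>auto simp: st_def\<close>)
    moreover have "(st [] (xf a))(D := []) = ?s5"
      using dist emp by (auto simp: st_def fun_eq_iff)
    ultimately have 5: "exec (clear D) (st [] (xf a)) (3 * length (xf a) + 1) ?s5" by simp
    have len: "length (R a (xf a)) \<le> N a" using N[of a "[]"] by simp
    have "exec (move_reg A out V) ?s5 (16 * N a + 5) (?s5(A := [], out := ?s5 A @ ?s5 out))"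
      by (rule exec_move_reg) (use dist emp out len in auto)
    moreover have "?s5(A := [], out := ?s5 A @ ?s5 out) = s(out := letters (R a (xf a)))"
      using dist emp out s(2) by (auto simp: fun_eq_iff)
    ultimately have 6: "exec (move_reg A out V) ?s5 (16 * N a + 5) (s(out := letters (R a (xf a))))" by simp
    show ?thesis
      by (rule exec.Seq[OF 1 exec.Seq[OF 2 exec.Seq[OF 3 exec.Seq[OF 4 exec.Seq[OF 5 6
        order_refl] order_refl] order_refl] order_refl]]) simp
  qed
  show "\<exists>c B. polyb gs B \<and> (\<forall>aa s. map s ins = map (\<lambda>g. letters (g aa)) gs \<longrightarrow> s out = [] \<longrightarrow>
      (\<forall>i\<ge>m. s i = []) \<longrightarrow> exec c s (B aa) (s(out := letters (R aa (xf aa)))))"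
    by (rule exI, rule exI[of _ ?B], intro conjI pB allI impI, rule run)
qed

text \<open>A machine has to deliver its output on the tape that held the input; hence the final
  clearing and moving.\<close>

lemma pt_poly_time:
  assumes "pt [\<lambda>w. w] f"
  shows "poly_time f"
proof -
  obtain c B where B: "polyb [\<lambda>w. w] B" and c:
    "\<And>a s. map s [0] = map (\<lambda>g. letters (g a)) [\<lambda>w. w] \<Longrightarrow> s 1 = [] \<Longrightarrow> (\<And>i. i \<ge> 2 \<Longrightarrow> s i = []) \<Longrightarrow>
        exec c s (B a) (s(1 := letters (f a)))"
    by (rule ptE[OF assms, of "[0]" 2 1]) auto
  have "polyb [\<lambda>w. w] (\<lambda>w. (B w + 3) + ((3 * length w + 1 + 3) + (16 * length (f w) + 5)))"
    by (intro polyb_add polyb_mult polyb_const B polyb_length pt_length assms) auto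
  then obtain p where p: "\<And>w. (B w + 3) + ((3 * length w + 1 + 3) + (16 * length (f w) + 5)) \<le> poly p (length w)"
    by (auto simp: polyb_def isize_def)
  show ?thesis
  proof (rule poly_time_exec)
    fix w
    let ?s = "(\<lambda>_. [])(0 := letters w) :: regs"
    let ?s1 = "?s(1 := letters (f w))"
    have 1: "exec c ?s (B w) ?s1" by (rule c) auto
    have 2: "exec (clear 0) ?s1 (3 * length w + 1) (?s1(0 := []))"
      by (rule exec_clear) auto
    let ?s2 = "?s1(0 := [])"
    have 3: "exec (move_reg 1 0 2) ?s2 (16 * length (f w) + 5) (?s2(1 := [], 0 := ?s2 1 @ ?s2 0))"
      by (rule exec_move_reg[of ?s2 1 0 2]) auto
    have "exec (c ;; clear 0 ;; move_reg 1 0 2) ?s (poly p (length w)) (?s2(1 := [], 0 := ?s2 1 @ ?s2 0))"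
      by (rule exec.Seq[OF 1 exec.Seq[OF 2 3 order_refl]]) (use p[of w] in simp)
    then show "\<exists>s. exec (c ;; clear 0 ;; move_reg 1 0 2) ?s (poly p (length w)) s \<and> s 0 = letters (f w)"
      by (intro exI[of _ "?s2(1 := [], 0 := ?s2 1 @ ?s2 0)"] conjI) simp_all
  qed
qed

subsection \<open>Simulating a Turing machine by a stack program\<close>

text \<open>A tape is stored as two stacks, the cells from the head on to the right and those to the left
  of the head. Blanks inside them are replaced by a symbol \<open>Aux b\<close> foreign to the machine, so that
  the stacks can be emptied afterwards.\<close>

definition dec :: "nat \<Rightarrow> cell \<Rightarrow> cell" where
  "dec b x = (if x = Aux b then Blank else x)"

definition enc :: "nat \<Rightarrow> cell \<Rightarrow> cell" where
  "enc b x = (if x = Blank then Aux b else x)"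

text \<open>Only a finite part of a half-tape is stored, and all cells beyond it are blank.\<close>

definition holds :: "nat \<Rightarrow> (nat \<Rightarrow> cell) \<Rightarrow> cell list \<Rightarrow> bool" where
  "holds b u xs \<longleftrightarrow> Blank \<notin> set xs \<and> (\<forall>i. u i = dec b (if i < length xs then xs ! i else Blank))"

lemma holds_top: "holds b u xs \<Longrightarrow> dec b (top_cell xs) = u 0"
  by (cases xs) (auto simp: holds_def)

lemma holds_tl: "holds b u xs \<Longrightarrow> holds b (\<lambda>i. u (Suc i)) (tl xs)"
  by (cases xs) (auto simp: holds_def)

lemma holds_Cons:
  assumes "holds b u xs" "x \<noteq> Blank" "v 0 = dec b x" "\<And>i. v (Suc i) = u i"
  shows "holds b v (x # xs)"
proof -
  have "v i = dec b (if i < length (x # xs) then (x # xs) ! i else Blank)" for i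
    using assms by (cases i) (auto simp: holds_def)
  then show ?thesis using assms(1,2) by (simp add: holds_def)
qed

definition sim_tape :: "nat \<Rightarrow> tape \<Rightarrow> cell list \<Rightarrow> cell list \<Rightarrow> bool" where
  "sim_tape b th l r \<longleftrightarrow>
     holds b (\<lambda>i. fst th (snd th + int i)) r \<and> holds b (\<lambda>i. fst th (snd th - 1 - int i)) l"

lemma sim_tape_scanned: "sim_tape b th l r \<Longrightarrow> dec b (top_cell r) = scanned th"
  by (cases th) (auto simp: sim_tape_def dest: holds_top)

lemma dec_enc: "x \<noteq> Aux b \<Longrightarrow> dec b (enc b x) = x"
  by (simp add: dec_def enc_def)

lemma enc_not_Blank: "enc b x \<noteq> Blank"
  by (simp add: enc_def)

text \<open>A stack may be exhausted where the tape continues with blanks. Popping an empty stack is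
  harmless, and a head that moves left beyond the stored part meets the coded blank
  \<open>Aux b\<close>.\<close>

definition act_prog :: "nat \<Rightarrow> nat \<Rightarrow> nat \<Rightarrow> cell \<times> move \<Rightarrow> com" where
  "act_prog b L R a = (case snd a of
      MoveRight \<Rightarrow> Pop R ;; Push L (enc b (fst a))
    | Stay \<Rightarrow> Pop R ;; Push R (enc b (fst a))
    | MoveLeft \<Rightarrow> Pop R ;; Push R (enc b (fst a)) ;;
        If [L] (\<lambda>v. v = [Blank]) (Push R (Aux b)) (Dup L R ;; Pop L))"

lemma exec_act_prog:
  assumes "sim_tape b th (s L) (s R)" "L \<noteq> R" "fst a \<noteq> Aux b"
  shows "\<exists>l r. exec (act_prog b L R a) s 20 (s(L := l, R := r)) \<and> sim_tape b (act a th) l r"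
proof -
  obtain t h where th: "th = (t, h)" by (cases th)
  obtain c mv where a: "a = (c, mv)" by (cases a)
  have r: "holds b (\<lambda>i. t (h + int i)) (s R)" and l: "holds b (\<lambda>i. t (h - 1 - int i)) (s L)"
    using assms(1) by (auto simp: sim_tape_def th)
  have r': "holds b (\<lambda>i. (t(h := c)) (h + 1 + int i)) (tl (s R))"
    using holds_tl[OF r] by (simp add: algebra_simps)
  have l': "holds b (\<lambda>i. (t(h := c)) (h - 1 - int i)) (s L)" using l by simp
  have c: "dec b (enc b c) = c" using assms(3) a by (simp add: dec_enc)
  have r'': "holds b (\<lambda>i. (t(h := c)) (h + int i)) (enc b c # tl (s R))"
    by (rule holds_Cons[OF r' enc_not_Blank]) (auto simp: c algebra_simps)
  have pop: "exec (Pop R) s 1 (s(R := tl (s R)))" by (rule exec.Pop) simp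
  let ?s1 = "s(R := enc b c # tl (s R))"
  have push: "exec (Push R (enc b c)) (s(R := tl (s R))) 2 ?s1"
    using exec.Push[of 2 R "enc b c" "s(R := tl (s R))"] by simp
  have 1: "exec (Pop R ;; Push R (enc b c)) s 6 ?s1" by (rule exec.Seq[OF pop push]) simp
  show ?thesis
  proof (cases mv)
    case Stay
    have "sim_tape b (act a th) (s L) (enc b c # tl (s R))"
      using r'' l' Stay by (simp add: sim_tape_def th a)
    moreover have "exec (act_prog b L R a) s 20 ?s1"
      using exec_mono[OF 1, of 20] Stay a by (simp add: act_prog_def)
    moreover have "?s1 = s(L := s L, R := enc b c # tl (s R))" by auto
    ultimately show ?thesis by metis
  next
    case MoveRight
    have "holds b (\<lambda>i. (t(h := c)) (h + 1 - 1 - int i)) (enc b c # s L)"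
      by (rule holds_Cons[OF l' enc_not_Blank]) (auto simp: c algebra_simps)
    then have "sim_tape b (act a th) (enc b c # s L) (tl (s R))"
      using r' MoveRight by (simp add: sim_tape_def th a algebra_simps)
    moreover have "exec (Push L (enc b c)) (s(R := tl (s R))) 2 (s(L := enc b c # s L, R := tl (s R)))"
      using exec.Push[of 2 L "enc b c" "s(R := tl (s R))"] assms(2) by (simp add: fun_upd_twist)
    then have "exec (act_prog b L R a) s 20 (s(L := enc b c # s L, R := tl (s R)))"
      using exec.Seq[OF pop, of "Push L (enc b c)" 2 _ 20] MoveRight a by (simp add: act_prog_def)
    ultimately show ?thesis by blast
  next
    case MoveLeft
    \<comment> \<open>The cell that comes under the head; an exhausted left stack stands for
      blanks.\<close>
    define y where "y = (if s L = [] then Aux b else hd (s L))"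
    have y: "y \<noteq> Blank" "dec b y = t (h - 1)"
      using l holds_top[OF l] by (auto simp: y_def holds_def dec_def neq_Nil_conv)
    have "holds b (\<lambda>i. (t(h := c)) (h - 1 + int i)) (y # enc b c # tl (s R))"
      by (rule holds_Cons[OF r'' y(1)]) (use y(2) in \<open>auto simp: algebra_simps\<close>)
    moreover have "holds b (\<lambda>i. (t(h := c)) (h - 1 - 1 - int i)) (tl (s L))"
      using holds_tl[OF l'] by (simp add: algebra_simps)
    ultimately have sim: "sim_tape b (act a th) (tl (s L)) (y # enc b c # tl (s R))"
      using MoveLeft by (simp add: sim_tape_def th a)
    let ?s2 = "s(L := tl (s L), R := y # enc b c # tl (s R))"
    have "exec (If [L] (\<lambda>v. v = [Blank]) (Push R (Aux b)) (Dup L R ;; Pop L)) ?s1 8 ?s2"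
    proof (cases "s L")
      case Nil
      have "exec (Push R (Aux b)) ?s1 2 (?s1(R := Aux b # ?s1 R))" by (rule exec.Push) simp
      moreover have "?s1(R := Aux b # ?s1 R) = ?s2" using Nil assms(2) by (auto simp: y_def fun_eq_iff)
      ultimately have "exec (Push R (Aux b)) ?s1 2 ?s2" by simp
      then show ?thesis by (rule exec.IfTrue[rotated]) (use Nil assms(2) in auto)
    next
      case (Cons z zs)
      then have z: "z \<noteq> Blank" "y = z" using l by (auto simp: holds_def y_def)
      have 2: "exec (Dup L R) ?s1 2 (?s1(R := top_cell (?s1 L) # ?s1 R))"
        by (rule exec.Dup) (use assms(2) in auto)
      have 3: "exec (Pop L) (?s1(R := top_cell (?s1 L) # ?s1 R)) 1
          (?s1(R := top_cell (?s1 L) # ?s1 R, L := tl ((?s1(R := top_cell (?s1 L) # ?s1 R)) L)))"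
        by (rule exec.Pop) simp
      have 4: "?s1(R := top_cell (?s1 L) # ?s1 R, L := tl ((?s1(R := top_cell (?s1 L) # ?s1 R)) L)) = ?s2"
        using Cons z assms(2) by (auto simp: fun_eq_iff)
      have "exec (Dup L R ;; Pop L) ?s1 6 ?s2" by (rule exec.Seq[OF 2 3[unfolded 4]]) simp
      then show ?thesis by (rule exec.IfFalse[rotated]) (use Cons z assms(2) in auto)
    qed
    note 5 = this
    have "exec (Push R (enc b c) ;; If [L] (\<lambda>v. v = [Blank]) (Push R (Aux b)) (Dup L R ;; Pop L))
        (s(R := tl (s R))) 13 ?s2"
      by (rule exec.Seq[OF push 5]) simp
    note 6 = exec.Seq[OF pop this, of 20]
    have "exec (act_prog b L R a) s 20 ?s2"
      using 6 MoveLeft a by (simp add: act_prog_def)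
    with sim show ?thesis by blast
  qed
qed

text \<open>Tape \<open>j\<close> occupies the registers \<open>m + 2 * j\<close> (left of the head)
  and \<open>m + 2 * j + 1\<close> (from the head on).\<close>

fun acts_prog :: "nat \<Rightarrow> nat \<Rightarrow> nat \<Rightarrow> (cell \<times> move) list \<Rightarrow> com" where
  "acts_prog b m j [] = Skip"
| "acts_prog b m j (a # as) = act_prog b (m + 2 * j) (m + 2 * j + 1) a ;; acts_prog b m (Suc j) as"

lemma exec_acts_prog:
  assumes "length ts = length as" "Aux b \<notin> fst ` set as"
    and "\<And>i. i < length ts \<Longrightarrow> sim_tape b (ts ! i) (s (m + 2 * (j + i))) (s (m + 2 * (j + i) + 1))"
  shows "\<exists>s'. exec (acts_prog b m j as) s (23 * length as) s' \<and>
    (\<forall>i < length ts. sim_tape b (act (as ! i) (ts ! i)) (s' (m + 2 * (j + i))) (s' (m + 2 * (j + i) + 1))) \<and>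
    (\<forall>r. r < m + 2 * j \<or> m + 2 * (j + length as) \<le> r \<longrightarrow> s' r = s r)"
  using assms
proof (induction as arbitrary: ts j s)
  case Nil
  then show ?case by (auto intro!: exec.Skip)
next
  case (Cons a as)
  then obtain th ts' where ts: "ts = th # ts'" by (cases ts) auto
  let ?L = "m + 2 * j" and ?R = "m + 2 * j + 1"
  have "sim_tape b th (s ?L) (s ?R)" using Cons.prems(3)[of 0] ts by simp
  moreover have "fst a \<noteq> Aux b" using Cons.prems(2) by force
  ultimately obtain l r where 1: "exec (act_prog b ?L ?R a) s 20 (s(?L := l, ?R := r))"
    and sim: "sim_tape b (act a th) l r"
    using exec_act_prog[of b th s ?L ?R a] by auto
  let ?s = "s(?L := l, ?R := r)"
  have sim': "sim_tape b (ts' ! i) (?s (m + 2 * (Suc j + i))) (?s (m + 2 * (Suc j + i) + 1))"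
    if "i < length ts'" for i
    using Cons.prems(3)[of "Suc i"] that ts by simp
  have "\<exists>s'. exec (acts_prog b m (Suc j) as) ?s (23 * length as) s' \<and>
    (\<forall>i < length ts'. sim_tape b (act (as ! i) (ts' ! i)) (s' (m + 2 * (Suc j + i))) (s' (m + 2 * (Suc j + i) + 1))) \<and>
    (\<forall>r. r < m + 2 * Suc j \<or> m + 2 * (Suc j + length as) \<le> r \<longrightarrow> s' r = ?s r)"
    by (rule Cons.IH) (use Cons.prems(1,2) ts sim' in auto)
  then obtain s' where 2: "exec (acts_prog b m (Suc j) as) ?s (23 * length as) s'"
    and s': "\<And>i. i < length ts' \<Longrightarrow>
        sim_tape b (act (as ! i) (ts' ! i)) (s' (m + 2 * (Suc j + i))) (s' (m + 2 * (Suc j + i) + 1))"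
      "\<And>r. r < m + 2 * Suc j \<or> m + 2 * (Suc j + length as) \<le> r \<Longrightarrow> s' r = ?s r"
    by blast
  show ?case
  proof (intro exI[of _ s'] conjI allI impI)
    show "exec (acts_prog b m j (a # as)) s (23 * length (a # as)) s'"
      using exec.Seq[OF 1 2] by simp
  next
    fix i
    assume i: "i < length ts"
    show "sim_tape b (act ((a # as) ! i) (ts ! i)) (s' (m + 2 * (j + i))) (s' (m + 2 * (j + i) + 1))"
    proof (cases i)
      case 0
      then show ?thesis using s'(2) sim ts by simp
    next
      case (Suc i')
      then show ?thesis using s'(1)[of i'] i ts by simp
    qed
  next
    fix r
    assume "r < m + 2 * j \<or> m + 2 * (j + length (a # as)) \<le> r"
    then show "s' r = s r" using s'(2)[of r] by auto
  qed
qed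

fun clears :: "nat list \<Rightarrow> com" where
  "clears [] = Skip"
| "clears (r # rs) = clear r ;; clears rs"

lemma exec_clears:
  assumes "\<And>r. r \<in> set rs \<Longrightarrow> Blank \<notin> set (s r) \<and> length (s r) \<le> n"
  shows "exec (clears rs) s (length rs * (3 * n + 4)) (\<lambda>i. if i \<in> set rs then [] else s i)"
  using assms
proof (induction rs arbitrary: s)
  case Nil
  then show ?case by (auto intro!: exec.Skip)
next
  case (Cons r rs)
  have 1: "exec (clear r) s (3 * n + 1) (s(r := []))"
    by (rule exec_clear) (use Cons.prems[of r] in auto)
  have 2: "exec (clears rs) (s(r := [])) (length rs * (3 * n + 4))
      (\<lambda>i. if i \<in> set rs then [] else (s(r := [])) i)"
    by (rule Cons.IH) (use Cons.prems in auto)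
  have "(\<lambda>i. if i \<in> set rs then [] else (s(r := [])) i) = (\<lambda>i. if i \<in> set (r # rs) then [] else s i)"
    by auto
  with exec.Seq[OF 1 2] show ?case by simp
qed

lemma exec_pour_letters:
  assumes "s r = letters v @ rest" "top_cell rest \<notin> range Letter" "r \<noteq> r'"
  shows "exec (While [r] (\<lambda>x. hd x \<in> range Letter) (Dup r r' ;; Pop r)) s (8 * length v + 1)
    (s(r := rest, r' := rev (letters v) @ s r'))"
  using assms
proof (induction v arbitrary: s)
  case Nil
  then have "s(r := rest, r' := rev (letters []) @ s r') = s" by (auto simp: fun_eq_iff)
  moreover have "exec (While [r] (\<lambda>x. hd x \<in> range Letter) (Dup r r' ;; Pop r)) s 1 s"
    using Nil by (intro exec.WhileFalse) auto
  ultimately show ?case by (simp only: list.size(3) mult_0_right add_0)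
next
  case (Cons x v)
  let ?s1 = "s(r' := Letter x # s r')"
  let ?s = "?s1(r := letters v @ rest)"
  have 1: "exec (Dup r r') s 2 ?s1" using exec.Dup[of 2 r r' s] Cons.prems by simp
  have 2: "exec (Pop r) ?s1 1 ?s" using exec.Pop[of 1 r ?s1] Cons.prems by simp
  have 3: "exec (Dup r r' ;; Pop r) s 6 ?s" by (rule exec.Seq[OF 1 2]) simp
  have 4: "exec (While [r] (\<lambda>x. hd x \<in> range Letter) (Dup r r' ;; Pop r)) ?s (8 * length v + 1)
      (?s(r := rest, r' := rev (letters v) @ ?s r'))"
    by (rule Cons.IH) (use Cons.prems in auto)
  have 5: "?s(r := rest, r' := rev (letters v) @ ?s r') = s(r := rest, r' := rev (letters (x # v)) @ s r')"
    using Cons.prems by (auto simp: fun_eq_iff)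
  show ?case
    by (rule exec.WhileTrue[OF _ 3 4[unfolded 5]]) (use Cons.prems in auto)
qed

text \<open>Only a letter decodes to a letter. The output is therefore a prefix of the right stack
  and ends before the first cell of another kind.\<close>

lemma sim_output:
  assumes "sim_tape b th l r" "has_output th v"
  shows "\<exists>rest. r = letters v @ rest \<and> top_cell rest \<notin> range Letter"
proof -
  obtain t h where th: "th = (t, h)" by (cases th)
  have r: "t (h + int i) = dec b (if i < length r then r ! i else Blank)" for i
    using assms(1) by (simp add: sim_tape_def th holds_def)
  have v: "\<And>i. i < length v \<Longrightarrow> t (h + int i) = Letter (v ! i)"
    and stop: "t (h + int (length v)) \<notin> range Letter"
    using assms(2) by (auto simp: th)
  have *: "i < length r \<and> r ! i = Letter (v ! i)" if "i < length v" for i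
    using r[of i] v[OF that] by (auto simp: dec_def split: if_splits)
  have len: "length v \<le> length r" using * by (meson leI less_irrefl)
  have "take (length v) r = letters v" using * len by (auto intro!: nth_equalityI)
  then have "r = letters v @ drop (length v) r" by (metis append_take_drop_id)
  moreover have "top_cell (drop (length v) r) \<notin> range Letter"
  proof (cases "length v < length r")
    case True
    then have "top_cell (drop (length v) r) = r ! length v" by (simp flip: Cons_nth_drop_Suc)
    then show ?thesis using True stop r[of "length v"] by (auto simp: dec_def split: if_splits)
  qed auto
  ultimately show ?thesis by blast
qed

text \<open>The converse of \<open>pt_poly_time\<close>. It makes an unknown machine, such as the
  one behind an assumed conversion of input types, available inside programs.\<close>

lemma poly_time_pt_id:
  assumes "poly_time f"
  shows "pt [\<lambda>w. w] f"
proof (rule ptI)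
  fix ins :: "nat list" and out m :: nat
  assume *: "length ins = length [\<lambda>w::word. w]" "\<And>r. r \<in> set ins \<Longrightarrow> r < m" "out < m" "out \<notin> set ins"
  then obtain r0 where r0: "ins = [r0]" "r0 < m" "r0 \<noteq> out" by (cases ins) auto
  obtain T p where T: "is_tm T" and p: "\<And>w. computes_within T w (f w) (poly p (length w))"
    using assms unfolding poly_time_def by blast
  define k where "k = tapes T"
  have k: "0 < k" using T by (simp add: is_tm_def k_def)
  have fin: "finite (symbols T)" "finite (states T)" using T by (auto simp: is_tm_def)
  \<comment> \<open>The alphabet of the machine is finite, but there are infinitely many auxiliary
    symbols.\<close>
  have "\<exists>b. Aux b \<notin> symbols T"
  proof (rule ccontr)
    assume "\<not> ?thesis"
    then have "range Aux \<subseteq> symbols T" by auto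
    then have "finite (range Aux)" using fin finite_subset by blast
    then show False by (simp add: finite_image_iff inj_def)
  qed
  then obtain b where b: "Aux b \<notin> symbols T" by blast
  \<comment> \<open>\<open>S\<close> holds the current state \<open>q\<close> as the single cell
    \<open>Aux q\<close>; \<open>V\<close> is scratch space.\<close>
  define S V where "S = m + 2 * k" and "V = m + 2 * k + 1"
  define step_prog where "step_prog q xs = Pop S ;; Push S (Aux (fst (delta T q xs))) ;;
    acts_prog b m 0 (snd (delta T q xs))" for q xs
  define rs where "rs = S # map (\<lambda>i. m + 2 * i + 1) [0..<k]"
  \<comment> \<open>Keeping all tape cells in the alphabet ensures that the spare symbol
    \<open>Aux b\<close> never occurs on a simulated tape and that the scanned cells take finitely
    many values.\<close>
  define Inv where "Inv s0 s c \<longleftrightarrow> length (snd c) = k \<and> fst c \<in> states T \<and> s S = [Aux (fst c)] \<and>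
      (\<forall>i<k. sim_tape b (snd c ! i) (s (m + 2 * i)) (s (m + 2 * i + 1))) \<and>
      (\<forall>i<k. \<forall>p. fst (snd c ! i) p \<in> symbols T) \<and>
      (\<forall>r. r < m \<or> S < r \<longrightarrow> s r = s0 r)" for s0 s :: regs and c :: config
  obtain sw C where sw: "\<And>s0 s q ts. Inv s0 s (q, ts) \<Longrightarrow> q \<noteq> halt T \<Longrightarrow>
      \<exists>s'. exec sw s C s' \<and> Inv s0 s' (step T (q, ts))"
  proof -
    \<comment> \<open>The tops decode to the state and the list of scanned cells. This pair lies in
      the finite set \<open>?A\<close>, so a finite switch can choose the action.\<close>
    let ?f = "\<lambda>v. (case hd v of Aux q \<Rightarrow> q | _ \<Rightarrow> 0, map (dec b) (tl v))"
    let ?A = "states T \<times> {xs. set xs \<subseteq> symbols T \<and> length xs = k}"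
    have "finite ?A" using fin by (simp add: finite_lists_length_eq)
    then obtain sw where sw: "\<And>s t s'. ?f (tops rs s) \<in> ?A \<Longrightarrow>
        exec ((\<lambda>(q, xs). step_prog q xs) (?f (tops rs s))) s t s' \<Longrightarrow> exec sw s (t + 2 * card ?A) s'"
      using switch_ex[of ?A ?f rs "\<lambda>(q, xs). step_prog q xs"] by blast
    have "\<exists>s'. exec sw s (23 * k + 20 + 2 * card ?A) s' \<and> Inv s0 s' (step T (q, ts))"
      if inv: "Inv s0 s (q, ts)" and q: "q \<noteq> halt T" for s0 s q ts
    proof -
      let ?xs = "map scanned ts"
      have len: "length ts = k" using inv by (simp add: Inv_def)
      have sim: "sim_tape b (ts ! i) (s (m + 2 * i)) (s (m + 2 * i + 1))" if "i < k" for i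
        using inv that by (simp add: Inv_def)
      have sym: "fst (ts ! i) p \<in> symbols T" if "i < k" for i p
        using inv that by (simp add: Inv_def)
      have "scanned (ts ! i) \<in> symbols T" if "i < k" for i
        using sym[OF that, of "snd (ts ! i)"] by (cases "ts ! i") simp
      then have "\<forall>i < length ?xs. ?xs ! i \<in> symbols T" using len by simp
      then have xs: "set ?xs \<subseteq> symbols T" "length ?xs = k"
        using len by (metis in_set_conv_nth subsetI, simp)
      have "map (dec b) (tl (tops rs s)) = ?xs"
        using sim_tape_scanned[OF sim] len by (auto simp: rs_def intro!: nth_equalityI)
      moreover have "hd (tops rs s) = Aux q" using inv by (simp add: rs_def Inv_def)
      ultimately have f: "?f (tops rs s) = (q, ?xs)" by simp
      have qs: "q \<in> states T" using inv by (simp add: Inv_def)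
      obtain q' as where d: "delta T q ?xs = (q', as)" by (cases "delta T q ?xs")
      have d': "q' \<in> states T" "length as = k" "fst ` set as \<subseteq> symbols T"
        using T qs xs d unfolding is_tm_def k_def by (metis fst_conv snd_conv)+
      let ?s = "s(S := [Aux q'])"
      have 1: "exec (Pop S) s 1 (s(S := []))"
        using exec.Pop[of 1 S s] inv by (simp add: Inv_def)
      have 2: "exec (Push S (Aux q')) (s(S := [])) 2 ?s"
        using exec.Push[of 2 S "Aux q'" "s(S := [])"] by simp
      have "\<exists>s'. exec (acts_prog b m 0 as) ?s (23 * length as) s' \<and>
        (\<forall>i < length ts. sim_tape b (act (as ! i) (ts ! i)) (s' (m + 2 * (0 + i))) (s' (m + 2 * (0 + i) + 1))) \<and>
        (\<forall>r. r < m + 2 * 0 \<or> m + 2 * (0 + length as) \<le> r \<longrightarrow> s' r = ?s r)"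
        by (rule exec_acts_prog) (use d' b len sim in \<open>auto simp: S_def\<close>)
      then obtain s' where 3: "exec (acts_prog b m 0 as) ?s (23 * k) s'"
        and s': "\<And>i. i < k \<Longrightarrow> sim_tape b (act (as ! i) (ts ! i)) (s' (m + 2 * i)) (s' (m + 2 * i + 1))"
          "\<And>r. r < m \<or> S \<le> r \<Longrightarrow> s' r = ?s r"
        unfolding d'(2) len S_def by (metis add_0 add_0_right mult_0_right)
      have "exec (Push S (Aux q') ;; acts_prog b m 0 as) (s(S := [])) (23 * k + 10) s'"
        by (rule exec.Seq[OF 2 3]) simp
      from exec.Seq[OF 1 this, of "23 * k + 20"] have "exec (step_prog q ?xs) s (23 * k + 20) s'"
        by (simp add: step_prog_def d)
      then have "exec sw s (23 * k + 20 + 2 * card ?A) s'"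
        using sw[of s "23 * k + 20" s'] f qs xs by simp
      moreover have "step T (q, ts) = (q', map2 act as ts)" using q d by simp
      moreover have "Inv s0 s' (q', map2 act as ts)"
        unfolding Inv_def
      proof (intro conjI allI impI)
        fix i p
        assume i: "i < k"
        obtain c mv where a: "as ! i = (c, mv)" by (cases "as ! i")
        have "c \<in> symbols T" using a d' i by (metis fst_conv image_subset_iff nth_mem)
        moreover obtain t h where "ts ! i = (t, h)" by (cases "ts ! i")
        ultimately show "fst (snd (q', map2 act as ts) ! i) p \<in> symbols T"
          using sym[OF i, of p] a i d' len by simp
      next
        fix r
        assume "r < m \<or> S < r"
        then show "s' r = s0 r" using s'(2)[of r] inv by (auto simp: Inv_def S_def)
      qed (use d' len s' in \<open>auto simp: S_def\<close>)
      ultimately show ?thesis by auto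
    qed
    then show ?thesis by (rule that)
  qed
  define loop where "loop = While [S] (\<lambda>v. v \<noteq> [Aux (halt T)]) sw"
  have loop: "\<exists>s'. exec loop s (u * (C + 2) + 1) s' \<and> Inv s0 s' (halt T, ts')"
    if "Inv s0 s (q, ts)" "(step T ^^ u) (q, ts) = (halt T, ts')" for s0 s q ts ts' u
    using that
  proof (induction u arbitrary: s q ts)
    case 0
    then have "exec loop s 1 s" unfolding loop_def by (intro exec.WhileFalse) (auto simp: Inv_def)
    then show ?case using 0 by auto
  next
    case (Suc u)
    show ?case
    proof (cases "q = halt T")
      case True
      then have "ts' = ts" using Suc.prems(2) step_halt[of "Suc u" T ts] by (simp only: prod.inject)
      moreover have "exec loop s (Suc u * (C + 2) + 1) s"
        unfolding loop_def using Suc.prems True by (intro exec.WhileFalse) (auto simp: Inv_def)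
      ultimately show ?thesis using Suc.prems(1) True by blast
    next
      case False
      obtain s1 where s1: "exec sw s C s1" "Inv s0 s1 (step T (q, ts))"
        using sw[OF Suc.prems(1) False] by blast
      obtain q1 ts1 where 1: "step T (q, ts) = (q1, ts1)" by (cases "step T (q, ts)")
      have "(step T ^^ u) (q1, ts1) = (halt T, ts')"
        using Suc.prems(2) 1 by (simp only: funpow_Suc_right comp_apply)
      then obtain s' where s': "exec loop s1 (u * (C + 2) + 1) s'" "Inv s0 s' (halt T, ts')"
        using Suc.IH s1(2) 1 by metis
      have "exec loop s (Suc u * (C + 2) + 1) s'"
        unfolding loop_def
        by (rule exec.WhileTrue[OF _ s1(1) s'(1)[unfolded loop_def]])
          (use Suc.prems(1) False in \<open>auto simp: Inv_def\<close>)
      then show ?thesis using s'(2) by blast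
    qed
  qed
  let ?R = "m + 1"
  define xtr where "xtr = While [?R] (\<lambda>x. hd x \<in> range Letter) (Dup ?R V ;; Pop ?R)"
  define prog where "prog = ((copy_reg r0 ?R V ;; Push S (Aux (start T))) ;; loop) ;;
    xtr ;; pour V out ;; clears [m..<S + 1]"
  \<comment> \<open>\<open>B1\<close> bounds the time up to the end of the simulation and hence the
    length of each work register at that moment, from which the cost of extracting the output and of
    cleaning up follows.\<close>
  define B1 where "B1 w = 21 * length w + 10 + (poly p (length w) * (C + 2) + 1) + 3" for w :: word
  define B where "B w = B1 w + (8 * B1 w + 1 + (8 * B1 w + 1 + (2 * k + 1) * (3 * B1 w + 4) + 3) + 3) + 3" for w :: word
  have polyB1: "polyb [\<lambda>w. w] B1" unfolding B1_def
    by (intro polyb_add polyb_mult polyb_const polyb_poly polyb_length) auto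
  have polyB: "polyb [\<lambda>w. w] B" unfolding B_def
    by (intro polyb_add polyb_mult polyb_const polyB1)
  have run: "exec prog s (B w) (s(out := letters (f w)))"
    if s: "map s ins = map (\<lambda>g. letters (g w)) [\<lambda>w. w]" "s out = []" "\<forall>i\<ge>m. s i = []" for w s
  proof -
    have sr0: "s r0 = letters w" using s(1) r0 by simp
    have ne: "r0 \<noteq> ?R" "r0 \<noteq> V" "?R \<noteq> V" "?R \<noteq> S" "S \<noteq> ?R" "V \<noteq> out" "S \<noteq> V" "?R < S"
      using r0 k *(3) by (auto simp: V_def S_def)
    let ?s1 = "s(?R := letters w)"
    have "exec (copy_reg r0 ?R V) s (21 * length w + 5) (s(?R := s r0 @ s ?R))"
      by (rule exec_copy_reg) (use ne sr0 s(3) in \<open>auto simp: V_def\<close>)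
    then have 1: "exec (copy_reg r0 ?R V) s (21 * length w + 5) ?s1" using sr0 s(3) by simp
    let ?s2 = "?s1(S := [Aux (start T)])"
    have 2: "exec (Push S (Aux (start T))) ?s1 2 ?s2"
      using exec.Push[of 2 S "Aux (start T)" ?s1] ne s(3) by (simp add: S_def)
    have 3: "exec (copy_reg r0 ?R V ;; Push S (Aux (start T))) s (21 * length w + 10) ?s2"
      by (rule exec.Seq[OF 1 2]) simp
    let ?ts = "snd (initial T w)"
    have lett: "Letter x \<in> symbols T" "Blank \<in> symbols T" for x using T by (auto simp: is_tm_def)
    have inv2: "Inv s ?s2 (start T, ?ts)"
      unfolding Inv_def
    proof (intro conjI allI impI)
      fix i
      assume i: "i < k"
      show "sim_tape b (snd (start T, ?ts) ! i) (?s2 (m + 2 * i)) (?s2 (m + 2 * i + 1))"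
      proof (cases "i = 0")
        case True
        have "m \<noteq> S" "m \<noteq> ?R" "s m = []" using k s(3) by (auto simp: S_def)
        then show ?thesis using True ne
          by (auto simp: initial_def sim_tape_def word_tape_def holds_def dec_def)
      next
        case False
        have 1: "m + 2 * i \<noteq> S" "m + 2 * i \<noteq> ?R" "m + 2 * i + 1 \<noteq> S" "m + 2 * i + 1 \<noteq> ?R"
          using i False unfolding S_def by presburger+
        have "?ts ! i = blank_tape" using i False by (simp add: initial_def k_def)
        then show ?thesis using 1 s(3) by (auto simp: sim_tape_def holds_def dec_def blank_tape_def)
      qed
      fix p
      have "?ts ! i = word_tape w \<or> ?ts ! i = blank_tape"
        using i by (auto simp: initial_def nth_Cons' k_def)
      then show "fst (snd (start T, ?ts) ! i) p \<in> symbols T"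
        using lett by (auto simp: word_tape_def blank_tape_def)
    next
      fix r
      assume "r < m \<or> S < r"
      then show "?s2 r = s r" using ne by auto
    qed (use T k in \<open>auto simp: initial_def is_tm_def k_def\<close>)
    obtain u where u': "u \<le> poly p (length w)"
        "case (step T ^^ u) (initial T w) of (q, ts) \<Rightarrow> q = halt T \<and> has_output (hd ts) (f w)"
      using p[of w, unfolded computes_within_def] by (elim exE conjE) (rule that)
    obtain q ts' where q: "(step T ^^ u) (initial T w) = (q, ts')" by (rule prod.exhaust)
    have ini: "initial T w = (start T, ?ts)" by (simp add: initial_def)
    have u: "u \<le> poly p (length w)" "(step T ^^ u) (start T, ?ts) = (halt T, ts')" "has_output (hd ts') (f w)"
      using u' unfolding q prod.case ini[symmetric] by simp_all
    obtain s3 where s3: "exec loop ?s2 (u * (C + 2) + 1) s3" "Inv s s3 (halt T, ts')"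
      using loop[OF inv2 u(2)] by (elim exE conjE) (rule that)
    have 4: "exec ((copy_reg r0 ?R V ;; Push S (Aux (start T))) ;; loop) s (B1 w) s3"
      by (rule exec.Seq[OF 3 s3(1)]) (use mult_right_mono[OF u(1), of "C + 2"] in \<open>simp add: B1_def\<close>)
    have len3: "length (s3 r) \<le> B1 w" if "m \<le> r" for r
      using exec_length[OF 4, of r] s(3) that by simp
    have ts': "length ts' = k" "hd ts' = ts' ! 0"
      using s3(2) k by (auto simp: Inv_def intro!: hd_conv_nth)
    have "sim_tape b (hd ts') (s3 m) (s3 ?R)"
      using s3(2) k ts'(2) by (auto simp: Inv_def dest: spec[of _ 0])
    then obtain rest where rest: "s3 ?R = letters (f w) @ rest" "top_cell rest \<notin> range Letter"
      using sim_output u(3) by blast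
    have lenf: "length (f w) \<le> B1 w" using len3[of ?R] rest(1) by simp
    have s3f: "s3 r = s r" if "r < m \<or> S < r" for r
      using s3(2) that unfolding Inv_def by blast
    have s3V: "s3 V = []" and s3o: "s3 out = []"
      using s3f[of V] s3f[of out] s(2,3) *(3) by (auto simp: V_def S_def)
    let ?s4 = "s3(?R := rest, V := rev (letters (f w)))"
    have 5: "exec xtr s3 (8 * B1 w + 1) ?s4"
      unfolding xtr_def
      by (rule exec_mono, rule exec_pour_letters[of s3, OF rest ne(3), unfolded s3V append_Nil2]) (use lenf in simp)
    let ?s5 = "?s4(V := [], out := letters (f w))"
    have "exec (pour V out) ?s4 (8 * B1 w + 1) (?s4(V := [], out := rev (?s4 V) @ ?s4 out))"
      by (rule exec_pour) (use ne lenf in auto)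
    moreover have "?s4(V := [], out := rev (?s4 V) @ ?s4 out) = ?s5"
      using s3o ne *(3) by simp
    ultimately have 6: "exec (pour V out) ?s4 (8 * B1 w + 1) ?s5" by simp
    have noB: "Blank \<notin> set (s3 r)" if "m \<le> r" "r \<le> S" for r
    proof (cases "r = S")
      case True
      then show ?thesis using s3(2) by (simp add: Inv_def)
    next
      case False
      define i where "i = (r - m) div 2"
      have i: "i < k" "r = m + 2 * i \<or> r = m + 2 * i + 1" using that False by (auto simp: i_def S_def)
      have "sim_tape b (ts' ! i) (s3 (m + 2 * i)) (s3 (m + 2 * i + 1))"
        using s3(2) i(1) by (simp add: Inv_def)
      then show ?thesis using i(2) by (auto simp: sim_tape_def holds_def)
    qed
    have s5: "?s5 r = (if r = ?R then rest else s3 r)" if "r \<in> {m..S}" for r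
      using that *(3) by (auto simp: V_def S_def)
    have clr: "Blank \<notin> set (?s5 r) \<and> length (?s5 r) \<le> B1 w" if "r \<in> set [m..<S + 1]" for r
    proof -
      have rest_le: "set rest \<subseteq> set (s3 ?R)" "length rest \<le> length (s3 ?R)" using rest(1) by auto
      have r: "m \<le> r" "r \<le> S" using that by auto
      then have eq: "?s5 r = (if r = ?R then rest else s3 r)" by (intro s5) simp
      have "Blank \<notin> set (s3 r)" "length (s3 r) \<le> B1 w" using noB len3 r by blast+
      with rest_le show ?thesis unfolding eq by (cases "r = ?R") auto
    qed
    have "exec (clears [m..<S + 1]) ?s5 (length [m..<S + 1] * (3 * B1 w + 4))
        (\<lambda>i. if i \<in> set [m..<S + 1] then [] else ?s5 i)"
      by (rule exec_clears) (rule clr)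
    moreover have "(\<lambda>i. if i \<in> set [m..<S + 1] then [] else ?s5 i) = s(out := letters (f w))"
      using s3f s(3) *(3) ne by (auto simp: fun_eq_iff V_def)
    moreover have "length [m..<S + 1] = 2 * k + 1" by (simp add: S_def)
    ultimately have 7: "exec (clears [m..<S + 1]) ?s5 ((2 * k + 1) * (3 * B1 w + 4)) (s(out := letters (f w)))"
      by simp
    show ?thesis unfolding prog_def
      by (rule exec.Seq[OF 4 exec.Seq[OF 5 exec.Seq[OF 6 7 order_refl] order_refl]]) (simp add: B_def)
  qed
  show "\<exists>c B. polyb [\<lambda>w. w] B \<and> (\<forall>a s. map s ins = map (\<lambda>g. letters (g a)) [\<lambda>w. w] \<longrightarrow> s out = [] \<longrightarrow>
      (\<forall>i\<ge>m. s i = []) \<longrightarrow> exec c s (B a) (s(out := letters (f a))))"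
    by (rule exI, rule exI[of _ B], intro conjI polyB allI impI, rule run)
qed

lemma pt_comp:
  assumes "pt [\<lambda>w. w] f" "pt gs g"
  shows "pt gs (\<lambda>a. f (g a))"
proof -
  have "pt [g] (\<lambda>a. f (g a))" using pt_reparam[OF assms(1), of g] by (simp add: comp_def)
  then have "pt (g # gs) (\<lambda>a. f (g a))" by (rule pt_weaken) auto
  with assms(2) show ?thesis by (rule pt_cut)
qed

subsection \<open>Closure properties\<close>

text \<open>The functions in \<open>hs\<close> are added to the inputs and then removed one by one
  with \<open>pt_cut\<close>.\<close>

lemma pt_subst:
  assumes "pt hs f" "\<And>h. h \<in> set hs \<Longrightarrow> pt gs h"
  shows "pt gs f"
proof -
  have "pt (ks @ gs) f \<Longrightarrow> set ks \<subseteq> set hs \<Longrightarrow> pt gs f" for ks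
  proof (induction ks)
    case (Cons k ks)
    have "pt gs k" using Cons.prems(2) assms(2) by simp
    then have "pt (ks @ gs) k" by (rule pt_weaken) simp
    then have "pt (ks @ gs) f" by (rule pt_cut) (use Cons.prems(1) in simp)
    then show ?case using Cons by simp
  qed simp
  moreover have "pt (hs @ gs) f" by (rule pt_weaken[OF assms(1)]) simp
  ultimately show ?thesis by simp
qed

text \<open>Substitution with a change of environment: a program for functions of pairs or triples
  is applied to components computed from \<open>a\<close>.\<close>

lemma pt_app:
  assumes "pt hs F" "\<And>h. h \<in> set hs \<Longrightarrow> pt gs (\<lambda>a. h (k a))"
  shows "pt gs (\<lambda>a. F (k a))"
proof -
  have "pt (map (\<lambda>h. h \<circ> k) hs) (F \<circ> k)" by (rule pt_reparam[OF assms(1)])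
  then have "pt gs (F \<circ> k)" by (rule pt_subst) (use assms(2) in \<open>auto simp: comp_def\<close>)
  then show ?thesis by (simp add: comp_def)
qed

lemma pt_const: "pt gs (\<lambda>_. w)"
  by (induction w) (auto intro: pt_Nil pt_Cons)

lemma polyb_case:
  assumes "polyb gs A" "\<And>c. polyb gs (B c)"
  shows "polyb gs (\<lambda>a. A a + (\<Sum>c\<in>(UNIV::sym set). B c a))"
  by (intro polyb_add polyb_sum assms)

lemma pt_rec_var:
  "pt (fst # (\<lambda>e. fst (snd e)) # map (\<lambda>g e. g (snd (snd e))) gs) fst"
  "pt (fst # (\<lambda>e. fst (snd e)) # map (\<lambda>g e. g (snd (snd e))) gs) (\<lambda>e. fst (snd e))"
  by (rule pt_proj, simp)+

lemma pt_rec_env: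
  assumes "pt gs f"
  shows "pt (fst # (\<lambda>e. fst (snd e)) # map (\<lambda>g e. g (snd (snd e))) gs) (\<lambda>e. f (snd (snd e)))"
  by (rule pt_app[OF assms]) (auto intro: pt_proj)

text \<open>A case distinction is a recursion that ignores the value at the tail. The sum over all
  letters bounds whichever branch is taken.\<close>

lemma pt_case:
  assumes "pt gs x" "pt gs f" "\<And>c. pt gs (h c)"
  shows "pt gs (\<lambda>a. case x a of [] \<Rightarrow> f a | c # _ \<Rightarrow> h c a)"
proof -
  let ?N = "\<lambda>a. length (f a) + (\<Sum>c\<in>UNIV. length (h c a))"
  have "pt gs (\<lambda>a. rec_list (f a) (\<lambda>c y r. h c (snd (snd (y, r, a)))) (x a))"
  proof (rule pt_rec[OF assms(1,2)])
    show "polyb gs ?N" by (intro polyb_case pt_length assms)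
    fix a u y
    have "length (h c a) \<le> (\<Sum>c\<in>UNIV. length (h c a))" for c
      by (rule member_le_sum) (auto simp: finite_sym)
    then show "length (rec_list (f a) (\<lambda>c y r. h c (snd (snd (y, r, a)))) y) \<le> ?N a"
      by (cases y) (auto intro: trans_le_add2)
  qed (rule pt_rec_env[OF assms(3)])
  moreover have "rec_list (f a) (\<lambda>c y r. h c (snd (snd (y, r, a)))) (x a) =
      (case x a of [] \<Rightarrow> f a | c # _ \<Rightarrow> h c a)" for a
    by (cases "x a") auto
  ultimately show ?thesis by simp
qed

lemma pt_tl:
  assumes "pt gs x"
  shows "pt gs (\<lambda>a. tl (x a))"
proof -
  have "pt gs (\<lambda>a. rec_list [] (\<lambda>c y r. fst (y, r, a)) (x a))"
  proof (rule pt_rec[OF assms pt_Nil])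
    show "polyb gs (\<lambda>a. length (x a))" by (intro pt_length assms)
    fix a u y
    assume "x a = u @ y"
    then show "length (rec_list [] (\<lambda>c y r. fst (y, r, a)) y) \<le> length (x a)" by (cases y) auto
  qed (rule pt_rec_var)
  moreover have "rec_list [] (\<lambda>c y r. fst (y, r, a)) (x a) = tl (x a)" for a by (cases "x a") auto
  ultimately show ?thesis by simp
qed

lemma pt_append:
  assumes "pt gs x" "pt gs f"
  shows "pt gs (\<lambda>a. x a @ f a)"
proof -
  have "pt gs (\<lambda>a. rec_list (f a) (\<lambda>c y r. c # fst (snd (y, r, a))) (x a))"
  proof (rule pt_rec[OF assms])
    show "polyb gs (\<lambda>a. length (x a) + length (f a))" by (intro polyb_add pt_length assms)
    fix a u y
    assume "x a = u @ y"
    moreover have "length (rec_list (f a) (\<lambda>c y r. c # fst (snd (y, r, a))) y) = length y + length (f a)"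
      by (induction y) auto
    ultimately show "length (rec_list (f a) (\<lambda>c y r. c # fst (snd (y, r, a))) y) \<le> length (x a) + length (f a)"
      by simp
  qed (intro pt_Cons pt_rec_var)
  moreover have "rec_list (f a) (\<lambda>c y r. c # fst (snd (y, r, a))) y = y @ f a" for a y
    by (induction y) auto
  ultimately show ?thesis by simp
qed

text \<open>Words also serve as unary numbers through their lengths. Then \<open>drop\<close> is
  truncated subtraction, and the comparisons of lengths follow from it.\<close>

lemma pt_drop:
  assumes "pt gs x" "pt gs f"
  shows "pt gs (\<lambda>a. drop (length (x a)) (f a))"
proof -
  have eq: "rec_list (f a) (\<lambda>c y r. tl (fst (snd (y, r, a)))) y = drop (length y) (f a)" for a y
    by (induction y) (auto simp: drop_Suc tl_drop)
  have "pt gs (\<lambda>a. rec_list (f a) (\<lambda>c y r. tl (fst (snd (y, r, a)))) (x a))"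
  proof (rule pt_rec[OF assms])
    show "polyb gs (\<lambda>a. length (f a))" by (intro pt_length assms)
    show "length (rec_list (f a) (\<lambda>c y r. tl (fst (snd (y, r, a)))) y) \<le> length (f a)" for a y
      unfolding eq by simp
  qed (intro pt_tl pt_rec_var)
  then show ?thesis unfolding eq .
qed

section \<open>Predicates decidable in polynomial time\<close>

definition ptb :: "('a \<Rightarrow> word) list \<Rightarrow> ('a \<Rightarrow> bool) \<Rightarrow> bool" where
  "ptb gs P \<longleftrightarrow> pt gs (\<lambda>a. if P a then [One] else [])"

lemma pt_if:
  assumes "ptb gs P" "pt gs f" "pt gs g"
  shows "pt gs (\<lambda>a. if P a then f a else g a)"
proof -
  have "pt gs (\<lambda>a. case (if P a then [One] else []) of [] \<Rightarrow> g a | c # _ \<Rightarrow> f a)"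
    using assms unfolding ptb_def by (intro pt_case)
  moreover have "(case (if P a then [One] else []) of [] \<Rightarrow> g a | c # _ \<Rightarrow> f a) = (if P a then f a else g a)" for a
    by simp
  ultimately show ?thesis by simp
qed

lemma ptb_nonempty:
  assumes "pt gs x"
  shows "ptb gs (\<lambda>a. x a \<noteq> [])"
proof -
  have "pt gs (\<lambda>a. case x a of [] \<Rightarrow> [] | c # _ \<Rightarrow> [One])" by (intro pt_case pt_const assms)
  moreover have "(case x a of [] \<Rightarrow> [] | c # _ \<Rightarrow> [One]) = (if x a \<noteq> [] then [One] else [])" for a
    by (cases "x a") auto
  ultimately show ?thesis by (simp add: ptb_def)
qed

lemma ptb_not:
  assumes "ptb gs P"
  shows "ptb gs (\<lambda>a. \<not> P a)"
proof -
  have "pt gs (\<lambda>a. if P a then [] else [One])"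
    by (intro pt_if assms pt_const)
  moreover have "(if P a then [] else [One]) = (if \<not> P a then [One] else [])" for a
    by simp
  ultimately show ?thesis by (simp only: ptb_def)
qed

lemma ptb_conj:
  assumes "ptb gs P" "ptb gs Q"
  shows "ptb gs (\<lambda>a. P a \<and> Q a)"
proof -
  have "pt gs (\<lambda>a. if P a then (if Q a then [One] else []) else [])"
    using assms by (intro pt_if pt_const)
  moreover have "(if P a then (if Q a then [One] else []) else []) = (if P a \<and> Q a then [One] else [])" for a
    by simp
  ultimately show ?thesis by (simp only: ptb_def)
qed

lemma ptb_disj:
  assumes "ptb gs P" "ptb gs Q"
  shows "ptb gs (\<lambda>a. P a \<or> Q a)"
  using ptb_not[OF ptb_conj[OF ptb_not[OF assms(1)] ptb_not[OF assms(2)]]] by simp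

definition starts :: "sym \<Rightarrow> word \<Rightarrow> bool" where
  "starts c x \<longleftrightarrow> x \<noteq> [] \<and> hd x = c"

lemma starts_simps [simp]: "\<not> starts c []" "starts c (d # x) \<longleftrightarrow> d = c"
  by (auto simp: starts_def)

lemma ptb_starts:
  assumes "pt gs x"
  shows "ptb gs (\<lambda>a. starts c (x a))"
proof -
  have "pt gs (\<lambda>a. case x a of [] \<Rightarrow> [] | d # _ \<Rightarrow> if d = c then [One] else [])"
    by (intro pt_case pt_const assms)
  moreover have "(case x a of [] \<Rightarrow> [] | d # _ \<Rightarrow> if d = c then [One] else []) =
      (if starts c (x a) then [One] else [])" for a
    by (cases "x a") auto
  ultimately show ?thesis by (simp add: ptb_def)
qed

lemma ptb_less:
  assumes "pt gs x" "pt gs y"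
  shows "ptb gs (\<lambda>a. length (x a) < length (y a))"
  using ptb_nonempty[OF pt_drop[OF assms]] by (simp add: not_le)

lemma ptb_le:
  assumes "pt gs x" "pt gs y"
  shows "ptb gs (\<lambda>a. length (x a) \<le> length (y a))"
  using ptb_not[OF ptb_less[OF assms(2,1)]] by (simp add: not_less)

lemma ptb_neq_length:
  assumes "pt gs x" "pt gs y"
  shows "ptb gs (\<lambda>a. length (x a) \<noteq> length (y a))"
  using ptb_disj[OF ptb_less[OF assms] ptb_less[OF assms(2,1)]] by (simp add: neq_iff)

lemma pt_takeWhile:
  assumes "pt gs x"
  shows "pt gs (\<lambda>a. takeWhile P (x a))"
proof -
  have eq: "rec_list [] (\<lambda>c y r. if P c then c # fst (snd (y, r, a)) else []) y = takeWhile P y" for y and a :: 'a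
    by (induction y) auto
  have "pt gs (\<lambda>a. rec_list [] (\<lambda>c y r. (\<lambda>e. if P c then c # fst (snd e) else []) (y, r, a)) (x a))"
  proof (rule pt_rec[OF assms pt_const])
    show "polyb gs (\<lambda>a. length (x a))" by (intro pt_length assms)
    show "length (rec_list [] (\<lambda>c y r. if P c then c # fst (snd (y, r, a)) else []) y) \<le> length (x a)"
      if "x a = u @ y" for a u y
      unfolding eq that by (simp add: length_takeWhile_le trans_le_add2)
    show "pt (fst # (\<lambda>e. fst (snd e)) # map (\<lambda>g e. g (snd (snd e))) gs) (\<lambda>e. if P c then c # fst (snd e) else [])" for c
      by (cases "P c") (simp_all add: pt_const pt_Cons pt_rec_var)
  qed
  then show ?thesis unfolding eq .
qed

lemma pt_dropWhile:
  assumes "pt gs x"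
  shows "pt gs (\<lambda>a. dropWhile P (x a))"
proof -
  have eq: "rec_list [] (\<lambda>c y r. if P c then fst (snd (y, r, a)) else c # fst (y, r, a)) y = dropWhile P y" for y and a :: 'a
    by (induction y) auto
  have "pt gs (\<lambda>a. rec_list [] (\<lambda>c y r. (\<lambda>e. if P c then fst (snd e) else c # fst e) (y, r, a)) (x a))"
  proof (rule pt_rec[OF assms pt_const])
    show "polyb gs (\<lambda>a. length (x a))" by (intro pt_length assms)
    show "length (rec_list [] (\<lambda>c y r. if P c then fst (snd (y, r, a)) else c # fst (y, r, a)) y) \<le> length (x a)"
      if "x a = u @ y" for a u y
      unfolding eq that by (simp add: length_dropWhile_le trans_le_add2)
    show "pt (fst # (\<lambda>e. fst (snd e)) # map (\<lambda>g e. g (snd (snd e))) gs) (\<lambda>e. if P c then fst (snd e) else c # fst e)" for c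
      by (cases "P c") (simp_all add: pt_Cons pt_rec_var)
  qed
  then show ?thesis unfolding eq .
qed

lemma pt_filter:
  assumes "pt gs x"
  shows "pt gs (\<lambda>a. filter P (x a))"
proof -
  have eq: "rec_list [] (\<lambda>c y r. if P c then c # fst (snd (y, r, a)) else fst (snd (y, r, a))) y = filter P y" for y and a :: 'a
    by (induction y) auto
  have "pt gs (\<lambda>a. rec_list [] (\<lambda>c y r. (\<lambda>e. if P c then c # fst (snd e) else fst (snd e)) (y, r, a)) (x a))"
  proof (rule pt_rec[OF assms pt_const])
    show "polyb gs (\<lambda>a. length (x a))" by (intro pt_length assms)
    show "length (rec_list [] (\<lambda>c y r. if P c then c # fst (snd (y, r, a)) else fst (snd (y, r, a))) y) \<le> length (x a)"
      if "x a = u @ y" for a u y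
      unfolding eq that by (simp add: length_filter_le trans_le_add2)
    show "pt (fst # (\<lambda>e. fst (snd e)) # map (\<lambda>g e. g (snd (snd e))) gs) (\<lambda>e. if P c then c # fst (snd e) else fst (snd e))" for c
      by (cases "P c") (simp_all add: pt_Cons pt_rec_var)
  qed
  then show ?thesis unfolding eq .
qed

lemma pt_map:
  assumes "pt gs x"
  shows "pt gs (\<lambda>a. map f (x a))"
proof -
  have eq: "rec_list [] (\<lambda>c y r. f c # fst (snd (y, r, a))) y = map f y" for y and a :: 'a
    by (induction y) auto
  have "pt gs (\<lambda>a. rec_list [] (\<lambda>c y r. (\<lambda>e. f c # fst (snd e)) (y, r, a)) (x a))"
  proof (rule pt_rec[OF assms pt_const])
    show "polyb gs (\<lambda>a. length (x a))" by (intro pt_length assms)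
    show "length (rec_list [] (\<lambda>c y r. f c # fst (snd (y, r, a))) y) \<le> length (x a)"
      if "x a = u @ y" for a u y
      unfolding eq that by simp
  qed (intro pt_Cons pt_rec_var)
  then show ?thesis unfolding eq .
qed

text \<open>A nonempty suffix is a pointer to the position where it starts. Loops over positions are
  loops over suffixes.\<close>

primrec tails :: "'a list \<Rightarrow> 'a list list" where
  "tails [] = []"
| "tails (c # x) = (c # x) # tails x"

lemma tails_conv_drop: "tails x = map (\<lambda>i. drop i x) [0..<length x]"
proof (induction x)
  case (Cons c x)
  have "[0..<length (c # x)] = 0 # map Suc [0..<length x]" by (simp add: upt_conv_Cons map_Suc_upt del: upt_Suc)
  then show ?case using Cons by (simp add: comp_def del: upt_Suc)
qed simp

text \<open>A loop over positions that collects outputs. In contrast to \<open>pt_rec\<close> no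
  size bound has to be assumed: there are \<open>length (x a)\<close> rounds, and each adds a word
  of polynomial length.\<close>

lemma pt_concat_tails:
  assumes "pt gs x" "pt (fst # map (\<lambda>g e. g (snd e)) gs) f"
  shows "pt gs (\<lambda>a. concat (map (\<lambda>y. f (y, a)) (tails (x a))))"
proof -
  have eq: "rec_list [] (\<lambda>c y r. f (c # fst (y, r, a), snd (snd (y, r, a))) @ fst (snd (y, r, a))) y =
      concat (map (\<lambda>y. f (y, a)) (tails y))" for y a
    by (induction y) auto
  obtain p where p: "\<And>e. length (f e) \<le> poly p (isize (fst # map (\<lambda>g e. g (snd e)) gs) e)"
    using pt_length[OF assms(2)] unfolding polyb_def by blast
  have isz: "isize (fst # map (\<lambda>g e. g (snd e)) gs) (y, a) = length y + isize gs a" for y a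
    by (simp add: isize_def comp_def)
  let ?N = "\<lambda>a. length (x a) * poly p (length (x a) + isize gs a)"
  have "pt gs (\<lambda>a. rec_list [] (\<lambda>c y r. (\<lambda>e. f (c # fst e, snd (snd e)) @ fst (snd e)) (y, r, a)) (x a))"
  proof (rule pt_rec[OF assms(1) pt_const])
    show "polyb gs ?N" by (intro polyb_mult polyb_poly polyb_add polyb_isize pt_length assms(1))
    have len: "length (concat (map (\<lambda>y. f (y, a)) (tails y))) \<le> length y * poly p (length (x a) + isize gs a)"
      if "length y \<le> length (x a)" for a y
      using that
    proof (induction y)
      case (Cons c y)
      have "length (f (c # y, a)) \<le> poly p (length (c # y) + isize gs a)" using p[of "(c # y, a)"] isz by simp
      also have "\<dots> \<le> poly p (length (x a) + isize gs a)" using Cons.prems by (intro poly_nat_mono) simp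
      finally show ?case using Cons by simp
    qed simp
    show "length (rec_list [] (\<lambda>c y r. f (c # fst (y, r, a), snd (snd (y, r, a))) @ fst (snd (y, r, a))) y) \<le> ?N a"
      if "x a = u @ y" for a u y
      unfolding eq using len[of y a] that by (auto intro: order_trans mult_le_mono1)
    show "pt (fst # (\<lambda>e. fst (snd e)) # map (\<lambda>g e. g (snd (snd e))) gs)
        (\<lambda>e. f (c # fst e, snd (snd e)) @ fst (snd e))" for c
    proof (intro pt_append pt_rec_var)
      show "pt (fst # (\<lambda>e. fst (snd e)) # map (\<lambda>g e. g (snd (snd e))) gs) (\<lambda>e. f (c # fst e, snd (snd e)))"
        by (rule pt_app[OF assms(2)]) (auto intro!: pt_Cons pt_rec_var intro: pt_proj)
    qed
  qed
  then show ?thesis unfolding eq .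
qed

lemma ptb_ex_tails:
  assumes "pt gs x" "ptb (fst # map (\<lambda>g e. g (snd e)) gs) P"
  shows "ptb gs (\<lambda>a. \<exists>y \<in> set (tails (x a)). P (y, a))"
proof -
  have "ptb gs (\<lambda>a. concat (map (\<lambda>y. if P (y, a) then [One] else []) (tails (x a))) \<noteq> [])"
    by (intro ptb_nonempty pt_concat_tails[where f = "\<lambda>e. if P e then [One] else []"] assms(1)
      assms(2)[unfolded ptb_def])
  moreover have "concat (map (\<lambda>y. if P (y, a) then [One] else []) ys) \<noteq> [] \<longleftrightarrow> (\<exists>y \<in> set ys. P (y, a))"
    for a ys by (induction ys) auto
  ultimately show ?thesis by (simp only:)
qed

text \<open>Comparison letter by letter in terms of pointers: \<open>p\<close> starts at a position
  equal to the length of \<open>drop (length p) x\<close>, and dropping as many letters from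
  \<open>y\<close> gives the pointer to the same position in \<open>y\<close>.\<close>

lemma word_eq_iff_tails:
  "x = y \<longleftrightarrow> length x = length y \<and>
    \<not> (\<exists>p \<in> set (tails x). \<exists>c. starts c p \<and> \<not> starts c (drop (length (drop (length p) x)) y))"
  (is "_ \<longleftrightarrow> _ \<and> \<not> ?D")
proof (cases "length x = length y")
  case True
  have *: "starts c (drop i z) \<longleftrightarrow> z ! i = c" if "i < length z" for c i z
    using that by (auto simp: starts_def hd_drop_conv_nth)
  have "?D \<longleftrightarrow> (\<exists>i < length x. \<exists>c. starts c (drop i x) \<and> \<not> starts c (drop i y))"
    by (auto simp: tails_conv_drop Bex_def)
  also have "\<dots> \<longleftrightarrow> (\<exists>i < length x. x ! i \<noteq> y ! i)" using True * by metis
  finally show ?thesis using True by (auto simp: list_eq_iff_nth_eq)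
qed auto

lemma ptb_eq:
  assumes "pt gs f" "pt gs g"
  shows "ptb gs (\<lambda>a. f a = g a)"
proof -
  let ?gs = "[fst, \<lambda>e. fst (snd e), \<lambda>e. snd (snd e)] :: (word \<times> word \<times> word \<Rightarrow> word) list"
  have ex: "(\<exists>c. Q c) \<longleftrightarrow> Q Zero \<or> Q One \<or> Q Tick \<or> Q Comma \<or> Q Amp" for Q
    by (metis sym.exhaust)
  have v: "pt ?gs fst" "pt ?gs (\<lambda>e. fst (snd e))" "pt ?gs (\<lambda>e. snd (snd e))" by (rule pt_proj, simp)+
  have 1: "ptb ?gs (\<lambda>e. \<exists>c. starts c (fst e) \<and>
      \<not> starts c (drop (length (drop (length (fst e)) (fst (snd e)))) (snd (snd e))))"
    unfolding ex by (intro ptb_disj ptb_conj ptb_not ptb_starts pt_drop v)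
  let ?gs2 = "[fst, snd] :: (word \<times> word \<Rightarrow> word) list"
  have w: "pt ?gs2 fst" "pt ?gs2 snd" by (rule pt_proj, simp)+
  have "ptb ?gs2 (\<lambda>a. \<not> length (fst a) \<noteq> length (snd a) \<and>
      \<not> (\<exists>p \<in> set (tails (fst a)). (\<lambda>e. \<exists>c. starts c (fst e) \<and>
      \<not> starts c (drop (length (drop (length (fst e)) (fst (snd e)))) (snd (snd e)))) (p, a)))"
    by (intro ptb_conj ptb_not ptb_neq_length ptb_ex_tails w) (use 1 in simp)
  then have "ptb ?gs2 (\<lambda>a. fst a = snd a)" unfolding word_eq_iff_tails by simp
  then have "pt gs (\<lambda>a. (\<lambda>e. if fst e = snd e then [One] else []) (f a, g a))"
    unfolding ptb_def by (rule pt_app) (use assms in auto)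
  then show ?thesis by (simp add: ptb_def)
qed

subsection \<open>Lists of words\<close>

definition enc_list :: "word list \<Rightarrow> word" where
  "enc_list xs = concat (map (Cons Comma) xs)"

definition item :: "word \<Rightarrow> word" where
  "item p = takeWhile (\<lambda>c. c \<noteq> Comma) (tl p)"

lemma enc_list_simps [simp]: "enc_list [] = []" "enc_list (x # xs) = Comma # x @ enc_list xs"
  by (simp_all add: enc_list_def)

lemma enc_list_append: "enc_list (xs @ ys) = enc_list xs @ enc_list ys"
  by (simp add: enc_list_def)

lemma item_Comma: "Comma \<notin> set x \<Longrightarrow> item (Comma # x @ enc_list xs) = x"
proof -
  assume x: "Comma \<notin> set x"
  then have "takeWhile (\<lambda>c. c \<noteq> Comma) (x @ y) = x @ takeWhile (\<lambda>c. c \<noteq> Comma) y" for y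
    by (intro takeWhile_append2) auto
  with x show ?thesis by (cases xs) (auto simp: item_def)
qed

lemma tails_append: "tails (x @ y) = map (\<lambda>z. z @ y) (tails x) @ tails y"
  by (induction x) auto

lemma tails_no_Comma: "Comma \<notin> set x \<Longrightarrow> p \<in> set (tails x) \<Longrightarrow> \<not> starts Comma (p @ y)"
  by (induction x) auto

text \<open>As items contain no comma, the pointers to commas correspond to the items, and a loop
  over positions becomes a loop over the list.\<close>

lemma concat_tails_enc_list:
  assumes "\<And>x. x \<in> set xs \<Longrightarrow> Comma \<notin> set x"
  shows "concat (map (\<lambda>p. if starts Comma p then f (item p) else []) (tails (enc_list xs))) = concat (map f xs)"
  using assms
proof (induction xs)
  case (Cons x xs)
  have "concat (map (\<lambda>p. if starts Comma p then f (item p) else []) (map (\<lambda>z. z @ enc_list xs) (tails x))) = []"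
    using tails_no_Comma[of x] Cons.prems by auto
  then show ?case using Cons by (simp add: tails_append item_Comma)
qed simp

lemma ex_tails_enc_list:
  assumes "\<And>x. x \<in> set xs \<Longrightarrow> Comma \<notin> set x"
  shows "(\<exists>p \<in> set (tails (enc_list xs)). starts Comma p \<and> item p = y) \<longleftrightarrow> y \<in> set xs"
  using assms
proof (induction xs)
  case (Cons x xs)
  have "\<not> (\<exists>p \<in> set (map (\<lambda>z. z @ enc_list xs) (tails x)). starts Comma p \<and> item p = y)"
    using tails_no_Comma[of x] Cons.prems by auto
  then show ?case using Cons by (auto simp: tails_append item_Comma)
qed simp

lemma pt_item: "pt gs x \<Longrightarrow> pt gs (\<lambda>a. item (x a))"
  unfolding item_def by (intro pt_takeWhile pt_tl)

definition insert_all :: "sym \<Rightarrow> word \<Rightarrow> word" where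
  "insert_all c w = concat (map (\<lambda>d. if d = Comma then [Comma, c] else [d]) w)"

lemma insert_all_append: "insert_all c (x @ y) = insert_all c x @ insert_all c y"
  by (simp add: insert_all_def)

lemma insert_all_no_Comma: "Comma \<notin> set x \<Longrightarrow> insert_all c x = x"
  by (induction x) (auto simp: insert_all_def)

lemma insert_all_enc_list:
  "(\<And>x. x \<in> set xs \<Longrightarrow> Comma \<notin> set x) \<Longrightarrow> insert_all c (enc_list xs) = enc_list (map (Cons c) xs)"
proof (induction xs)
  case (Cons x xs)
  have "insert_all c (Comma # x @ enc_list xs) = Comma # c # insert_all c (x @ enc_list xs)"
    by (simp add: insert_all_def)
  then show ?case using Cons by (simp add: insert_all_append insert_all_no_Comma)
qed (simp add: insert_all_def)

lemma pt_insert_all: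
  assumes "pt gs x"
  shows "pt gs (\<lambda>a. insert_all c (x a))"
proof -
  have eq: "rec_list [] (\<lambda>d y r. if d = Comma then Comma # c # fst (snd (y, r, a)) else d # fst (snd (y, r, a))) y =
      insert_all c y" for y and a :: 'a
    by (induction y) (auto simp: insert_all_def)
  have len: "length (insert_all c y) \<le> 2 * length y" for y
    by (induction y) (auto simp: insert_all_def)
  have "pt gs (\<lambda>a. rec_list [] (\<lambda>d y r. (\<lambda>e. if d = Comma then Comma # c # fst (snd e) else d # fst (snd e)) (y, r, a)) (x a))"
  proof (rule pt_rec[OF assms pt_const])
    show "polyb gs (\<lambda>a. 2 * length (x a))" by (intro polyb_mult polyb_const pt_length assms)
    show "length (rec_list [] (\<lambda>d y r. if d = Comma then Comma # c # fst (snd (y, r, a)) else d # fst (snd (y, r, a))) y)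
        \<le> 2 * length (x a)"
      if "x a = u @ y" for a u y
      unfolding eq using len[of y] that by simp
    show "pt (fst # (\<lambda>e. fst (snd e)) # map (\<lambda>g e. g (snd (snd e))) gs)
        (\<lambda>e. if d = Comma then Comma # c # fst (snd e) else d # fst (snd e))" for d
      by (cases "d = Comma") (simp_all add: pt_Cons pt_rec_var)
  qed
  then show ?thesis unfolding eq .
qed

text \<open>Vectors of length \<open>n\<close> with at most \<open>k\<close> ones, generated by
  Pascal's recursion. For fixed \<open>k\<close> their number is polynomial in \<open>n\<close>;
  this is what a constant rank is good for.\<close>

fun vecs :: "nat \<Rightarrow> nat \<Rightarrow> word list" where
  "vecs k 0 = [[]]"
| "vecs 0 (Suc n) = map (Cons Zero) (vecs 0 n)"
| "vecs (Suc k) (Suc n) = map (Cons Zero) (vecs (Suc k) n) @ map (Cons One) (vecs k n)"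

lemma set_vecs: "set (vecs k n) = {v. length v = n \<and> set v \<subseteq> {Zero, One} \<and> length (filter (\<lambda>c. c = One) v) \<le> k}"
proof (induction k n rule: vecs.induct)
  case (2 n)
  have "v \<in> set (vecs 0 (Suc n)) \<longleftrightarrow> length v = Suc n \<and> set v \<subseteq> {Zero, One} \<and> length (filter (\<lambda>c. c = One) v) \<le> 0" for v
    using 2 by (cases v) auto
  then show ?case by blast
next
  case (3 k n)
  have "v \<in> set (vecs (Suc k) (Suc n)) \<longleftrightarrow>
      length v = Suc n \<and> set v \<subseteq> {Zero, One} \<and> length (filter (\<lambda>c. c = One) v) \<le> Suc k" for v
    using 3 by (cases v) auto
  then show ?case by blast
qed auto

lemma distinct_vecs: "distinct (vecs k n)"
  by (induction k n rule: vecs.induct) (auto simp: distinct_map)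

lemma length_vecs: "length (vecs k n) \<le> Suc n ^ k"
proof (induction k n rule: vecs.induct)
  case (3 k n)
  have "length (vecs (Suc k) (Suc n)) \<le> Suc n ^ Suc k + Suc n ^ k" using 3 by simp
  also have "\<dots> = Suc (Suc n) * Suc n ^ k" by (simp add: algebra_simps)
  also have "\<dots> \<le> Suc (Suc n) * Suc (Suc n) ^ k" by (intro mult_le_mono2 power_mono) auto
  finally show ?case by simp
qed auto

lemma length_enc_list: "(\<And>x. x \<in> set xs \<Longrightarrow> length x = n) \<Longrightarrow> length (enc_list xs) = length xs * Suc n"
  by (induction xs) auto

lemma vecs_no_Comma: "x \<in> set (vecs k n) \<Longrightarrow> Comma \<notin> set x"
  by (auto simp: set_vecs)

text \<open>There is one program for each \<open>k\<close>: the outer induction on \<open>k\<close>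
  supplies the program that is called in the recursion on the length.\<close>

lemma pt_vecs:
  assumes "pt gs x"
  shows "pt gs (\<lambda>a. enc_list (vecs k (length (x a))))"
proof -
  have "pt [\<lambda>w. w] (\<lambda>w. enc_list (vecs k (length w)))"
  proof (induction k)
    case 0
    have eq: "rec_list [Comma] (\<lambda>c y r. insert_all Zero (fst (snd (y, r, a)))) y = enc_list (vecs 0 (length y))"
      for y :: word and a :: word
      by (induction y) (auto simp: insert_all_enc_list vecs_no_Comma)
    have "pt [\<lambda>w. w] (\<lambda>w. rec_list [Comma] (\<lambda>c y r. insert_all Zero (fst (snd (y, r, w)))) w)"
    proof (rule pt_rec[OF _ pt_const])
      show "polyb [\<lambda>w. w] (\<lambda>w. Suc (length w))"
        unfolding Suc_eq_plus1 by (intro polyb_add polyb_const polyb_length) simp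
      show "length (rec_list [Comma] (\<lambda>c y r. insert_all Zero (fst (snd (y, r, w)))) y) \<le> Suc (length w)"
        if "w = u @ y" for u y and w :: word
      proof -
        have "length (enc_list (vecs 0 (length y))) = length (vecs 0 (length y)) * Suc (length y)"
          by (rule length_enc_list) (auto simp: set_vecs)
        also have "\<dots> \<le> Suc (length y) ^ 0 * Suc (length y)" by (intro mult_le_mono1 length_vecs)
        also have "\<dots> \<le> Suc (length w)" using that by simp
        finally show ?thesis unfolding eq .
      qed
    qed (auto intro: pt_proj intro!: pt_insert_all)
    then show ?case unfolding eq .
  next
    case (Suc k)
    have eq: "rec_list [Comma] (\<lambda>c y r. insert_all Zero (fst (snd (y, r, a))) @
        insert_all One (enc_list (vecs k (length (fst (y, r, a)))))) y = enc_list (vecs (Suc k) (length y))"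
      for y :: word and a :: word
      by (induction y) (auto simp: insert_all_enc_list vecs_no_Comma enc_list_append)
    have "pt [\<lambda>w. w] (\<lambda>w. rec_list [Comma] (\<lambda>c y r. (\<lambda>e. insert_all Zero (fst (snd e)) @
        insert_all One (enc_list (vecs k (length (fst e))))) (y, r, w)) w)"
    proof (rule pt_rec[OF _ pt_const])
      show "polyb [\<lambda>w. w] (\<lambda>w. (length w + 1) ^ Suc k * (length w + 1))"
        by (intro polyb_add polyb_mult polyb_power polyb_const polyb_length) simp_all
      show "length (rec_list [Comma] (\<lambda>c y r. insert_all Zero (fst (snd (y, r, w))) @
          insert_all One (enc_list (vecs k (length (fst (y, r, w)))))) y) \<le> (length w + 1) ^ Suc k * (length w + 1)"
        if "w = u @ y" for u y and w :: word
      proof -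
        have "length (enc_list (vecs (Suc k) (length y))) = length (vecs (Suc k) (length y)) * Suc (length y)"
          by (rule length_enc_list) (auto simp: set_vecs)
        also have "\<dots> \<le> Suc (length y) ^ Suc k * Suc (length y)" by (intro mult_le_mono1 length_vecs)
        also have "\<dots> \<le> (length w + 1) ^ Suc k * (length w + 1)"
          using that by (intro mult_le_mono power_mono) auto
        finally show ?thesis unfolding eq .
      qed
      have "pt [fst, \<lambda>e. fst (snd e), \<lambda>e. snd (snd e)] (\<lambda>e. enc_list (vecs k (length (fst e))))"
        by (rule pt_comp[OF Suc]) (auto intro: pt_proj)
      then show "pt (fst # (\<lambda>e. fst (snd e)) # map (\<lambda>g e. g (snd (snd e))) [\<lambda>w. w])
          (\<lambda>e. insert_all Zero (fst (snd e)) @ insert_all One (enc_list (vecs k (length (fst e)))))" for c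
        by (intro pt_append pt_insert_all pt_rec_var) simp
    qed (auto intro: pt_proj)
    then show ?case unfolding eq .
  qed
  then show ?thesis by (rule pt_comp) (rule assms)
qed

subsection \<open>The two reductions as word functions\<close>

definition commas :: "word \<Rightarrow> word" where
  "commas w = filter (\<lambda>c. c = Comma) w"

definition zeros :: "word \<Rightarrow> word" where
  "zeros w = map (\<lambda>_. Zero) w"

text \<open>For the adjacency matrix \<open>w\<close> of a graph, \<open>edge_vectors w\<close> lists the vectors \<open>h @ h\<close>, where
  \<open>h\<close> is the characteristic vector of an edge of the graph extended by a universal vertex and an
  isolated one.
  The suffix \<open>p\<close> starts with the row of the first vertex of the edge, and the suffix \<open>q\<close> of that
  row with the entry of the second one.\<close>

definition half_vector :: "word \<Rightarrow> word \<Rightarrow> word \<Rightarrow> word" where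
  "half_vector w p q = zeros (drop (length (commas p)) (commas w)) @
     One # zeros (drop (length q) (commas p)) @ One # zeros q"

definition edge_vectors :: "word \<Rightarrow> word" where
  "edge_vectors w = concat (map (\<lambda>p. if starts Comma p then
       concat (map (\<lambda>q. if starts One q \<and> length q \<le> length (commas p)
           then Comma # half_vector w p q @ half_vector w p q else [])
         (tails (item p @ [One]))) else [])
     (tails w))"

text \<open>A graph word has one comma per vertex, so this is the characteristic vector of a ground
  set consisting of two copies of the \<open>n + 2\<close> extended vertices.\<close>

definition ones_word :: "word \<Rightarrow> word" where
  "ones_word w = map (\<lambda>_. One) (Comma # Comma # commas w @ Comma # Comma # commas w)"

definition indep_list :: "word \<Rightarrow> word" where
  "indep_list w = concat (map (\<lambda>v. if starts Comma v then
       (if \<exists>d \<in> set (tails (edge_vectors w)). starts Comma d \<and> item d = item v then []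
        else Comma # item v) else [])
     (tails (enc_list (vecs 4 (length (ones_word w))))))"

definition flip :: "sym \<Rightarrow> sym" where
  "flip c = (if c = Zero then One else if c = One then Zero else c)"

definition indep_word :: "word \<Rightarrow> word" where
  "indep_word w = ones_word w @ indep_list w"

text \<open>The spanning sets of the dual are the complements of the independent sets, so it
  suffices to exchange zeros and ones.\<close>

definition spanning_word :: "word \<Rightarrow> word" where
  "spanning_word w = ones_word w @ map flip (indep_list w)"

text \<open>The vertices are the positions of a description \<open>w\<close>, preceded by three further vertices. A
  position is given by the suffix that starts there.\<close>

definition is_elem :: "word \<Rightarrow> word \<Rightarrow> bool" where
  "is_elem w p \<longleftrightarrow> length (dropWhile (\<lambda>c. c = One) w) < length p \<and> length p \<le> length w"

text \<open>The cases are those of \<open>inc_arc\<close>. Pointers longer than \<open>w\<close> are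
  the three vertices of the triangle. An element \<open>p\<close> has the number
  \<open>length (drop (length p) w)\<close>, by which its entry is looked up in the vector behind
  the comma \<open>q\<close>. Ticks belong to the comma \<open>p\<close> if they precede the next
  comma; the ticks of a header follow no comma and remain isolated.\<close>

definition arc :: "word \<Rightarrow> word \<Rightarrow> word \<Rightarrow> bool" where
  "arc w p q \<longleftrightarrow>
     length w < length p \<and> length w < length q \<or>
     length (One # One # w) < length p \<and> is_elem w q \<or>
     is_elem w p \<and> starts Comma q \<and> starts One (drop (length (drop (length p) w)) (tl q)) \<or>
     starts Comma p \<and> starts Tick q \<and> length q < length p \<and>
       length (dropWhile (\<lambda>c. c \<noteq> Comma) (tl p)) < length q"

definition adjacency :: "word \<Rightarrow> word" where
  "adjacency w = (let y = Amp # Amp # Amp # w in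
     concat (map (\<lambda>p. Comma # concat (map (\<lambda>q.
       if length p \<noteq> length q \<and> (arc w p q \<or> arc w q p) then [One] else [Zero]) (tails y))) (tails y)))"

lemma pt_commas: "pt gs x \<Longrightarrow> pt gs (\<lambda>a. commas (x a))"
  unfolding commas_def by (rule pt_filter)

lemma pt_half_vector:
  "pt gs w \<Longrightarrow> pt gs p \<Longrightarrow> pt gs q \<Longrightarrow> pt gs (\<lambda>a. half_vector (w a) (p a) (q a))"
  unfolding half_vector_def zeros_def by (intro pt_append pt_Cons pt_map pt_drop pt_tl pt_commas)

lemma pt_edge_vectors:
  assumes "pt gs x"
  shows "pt gs (\<lambda>a. edge_vectors (x a))"
proof -
  have v3: "pt [fst, \<lambda>e. fst (snd e), \<lambda>e. snd (snd e)] fst"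
    "pt [fst, \<lambda>e. fst (snd e), \<lambda>e. snd (snd e)] (\<lambda>e. fst (snd e))"
    "pt [fst, \<lambda>e. fst (snd e), \<lambda>e. snd (snd e)] (\<lambda>e. snd (snd e))" by (rule pt_proj, simp)+
  have v2: "pt [fst, snd] fst" "pt [fst, snd] snd" by (rule pt_proj, simp)+
  have 1: "pt [fst, \<lambda>e. fst (snd e), \<lambda>e. snd (snd e)] (\<lambda>e.
      if starts One (fst e) \<and> length (fst e) \<le> length (commas (fst (snd e)))
      then Comma # half_vector (snd (snd e)) (fst (snd e)) (fst e) @ half_vector (snd (snd e)) (fst (snd e)) (fst e) else [])"
    by (intro pt_if ptb_conj ptb_starts ptb_le pt_commas pt_Cons pt_append pt_half_vector pt_const v3)
  have "pt [fst, snd] (\<lambda>a. concat (map (\<lambda>q. (\<lambda>e.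
      if starts One (fst e) \<and> length (fst e) \<le> length (commas (fst (snd e)))
      then Comma # half_vector (snd (snd e)) (fst (snd e)) (fst e) @ half_vector (snd (snd e)) (fst (snd e)) (fst e) else [])
      (q, a)) (tails (item (fst a) @ [One]))))"
    by (intro pt_concat_tails pt_append pt_item pt_const v2) (use 1 in simp)
  then have 2: "pt [fst, snd] (\<lambda>e. if starts Comma (fst e) then
      concat (map (\<lambda>q. if starts One q \<and> length q \<le> length (commas (fst e))
           then Comma # half_vector (snd e) (fst e) q @ half_vector (snd e) (fst e) q else [])
         (tails (item (fst e) @ [One]))) else [])"
    unfolding fst_conv snd_conv by (intro pt_if ptb_starts pt_const v2)
  have v1: "pt [\<lambda>w. w] (\<lambda>w. w)" by (rule pt_proj) simp
  have "pt [\<lambda>w. w] (\<lambda>w. concat (map (\<lambda>p. (\<lambda>e. if starts Comma (fst e) then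
      concat (map (\<lambda>q. if starts One q \<and> length q \<le> length (commas (fst e))
           then Comma # half_vector (snd e) (fst e) q @ half_vector (snd e) (fst e) q else [])
         (tails (item (fst e) @ [One]))) else []) (p, w)) (tails w)))"
    by (intro pt_concat_tails v1) (use 2 in simp)
  then have "pt [\<lambda>w. w] edge_vectors" unfolding edge_vectors_def[abs_def] fst_conv snd_conv .
  then show ?thesis by (rule pt_comp) (rule assms)
qed

lemma pt_ones_word: "pt gs x \<Longrightarrow> pt gs (\<lambda>a. ones_word (x a))"
  unfolding ones_word_def by (intro pt_map pt_Cons pt_append pt_commas)

lemma pt_indep_list:
  assumes "pt gs x"
  shows "pt gs (\<lambda>a. indep_list (x a))"
proof -
  have v3: "pt [fst, \<lambda>e. fst (snd e), \<lambda>e. snd (snd e)] fst"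
    "pt [fst, \<lambda>e. fst (snd e), \<lambda>e. snd (snd e)] (\<lambda>e. fst (snd e))" by (rule pt_proj, simp)+
  have v2: "pt [fst, snd] fst" "pt [fst, snd] snd" by (rule pt_proj, simp)+
  have 1: "ptb [fst, \<lambda>e. fst (snd e), \<lambda>e. snd (snd e)] (\<lambda>e. starts Comma (fst e) \<and> item (fst e) = item (fst (snd e)))"
    by (intro ptb_conj ptb_starts ptb_eq pt_item v3)
  have "ptb [fst, snd] (\<lambda>a. \<exists>d \<in> set (tails (edge_vectors (snd a))).
      (\<lambda>e. starts Comma (fst e) \<and> item (fst e) = item (fst (snd e))) (d, a))"
    by (intro ptb_ex_tails pt_edge_vectors v2) (use 1 in simp)
  then have 2: "pt [fst, snd] (\<lambda>e. if starts Comma (fst e) then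
      (if \<exists>d \<in> set (tails (edge_vectors (snd e))). starts Comma d \<and> item d = item (fst e) then []
       else Comma # item (fst e)) else [])"
    by (intro pt_if ptb_starts pt_Cons pt_item pt_const v2) simp
  have v1: "pt [\<lambda>w. w] (\<lambda>w. w)" by (rule pt_proj) simp
  have "pt [\<lambda>w. w] (\<lambda>w. concat (map (\<lambda>p. (\<lambda>e. if starts Comma (fst e) then
      (if \<exists>d \<in> set (tails (edge_vectors (snd e))). starts Comma d \<and> item d = item (fst e) then []
       else Comma # item (fst e)) else []) (p, w)) (tails (enc_list (vecs 4 (length (ones_word w)))))))"
    by (intro pt_concat_tails pt_vecs pt_ones_word v1) (use 2 in simp)
  then have "pt [\<lambda>w. w] indep_list" unfolding indep_list_def[abs_def] fst_conv snd_conv .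
  then show ?thesis by (rule pt_comp) (rule assms)
qed

lemma pt_indep_word: "pt gs x \<Longrightarrow> pt gs (\<lambda>a. indep_word (x a))"
  unfolding indep_word_def by (intro pt_append pt_ones_word pt_indep_list)

lemma pt_spanning_word: "pt gs x \<Longrightarrow> pt gs (\<lambda>a. spanning_word (x a))"
  unfolding spanning_word_def by (intro pt_append pt_ones_word pt_map pt_indep_list)

lemma ptb_is_elem: "pt gs w \<Longrightarrow> pt gs p \<Longrightarrow> ptb gs (\<lambda>a. is_elem (w a) (p a))"
  unfolding is_elem_def by (intro ptb_conj ptb_less ptb_le pt_dropWhile)

lemma ptb_arc: "pt gs w \<Longrightarrow> pt gs p \<Longrightarrow> pt gs q \<Longrightarrow> ptb gs (\<lambda>a. arc (w a) (p a) (q a))"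
  unfolding arc_def
  by (intro ptb_disj ptb_conj ptb_less ptb_is_elem ptb_starts pt_dropWhile pt_drop pt_tl pt_Cons)

lemma pt_adjacency:
  assumes "pt gs x"
  shows "pt gs (\<lambda>a. adjacency (x a))"
proof -
  let ?y = "\<lambda>w. Amp # Amp # Amp # w"
  have v3: "pt [fst, \<lambda>e. fst (snd e), \<lambda>e. snd (snd e)] fst"
    "pt [fst, \<lambda>e. fst (snd e), \<lambda>e. snd (snd e)] (\<lambda>e. fst (snd e))"
    "pt [fst, \<lambda>e. fst (snd e), \<lambda>e. snd (snd e)] (\<lambda>e. snd (snd e))" by (rule pt_proj, simp)+
  have v2: "pt [fst, snd] fst" "pt [fst, snd] snd" by (rule pt_proj, simp)+
  have v1: "pt [\<lambda>w. w] (\<lambda>w. w)" by (rule pt_proj) simp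
  have 1: "pt [fst, \<lambda>e. fst (snd e), \<lambda>e. snd (snd e)] (\<lambda>e. if length (fst (snd e)) \<noteq> length (fst e) \<and>
      (arc (snd (snd e)) (fst (snd e)) (fst e) \<or> arc (snd (snd e)) (fst e) (fst (snd e))) then [One] else [Zero])"
    by (intro pt_if ptb_conj ptb_disj ptb_neq_length ptb_arc pt_const v3)
  have "pt [fst, snd] (\<lambda>a. Comma # concat (map (\<lambda>q. (\<lambda>e. if length (fst (snd e)) \<noteq> length (fst e) \<and>
      (arc (snd (snd e)) (fst (snd e)) (fst e) \<or> arc (snd (snd e)) (fst e) (fst (snd e))) then [One] else [Zero])
      (q, a)) (tails (?y (snd a)))))"
    by (intro pt_Cons pt_concat_tails v2) (use 1 in simp)
  then have 2: "pt [fst, snd] (\<lambda>e. Comma # concat (map (\<lambda>q. if length (fst e) \<noteq> length q \<and>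
      (arc (snd e) (fst e) q \<or> arc (snd e) q (fst e)) then [One] else [Zero]) (tails (?y (snd e)))))"
    unfolding fst_conv snd_conv .
  have "pt [\<lambda>w. w] (\<lambda>w. concat (map (\<lambda>p. (\<lambda>e. Comma # concat (map (\<lambda>q. if length (fst e) \<noteq> length q \<and>
      (arc (snd e) (fst e) q \<or> arc (snd e) q (fst e)) then [One] else [Zero]) (tails (?y (snd e))))) (p, w)) (tails (?y w))))"
    by (rule pt_concat_tails, intro pt_Cons v1) (use 2 in \<open>simp only: list.map\<close>)
  then have "pt [\<lambda>w. w] adjacency" unfolding adjacency_def[abs_def] Let_def fst_conv snd_conv .
  then show ?thesis by (rule pt_comp) (rule assms)
qed

lemma poly_time_on_halves:
  assumes "pt [\<lambda>w. w] f"
  shows "poly_time (\<lambda>w. f (takeWhile (\<lambda>c. c \<noteq> Amp) w) @ Amp # f (tl (dropWhile (\<lambda>c. c \<noteq> Amp) w)))"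
  by (intro pt_poly_time pt_append pt_Cons pt_comp[OF assms] pt_takeWhile pt_tl pt_dropWhile pt_proj) simp_all

section \<open>Matroids are determined by their descriptions\<close>

locale matroid =
  fixes M :: "'a matroid"
  assumes is_matroid: "is_matroid M"
begin

lemma finite_ground: "finite (ground M)"
  and indep_subset: "X \<in> indep M \<Longrightarrow> X \<subseteq> ground M"
  and empty_indep: "{} \<in> indep M"
  and indep_mono: "X \<in> indep M \<Longrightarrow> Y \<subseteq> X \<Longrightarrow> Y \<in> indep M"
  and augment: "X \<in> indep M \<Longrightarrow> Y \<in> indep M \<Longrightarrow> card X < card Y \<Longrightarrow> \<exists>e \<in> Y - X. insert e X \<in> indep M"
  using is_matroid unfolding is_matroid_def by blast+

lemma finite_indep: "X \<in> indep M \<Longrightarrow> finite X"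
  using indep_subset finite_ground finite_subset by blast

lemma rank_set: "finite (card ` {Y \<in> indep M. Y \<subseteq> X})" "card ` {Y \<in> indep M. Y \<subseteq> X} \<noteq> {}"
proof -
  have "{Y \<in> indep M. Y \<subseteq> X} \<subseteq> Pow (ground M)" using indep_subset by blast
  then show "finite (card ` {Y \<in> indep M. Y \<subseteq> X})" using finite_ground by (meson finite_Pow_iff finite_imageI finite_subset)
  show "card ` {Y \<in> indep M. Y \<subseteq> X} \<noteq> {}" using empty_indep by blast
qed

lemma rank_witness: "\<exists>Y \<in> indep M. Y \<subseteq> X \<and> card Y = rank M X"
proof -
  have "rank M X \<in> card ` {Y \<in> indep M. Y \<subseteq> X}" unfolding rank_def by (rule Max_in[OF rank_set])
  then obtain Y where "rank M X = card Y" "Y \<in> {Y \<in> indep M. Y \<subseteq> X}" by (rule imageE)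
  then show ?thesis by (intro bexI[of _ Y]) simp_all
qed

lemma card_le_rank: "Y \<in> indep M \<Longrightarrow> Y \<subseteq> X \<Longrightarrow> card Y \<le> rank M X"
  unfolding rank_def by (intro Max_ge rank_set) auto

lemma rank_mono: "X \<subseteq> Y \<Longrightarrow> rank M X \<le> rank M Y"
  using rank_witness[of X] card_le_rank[of _ Y] by fastforce

lemma rank_le_card: "finite X \<Longrightarrow> rank M X \<le> card X"
  using rank_witness[of X] card_mono by metis

lemma rank_indep: "X \<in> indep M \<Longrightarrow> rank M X = card X"
  using card_le_rank[of X X] rank_le_card[of X] finite_indep by force

lemma indep_iff_rank: "X \<subseteq> ground M \<Longrightarrow> X \<in> indep M \<longleftrightarrow> rank M X = card X"
proof
  assume X: "X \<subseteq> ground M" and r: "rank M X = card X"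
  obtain Y where Y: "Y \<in> indep M" "Y \<subseteq> X" "card Y = card X" using rank_witness[of X] r by auto
  then have "Y = X" using finite_subset[OF X finite_ground] by (simp add: card_subset_eq)
  with Y show "X \<in> indep M" by simp
qed (rule rank_indep)

text \<open>A largest independent set between \<open>Y\<close> and \<open>X\<close> has full rank,
  for otherwise it could be augmented from a maximum independent subset of \<open>X\<close>.\<close>

lemma extend:
  assumes "Y \<in> indep M" "Y \<subseteq> X"
  shows "\<exists>Z \<in> indep M. Y \<subseteq> Z \<and> Z \<subseteq> X \<and> card Z = rank M X"
proof -
  let ?P = "\<lambda>Z. Z \<in> indep M \<and> Y \<subseteq> Z \<and> Z \<subseteq> X"
  have "\<And>Z. ?P Z \<Longrightarrow> card Z < Suc (rank M X)" using card_le_rank by (simp add: less_Suc_eq_le)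
  then obtain Z where Z: "?P Z" and max: "\<And>W. ?P W \<Longrightarrow> card W \<le> card Z"
    using ex_has_greatest_nat[of ?P Y card "Suc (rank M X)"] assms by blast
  have "\<not> card Z < rank M X"
  proof
    assume "card Z < rank M X"
    then obtain W e where "W \<in> indep M" "W \<subseteq> X" "e \<in> W - Z" "insert e Z \<in> indep M"
      using rank_witness[of X] augment[of Z] Z by metis
    then have "card (insert e Z) \<le> card Z" using Z by (intro max) auto
    then show False using \<open>e \<in> W - Z\<close> finite_indep Z by simp
  qed
  then show ?thesis using Z card_le_rank[of Z X] by (metis le_neq_implies_less)
qed

lemma bases_iff: "B \<in> bases M \<longleftrightarrow> B \<in> indep M \<and> card B = rk M"
proof
  assume B: "B \<in> bases M"
  then have "B \<in> indep M" by (simp add: bases_def)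
  then obtain Z where "Z \<in> indep M" "B \<subseteq> Z" "card Z = rk M"
    using extend[of B "ground M"] indep_subset unfolding rk_def by blast
  then show "B \<in> indep M \<and> card B = rk M" using B by (auto simp: bases_def)
next
  assume B: "B \<in> indep M \<and> card B = rk M"
  have "X = B" if "X \<in> indep M" "B \<subseteq> X" for X
    using card_le_rank[of X "ground M"] that B indep_subset[of X] finite_indep[of X] card_subset_eq[of X B]
      card_mono[of X B] unfolding rk_def by force
  then show "B \<in> bases M" using B by (auto simp: bases_def)
qed

lemma indep_basis: "X \<in> indep M \<longleftrightarrow> (\<exists>B \<in> bases M. X \<subseteq> B)"
proof
  assume X: "X \<in> indep M"
  then obtain B where "B \<in> indep M" "X \<subseteq> B" "card B = rk M"
    using extend[OF X indep_subset[OF X]] unfolding rk_def by blast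
  then show "\<exists>B \<in> bases M. X \<subseteq> B" using bases_iff by blast
next
  assume "\<exists>B \<in> bases M. X \<subseteq> B"
  then show "X \<in> indep M" using indep_mono by (auto simp: bases_def)
qed

lemma circuit_exists:
  assumes "X \<subseteq> ground M" "X \<notin> indep M"
  shows "\<exists>C \<in> circuits M. C \<subseteq> X"
proof -
  let ?P = "\<lambda>C. C \<subseteq> X \<and> C \<notin> indep M"
  obtain C where C: "?P C" and min: "\<And>D. ?P D \<Longrightarrow> card C \<le> card D"
    using ex_has_least_nat[of ?P X card] assms(2) by blast
  have "finite C" using C assms(1) finite_ground by (meson finite_subset)
  then have "D \<in> indep M" if "D \<subset> C" for D
    using min[of D] C that psubset_card_mono[of C D] by (meson leD order.trans psubset_imp_subset)
  then show ?thesis using C assms(1) by (auto simp: circuits_def)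
qed

lemma indep_circuits: "X \<in> indep M \<longleftrightarrow> X \<subseteq> ground M \<and> \<not> (\<exists>C \<in> circuits M. C \<subseteq> X)"
proof -
  have "C \<in> circuits M \<Longrightarrow> C \<notin> indep M" for C by (simp add: circuits_def)
  then show ?thesis using circuit_exists[of X] indep_subset[of X] indep_mono[of X] by blast
qed

text \<open>Closure can be tested on one maximum independent subset \<open>Z\<close> of
  \<open>X\<close>. The main facts on closures below rest on this.\<close>

lemma in_cl_iff:
  assumes Z: "Z \<in> indep M" "Z \<subseteq> X" "card Z = rank M X"
  shows "e \<in> cl M X \<longleftrightarrow> e \<in> ground M \<and> (e \<in> Z \<or> insert e Z \<notin> indep M)"
proof (cases "e \<in> ground M \<and> e \<notin> Z")
  case True
  have "rank M (insert e X) = rank M X \<longleftrightarrow> insert e Z \<notin> indep M"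
  proof
    assume r: "rank M (insert e X) = rank M X"
    show "insert e Z \<notin> indep M"
      using card_le_rank[of "insert e Z" "insert e X"] Z r True finite_indep[of Z] by auto
  next
    assume n: "insert e Z \<notin> indep M"
    obtain Z' where Z': "Z' \<in> indep M" "Z \<subseteq> Z'" "Z' \<subseteq> insert e X" "card Z' = rank M (insert e X)"
      using extend[of Z "insert e X"] Z by auto
    have "e \<notin> Z'" using n indep_mono[OF Z'(1), of "insert e Z"] Z'(2) by auto
    then have "card Z' \<le> rank M X" using Z' by (intro card_le_rank) auto
    moreover have "rank M X \<le> rank M (insert e X)" by (rule rank_mono) blast
    ultimately show "rank M (insert e X) = rank M X" using Z'(4) by linarith
  qed
  with True show ?thesis by (simp add: cl_def)
next
  case False
  then show ?thesis using Z(2) by (auto simp: cl_def insert_absorb)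
qed

lemma cl_subset_ground: "cl M X \<subseteq> ground M"
  by (auto simp: cl_def)

lemma subset_cl: "X \<subseteq> ground M \<Longrightarrow> X \<subseteq> cl M X"
  by (auto simp: cl_def insert_absorb)

text \<open>A larger independent set inside the closure would augment \<open>Z\<close> by an element
  of the closure, contrary to \<open>in_cl_iff\<close>.\<close>

lemma rank_cl:
  assumes "X \<subseteq> ground M"
  shows "rank M (cl M X) = rank M X"
proof -
  obtain Z where Z: "Z \<in> indep M" "Z \<subseteq> X" "card Z = rank M X" using rank_witness by blast
  obtain W where W: "W \<in> indep M" "W \<subseteq> cl M X" "card W = rank M (cl M X)" using rank_witness by blast
  have "\<not> card Z < card W"
    using augment[OF Z(1) W(1)] in_cl_iff[OF Z] W(2) by blast
  then show ?thesis using Z W rank_mono[OF subset_cl[OF assms]] by simp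
qed

lemma cl_in_flats:
  assumes "X \<subseteq> ground M"
  shows "cl M X \<in> flats M"
proof -
  have "cl M (cl M X) \<subseteq> cl M X"
  proof
    fix e
    assume e: "e \<in> cl M (cl M X)"
    have "rank M (insert e X) \<le> rank M (insert e (cl M X))"
      by (intro rank_mono insert_mono subset_cl assms)
    also have "\<dots> = rank M (cl M X)" using e unfolding cl_def[of M "cl M X"] by simp
    also have "\<dots> = rank M X" by (rule rank_cl[OF assms])
    finally have "rank M (insert e X) \<le> rank M X" .
    moreover have "rank M X \<le> rank M (insert e X)" by (rule rank_mono) blast
    moreover have "e \<in> ground M" using e cl_subset_ground by blast
    ultimately show "e \<in> cl M X" unfolding cl_def by simp
  qed
  then show ?thesis using subset_cl[OF cl_subset_ground[of X]] cl_subset_ground[of X]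
    by (auto simp: flats_def)
qed

text \<open>A maximum independent subset of \<open>X\<close> extends to one of \<open>Y\<close>, and
  an element dependent on the former is dependent on the latter.\<close>

lemma cl_mono:
  assumes "X \<subseteq> Y"
  shows "cl M X \<subseteq> cl M Y"
proof
  fix e
  assume e: "e \<in> cl M X"
  obtain Z where Z: "Z \<in> indep M" "Z \<subseteq> X" "card Z = rank M X" using rank_witness by blast
  obtain W where W: "W \<in> indep M" "Z \<subseteq> W" "W \<subseteq> Y" "card W = rank M Y"
    using extend[of Z Y] Z assms by blast
  have "e \<in> ground M" "e \<in> Z \<or> insert e Z \<notin> indep M" using e in_cl_iff[OF Z] by auto
  then show "e \<in> cl M Y"
    using in_cl_iff[OF W(1,3,4), of e] W(2) indep_mono[of "insert e W" "insert e Z"] by blast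
qed

lemma cl_subset_flat: "F \<in> flats M \<Longrightarrow> X \<subseteq> F \<Longrightarrow> cl M X \<subseteq> F"
  using cl_mono[of X F] by (simp add: flats_def)

lemma indep_cl:
  assumes "X \<subseteq> ground M"
  shows "X \<in> indep M \<longleftrightarrow> (\<forall>e \<in> X. e \<notin> cl M (X - {e}))"
proof
  assume X: "X \<in> indep M"
  show "\<forall>e \<in> X. e \<notin> cl M (X - {e})"
  proof
    fix e
    assume "e \<in> X"
    then have "rank M (insert e (X - {e})) = card X" "rank M (X - {e}) = card X - 1" "card X > 0"
      using rank_indep[OF X] rank_indep[OF indep_mono[OF X, of "X - {e}"]] finite_indep[OF X]
      by (auto simp: insert_absorb card_gt_0_iff)
    then show "e \<notin> cl M (X - {e})" by (auto simp: cl_def)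
  qed
next
  assume *: "\<forall>e \<in> X. e \<notin> cl M (X - {e})"
  show "X \<in> indep M"
  proof (rule ccontr)
    assume n: "X \<notin> indep M"
    obtain Z where Z: "Z \<in> indep M" "Z \<subseteq> X" "card Z = rank M X" using rank_witness by blast
    then have "Z \<noteq> X" using n by blast
    then obtain e where e: "e \<in> X" "e \<notin> Z" using Z(2) by blast
    have "Z \<subseteq> X - {e}" using Z(2) e by blast
    then have "card Z \<le> rank M (X - {e})" by (rule card_le_rank[OF Z(1)])
    moreover have "rank M (X - {e}) \<le> rank M X" by (rule rank_mono) blast
    ultimately have "rank M (X - {e}) = rank M X" using Z(3) by linarith
    then have "e \<in> cl M (X - {e})" using e assms by (auto simp: cl_def insert_absorb)
    then show False using * e by blast
  qed
qed

text \<open>If any flat separates \<open>e\<close> from \<open>X - {e}\<close>, then so does the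
  closure of \<open>X - {e}\<close>, which is the least flat around this set.\<close>

lemma indep_flats: "X \<in> indep M \<longleftrightarrow> X \<subseteq> ground M \<and> (\<forall>e \<in> X. \<exists>F \<in> flats M. X - {e} \<subseteq> F \<and> e \<notin> F)"
proof -
  have "e \<notin> cl M (X - {e}) \<longleftrightarrow> (\<exists>F \<in> flats M. X - {e} \<subseteq> F \<and> e \<notin> F)" if "X \<subseteq> ground M" for e
    using cl_in_flats[of "X - {e}"] subset_cl[of "X - {e}"] cl_subset_flat[of _ "X - {e}"] that by blast
  then show ?thesis using indep_cl[of X] indep_subset[of X] by blast
qed

lemma hyperplane_exists:
  assumes "B \<in> bases M" "e \<in> B"
  shows "cl M (B - {e}) \<in> hyperplanes M" "e \<notin> cl M (B - {e})"
proof -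
  have B: "B \<in> indep M" "card B = rk M" using assms(1) bases_iff by auto
  have "rank M (B - {e}) = card (B - {e})" using indep_mono[OF B(1)] rank_indep by blast
  then have "rank M (B - {e}) + 1 = rk M" using B assms(2) finite_indep[OF B(1)]
    by (metis Suc_eq_plus1 card.remove)
  moreover have "B - {e} \<subseteq> ground M" using indep_subset[OF B(1)] by blast
  ultimately show "cl M (B - {e}) \<in> hyperplanes M"
    using cl_in_flats[of "B - {e}"] rank_cl[of "B - {e}"] by (simp add: hyperplanes_def)
  show "e \<notin> cl M (B - {e})" using indep_cl[of B] B(1) indep_subset assms(2) by blast
qed

text \<open>For a basis \<open>B\<close> that contains \<open>X\<close>, the hyperplane spanned by
  \<open>B - {e}\<close> separates \<open>e\<close> from the rest of \<open>X\<close>. The converse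
  follows from \<open>indep_flats\<close>, since hyperplanes are flats.\<close>

lemma indep_hyperplanes:
  "X \<in> indep M \<longleftrightarrow> X \<subseteq> ground M \<and> (\<forall>e \<in> X. \<exists>H \<in> hyperplanes M. X - {e} \<subseteq> H \<and> e \<notin> H)"
proof
  assume X: "X \<in> indep M"
  then obtain B where B: "B \<in> bases M" "X \<subseteq> B" using indep_basis by blast
  then have "B \<subseteq> ground M" using indep_subset by (auto simp: bases_def)
  then have sub: "X - {e} \<subseteq> cl M (B - {e})" for e using B subset_cl[of "B - {e}"] by blast
  then show "X \<subseteq> ground M \<and> (\<forall>e \<in> X. \<exists>H \<in> hyperplanes M. X - {e} \<subseteq> H \<and> e \<notin> H)"
  proof (intro conjI ballI)
    fix e
    assume "e \<in> X"
    then have e: "e \<in> B" using B(2) by blast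
    show "\<exists>H \<in> hyperplanes M. X - {e} \<subseteq> H \<and> e \<notin> H"
      by (intro bexI[OF _ hyperplane_exists(1)[OF B(1) e]] conjI sub hyperplane_exists(2)[OF B(1) e])
  qed (rule indep_subset[OF X])
next
  assume "X \<subseteq> ground M \<and> (\<forall>e \<in> X. \<exists>H \<in> hyperplanes M. X - {e} \<subseteq> H \<and> e \<notin> H)"
  moreover have "hyperplanes M \<subseteq> flats M" by (auto simp: hyperplanes_def)
  ultimately show "X \<in> indep M" unfolding indep_flats[of X] by (meson subsetD)
qed

text \<open>A set of \<open>rk M\<close> elements that is no basis has smaller rank and lies in some
  hyperplane. This hyperplane has rank \<open>rk M - 1\<close> but at least \<open>rk M\<close>
  elements, so it is dependent.\<close>

lemma bases_dependent_hyperplanes: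
  "B \<in> bases M \<longleftrightarrow> B \<subseteq> ground M \<and> card B = rk M \<and> \<not> (\<exists>H \<in> dependent_hyperplanes M. B \<subseteq> H)"
proof
  assume B: "B \<in> bases M"
  then have le: "card B \<le> rank M H" if "B \<subseteq> H" for H using that card_le_rank bases_iff by blast
  then show "B \<subseteq> ground M \<and> card B = rk M \<and> \<not> (\<exists>H \<in> dependent_hyperplanes M. B \<subseteq> H)"
  proof (intro conjI notI)
    assume "\<exists>H \<in> dependent_hyperplanes M. B \<subseteq> H"
    then obtain H where H: "H \<in> dependent_hyperplanes M" "B \<subseteq> H" by blast
    then have "rank M H + 1 = rk M" by (simp add: dependent_hyperplanes_def hyperplanes_def)
    moreover have "card B \<le> rank M H" using H(2) by (rule le)
    ultimately show False using B bases_iff by simp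
  qed (use B bases_iff indep_subset in blast)+
next
  assume B: "B \<subseteq> ground M \<and> card B = rk M \<and> \<not> (\<exists>H \<in> dependent_hyperplanes M. B \<subseteq> H)"
  show "B \<in> bases M"
  proof (rule ccontr)
    assume "B \<notin> bases M"
    then have n: "B \<notin> indep M" using B bases_iff by blast
    obtain Z where Z: "Z \<in> indep M" "Z \<subseteq> B" "card Z = rank M B" using rank_witness by blast
    \<comment> \<open>Removing an element outside \<open>Z\<close> from a basis around
      \<open>Z\<close> leaves a set whose closure is a hyperplane and contains the closure of
      \<open>Z\<close>, hence \<open>B\<close>.\<close>
    obtain Z' where Z': "Z' \<in> bases M" "Z \<subseteq> Z'" using Z(1) indep_basis by blast
    have "rank M B \<le> card B" using rank_le_card finite_subset[OF _ finite_ground] B by blast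
    moreover have "rank M B \<noteq> card B" using indep_iff_rank B n by blast
    ultimately have "card Z < card Z'" using Z(3) B Z'(1) bases_iff by simp
    then have "Z \<noteq> Z'" by blast
    then obtain e where e: "e \<in> Z'" "e \<notin> Z" using Z'(2) by blast
    let ?H = "cl M (Z' - {e})"
    have H: "?H \<in> hyperplanes M" by (rule hyperplane_exists[OF Z'(1) e(1)])
    have "x \<in> cl M Z" if "x \<in> B" for x
    proof -
      have "x \<in> cl M B" using subset_cl B that by blast
      then show ?thesis using in_cl_iff[OF Z] in_cl_iff[of Z Z] Z(1) rank_indep[OF Z(1)] by simp
    qed
    moreover have "cl M Z \<subseteq> ?H" using Z'(2) e by (intro cl_mono) auto
    ultimately have sub: "B \<subseteq> ?H" by blast
    have "?H \<notin> indep M"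
    proof
      assume "?H \<in> indep M"
      then show False using rank_indep[of ?H] H card_mono[OF finite_indep sub] B by (simp add: hyperplanes_def)
    qed
    then show False using H sub B by (auto simp: dependent_hyperplanes_def)
  qed
qed

lemma indep_dependent_hyperplanes:
  "X \<in> indep M \<longleftrightarrow> (\<exists>B. B \<subseteq> ground M \<and> card B = rk M \<and> \<not> (\<exists>H \<in> dependent_hyperplanes M. B \<subseteq> H) \<and> X \<subseteq> B)"
  unfolding indep_basis[of X] Bex_def bases_dependent_hyperplanes by blast

text \<open>A spanning circuit properly contains a basis and so has more than \<open>rk M\<close>
  elements. Circuits inside a set of at most \<open>rk M\<close> elements are therefore
  non-spanning.\<close>

lemma indep_non_spanning_circuits:
  "X \<in> indep M \<longleftrightarrow> X \<subseteq> ground M \<and> card X \<le> rk M \<and> \<not> (\<exists>C \<in> non_spanning_circuits M. C \<subseteq> X)"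
proof
  assume X: "X \<in> indep M"
  then show "X \<subseteq> ground M \<and> card X \<le> rk M \<and> \<not> (\<exists>C \<in> non_spanning_circuits M. C \<subseteq> X)"
    using indep_circuits[of X] card_le_rank[of X "ground M"] by (auto simp: rk_def non_spanning_circuits_def)
next
  assume X: "X \<subseteq> ground M \<and> card X \<le> rk M \<and> \<not> (\<exists>C \<in> non_spanning_circuits M. C \<subseteq> X)"
  show "X \<in> indep M"
  proof (rule ccontr)
    assume n: "X \<notin> indep M"
    obtain C where C: "C \<in> circuits M" "C \<subseteq> X"
      using circuit_exists[OF conjunct1[OF X] n] by (elim bexE)
    have "C \<in> spanning_sets M"
    proof (rule ccontr)
      assume "C \<notin> spanning_sets M"
      then have "C \<in> non_spanning_circuits M" using C(1) by (simp add: non_spanning_circuits_def)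
      then show False using X C(2) by simp
    qed
    then obtain B where B: "B \<in> bases M" "B \<subseteq> C" by (auto simp: spanning_sets_def)
    have "finite X" by (rule finite_subset[OF conjunct1[OF X] finite_ground])
    then have fin: "finite C" "card C \<le> card X" using C(2) by (auto intro: finite_subset card_mono)
    have "B \<noteq> C" using B C by (auto simp: circuits_def bases_def)
    then have "card B < card C" using B(2) fin(1) by (simp add: psubset_card_mono psubset_eq)
    then show False using B(1) bases_iff X fin(2) by simp
  qed
qed

lemma bases_spanning: "B \<in> bases M \<Longrightarrow> B \<in> spanning_sets M"
  using indep_subset[of B] by (auto simp: spanning_sets_def bases_def)

lemma bases_iff_minimal_spanning:
  "B \<in> bases M \<longleftrightarrow> B \<in> spanning_sets M \<and> (\<forall>S \<in> spanning_sets M. S \<subseteq> B \<longrightarrow> S = B)"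
proof
  assume B: "B \<in> bases M"
  show "B \<in> spanning_sets M \<and> (\<forall>S \<in> spanning_sets M. S \<subseteq> B \<longrightarrow> S = B)"
  proof (intro conjI ballI impI)
    fix S
    assume S: "S \<in> spanning_sets M" "S \<subseteq> B"
    then obtain B' where B': "B' \<in> bases M" "B' \<subseteq> S" by (auto simp: spanning_sets_def)
    have "B \<in> indep M" using B by (simp add: bases_def)
    moreover have "B' \<subseteq> B" using B'(2) S(2) by (rule subset_trans)
    ultimately have "B = B'" using B'(1) by (simp add: bases_def)
    then show "S = B" using B'(2) S(2) by simp
  qed (rule bases_spanning[OF B])
next
  assume B: "B \<in> spanning_sets M \<and> (\<forall>S \<in> spanning_sets M. S \<subseteq> B \<longrightarrow> S = B)"
  then obtain B' where B': "B' \<in> bases M" "B' \<subseteq> B" by (auto simp: spanning_sets_def)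
  then have "B' = B" using B bases_spanning by simp
  then show "B \<in> bases M" using B'(1) by simp
qed

lemma indep_spanning_sets:
  "X \<in> indep M \<longleftrightarrow> (\<exists>B. (B \<in> spanning_sets M \<and> (\<forall>S \<in> spanning_sets M. S \<subseteq> B \<longrightarrow> S = B)) \<and> X \<subseteq> B)"
  unfolding indep_basis[of X] Bex_def bases_iff_minimal_spanning ..

text \<open>An element \<open>e\<close> of the closure outside \<open>C\<close> lies on its
  fundamental circuit with respect to the independent set \<open>C - {c}\<close>, and this circuit
  stays inside the closure.\<close>

lemma cl_circuit_cyclic:
  assumes "C \<in> circuits M"
  shows "cl M C \<in> cyclic_flats M" "rank M (cl M C) < card C"
proof -
  have C: "C \<subseteq> ground M" "C \<notin> indep M" "\<And>D. D \<subset> C \<Longrightarrow> D \<in> indep M"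
    using assms by (auto simp: circuits_def)
  have fin: "finite C" using C(1) finite_ground finite_subset by blast
  have "C \<noteq> {}" using C(2) empty_indep by metis
  then obtain c where c: "c \<in> C" by blast
  have Z: "C - {c} \<in> indep M" using C(3) c by blast
  have "rank M C \<le> card C" "rank M C \<noteq> card C"
    using rank_le_card[OF fin] indep_iff_rank[OF C(1)] C(2) by auto
  moreover have "card (C - {c}) \<le> rank M C" by (rule card_le_rank[OF Z]) auto
  ultimately have r: "card (C - {c}) = rank M C" "rank M C < card C" using c fin by auto
  show "rank M (cl M C) < card C" using r rank_cl[OF C(1)] by simp
  have "\<exists>D \<in> circuits M. D \<subseteq> cl M C \<and> e \<in> D" if "e \<in> cl M C" for e
  proof (cases "e \<in> C")
    case True
    then show ?thesis using assms subset_cl[OF C(1)] by blast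
  next
    case False
    then have n: "insert e (C - {c}) \<notin> indep M" "e \<in> ground M"
      using in_cl_iff[OF Z _ r(1)] that by auto
    then obtain D where D: "D \<in> circuits M" "D \<subseteq> insert e (C - {c})"
      using circuit_exists[of "insert e (C - {c})"] C(1) by blast
    have "e \<in> D"
    proof (rule ccontr)
      assume "e \<notin> D"
      then have "D \<subseteq> C - {c}" using D(2) by blast
      then show False using D(1) indep_mono[OF Z] by (auto simp: circuits_def)
    qed
    then show ?thesis using D that subset_cl[OF C(1)] by blast
  qed
  then have "cl M C = \<Union>{D \<in> circuits M. D \<subseteq> cl M C}" by blast
  moreover have "{D \<in> circuits M. D \<subseteq> cl M C} \<subseteq> circuits M" by blast
  ultimately show "cl M C \<in> cyclic_flats M"
    using cl_in_flats[OF C(1)] unfolding cyclic_flats_def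
    by (intro CollectI conjI exI[of _ "{D \<in> circuits M. D \<subseteq> cl M C}"])
qed

text \<open>If \<open>X\<close> contains a circuit, then the closure of this circuit is a cyclic
  flat that violates the inequality.\<close>

lemma indep_cyclic_flats:
  "X \<in> indep M \<longleftrightarrow> X \<subseteq> ground M \<and> (\<forall>F \<in> cyclic_flats M. card (X \<inter> F) \<le> rank M F)"
proof
  assume X: "X \<in> indep M"
  have "card (X \<inter> F) \<le> rank M F" for F
    using card_le_rank[OF indep_mono[OF X Int_lower1] Int_lower2] .
  then show "X \<subseteq> ground M \<and> (\<forall>F \<in> cyclic_flats M. card (X \<inter> F) \<le> rank M F)"
    using indep_subset[OF X] by simp
next
  assume X: "X \<subseteq> ground M \<and> (\<forall>F \<in> cyclic_flats M. card (X \<inter> F) \<le> rank M F)"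
  show "X \<in> indep M"
  proof (rule ccontr)
    assume n: "X \<notin> indep M"
    obtain C where C: "C \<in> circuits M" "C \<subseteq> X"
      using circuit_exists[OF conjunct1[OF X] n] by (elim bexE)
    have "C \<subseteq> X \<inter> cl M C" using C subset_cl by (auto simp: circuits_def)
    moreover have "finite (X \<inter> cl M C)" using finite_subset[OF conjunct1[OF X] finite_ground] by simp
    ultimately have "card C \<le> card (X \<inter> cl M C)" by (simp add: card_mono)
    moreover have "card (X \<inter> cl M C) \<le> rank M (cl M C)" using X cl_circuit_cyclic(1)[OF C(1)] by simp
    ultimately show False using cl_circuit_cyclic(2)[OF C(1)] by simp
  qed
qed

end

section \<open>The labelled set families behind the ten input types\<close>

fun family :: "input_type \<Rightarrow> 'a matroid \<Rightarrow> 'a set set" where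
  "family RANK M = Pow (ground M)"
| "family INDEPENDENT_SETS M = indep M"
| "family SPANNING_SETS M = spanning_sets M"
| "family BASES M = bases M"
| "family FLATS M = flats M"
| "family CIRCUITS M = circuits M"
| "family HYPERPLANES M = hyperplanes M"
| "family NON_SPANNING_CIRCUITS M = non_spanning_circuits M"
| "family DEPENDENT_HYPERPLANES M = dependent_hyperplanes M"
| "family CYCLIC_FLATS M = cyclic_flats M"

definition label :: "input_type \<Rightarrow> 'a matroid \<Rightarrow> 'a set \<Rightarrow> nat" where
  "label I M X = (if I = RANK \<or> I = CYCLIC_FLATS then rank M X else 0)"

definition header :: "input_type \<Rightarrow> 'a matroid \<Rightarrow> nat" where
  "header I M = (if I = NON_SPANNING_CIRCUITS \<or> I = DEPENDENT_HYPERPLANES then rk M else 0)"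

text \<open>For each type, independence has been expressed above by the ground set, the family, its
  labels and the header alone.\<close>

theorem matroid_determined:
  assumes "is_matroid M" "is_matroid N" "ground M = ground N" "family I M = family I N"
    and "\<And>X. X \<in> family I M \<Longrightarrow> label I M X = label I N X" "header I M = header I N"
  shows "M = N"
proof -
  interpret M: matroid M using assms(1) by unfold_locales
  interpret N: matroid N using assms(2) by unfold_locales
  have "X \<in> indep M \<longleftrightarrow> X \<in> indep N" for X
  proof (cases I)
    case RANK
    then have "X \<subseteq> ground M \<Longrightarrow> rank M X = rank N X" using assms(3,5) by (auto simp: label_def)
    then have "X \<subseteq> ground M \<Longrightarrow> ?thesis"
      using M.indep_iff_rank[of X] N.indep_iff_rank[of X] assms(3) by simp
    moreover have "\<not> X \<subseteq> ground M \<Longrightarrow> ?thesis"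
      using M.indep_subset[of X] N.indep_subset[of X] assms(3) by metis
    ultimately show ?thesis by (cases "X \<subseteq> ground M")
  next
    case CYCLIC_FLATS
    then have "F \<in> cyclic_flats M \<Longrightarrow> rank M F = rank N F" for F using assms(5) by (auto simp: label_def)
    then show ?thesis
      using assms(3,4) CYCLIC_FLATS unfolding M.indep_cyclic_flats[of X] N.indep_cyclic_flats[of X] by auto
  next
    case INDEPENDENT_SETS
    then show ?thesis using assms(4) by simp
  next
    case SPANNING_SETS
    then show ?thesis
      using assms(4) unfolding M.indep_spanning_sets[of X] N.indep_spanning_sets[of X] by simp
  next
    case BASES
    then show ?thesis using assms(4) unfolding M.indep_basis[of X] N.indep_basis[of X] by simp
  next
    case FLATS
    then show ?thesis using assms(3,4) unfolding M.indep_flats[of X] N.indep_flats[of X] by simp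
  next
    case CIRCUITS
    then show ?thesis using assms(3,4) unfolding M.indep_circuits[of X] N.indep_circuits[of X] by simp
  next
    case HYPERPLANES
    then show ?thesis
      using assms(3,4) unfolding M.indep_hyperplanes[of X] N.indep_hyperplanes[of X] by simp
  next
    case NON_SPANNING_CIRCUITS
    then have "rk M = rk N" using assms(6) by (simp add: header_def)
    with NON_SPANNING_CIRCUITS show ?thesis
      using assms(3,4) unfolding M.indep_non_spanning_circuits[of X] N.indep_non_spanning_circuits[of X]
      by simp
  next
    case DEPENDENT_HYPERPLANES
    then have "rk M = rk N" using assms(6) by (simp add: header_def)
    with DEPENDENT_HYPERPLANES show ?thesis
      using assms(3,4) unfolding M.indep_dependent_hyperplanes[of X] N.indep_dependent_hyperplanes[of X]
      by simp
  qed
  with assms(3) show ?thesis by (intro matroid.equality) auto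
qed

subsection \<open>Relabelling\<close>

text \<open>It is used with maps that are injective on the whole type and not only on the ground
  set, so that images of arbitrary sets can be compared without side conditions.\<close>

definition relabel :: "('a \<Rightarrow> 'a) \<Rightarrow> 'a matroid \<Rightarrow> 'a matroid" where
  "relabel p M = \<lparr>ground = p ` ground M, indep = (`) p ` indep M\<rparr>"

context
  fixes p :: "'a \<Rightarrow> 'a"
  assumes p: "inj p"
begin

lemma relabel_sel [simp]: "ground (relabel p M) = p ` ground M" "indep (relabel p M) = (`) p ` indep M"
  by (simp_all add: relabel_def)

lemma image_in_image_iff: "p ` X \<in> (`) p ` A \<longleftrightarrow> X \<in> A"
  using p by (auto simp: inj_image_eq_iff)

lemma image_subset_image_iff: "p ` X \<subseteq> p ` Y \<longleftrightarrow> X \<subseteq> Y"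
  using p by (rule inj_image_subset_iff)

lemma rank_relabel: "rank (relabel p M) (p ` X) = rank M X"
proof -
  have "{Y \<in> (`) p ` indep M. Y \<subseteq> p ` X} = (`) p ` {Y \<in> indep M. Y \<subseteq> X}"
    by (auto simp: image_subset_image_iff)
  moreover have "card (p ` Y) = card Y" for Y using p by (meson card_image inj_on_subset subset_UNIV)
  ultimately show ?thesis by (simp add: rank_def image_image)
qed

lemma rk_relabel: "rk (relabel p M) = rk M"
  using rank_relabel[of M "ground M"] by (simp add: rk_def)

lemma image_setI:
  assumes "\<And>X. p ` X \<in> B \<longleftrightarrow> X \<in> A" "\<And>Y. Y \<in> B \<Longrightarrow> Y \<subseteq> p ` UNIV"
  shows "B = (`) p ` A"
proof
  show "B \<subseteq> (`) p ` A"
  proof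
    fix Y
    assume Y: "Y \<in> B"
    then obtain X where "Y = p ` X" using assms(2) by (meson subset_imageE)
    then show "Y \<in> (`) p ` A" using Y assms(1) by blast
  qed
qed (use assms(1) in auto)

lemma bases_relabel: "bases (relabel p M) = (`) p ` bases M"
  by (rule image_setI)
    (auto simp: bases_def image_in_image_iff image_subset_image_iff p[THEN inj_image_eq_iff])

lemma spanning_sets_relabel: "spanning_sets (relabel p M) = (`) p ` spanning_sets M"
  by (rule image_setI)
    (auto simp: spanning_sets_def bases_relabel image_subset_image_iff)

lemma circuits_relabel: "circuits (relabel p M) = (`) p ` circuits M"
proof (rule image_setI)
  fix X
  have "(\<forall>D. D \<subset> p ` X \<longrightarrow> D \<in> (`) p ` indep M) \<longleftrightarrow> (\<forall>D. D \<subset> X \<longrightarrow> D \<in> indep M)"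
  proof (intro iffI allI impI)
    fix D
    assume *: "\<forall>D. D \<subset> p ` X \<longrightarrow> D \<in> (`) p ` indep M" "D \<subset> X"
    have "p ` D \<subset> p ` X"
      using *(2) by (auto simp: psubset_eq image_subset_image_iff p[THEN inj_image_eq_iff])
    then have "p ` D \<in> (`) p ` indep M" using *(1) by simp
    then show "D \<in> indep M" by (simp only: image_in_image_iff)
  next
    fix D
    assume *: "\<forall>D. D \<subset> X \<longrightarrow> D \<in> indep M" "D \<subset> p ` X"
    then obtain D' where D': "D = p ` D'" "D' \<subseteq> X" by (meson psubset_imp_subset subset_imageE)
    then have "D' \<subset> X" using *(2) by auto
    then show "D \<in> (`) p ` indep M" using *(1) D'(1) by simp
  qed
  then show "p ` X \<in> circuits (relabel p M) \<longleftrightarrow> X \<in> circuits M"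
    by (simp add: circuits_def image_in_image_iff image_subset_image_iff)
qed (auto simp: circuits_def)

lemma cl_relabel: "cl (relabel p M) (p ` X) = p ` cl M X"
proof -
  have "rank (relabel p M) (insert (p e) (p ` X)) = rank M (insert e X)" for e
    using rank_relabel[of M "insert e X"] by simp
  then show ?thesis by (auto simp: cl_def rank_relabel)
qed

lemma flats_relabel: "flats (relabel p M) = (`) p ` flats M"
  by (rule image_setI)
    (auto simp: flats_def cl_relabel image_subset_image_iff p[THEN inj_image_eq_iff])

lemma hyperplanes_relabel: "hyperplanes (relabel p M) = (`) p ` hyperplanes M"
  by (rule image_setI)
    (auto simp: hyperplanes_def flats_relabel rank_relabel rk_relabel image_in_image_iff)

lemma image_Diff: "(`) p ` A - (`) p ` B = (`) p ` (A - B)"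
proof -
  have "inj ((`) p)" by (rule injI) (simp add: p[THEN inj_image_eq_iff])
  then show ?thesis by (rule image_set_diff[symmetric])
qed

lemma cyclic_flats_relabel: "cyclic_flats (relabel p M) = (`) p ` cyclic_flats M"
proof (rule image_setI)
  fix X
  have "(\<exists>\<C> \<subseteq> (`) p ` circuits M. p ` X = \<Union>\<C>) \<longleftrightarrow> (\<exists>\<C> \<subseteq> circuits M. X = \<Union>\<C>)"
  proof (intro iffI)
    assume "\<exists>\<C> \<subseteq> (`) p ` circuits M. p ` X = \<Union>\<C>"
    then obtain \<C> where *: "\<C> \<subseteq> (`) p ` circuits M" "p ` X = \<Union>\<C>" by blast
    then obtain \<D> where \<D>: "\<C> = (`) p ` \<D>" "\<D> \<subseteq> circuits M" by (meson subset_imageE)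
    then have "p ` X = p ` \<Union>\<D>" using * by (simp add: image_Union)
    then have "X = \<Union>\<D>" by (simp only: p[THEN inj_image_eq_iff])
    then show "\<exists>\<C> \<subseteq> circuits M. X = \<Union>\<C>" using \<D>(2) by (intro exI[of _ \<D>] conjI)
  next
    assume "\<exists>\<C> \<subseteq> circuits M. X = \<Union>\<C>"
    then obtain \<C> where "\<C> \<subseteq> circuits M" "X = \<Union>\<C>" by (elim exE conjE)
    then show "\<exists>\<C> \<subseteq> (`) p ` circuits M. p ` X = \<Union>\<C>"
      by (intro exI[of _ "(`) p ` \<C>"]) (auto simp: image_Union)
  qed
  then show "p ` X \<in> cyclic_flats (relabel p M) \<longleftrightarrow> X \<in> cyclic_flats M"
    by (simp add: cyclic_flats_def flats_relabel circuits_relabel image_in_image_iff)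
qed (auto simp: cyclic_flats_def flats_relabel)

lemma family_relabel: "family I (relabel p M) = (`) p ` family I M"
proof (cases I)
  case RANK
  then show ?thesis by (simp add: image_Pow_surj)
qed (simp_all add: spanning_sets_relabel bases_relabel flats_relabel circuits_relabel hyperplanes_relabel
    cyclic_flats_relabel non_spanning_circuits_def dependent_hyperplanes_def image_Diff)

lemma label_relabel: "label I (relabel p M) (p ` X) = label I M X"
  by (simp add: label_def rank_relabel)

lemma header_relabel: "header I (relabel p M) = header I M"
  by (simp add: header_def rk_relabel)

lemma is_matroid_relabel:
  assumes "is_matroid M"
  shows "is_matroid (relabel p M)"
proof -
  interpret matroid M using assms by unfold_locales
  have card: "card (p ` Y) = card Y" for Y using p by (meson card_image inj_on_subset subset_UNIV)
  show ?thesis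
    unfolding is_matroid_def relabel_sel
  proof (intro conjI ballI allI impI)
    show "finite (p ` ground M)" using finite_ground by simp
    show "(`) p ` indep M \<subseteq> Pow (p ` ground M)" using indep_subset by blast
    show "{} \<in> (`) p ` indep M" using empty_indep by force
  next
    fix X Y
    assume "X \<in> (`) p ` indep M" "Y \<subseteq> X"
    then obtain X' where X': "X' \<in> indep M" "Y \<subseteq> p ` X'" by blast
    then obtain Y' where Y': "Y = p ` Y'" "Y' \<subseteq> X'" by (meson subset_imageE)
    then show "Y \<in> (`) p ` indep M" using indep_mono[OF X'(1) Y'(2)] by simp
  next
    fix X Y
    assume "X \<in> (`) p ` indep M" "Y \<in> (`) p ` indep M" "card X < card Y"
    then obtain X' Y' where X': "X = p ` X'" "X' \<in> indep M" and Y': "Y = p ` Y'" "Y' \<in> indep M"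
      and c: "card X' < card Y'"
      using card by auto
    obtain e where e: "e \<in> Y' - X'" "insert e X' \<in> indep M"
      using augment[OF X'(2) Y'(2) c] by (elim bexE)
    have 1: "insert (p e) X = p ` insert e X'" and 2: "p e \<in> Y - X"
      using X'(1) Y'(1) p e(1) by (auto dest: injD)
    show "\<exists>e \<in> Y - X. insert e X \<in> (`) p ` indep M"
      by (rule bexI[OF _ 2], unfold 1) (rule imageI[OF e(2)])
  qed
qed

end

definition description_iso :: "input_type \<Rightarrow> nat matroid \<Rightarrow> nat matroid \<Rightarrow> (nat \<Rightarrow> nat) \<Rightarrow> bool" where
  "description_iso I M N p \<longleftrightarrow> bij p \<and> p ` ground M = ground N \<and> family I N = (`) p ` family I M \<and>
     (\<forall>X \<in> family I M. label I N (p ` X) = label I M X) \<and> header I N = header I M"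

text \<open>Makes an isomorphism of numbered structures a permutation of all natural numbers, as
  relabelling needs it.\<close>

lemma bij_extend:
  assumes "bij_betw f {..<n::nat} {..<n}"
  shows "bij (\<lambda>i. if i < n then f i else i)"
proof -
  have "bij_betw (\<lambda>i. if i < n then f i else i) ({..<n} \<union> {n..}) ({..<n} \<union> {n..})"
  proof (rule bij_betw_combine)
    show "bij_betw (\<lambda>i. if i < n then f i else i) {..<n} {..<n}"
      using assms by (subst bij_betw_cong[of _ _ f]) auto
    show "bij_betw (\<lambda>i. if i < n then f i else i) {n..} {n..}"
      by (subst bij_betw_cong[of _ _ id]) auto
  qed auto
  moreover have "{..<n} \<union> {n..} = UNIV" by auto
  ultimately show ?thesis by simp
qed

text \<open>An isomorphism carries families, labels and headers along. Conversely, if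
  \<open>p\<close> matches these data, then the relabelled \<open>M\<close> has the same data as
  \<open>N\<close> and equals it by \<open>matroid_determined\<close>.\<close>

theorem matroid_isomorphic_iff:
  assumes "numbered_matroid M" "numbered_matroid N"
  shows "matroid_isomorphic M N \<longleftrightarrow> (\<exists>p. description_iso I M N p)"
proof
  assume "matroid_isomorphic M N"
  then obtain f where f: "bij_betw f (ground M) (ground N)"
    "\<And>X. X \<subseteq> ground M \<Longrightarrow> X \<in> indep M \<longleftrightarrow> f ` X \<in> indep N"
    unfolding matroid_isomorphic_def by blast
  define n where "n = card (ground M)"
  have n: "ground M = {..<n}" "ground N = {..<n}"
    using assms bij_betw_same_card[OF f(1)] by (auto simp: numbered_matroid_def n_def)
  define p where "p i = (if i < n then f i else i)" for i
  have p: "bij p" using bij_extend[of f n] f(1) n by (simp add: p_def[abs_def])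
  have pf: "p ` X = f ` X" if "X \<subseteq> ground M" for X using that n by (auto simp: p_def image_iff subset_iff)
  have "relabel p M = N"
  proof (rule matroid.equality)
    have g: "p ` ground M = ground N" using pf[of "ground M"] f(1) by (simp add: bij_betw_def)
    then show "ground (relabel p M) = ground N" by (simp add: relabel_def)
    have sub: "X \<in> indep M \<Longrightarrow> X \<subseteq> ground M" "Y \<in> indep N \<Longrightarrow> Y \<subseteq> ground N" for X Y
      using assms matroid.indep_subset[OF matroid.intro, of M X] matroid.indep_subset[OF matroid.intro, of N Y]
      by (simp_all add: numbered_matroid_def)
    have "(`) p ` indep M = indep N"
    proof
      show "(`) p ` indep M \<subseteq> indep N"
      proof (rule image_subsetI)
        fix X
        assume X: "X \<in> indep M"
        then show "p ` X \<in> indep N" using pf[OF sub(1)[OF X]] f(2)[OF sub(1)[OF X]] by simp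
      qed
      show "indep N \<subseteq> (`) p ` indep M"
      proof
        fix Y
        assume Y: "Y \<in> indep N"
        then obtain X where X: "Y = p ` X" "X \<subseteq> ground M" using sub(2) g by (metis subset_imageE)
        then have "X \<in> indep M" using Y f(2)[OF X(2)] pf[OF X(2)] by simp
        then show "Y \<in> (`) p ` indep M" using X(1) by simp
      qed
    qed
    then show "indep (relabel p M) = indep N" by (simp add: relabel_def)
  qed simp
  then have "description_iso I M N p"
    using p family_relabel[OF bij_is_inj[OF p], of I M] label_relabel[OF bij_is_inj[OF p], of I M]
      header_relabel[OF bij_is_inj[OF p], of I M] relabel_sel[OF bij_is_inj[OF p], of M]
    by (auto simp: description_iso_def)
  then show "\<exists>p. description_iso I M N p" by (rule exI[of _ p])
next
  assume "\<exists>p. description_iso I M N p"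
  then obtain p where p: "description_iso I M N p" by (rule exE)
  then have inj: "inj p" by (simp add: description_iso_def bij_is_inj)
  have "relabel p M = N"
  proof (rule matroid_determined)
    show "is_matroid (relabel p M)" using is_matroid_relabel[OF inj] assms by (simp add: numbered_matroid_def)
    show "is_matroid N" using assms by (simp add: numbered_matroid_def)
    show "ground (relabel p M) = ground N" using p by (simp add: relabel_sel[OF inj] description_iso_def)
    show fam: "family I (relabel p M) = family I N"
      using p by (simp add: family_relabel[OF inj] description_iso_def)
    show "header I (relabel p M) = header I N"
      using p by (simp add: header_relabel[OF inj] description_iso_def)
    show "label I (relabel p M) X = label I N X" if "X \<in> family I (relabel p M)" for X
      using that p by (auto simp: family_relabel[OF inj] label_relabel[OF inj] description_iso_def)
  qed
  then have "X \<in> indep M \<longleftrightarrow> p ` X \<in> indep N" "p ` ground M = ground N" for X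
    using image_in_image_iff[OF inj] relabel_sel[OF inj, of M] by auto
  then show "matroid_isomorphic M N"
    using inj unfolding matroid_isomorphic_def
    by (intro exI[of _ p]) (auto simp: bij_betw_def intro: inj_on_subset)
qed

section \<open>One word format for all descriptions\<close>

definition gen_word :: "nat \<Rightarrow> nat \<Rightarrow> (nat set \<times> nat) list \<Rightarrow> word" where
  "gen_word n r ps = replicate n One @ replicate r Tick @
     concat (map (\<lambda>(X, k). Comma # char_vector n X @ replicate k Tick) ps)"

lemma mem_ground_iff: "numbered_matroid M \<Longrightarrow> i \<in> ground M \<longleftrightarrow> i < card (ground M)"
  unfolding numbered_matroid_def by (metis lessThan_iff)

lemma char_vector_ground:
  "numbered_matroid M \<Longrightarrow> char_vector (card (ground M)) (ground M) = replicate (card (ground M)) One"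
  by (rule nth_equalityI) (simp_all add: char_vector_def mem_ground_iff)

lemma descriptions_eq:
  assumes "numbered_matroid M"
  shows "descriptions I M = (\<lambda>Xs. gen_word (card (ground M)) (header I M) (map (\<lambda>X. (X, label I M X)) Xs)) `
    listings (family I M)"
  by (cases I) (auto simp: list_word_def rank_and_list_word_def list_with_ranks_word_def gen_word_def
      char_vector_ground[OF assms] label_def header_def rank_word_def Let_def comp_def)

section \<open>From matroids to graphs\<close>

lemma graph_isomorphicI:
  assumes "bij_betw f (verts G) (verts H)"
    and "\<And>u v. u \<in> verts G \<Longrightarrow> v \<in> verts G \<Longrightarrow> {u, v} \<in> edges G \<longleftrightarrow> {f u, f v} \<in> edges H"
  shows "graph_isomorphic G H"
  unfolding graph_isomorphic_def by (rule exI[of _ f], intro conjI ballI assms)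

lemma graph_isomorphicE:
  assumes "graph_isomorphic G H"
  obtains f where "bij_betw f (verts G) (verts H)"
    "\<And>u v. u \<in> verts G \<Longrightarrow> v \<in> verts G \<Longrightarrow> {u, v} \<in> edges G \<longleftrightarrow> {f u, f v} \<in> edges H"
  using assms unfolding graph_isomorphic_def by (elim exE conjE) simp

lemma graph_isomorphic_sym:
  assumes "graph_isomorphic G H"
  shows "graph_isomorphic H G"
proof -
  obtain f where f: "bij_betw f (verts G) (verts H)"
    and e: "\<And>u v. u \<in> verts G \<Longrightarrow> v \<in> verts G \<Longrightarrow> {u, v} \<in> edges G \<longleftrightarrow> {f u, f v} \<in> edges H"
    by (rule graph_isomorphicE[OF assms]) (rule that)
  let ?g = "inv_into (verts G) f"
  have g: "?g u \<in> verts G" "f (?g u) = u" if "u \<in> verts H" for u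
    using f that by (auto simp: bij_betw_def inv_into_into f_inv_into_f)
  show ?thesis
  proof (rule graph_isomorphicI)
    show "bij_betw ?g (verts H) (verts G)" by (rule bij_betw_inv_into[OF f])
    show "{u, v} \<in> edges H \<longleftrightarrow> {?g u, ?g v} \<in> edges G" if "u \<in> verts H" "v \<in> verts H" for u v
      using e[of "?g u" "?g v"] g that by simp
  qed
qed

lemma graph_isomorphic_trans:
  assumes "graph_isomorphic G H" "graph_isomorphic H K"
  shows "graph_isomorphic G K"
proof -
  obtain f where f: "bij_betw f (verts G) (verts H)"
    and e: "\<And>u v. u \<in> verts G \<Longrightarrow> v \<in> verts G \<Longrightarrow> {u, v} \<in> edges G \<longleftrightarrow> {f u, f v} \<in> edges H"
    by (rule graph_isomorphicE[OF assms(1)]) (rule that)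
  obtain g where g: "bij_betw g (verts H) (verts K)"
    and e': "\<And>u v. u \<in> verts H \<Longrightarrow> v \<in> verts H \<Longrightarrow> {u, v} \<in> edges H \<longleftrightarrow> {g u, g v} \<in> edges K"
    by (rule graph_isomorphicE[OF assms(2)]) (rule that)
  show ?thesis
  proof (rule graph_isomorphicI)
    show "bij_betw (g \<circ> f) (verts G) (verts K)" by (rule bij_betw_trans[OF f g])
    show "{u, v} \<in> edges G \<longleftrightarrow> {(g \<circ> f) u, (g \<circ> f) v} \<in> edges K" if "u \<in> verts G" "v \<in> verts G" for u v
      using e[OF that] e'[of "f u" "f v"] that f by (simp add: bij_betwE)
  qed
qed

text \<open>Symmetry and the absence of loops are built in, so arcs need to be given in one
  direction only.\<close>

definition rel_graph :: "'a set \<Rightarrow> ('a \<Rightarrow> 'a \<Rightarrow> bool) \<Rightarrow> 'a graph" where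
  "rel_graph V A = \<lparr>verts = V, edges = {{x, y} | x y. x \<in> V \<and> y \<in> V \<and> x \<noteq> y \<and> (A x y \<or> A y x)}\<rparr>"

lemma verts_rel_graph [simp]: "verts (rel_graph V A) = V"
  by (simp add: rel_graph_def)

lemma edges_rel_graph:
  "{x, y} \<in> edges (rel_graph V A) \<longleftrightarrow> x \<in> V \<and> y \<in> V \<and> x \<noteq> y \<and> (A x y \<or> A y x)"
  by (auto simp: rel_graph_def doubleton_eq_iff)

lemma is_simple_rel_graph: "finite V \<Longrightarrow> is_simple_graph (rel_graph V A)"
  by (auto simp: is_simple_graph_def rel_graph_def)

definition padded :: "word \<Rightarrow> word" where
  "padded w = Amp # Amp # Amp # w"

definition pos_graph :: "word \<Rightarrow> nat graph" where
  "pos_graph w = rel_graph {..<length (padded w)} (\<lambda>u v. arc w (drop u (padded w)) (drop v (padded w)))"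

lemma numbered_pos_graph: "numbered_graph (pos_graph w)"
  by (simp add: numbered_graph_def pos_graph_def is_simple_rel_graph)

lemma concat_map_singleton: "concat (map (\<lambda>q. if P q then [a] else [b]) ys) = map (\<lambda>q. if P q then a else b) ys"
  by (induction ys) auto

lemma graph_word_pos_graph: "graph_word (pos_graph w) = adjacency w"
proof -
  let ?y = "padded w"
  let ?N = "length ?y"
  have row: "char_vector ?N {v. {u, v} \<in> edges (pos_graph w)} = map (\<lambda>q. if length (drop u ?y) \<noteq> length q \<and>
      (arc w (drop u ?y) q \<or> arc w q (drop u ?y)) then One else Zero) (tails ?y)" if u: "u < ?N" for u
  proof -
    have "{u, v} \<in> edges (pos_graph w) \<longleftrightarrow> length (drop u ?y) \<noteq> length (drop v ?y) \<and>
      (arc w (drop u ?y) (drop v ?y) \<or> arc w (drop v ?y) (drop u ?y))" if "v < ?N" for v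
    proof -
      have "length (drop u ?y) \<noteq> length (drop v ?y) \<longleftrightarrow> u \<noteq> v" using u that by auto
      then show ?thesis using u that unfolding pos_graph_def edges_rel_graph by (simp only: lessThan_iff simp_thms)
    qed
    then show ?thesis unfolding char_vector_def tails_conv_drop by (auto simp del: length_drop)
  qed
  have "card (verts (pos_graph w)) = ?N" by (simp add: pos_graph_def)
  then have "graph_word (pos_graph w) = concat (map (\<lambda>u. Comma # char_vector ?N {v. {u, v} \<in> edges (pos_graph w)}) [0..<?N])"
    unfolding graph_word_def Let_def by simp
  also have "\<dots> = concat (map (\<lambda>u. Comma # map (\<lambda>q. if length (drop u ?y) \<noteq> length q \<and>
      (arc w (drop u ?y) q \<or> arc w q (drop u ?y)) then One else Zero) (tails ?y)) [0..<?N])"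
    by (intro arg_cong[where f = concat] map_cong refl) (use row in auto)
  also have "\<dots> = adjacency w"
    unfolding adjacency_def Let_def padded_def[symmetric] concat_map_singleton tails_conv_drop[of ?y] map_map comp_def ..
  finally show ?thesis .
qed

subsection \<open>The incidence graph of a labelled set system\<close>

text \<open>The vertices 0, 1, 2 form the only triangle; vertex 0 is also joined to the vertices \<open>3 + i\<close>
  that represent the elements. A set \<open>X\<close> gives the vertex \<open>(X, 0)\<close>, joined to its elements and to
  pendant vertices whose number is its label; the other vertices are isolated.\<close>

type_synonym vertex = "nat + nat set \<times> nat"

definition inc_verts :: "nat \<Rightarrow> nat \<Rightarrow> nat set set \<Rightarrow> (nat set \<Rightarrow> nat) \<Rightarrow> vertex set" where
  "inc_verts n r F k = Inl ` {..<3 + n + r} \<union> Inr ` (SIGMA X:F. {..<1 + n + k X})"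

fun inc_arc :: "nat \<Rightarrow> vertex \<Rightarrow> vertex \<Rightarrow> bool" where
  "inc_arc n (Inl u) (Inl v) \<longleftrightarrow> u < 3 \<and> v < 3 \<or> u = 0 \<and> 3 \<le> v \<and> v < 3 + n"
| "inc_arc n (Inl u) (Inr (X, i)) \<longleftrightarrow> 3 \<le> u \<and> u - 3 \<in> X \<and> i = 0"
| "inc_arc n (Inr (X, i)) (Inr (Y, j)) \<longleftrightarrow> X = Y \<and> i = 0 \<and> n < j"
| "inc_arc n (Inr _) (Inl _) \<longleftrightarrow> False"

definition inc_graph :: "nat \<Rightarrow> nat \<Rightarrow> nat set set \<Rightarrow> (nat set \<Rightarrow> nat) \<Rightarrow> vertex graph" where
  "inc_graph n r F k = rel_graph (inc_verts n r F k) (inc_arc n)"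

subsubsection \<open>It is isomorphic to the graph on the positions of a description\<close>

definition block :: "nat \<Rightarrow> nat set \<times> nat \<Rightarrow> word" where
  "block n = (\<lambda>(X, k). Comma # char_vector n X @ replicate k Tick)"

definition blocks :: "nat \<Rightarrow> (nat set \<times> nat) list \<Rightarrow> word" where
  "blocks n ps = concat (map (block n) ps)"

text \<open>The vertices of the sets in the order of the letters of \<open>blocks n ps\<close>; the
  isomorphism will be the look-up in such a list.\<close>

definition block_verts :: "nat \<Rightarrow> (nat set \<times> nat) list \<Rightarrow> vertex list" where
  "block_verts n ps = concat (map (\<lambda>(X, k). map (\<lambda>i. Inr (X, i)) [0..<1 + n + k]) ps)"

lemma length_block: "length (block n (X, k)) = 1 + n + k"
  by (simp add: block_def char_vector_def)

lemma blocks_simps [simp]: "blocks n [] = []" "blocks n (p # ps) = block n p @ blocks n ps"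
  by (simp_all add: blocks_def)

lemma block_verts_simps [simp]: "block_verts n [] = []"
  "block_verts n ((X, k) # ps) = map (\<lambda>i. Inr (X, i)) [0..<1 + n + k] @ block_verts n ps"
  by (simp_all add: block_verts_def)

lemma blocks_append: "blocks n (ps @ qs) = blocks n ps @ blocks n qs"
  by (simp add: blocks_def)

lemma block_verts_append: "block_verts n (ps @ qs) = block_verts n ps @ block_verts n qs"
  by (simp add: block_verts_def)

lemma length_block_verts: "length (block_verts n ps) = length (blocks n ps)"
proof (induction ps)
  case (Cons p ps)
  then show ?case by (cases p) (simp add: length_block)
qed simp

lemma blocks_position:
  "v < length (blocks n ps) \<Longrightarrow>
    \<exists>ps1 X k ps2 i. ps = ps1 @ (X, k) # ps2 \<and> i < 1 + n + k \<and> v = length (blocks n ps1) + i"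
proof (induction ps arbitrary: v)
  case (Cons p ps)
  obtain X k where p: "p = (X, k)" by (cases p)
  show ?case
  proof (cases "v < 1 + n + k")
    case True
    then show ?thesis
      by (intro exI[of _ "[]"] exI[of _ X] exI[of _ k] exI[of _ ps] exI[of _ v]) (simp add: p)
  next
    case False
    then have "v - (1 + n + k) < length (blocks n ps)" using Cons.prems by (simp add: p length_block)
    then obtain ps1 Y l ps2 i where *: "ps = ps1 @ (Y, l) # ps2" "i < 1 + n + l"
        "v - (1 + n + k) = length (blocks n ps1) + i"
      using Cons.IH by blast
    then show ?thesis using False
      by (intro exI[of _ "p # ps1"] exI[of _ Y] exI[of _ l] exI[of _ ps2] exI[of _ i])
        (simp add: p length_block)
  qed
qed simp

lemma blocks_start: "blocks n ps = [] \<or> starts Comma (blocks n ps)"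
  by (cases ps) (auto simp: block_def split: prod.splits)

lemma dropWhile_blocks: "dropWhile (\<lambda>c. c \<noteq> Comma) (blocks n ps) = blocks n ps"
  using blocks_start[of n ps] by (cases "blocks n ps") auto

lemma char_vector_nth: "i < n \<Longrightarrow> char_vector n X ! i = (if i \<in> X then One else Zero)"
  by (simp add: char_vector_def)

lemma length_char_vector [simp]: "length (char_vector n X) = n"
  by (simp add: char_vector_def)

lemma starts_drop: "i < length z \<Longrightarrow> starts c (drop i z) \<longleftrightarrow> z ! i = c"
  by (auto simp: starts_def hd_drop_conv_nth)

lemma block_nth:
  assumes "i < 1 + n + k"
  shows "block n (X, k) ! i = (if i = 0 then Comma else if i \<le> n then (if i - 1 \<in> X then One else Zero) else Tick)"
proof (cases i)
  case (Suc j)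
  then show ?thesis using assms by (simp add: block_def nth_append char_vector_nth)
qed (simp add: block_def)

context
  fixes n r :: nat and ps :: "(nat set \<times> nat) list"
  assumes dist: "distinct (map fst ps)" and sub: "\<And>X k. (X, k) \<in> set ps \<Longrightarrow> X \<subseteq> {..<n}"
begin

definition "gw = gen_word n r ps"
definition "vlist = map Inl [0..<3 + n + r] @ block_verts n ps"

lemma gw: "gw = replicate n One @ replicate r Tick @ blocks n ps"
  by (simp add: gw_def gen_word_def blocks_def block_def)

lemma length_gw: "length gw = n + r + length (blocks n ps)"
  by (simp add: gw)

lemma length_vlist: "length vlist = length (padded gw)"
  by (simp add: vlist_def padded_def length_gw length_block_verts)

lemma set_block_verts: "set (block_verts n ps) = Inr ` (SIGMA X : fst ` set ps. {..<1 + n + the (map_of ps X)})"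
proof -
  have "the (map_of ps X) = k" if "(X, k) \<in> set ps" for X k
    using map_of_is_SomeI[OF dist that] by simp
  then show ?thesis unfolding block_verts_def by force
qed

lemma block_verts_mem: "x \<in> set (block_verts n qs) \<Longrightarrow> \<exists>X i. x = Inr (X, i) \<and> X \<in> fst ` set qs"
  unfolding block_verts_def by force

lemma distinct_vlist: "distinct vlist"
proof -
  have "distinct (map fst qs) \<Longrightarrow> distinct (block_verts n qs)" for qs
  proof (induction qs)
    case (Cons q qs)
    obtain X k where q: "q = (X, k)" by (cases q)
    have "distinct (map (\<lambda>i. Inr (X, i) :: vertex) [0..<1 + n + k])"
      by (simp add: distinct_map inj_on_def del: upt_Suc)
    moreover have "set (map (\<lambda>i. Inr (X, i)) [0..<1 + n + k]) \<inter> set (block_verts n qs) = {}"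
      using block_verts_mem[of _ qs] Cons.prems q by fastforce
    ultimately show ?case using Cons by (simp add: q del: upt_Suc)
  qed simp
  from this[OF dist] show ?thesis
    unfolding vlist_def using block_verts_mem[of _ ps] by (fastforce simp: distinct_map simp del: upt_Suc)
qed

lemma set_vlist: "set vlist = inc_verts n r (fst ` set ps) (\<lambda>X. the (map_of ps X))"
  unfolding vlist_def inc_verts_def set_append set_block_verts by (auto simp: atLeast0LessThan simp del: upt_Suc)

text \<open>Letter \<open>i\<close> of the block of \<open>X\<close> seen in both ways, as a vertex
  of the incidence graph and as a pointer into the word.\<close>

lemma at_block:
  assumes "ps = ps1 @ (X, k) # ps2" "i < 1 + n + k"
  defines "v \<equiv> 3 + n + r + length (blocks n ps1) + i"
  shows "vlist ! v = Inr (X, i)"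
    and "drop v (padded gw) = drop i (block n (X, k)) @ blocks n ps2"
    and "length (padded gw) - v = 1 + n + k - i + length (blocks n ps2)"
    and "v < length (padded gw)"
proof -
  show "vlist ! v = Inr (X, i)"
    unfolding vlist_def v_def
    by (subst assms(1)) (use assms(2) in \<open>simp add: block_verts_append nth_append length_block_verts del: upt_Suc\<close>)
  have "padded gw = (Amp # Amp # Amp # replicate n One @ replicate r Tick) @ blocks n ps"
    by (simp add: padded_def gw)
  then have "drop (3 + n + r) (padded gw) = blocks n ps" by (simp only: drop_append) simp
  moreover have "drop v (padded gw) = drop (length (blocks n ps1) + i) (drop (3 + n + r) (padded gw))"
    by (simp add: v_def add.commute add.left_commute)
  ultimately show "drop v (padded gw) = drop i (block n (X, k)) @ blocks n ps2"
    by (simp only:, subst (1) assms(1)) (use assms(2) in \<open>simp add: blocks_append length_block\<close>)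
  have len: "length (blocks n ps) = length (blocks n ps1) + (1 + n + k) + length (blocks n ps2)"
    by (subst assms(1)) (simp add: blocks_append length_block)
  show "length (padded gw) - v = 1 + n + k - i + length (blocks n ps2)" "v < length (padded gw)"
    using assms(2) by (simp_all add: padded_def length_gw v_def len)
qed

lemma at_head:
  assumes "v < 3 + n + r"
  shows "vlist ! v = Inl v" "\<not> starts Comma (drop v (padded gw))"
proof -
  show "vlist ! v = Inl v" using assms by (simp add: vlist_def nth_append del: upt_Suc)
  have "padded gw = (Amp # Amp # Amp # replicate n One @ replicate r Tick) @ blocks n ps"
    by (simp add: padded_def gw)
  then have "padded gw ! v = (Amp # Amp # Amp # replicate n One @ replicate r Tick) ! v"
    using assms by (metis (no_types, lifting) length_Cons length_append length_replicate nth_append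
        numeral_3_eq_3 add.assoc add_Suc add_0)
  also have "\<dots> \<in> set (Amp # Amp # Amp # replicate n One @ replicate r Tick)"
    by (rule nth_mem) (use assms in simp)
  finally have "padded gw ! v \<noteq> Comma" by auto
  moreover have "v < length (padded gw)" using assms by (simp add: padded_def length_gw)
  ultimately show "\<not> starts Comma (drop v (padded gw))" by (simp add: starts_drop)
qed

lemma starts_Comma_iff:
  assumes "v < length (padded gw)"
  shows "starts Comma (drop v (padded gw)) \<longleftrightarrow> (\<exists>X. vlist ! v = Inr (X, 0))"
proof (cases "v < 3 + n + r")
  case True
  then show ?thesis using at_head[OF True] by simp
next
  case False
  then have "v - (3 + n + r) < length (blocks n ps)" using assms by (simp add: padded_def length_gw)
  then obtain ps1 X k ps2 i where *: "ps = ps1 @ (X, k) # ps2" "i < 1 + n + k"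
      "v - (3 + n + r) = length (blocks n ps1) + i"
    using blocks_position by blast
  then have v: "v = 3 + n + r + length (blocks n ps1) + i" using False by simp
  have "starts Comma (drop i (block n (X, k)) @ blocks n ps2) \<longleftrightarrow> block n (X, k) ! i = Comma"
    using *(2) by (simp add: starts_def length_block hd_append hd_drop_conv_nth)
  then show ?thesis using at_block(1,2)[OF *(1,2)] block_nth[OF *(2)] unfolding v by simp
qed

text \<open>Tests on words compare suffixes, whereas vertices carry sets and indices. Both are
  matched case by case: incidences in \<open>c3\<close>, ticks in \<open>c4\<close>.\<close>

lemma arc_iff:
  assumes u: "u < length (padded gw)" and v: "v < length (padded gw)"
  shows "arc gw (drop u (padded gw)) (drop v (padded gw)) \<longleftrightarrow> inc_arc n (vlist ! u) (vlist ! v)"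
proof -
  let ?y = "padded gw" and ?N = "length (padded gw)"
  have N: "?N = length gw + 3" by (simp add: padded_def)
  have "length (dropWhile (\<lambda>c. c = One) gw) = r + length (blocks n ps)"
  proof -
    have "dropWhile (\<lambda>c. c = One) (replicate r Tick @ blocks n ps) = replicate r Tick @ blocks n ps"
      using blocks_start[of n ps] by (cases r; cases "blocks n ps") auto
    then show ?thesis by (simp add: gw dropWhile_append)
  qed
  then have elem: "is_elem gw (drop u ?y) \<longleftrightarrow> 3 \<le> u \<and> u < 3 + n" if "u < ?N" for u
    using that N length_gw unfolding is_elem_def length_drop by linarith
  have hub: "length gw < length (drop u ?y) \<longleftrightarrow> u < 3" "length (One # One # gw) < length (drop u ?y) \<longleftrightarrow> u = 0"
    if "u < ?N" for u
    using that N by auto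
  have Inl: "(\<exists>x. vlist ! u = Inl x) \<longleftrightarrow> u < 3 + n + r" "u < 3 + n + r \<longleftrightarrow> vlist ! u = Inl u" if "u < ?N" for u
  proof -
    have "vlist ! u \<noteq> Inl x" if nlt: "\<not> u < 3 + n + r" for x
    proof -
      have "u - (3 + n + r) < length (blocks n ps)" using \<open>u < ?N\<close> nlt by (simp add: padded_def length_gw)
      then obtain ps1 X k ps2 i where *: "ps = ps1 @ (X, k) # ps2" "i < 1 + n + k"
          "u - (3 + n + r) = length (blocks n ps1) + i"
        using blocks_position by blast
      then have "u = 3 + n + r + length (blocks n ps1) + i" using nlt by simp
      then show ?thesis using at_block(1)[OF *(1,2)] by simp
    qed
    then show "(\<exists>x. vlist ! u = Inl x) \<longleftrightarrow> u < 3 + n + r" "u < 3 + n + r \<longleftrightarrow> vlist ! u = Inl u"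
      using at_head(1)[of u] by auto
  qed
  have blk: "\<exists>ps1 k ps2. ps = ps1 @ (X, k) # ps2 \<and> i < 1 + n + k \<and> u = 3 + n + r + length (blocks n ps1) + i"
    if "u < ?N" "vlist ! u = Inr (X, i)" for u X i
  proof -
    have "\<not> u < 3 + n + r" using that Inl[of u] by simp
    then have "u - (3 + n + r) < length (blocks n ps)" using \<open>u < ?N\<close> by (simp add: padded_def length_gw)
    then obtain ps1 Y k ps2 j where *: "ps = ps1 @ (Y, k) # ps2" "j < 1 + n + k"
        "u - (3 + n + r) = length (blocks n ps1) + j"
      using blocks_position by blast
    then have "u = 3 + n + r + length (blocks n ps1) + j" using \<open>\<not> u < 3 + n + r\<close> by simp
    moreover from this have "Y = X" "j = i" using at_block(1)[OF *(1,2)] that(2) by simp_all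
    ultimately show ?thesis using *(1,2) by blast
  qed
  have c3: "is_elem gw (drop u ?y) \<and> starts Comma (drop v ?y) \<and>
      starts One (drop (length (drop (length (drop u ?y)) gw)) (tl (drop v ?y))) \<longleftrightarrow>
      (\<exists>X. 3 \<le> u \<and> u < 3 + n \<and> vlist ! v = Inr (X, 0) \<and> u - 3 \<in> X)"
  proof (cases "3 \<le> u \<and> u < 3 + n \<and> (\<exists>X. vlist ! v = Inr (X, 0))")
    case True
    then obtain X where X: "vlist ! v = Inr (X, 0)" by blast
    obtain ps1 k ps2 where *: "ps = ps1 @ (X, k) # ps2" "0 < 1 + n + k" "v = 3 + n + r + length (blocks n ps1) + 0"
      using blk[OF v X] by (elim exE conjE) (rule that)
    have "drop v ?y = block n (X, k) @ blocks n ps2" using at_block(2)[OF *(1,2)] *(3) by simp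
    then have tl: "tl (drop v ?y) = char_vector n X @ replicate k Tick @ blocks n ps2" by (simp add: block_def)
    have len: "length (drop (length (drop u ?y)) gw) = u - 3" using u N by simp
    have "starts One (drop (u - 3) (char_vector n X @ replicate k Tick @ blocks n ps2)) \<longleftrightarrow> u - 3 \<in> X"
      using True by (subst starts_drop) (auto simp: nth_append char_vector_nth)
    then show ?thesis using True X elem[OF u] starts_Comma_iff[OF v] unfolding tl len by simp
  next
    case False
    then show ?thesis using elem[OF u] starts_Comma_iff[OF v] by blast
  qed
  have c4: "starts Comma (drop u ?y) \<and> starts Tick (drop v ?y) \<and> length (drop v ?y) < length (drop u ?y) \<and>
       length (dropWhile (\<lambda>c. c \<noteq> Comma) (tl (drop u ?y))) < length (drop v ?y) \<longleftrightarrow>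
      (\<exists>X i. vlist ! u = Inr (X, 0) \<and> vlist ! v = Inr (X, i) \<and> n < i)"
  proof (cases "\<exists>X. vlist ! u = Inr (X, 0)")
    case True
    then obtain X where X: "vlist ! u = Inr (X, 0)" by blast
    obtain ps1 k ps2 where *: "ps = ps1 @ (X, k) # ps2" "0 < 1 + n + k" "u = 3 + n + r + length (blocks n ps1) + 0"
      using blk[OF u X] by (elim exE conjE) (rule that)
    have u': "drop u ?y = block n (X, k) @ blocks n ps2" using at_block(2)[OF *(1,2)] *(3) by simp
    \<comment> \<open>After its initial comma a block contains no further comma, so the search stops
      where the next block begins or the word ends.\<close>
    have "dropWhile (\<lambda>c. c \<noteq> Comma) (char_vector n X @ replicate k Tick @ blocks n ps2) = blocks n ps2"
    proof -
      have "dropWhile (\<lambda>c. c \<noteq> Comma) ((char_vector n X @ replicate k Tick) @ blocks n ps2) =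
          dropWhile (\<lambda>c. c \<noteq> Comma) (blocks n ps2)"
        by (rule dropWhile_append2) (auto simp: char_vector_def)
      then show ?thesis by (simp add: dropWhile_blocks)
    qed
    then have dw: "dropWhile (\<lambda>c. c \<noteq> Comma) (tl (drop u ?y)) = blocks n ps2" unfolding u' by (simp add: block_def)
    have Nu: "?N - u = 1 + n + k + length (blocks n ps2)" using at_block(3)[OF *(1,2)] *(3) by simp
    show ?thesis
    proof
      assume a: "starts Comma (drop u ?y) \<and> starts Tick (drop v ?y) \<and> length (drop v ?y) < length (drop u ?y) \<and>
       length (dropWhile (\<lambda>c. c \<noteq> Comma) (tl (drop u ?y))) < length (drop v ?y)"
      define i where "i = v - u"
      have i: "v = u + i" "i < 1 + n + k"
        using a Nu u v unfolding dw length_drop i_def by linarith+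
      have v': "v = 3 + n + r + length (blocks n ps1) + i" using i(1) *(3) by simp
      have "starts Tick (drop i (block n (X, k)) @ blocks n ps2)"
        using a at_block(2)[OF *(1) i(2)] unfolding v' by simp
      then have "block n (X, k) ! i = Tick"
        using i(2) by (simp add: starts_def length_block hd_append hd_drop_conv_nth)
      then have "n < i" using block_nth[OF i(2), of X] by (auto split: if_splits)
      then show "\<exists>X i. vlist ! u = Inr (X, 0) \<and> vlist ! v = Inr (X, i) \<and> n < i"
        using X at_block(1)[OF *(1) i(2)] v' by blast
    next
      assume "\<exists>X i. vlist ! u = Inr (X, 0) \<and> vlist ! v = Inr (X, i) \<and> n < i"
      then obtain i where i: "vlist ! v = Inr (X, i)" "n < i" using X by auto
      obtain qs1 l qs2 where q: "ps = qs1 @ (X, l) # qs2" "i < 1 + n + l" "v = 3 + n + r + length (blocks n qs1) + i"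
        using blk[OF v i(1)] by (elim exE conjE) (rule that)
      \<comment> \<open>A set is listed only once, so \<open>v\<close> lies in the very block that
        starts at \<open>u\<close>.\<close>
      have "(X, k) \<in> set ps" "(X, l) \<in> set ps" using *(1) q(1) by (metis in_set_conv_decomp)+
      then have "l = k" using eq_key_imp_eq_value[OF dist] by metis
      then have ik: "i < 1 + n + k" using q(2) by simp
      have "vlist ! (u + i) = vlist ! v" "u + i < ?N"
        using at_block(1,4)[OF *(1) ik] *(3) i(1) by simp_all
      then have v': "v = u + i" using distinct_vlist v by (simp add: nth_eq_iff_index_eq length_vlist)
      have "drop v ?y = drop i (block n (X, k)) @ blocks n ps2"
        using at_block(2)[OF *(1) ik] *(3) v' by simp
      moreover have "block n (X, k) ! i = Tick" using block_nth[OF ik] i(2) by simp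
      ultimately have "starts Tick (drop v ?y)"
        using ik by (simp add: starts_def length_block hd_append hd_drop_conv_nth)
      moreover have "starts Comma (drop u ?y)" using X starts_Comma_iff[OF u] by blast
      moreover have "?N - v < ?N - u" "length (blocks n ps2) < ?N - v"
        using Nu v' ik i(2) u v by linarith+
      ultimately show "starts Comma (drop u ?y) \<and> starts Tick (drop v ?y) \<and> length (drop v ?y) < length (drop u ?y) \<and>
       length (dropWhile (\<lambda>c. c \<noteq> Comma) (tl (drop u ?y))) < length (drop v ?y)"
        unfolding dw length_drop by (intro conjI)
    qed
  next
    case False
    then show ?thesis using starts_Comma_iff[OF u] by blast
  qed
  have small: "x < 3 \<Longrightarrow> x < ?N \<Longrightarrow> vlist ! x = Inl x" "x < 3 + n \<Longrightarrow> x < ?N \<Longrightarrow> vlist ! x = Inl x" for x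
    using at_head(1)[of x] by simp_all
  have Inlu: "vlist ! x = Inl z \<Longrightarrow> x < ?N \<Longrightarrow> z = x" for x z using Inl[of x] by auto
  show ?thesis
    unfolding arc_def c3 c4 hub[OF u] hub[OF v] elem[OF v]
  proof (cases "vlist ! u")
    case (Inl x)
    then have [simp]: "x = u" using Inlu u by blast
    show "u < 3 \<and> v < 3 \<or> u = 0 \<and> 3 \<le> v \<and> v < 3 + n \<or>
      (\<exists>X. 3 \<le> u \<and> u < 3 + n \<and> vlist ! v = Inr (X, 0) \<and> u - 3 \<in> X) \<or>
      (\<exists>X i. vlist ! u = Inr (X, 0) \<and> vlist ! v = Inr (X, i) \<and> n < i) \<longleftrightarrow> inc_arc n (vlist ! u) (vlist ! v)"
    proof (cases "vlist ! v")
      case (Inl z)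
      then have "z = v" using Inlu v by blast
      with Inl \<open>vlist ! u = Inl x\<close> show ?thesis by simp
    next
      case (Inr b)
      obtain X i where b: "b = (X, i)" by (cases b)
      have nv: "\<not> v < 3 + n" using small(2) v Inr by force
      obtain ps1 k ps2 where "ps = ps1 @ (X, k) # ps2"
        using blk[OF v Inr[unfolded b]] by (elim exE conjE) (rule that)
      then have "(X, k) \<in> set ps" by (metis in_set_conv_decomp)
      then have "X \<subseteq> {..<n}" by (rule sub)
      then have "3 \<le> u \<Longrightarrow> u - 3 \<in> X \<Longrightarrow> u < 3 + n" by auto
      then show ?thesis using nv Inr b \<open>vlist ! u = Inl x\<close> by auto
    qed
  next
    case (Inr b)
    obtain X i where b: "b = (X, i)" by (cases b)
    have nu: "\<not> u < 3 + n" using small(2) u Inr by force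
    show "u < 3 \<and> v < 3 \<or> u = 0 \<and> 3 \<le> v \<and> v < 3 + n \<or>
      (\<exists>X. 3 \<le> u \<and> u < 3 + n \<and> vlist ! v = Inr (X, 0) \<and> u - 3 \<in> X) \<or>
      (\<exists>X i. vlist ! u = Inr (X, 0) \<and> vlist ! v = Inr (X, i) \<and> n < i) \<longleftrightarrow> inc_arc n (vlist ! u) (vlist ! v)"
    proof (cases "vlist ! v")
      case (Inl z)
      then show ?thesis using nu Inr b by simp
    next
      case (Inr c)
      obtain Y j where c: "c = (Y, j)" by (cases c)
      then show ?thesis using nu Inr b \<open>vlist ! u = Inr b\<close> by auto
    qed
  qed
qed

lemma pos_graph_iso: "graph_isomorphic (pos_graph gw) (inc_graph n r (fst ` set ps) (\<lambda>X. the (map_of ps X)))"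
proof (rule graph_isomorphicI)
  let ?V = "inc_verts n r (fst ` set ps) (\<lambda>X. the (map_of ps X))"
  have b: "bij_betw ((!) vlist) {..<length (padded gw)} ?V"
    using bij_betw_nth[OF distinct_vlist] set_vlist length_vlist by simp
  then show "bij_betw ((!) vlist) (verts (pos_graph gw))
      (verts (inc_graph n r (fst ` set ps) (\<lambda>X. the (map_of ps X))))"
    by (simp add: pos_graph_def inc_graph_def)
  fix u v
  assume "u \<in> verts (pos_graph gw)" "v \<in> verts (pos_graph gw)"
  then have u: "u < length (padded gw)" and v: "v < length (padded gw)" by (simp_all add: pos_graph_def)
  have "vlist ! u \<in> ?V" "vlist ! v \<in> ?V" using b u v by (auto dest: bij_betwE)
  moreover have "vlist ! u = vlist ! v \<longleftrightarrow> u = v"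
    using distinct_vlist u v by (simp add: nth_eq_iff_index_eq length_vlist)
  ultimately show "{u, v} \<in> edges (pos_graph gw) \<longleftrightarrow>
      {vlist ! u, vlist ! v} \<in> edges (inc_graph n r (fst ` set ps) (\<lambda>X. the (map_of ps X)))"
    unfolding pos_graph_def inc_graph_def edges_rel_graph using arc_iff[OF u v] arc_iff[OF v u] u v by simp
qed

lemma pos_graph_gen_word:
  "graph_isomorphic (pos_graph (gen_word n r ps)) (inc_graph n r (fst ` set ps) (\<lambda>X. the (map_of ps X)))"
  using pos_graph_iso by (simp only: gw_def)

end

subsubsection \<open>It determines the set system\<close>

lemma inc_verts_iff [simp]:
  "Inl u \<in> inc_verts n r F k \<longleftrightarrow> u < 3 + n + r"
  "Inr (X, i) \<in> inc_verts n r F k \<longleftrightarrow> X \<in> F \<and> i < 1 + n + k X"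
  by (auto simp: inc_verts_def)

text \<open>The permutation acts on the element vertices and on the sets; indices within a block and
  all other vertices are fixed.\<close>

lemma inc_graph_iso:
  assumes "bij p" and pn: "p ` {..<n} = {..<n}" and F': "F' = (`) p ` F"
    and k': "\<And>X. X \<in> F \<Longrightarrow> k' (p ` X) = k X" and F: "\<And>X. X \<in> F \<Longrightarrow> X \<subseteq> {..<n}"
  shows "graph_isomorphic (inc_graph n r F k) (inc_graph n r F' k')"
proof (rule graph_isomorphicI)
  let ?V = "inc_verts n r F k" and ?V' = "inc_verts n r F' k'"
  have inj: "inj p" using assms(1) by (rule bij_is_inj)
  have plt: "p i < n \<longleftrightarrow> i < n" for i
    using inj_image_mem_iff[OF inj, of i "{..<n}"] pn by simp
  define g where "g u = (if 3 \<le> u \<and> u < 3 + n then 3 + p (u - 3) else u)" for u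
  define f where "f x = (case x of Inl u \<Rightarrow> Inl (g u) | Inr (X, i) \<Rightarrow> Inr (p ` X, i))" for x :: vertex
  have f: "f (Inl u) = Inl (g u)" "f (Inr (X, i)) = Inr (p ` X, i)" for u X i by (simp_all add: f_def)
  have g3: "g u < 3 \<longleftrightarrow> u < 3" "g u = 0 \<longleftrightarrow> u = 0" "3 \<le> g u \<and> g u < 3 + n \<longleftrightarrow> 3 \<le> u \<and> u < 3 + n"
      "u < 3 + n + r \<Longrightarrow> g u < 3 + n + r" for u
    using plt[of "u - 3"] by (auto simp: g_def)
  have injg: "inj g"
  proof (rule injI)
    fix u v
    assume eq: "g u = g v"
    have "3 \<le> u \<and> u < 3 + n \<longleftrightarrow> 3 \<le> v \<and> v < 3 + n" using eq g3(3)[of u] g3(3)[of v] by simp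
    then show "u = v" using eq injD[OF inj, of "u - 3" "v - 3"] by (auto simp: g_def split: if_splits)
  qed
  have injf: "inj f"
  proof (rule injI)
    fix x y
    assume eq: "f x = f y"
    show "x = y"
    proof (cases x)
      case (Inl u)
      then show ?thesis using eq injD[OF injg] by (cases y) (auto simp: f_def)
    next
      case (Inr a)
      then show ?thesis using eq inj_image_eq_iff[OF inj] by (cases y; cases a) (auto simp: f_def)
    qed
  qed
  have "f ` ?V = ?V'"
  proof
    show "f ` ?V \<subseteq> ?V'"
    proof (rule image_subsetI)
      fix x
      assume x: "x \<in> ?V"
      show "f x \<in> ?V'"
      proof (cases x)
        case (Inl u)
        then show ?thesis using x g3(4) by (simp add: f)
      next
        case (Inr a)
        obtain X i where "a = (X, i)" by (cases a)
        then show ?thesis using x Inr F' k' by (simp add: f)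
      qed
    qed
    have "g ` {..<3 + n + r} = {..<3 + n + r}"
      by (rule endo_inj_surj) (use g3(4) in \<open>auto intro: inj_on_subset[OF injg]\<close>)
    then have surj: "\<exists>u < 3 + n + r. v = g u" if "v < 3 + n + r" for v using that by (auto simp: image_iff)
    show "?V' \<subseteq> f ` ?V"
    proof
      fix y
      assume y: "y \<in> ?V'"
      show "y \<in> f ` ?V"
      proof (cases y)
        case (Inl v)
        then obtain u where "u < 3 + n + r" "v = g u" using surj y by auto
        then show ?thesis using Inl by (intro image_eqI[of _ _ "Inl u"]) (simp_all add: f)
      next
        case (Inr a)
        obtain Y i where a: "a = (Y, i)" by (cases a)
        then obtain X where "X \<in> F" "Y = p ` X" using y Inr F' by auto
        then show ?thesis using Inr a y k' by (intro image_eqI[of _ _ "Inr (X, i)"]) (simp_all add: f)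
      qed
    qed
  qed
  then have bij: "bij_betw f ?V ?V'" using injf by (auto simp: bij_betw_def intro: inj_on_subset)
  then show "bij_betw f (verts (inc_graph n r F k)) (verts (inc_graph n r F' k'))" by (simp add: inc_graph_def)
  have arc: "inc_arc n (f x) (f y) \<longleftrightarrow> inc_arc n x y" if "y \<in> ?V" for x y
  proof (cases x)
    case (Inl u)
    show ?thesis
    proof (cases y)
      case (Inl v)
      then show ?thesis using \<open>x = Inl u\<close> g3[of u] g3[of v] by (simp add: f)
    next
      case (Inr a)
      obtain X i where a: "a = (X, i)" by (cases a)
      then have X: "X \<subseteq> {..<n}" using that Inr F by simp
      then have pX: "p ` X \<subseteq> {..<n}" using pn by blast
      have "3 \<le> g u \<and> g u - 3 \<in> p ` X \<longleftrightarrow> 3 \<le> u \<and> u - 3 \<in> X"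
      proof (cases "3 \<le> u \<and> u < 3 + n")
        case True
        then show ?thesis using inj_image_mem_iff[OF inj] by (simp add: g_def)
      next
        case False
        then have "g u = u" unfolding g_def by (rule if_not_P)
        moreover have "\<not> (3 \<le> u \<and> u - 3 < n)" using False by auto
        ultimately show ?thesis using X pX by auto
      qed
      then show ?thesis using \<open>x = Inl u\<close> Inr a by (simp only: f inc_arc.simps conj_assoc[symmetric])
    qed
  next
    case (Inr a)
    then show ?thesis using inj_image_eq_iff[OF inj] by (cases y; cases a) (auto simp: f_def)
  qed
  fix x y
  assume "x \<in> verts (inc_graph n r F k)" "y \<in> verts (inc_graph n r F k)"
  then have x: "x \<in> ?V" and y: "y \<in> ?V" by (simp_all add: inc_graph_def)
  then have "f x \<in> ?V'" "f y \<in> ?V'" using bij by (auto dest: bij_betwE)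
  then show "{x, y} \<in> edges (inc_graph n r F k) \<longleftrightarrow> {f x, f y} \<in> edges (inc_graph n r F' k')"
    unfolding inc_graph_def edges_rel_graph using x y arc[OF x] arc[OF y] injD[OF injf, of x y] by auto
qed

section \<open>Neighbourhoods, degrees and triangles\<close>

definition nbrs :: "'a graph \<Rightarrow> 'a \<Rightarrow> 'a set" where
  "nbrs G x = {y. {x, y} \<in> edges G}"

definition in_triangle :: "'a graph \<Rightarrow> 'a \<Rightarrow> bool" where
  "in_triangle G x \<longleftrightarrow> (\<exists>y \<in> nbrs G x. \<exists>z \<in> nbrs G x. z \<in> nbrs G y)"

lemma nbrs_iso:
  assumes f: "bij_betw f (verts G) (verts H)"
    and e: "\<And>u v. u \<in> verts G \<Longrightarrow> v \<in> verts G \<Longrightarrow> {u, v} \<in> edges G \<longleftrightarrow> {f u, f v} \<in> edges H"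
    and G: "\<And>x y. {x, y} \<in> edges G \<Longrightarrow> y \<in> verts G" and H: "\<And>x y. {x, y} \<in> edges H \<Longrightarrow> y \<in> verts H"
    and x: "x \<in> verts G"
  shows "nbrs H (f x) = f ` nbrs G x" "card (nbrs H (f x)) = card (nbrs G x)"
    "in_triangle G x \<Longrightarrow> in_triangle H (f x)"
proof -
  have img: "nbrs H (f x) = f ` nbrs G x" if x: "x \<in> verts G" for x
  proof
    show "nbrs H (f x) \<subseteq> f ` nbrs G x"
    proof
      fix y
      assume y: "y \<in> nbrs H (f x)"
      then have "y \<in> verts H" using H by (simp add: nbrs_def)
      then obtain z where z: "z \<in> verts G" "y = f z" using f by (auto simp: bij_betw_def)
      then show "y \<in> f ` nbrs G x" using e[OF x z(1)] y by (auto simp: nbrs_def)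
    qed
    show "f ` nbrs G x \<subseteq> nbrs H (f x)" using e[OF x] G by (auto simp: nbrs_def)
  qed
  then show "nbrs H (f x) = f ` nbrs G x" using x by blast
  have "nbrs G x \<subseteq> verts G" using G by (auto simp: nbrs_def)
  then have "inj_on f (nbrs G x)" using f by (auto simp: bij_betw_def intro: inj_on_subset)
  then show "card (nbrs H (f x)) = card (nbrs G x)" using img[OF x] by (simp add: card_image)
  assume "in_triangle G x"
  then obtain y z where yz: "y \<in> nbrs G x" "z \<in> nbrs G x" "z \<in> nbrs G y" by (auto simp: in_triangle_def)
  then have y: "y \<in> verts G" using G by (auto simp: nbrs_def)
  have "f y \<in> nbrs H (f x)" "f z \<in> nbrs H (f x)" "f z \<in> nbrs H (f y)"
    using yz img[OF x] img[OF y] by simp_all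
  then show "in_triangle H (f x)" by (auto simp: in_triangle_def)
qed

context
  fixes n r :: nat and F :: "nat set set" and k :: "nat set \<Rightarrow> nat"
  assumes F: "\<And>X. X \<in> F \<Longrightarrow> X \<subseteq> {..<n}"
begin

lemma inc_nbrs_Inl:
  "y \<in> nbrs (inc_graph n r F k) (Inl u) \<longleftrightarrow>
    (u = 0 \<and> (\<exists>v. y = Inl v \<and> 0 < v \<and> v < 3 + n)) \<or>
    (u \<noteq> 0 \<and> u < 3 \<and> (\<exists>v. y = Inl v \<and> v < 3 \<and> v \<noteq> u)) \<or>
    (3 \<le> u \<and> u < 3 + n \<and> (y = Inl 0 \<or> (\<exists>X \<in> F. y = Inr (X, 0) \<and> u - 3 \<in> X)))"
proof (cases y)
  case (Inl v)
  then show ?thesis unfolding nbrs_def mem_Collect_eq inc_graph_def edges_rel_graph by auto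
next
  case (Inr a)
  obtain X i where a: "a = (X, i)" by (cases a)
  have "X \<in> F \<Longrightarrow> u - 3 \<in> X \<Longrightarrow> u < 3 + n" using F[of X] by auto
  then show ?thesis using Inr a unfolding nbrs_def mem_Collect_eq inc_graph_def edges_rel_graph by auto
qed

lemma inc_nbrs_set:
  assumes "X \<in> F"
  shows "nbrs (inc_graph n r F k) (Inr (X, 0)) = (\<lambda>e. Inl (3 + e)) ` X \<union> (\<lambda>i. Inr (X, i)) ` {n<..<1 + n + k X}"
proof (rule set_eqI)
  fix y
  show "y \<in> nbrs (inc_graph n r F k) (Inr (X, 0)) \<longleftrightarrow>
    y \<in> (\<lambda>e. Inl (3 + e)) ` X \<union> (\<lambda>i. Inr (X, i)) ` {n<..<1 + n + k X}"
  proof (cases y)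
    case (Inl v)
    have "v \<in> (\<lambda>e. 3 + e) ` X \<longleftrightarrow> 3 \<le> v \<and> v - 3 \<in> X" by (auto simp: image_iff intro: bexI[of _ "v - 3"])
    moreover have "v - 3 \<in> X \<Longrightarrow> v < 3 + n" using F[OF assms] by auto
    ultimately show ?thesis
      using Inl assms unfolding nbrs_def mem_Collect_eq inc_graph_def edges_rel_graph by auto
  next
    case (Inr a)
    obtain Y i where a: "a = (Y, i)" by (cases a)
    show ?thesis
      using Inr a assms unfolding nbrs_def mem_Collect_eq inc_graph_def edges_rel_graph by auto
  qed
qed

text \<open>Once the size of a set is known, its degree reveals its label.\<close>

lemma inc_degree_set:
  assumes "X \<in> F"
  shows "card (nbrs (inc_graph n r F k) (Inr (X, 0))) = card X + k X"
proof -
  have fin: "finite X" using F[OF assms] finite_subset by blast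
  have "card ((\<lambda>e. Inl (3 + e) :: vertex) ` X) = card X" by (rule card_image) (simp add: inj_on_def)
  moreover have "card ((\<lambda>i. Inr (X, i) :: vertex) ` {n<..<1 + n + k X}) = k X"
    by (subst card_image) (simp_all add: inj_on_def)
  ultimately show ?thesis unfolding inc_nbrs_set[OF assms]
    by (subst card_Un_disjoint) (auto simp: fin)
qed

lemma inc_degree_0: "card (nbrs (inc_graph n r F k) (Inl 0)) = n + 2"
proof -
  have "nbrs (inc_graph n r F k) (Inl 0) = Inl ` {0<..<3 + n}" using inc_nbrs_Inl[of _ 0] by auto
  then show ?thesis by (simp add: card_image)
qed

lemma inc_degree_12:
  assumes "u = 1 \<or> u = 2"
  shows "card (nbrs (inc_graph n r F k) (Inl u)) = 2"
proof -
  have "y \<in> nbrs (inc_graph n r F k) (Inl u) \<longleftrightarrow> y \<in> Inl ` ({..<3} - {u})" for y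
    using assms unfolding inc_nbrs_Inl by (elim disjE) auto
  then have "nbrs (inc_graph n r F k) (Inl u) = Inl ` ({..<3} - {u})" by (rule set_eqI)
  then show ?thesis using assms by (auto simp: card_image)
qed

text \<open>Apart from the edge between 1 and 2, the graph is bipartite.\<close>

lemma inc_triangle: "in_triangle (inc_graph n r F k) x \<longleftrightarrow> x \<in> Inl ` {0, 1, 2}"
proof
  define col where "col z = (case z of Inl u \<Rightarrow> u = 0 | Inr (X, i) \<Rightarrow> i = 0)" for z :: vertex
  have alt: "col y \<noteq> col z \<or> y \<in> Inl ` {1, 2} \<and> z \<in> Inl ` {1, 2}"
    if "z \<in> nbrs (inc_graph n r F k) y" for y z
    using that unfolding nbrs_def mem_Collect_eq inc_graph_def edges_rel_graph
    by (cases y; cases z) (auto simp: col_def)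
  have hub: "x \<in> Inl ` {0, 1, 2}" if yx: "y \<in> nbrs (inc_graph n r F k) x" and y: "y \<in> Inl ` {1, 2}" for x y
  proof -
    have "x \<in> nbrs (inc_graph n r F k) y" using yx by (simp add: nbrs_def insert_commute)
    moreover obtain u where u: "y = Inl u" "u = 1 \<or> u = 2" using y by blast
    ultimately show ?thesis unfolding u(1) inc_nbrs_Inl using u(2) by auto
  qed
  assume "in_triangle (inc_graph n r F k) x"
  then obtain y z where yz: "y \<in> nbrs (inc_graph n r F k) x" "z \<in> nbrs (inc_graph n r F k) x"
    "z \<in> nbrs (inc_graph n r F k) y" by (auto simp: in_triangle_def)
  show "x \<in> Inl ` {0, 1, 2}"
  proof (cases "x \<in> Inl ` {1, 2}")
    case False
    then have "col x \<noteq> col y" "col x \<noteq> col z" using alt[OF yz(1)] alt[OF yz(2)] by simp_all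
    then have "y \<in> Inl ` {1, 2}" using alt[OF yz(3)] by simp
    with yz(1) show ?thesis by (rule hub)
  qed auto
next
  assume "x \<in> Inl ` {0, 1, 2}"
  then obtain u where u: "x = Inl u" "u = 0 \<or> u = 1 \<or> u = 2" by blast
  define v where "v = (if u = 0 then 1 else if u = 1 then 2 else 0 :: nat)"
  define z where "z = (if u = 0 then 2 else if u = 1 then 0 else 1 :: nat)"
  have "Inl v \<in> nbrs (inc_graph n r F k) x" "Inl z \<in> nbrs (inc_graph n r F k) x" "Inl z \<in> nbrs (inc_graph n r F k) (Inl v)"
    using u unfolding u(1) inc_nbrs_Inl by (auto simp: v_def z_def)
  then show "in_triangle (inc_graph n r F k) x" by (auto simp: in_triangle_def)
qed

lemma finite_F: "finite F"
  using F finite_subset[of F "Pow {..<n}"] by auto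

text \<open>Neighbourhoods say nothing about isolated vertices. Their number enters the argument
  through this count.\<close>

lemma card_inc_verts: "card (inc_verts n r F k) = 3 + n + r + (\<Sum>X\<in>F. 1 + n + k X)"
proof -
  have fin: "finite (SIGMA X:F. {..<1 + n + k X})" using finite_F by (intro finite_SigmaI) auto
  have "card (Inl ` {..<3 + n + r} :: vertex set) = 3 + n + r" by (simp add: card_image)
  moreover have "card (Inr ` (SIGMA X:F. {..<1 + n + k X}) :: vertex set) = (\<Sum>X\<in>F. 1 + n + k X)"
    using finite_F by (simp add: card_image)
  moreover have "card (Inl ` {..<3 + n + r} \<union> Inr ` (SIGMA X:F. {..<1 + n + k X}) :: vertex set) =
      card (Inl ` {..<3 + n + r} :: vertex set) + card (Inr ` (SIGMA X:F. {..<1 + n + k X}) :: vertex set)"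
    by (rule card_Un_disjoint) (use fin in auto)
  ultimately show ?thesis unfolding inc_verts_def by presburger
qed

end

text \<open>The triangle is preserved, and its vertex 0 is singled out by its degree
  \<open>n + 2\<close>. The elements are the neighbours of 0 off the triangle, the nonempty sets are
  the other neighbours of elements, and labels follow from degrees. The empty set and the header
  consist of isolated vertices and are recovered from the number of vertices; assumption
  \<open>r\<close> prevents one from being mistaken for the other.\<close>

lemma inc_graph_iso_structure:
  assumes F: "\<And>X. X \<in> F \<Longrightarrow> X \<subseteq> {..<n}" and F': "\<And>X. X \<in> F' \<Longrightarrow> X \<subseteq> {..<n'}"
    and k: "{} \<in> F \<Longrightarrow> k {} = 0" "{} \<in> F' \<Longrightarrow> k' {} = 0"
    and r: "r = 0 \<and> r' = 0 \<or> {} \<notin> F \<and> {} \<notin> F'"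
    and iso: "graph_isomorphic (inc_graph n r F k) (inc_graph n' r' F' k')"
  shows "n = n' \<and> r = r' \<and> (\<exists>p. bij p \<and> p ` {..<n} = {..<n} \<and> F' = (`) p ` F \<and> (\<forall>X \<in> F. k' (p ` X) = k X))"
proof -
  let ?G = "inc_graph n r F k" and ?H = "inc_graph n' r' F' k'"
  obtain f where f: "bij_betw f (verts ?G) (verts ?H)"
    and e: "\<And>u v. u \<in> verts ?G \<Longrightarrow> v \<in> verts ?G \<Longrightarrow> {u, v} \<in> edges ?G \<longleftrightarrow> {f u, f v} \<in> edges ?H"
    by (rule graph_isomorphicE[OF iso]) (rule that)
  have V: "verts ?G = inc_verts n r F k" "verts ?H = inc_verts n' r' F' k'" by (simp_all add: inc_graph_def)
  have vG: "{x, y} \<in> edges ?G \<Longrightarrow> y \<in> verts ?G" and vH: "{x, y} \<in> edges ?H \<Longrightarrow> y \<in> verts ?H" for x y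
    by (simp_all add: inc_graph_def edges_rel_graph)
  have nb: "nbrs ?H (f x) = f ` nbrs ?G x" "card (nbrs ?H (f x)) = card (nbrs ?G x)"
    "in_triangle ?G x \<Longrightarrow> in_triangle ?H (f x)" if x: "x \<in> verts ?G" for x
    by (rule nbrs_iso[OF f _ _ _ x], erule (1) e, erule vG, erule vH, assumption?)+
  have finF: "finite F" "finite F'" by (rule finite_F, erule F) (rule finite_F, erule F')
  have nbG: "y \<in> nbrs ?G (Inl u) \<longleftrightarrow>
    (u = 0 \<and> (\<exists>v. y = Inl v \<and> 0 < v \<and> v < 3 + n)) \<or>
    (u \<noteq> 0 \<and> u < 3 \<and> (\<exists>v. y = Inl v \<and> v < 3 \<and> v \<noteq> u)) \<or>
    (3 \<le> u \<and> u < 3 + n \<and> (y = Inl 0 \<or> (\<exists>X \<in> F. y = Inr (X, 0) \<and> u - 3 \<in> X)))" for y u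
    by (rule inc_nbrs_Inl) (erule F)
  have nbH: "y \<in> nbrs ?H (Inl u) \<longleftrightarrow>
    (u = 0 \<and> (\<exists>v. y = Inl v \<and> 0 < v \<and> v < 3 + n')) \<or>
    (u \<noteq> 0 \<and> u < 3 \<and> (\<exists>v. y = Inl v \<and> v < 3 \<and> v \<noteq> u)) \<or>
    (3 \<le> u \<and> u < 3 + n' \<and> (y = Inl 0 \<or> (\<exists>X \<in> F'. y = Inr (X, 0) \<and> u - 3 \<in> X)))" for y u
    by (rule inc_nbrs_Inl) (erule F')
  have setG: "X \<in> F \<Longrightarrow> nbrs ?G (Inr (X, 0)) = (\<lambda>e. Inl (3 + e)) ` X \<union> (\<lambda>i. Inr (X, i)) ` {n<..<1 + n + k X}" for X
    by (rule inc_nbrs_set) (erule F)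
  have setH: "X \<in> F' \<Longrightarrow> nbrs ?H (Inr (X, 0)) = (\<lambda>e. Inl (3 + e)) ` X \<union> (\<lambda>i. Inr (X, i)) ` {n'<..<1 + n' + k' X}" for X
    by (rule inc_nbrs_set) (erule F')
  have inj: "inj_on f (verts ?G)" using f by (simp add: bij_betw_def)
  have hubV: "Inl ` {0, 1, 2} \<subseteq> verts ?G" unfolding V by auto
  have "f ` Inl ` {0, 1, 2} \<subseteq> Inl ` {0, 1, 2}"
  proof (rule image_subsetI)
    fix x :: vertex
    assume x: "x \<in> Inl ` {0, 1, 2}"
    have "in_triangle ?G x" using x by (simp only: inc_triangle[OF F])
    then have "in_triangle ?H (f x)" by (rule nb(3)[OF subsetD[OF hubV x]])
    then show "f x \<in> Inl ` {0, 1, 2}" by (simp only: inc_triangle[OF F'])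
  qed
  then have hub: "f ` Inl ` {0, 1, 2} = Inl ` {0, 1, 2}"
  proof (rule card_subset_eq[rotated])
    have "card (f ` Inl ` {0, 1, 2 :: nat}) = card (Inl ` {0, 1, 2 :: nat} :: vertex set)"
      by (rule card_image[OF inj_on_subset[OF inj hubV]])
    then show "card (f ` Inl ` {0, 1, 2}) = card (Inl ` {0, 1, 2} :: vertex set)" .
  qed simp
  have deg: "card (nbrs ?H (f (Inl u))) = (if u = 0 then n + 2 else 2)" if "u \<in> {0, 1, 2}" for u
  proof -
    have "card (nbrs ?H (f (Inl u))) = card (nbrs ?G (Inl u))"
      by (rule nb(2)[OF subsetD[OF hubV imageI[OF that]]])
    then show ?thesis using inc_degree_0[OF F] inc_degree_12[where u = u, OF F] that by auto
  qed
  have deg': "card (nbrs ?H (Inl u)) = (if u = 0 then n' + 2 else 2)" if "u \<in> {0, 1, 2}" for u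
    using inc_degree_0[OF F'] inc_degree_12[where u = u, OF F'] that by auto
  obtain a where a: "a \<in> {0, 1, 2 :: nat}" "f (Inl 0) = Inl a"
  proof -
    have "f (Inl 0) \<in> f ` Inl ` {0, 1, 2 :: nat}" by (intro imageI) simp
    then have "f (Inl 0) \<in> Inl ` {0, 1, 2 :: nat}" unfolding hub .
    then show thesis by (rule imageE) (rule that)
  qed
  have pre: "\<exists>u \<in> {0, 1, 2}. f (Inl u) = Inl v" if v: "v \<in> {0, 1, 2}" for v
  proof -
    have "Inl v \<in> f ` Inl ` {0, 1, 2 :: nat}" unfolding hub by (rule imageI) (rule v)
    then obtain x where "x \<in> Inl ` {0, 1, 2 :: nat}" "Inl v = f x" by (rule imageE)
    then show ?thesis by (metis imageE)
  qed
  obtain b where b: "b \<in> {0, 1, 2 :: nat}" "f (Inl b) = Inl 0"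
    using bexE[OF pre[of 0]] by (metis insertI1)
  \<comment> \<open>The degrees on the two triangles are \<open>n + 2\<close>, 2, 2 and
    \<open>n' + 2\<close>, 2, 2. Comparing them at the image and at the preimage of vertex 0 leaves
    only \<open>n = n'\<close>.\<close>
  have n: "n = n'"
    using deg[of 0] deg'[OF a(1)] a(2) deg[OF b(1)] deg'[of 0] b(2) by (auto split: if_splits)
  \<comment> \<open>For \<open>n = 0\<close> all three vertices of the triangle have degree 2 and
    vertex 0 may be moved, but then there are no elements.\<close>
  have f0: "n > 0 \<Longrightarrow> f (Inl 0) = Inl 0"
    using deg[of 0] deg'[OF a(1)] a(2) by (auto split: if_splits)
  have el: "\<exists>j < n. f (Inl (3 + i)) = Inl (3 + j)" if i: "i < n" for i
  proof -
    have "Inl (3 + i) \<in> nbrs ?G (Inl 0)" using i unfolding nbG by simp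
    then have "f (Inl (3 + i)) \<in> nbrs ?H (f (Inl 0))" using nb(1)[of "Inl 0"] hubV by auto
    then have "f (Inl (3 + i)) \<in> nbrs ?H (Inl 0)" using f0 i by simp
    then obtain v where v: "f (Inl (3 + i)) = Inl v" "0 < v" "v < 3 + n"
      unfolding nbH n by auto
    have "\<not> v < 3"
    proof
      assume "v < 3"
      then have "v \<in> {0, 1, 2}" by auto
      from pre[OF this] obtain u where u: "u \<in> {0, 1, 2}" "f (Inl u) = Inl v" by (rule bexE)
      have "Inl u \<in> verts ?G" "Inl (3 + i) \<in> verts ?G" using u(1) i unfolding V by auto
      then have "Inl u = (Inl (3 + i) :: vertex)" using inj_onD[OF inj] u(2) v(1) by metis
      then show False using u(1) by auto
    qed
    then show ?thesis using v by (intro exI[of _ "v - 3"]) auto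
  qed
  define p0 where "p0 i = (SOME j. j < n \<and> f (Inl (3 + i)) = Inl (3 + j))" for i
  have p0: "p0 i < n" "f (Inl (3 + i)) = Inl (3 + p0 i)" if "i < n" for i
    using someI_ex[of "\<lambda>j. j < n \<and> f (Inl (3 + i)) = Inl (3 + j)"] el[OF that] by (simp_all add: p0_def)
  have "inj_on p0 {..<n}"
  proof (rule inj_onI)
    fix i j
    assume ij: "i \<in> {..<n}" "j \<in> {..<n}" "p0 i = p0 j"
    then have "f (Inl (3 + i)) = f (Inl (3 + j))" using p0(2) by simp
    then have "(Inl (3 + i) :: vertex) = Inl (3 + j)" by (rule inj_onD[OF inj]) (use ij in \<open>simp_all add: V\<close>)
    then show "i = j" by simp
  qed
  then have p0b: "bij_betw p0 {..<n} {..<n}"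
    using p0(1) endo_inj_surj[of "{..<n}" p0] by (auto simp: bij_betw_def)
  define p where "p i = (if i < n then p0 i else i)" for i
  have p: "bij p" using bij_extend[OF p0b] by (simp add: p_def[abs_def])
  have pi: "f (Inl (3 + i)) = Inl (3 + p i)" if "i < n" for i using p0(2) that by (simp add: p_def)
  have pn: "p ` {..<n} = {..<n}"
  proof -
    have "p ` {..<n} = p0 ` {..<n}" by (rule image_cong) (auto simp: p_def)
    then show ?thesis using p0b by (simp add: bij_betw_def)
  qed
  \<comment> \<open>Restricted to nonempty sets, because a set is located as a neighbour of one of
    its elements.\<close>
  have set: "f (Inr (X, 0)) = Inr (p ` X, 0) \<and> p ` X \<in> F' \<and> k' (p ` X) = k X" if X: "X \<in> F" "X \<noteq> {}" for X
  proof -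
    have sV: "Inr (X, 0) \<in> verts ?G" using X unfolding V by simp
    have adj: "e \<in> X \<longleftrightarrow> f (Inl (3 + e)) \<in> nbrs ?H (f (Inr (X, 0)))" if en: "e < n" for e
    proof -
      have eV: "Inl (3 + e) \<in> verts ?G" using en unfolding V by simp
      have "f (Inl (3 + e)) \<in> nbrs ?H (f (Inr (X, 0))) \<longleftrightarrow> Inl (3 + e) \<in> nbrs ?G (Inr (X, 0))"
        using e[OF sV eV] by (simp add: nbrs_def)
      also have "\<dots> \<longleftrightarrow> e \<in> X" unfolding setG[OF X(1)] by auto
      finally show ?thesis by simp
    qed
    obtain i where i: "i \<in> X" using X(2) by blast
    then have iN: "i < n" using F[OF X(1)] by auto
    have "f (Inr (X, 0)) \<in> nbrs ?H (Inl (3 + p i))"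
      using adj[OF iN] i pi[OF iN] by (simp add: nbrs_def insert_commute)
    moreover have "f (Inr (X, 0)) \<noteq> Inl 0"
    proof
      assume "f (Inr (X, 0)) = Inl 0"
      then have "f (Inr (X, 0)) = f (Inl 0)" using f0 iN by simp
      then have "(Inr (X, 0) :: vertex) = Inl 0" by (rule inj_onD[OF inj]) (use sV V in simp_all)
      then show False by simp
    qed
    ultimately obtain Y where Y: "Y \<in> F'" "f (Inr (X, 0)) = Inr (Y, 0)"
      unfolding nbH by auto
    have "e \<in> X \<longleftrightarrow> p e \<in> Y" if "e < n" for e
      using adj[OF that] unfolding Y(2) setH[OF Y(1)] pi[OF that] by auto
    moreover have "Y \<subseteq> p ` {..<n}" using F'[OF Y(1)] n pn by simp
    ultimately have "Y = p ` X" using F[OF X(1)] by blast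
    \<comment> \<open>The degree counts elements and pendant vertices together; as the sizes agree,
      so do the labels.\<close>
    moreover have "card Y + k' Y = card X + k X"
      using nb(2)[OF sV] inc_degree_set[OF F X(1)] inc_degree_set[OF F' Y(1)] Y(2) by simp
    moreover have "card (p ` X) = card X" using p by (intro card_image) (auto simp: bij_def intro: inj_on_subset)
    ultimately show ?thesis using Y by simp
  qed
  have injp: "inj p" using p by (rule bij_is_inj)
  have Fne: "F' - {{}} = (`) p ` (F - {{}})"
  proof
    show "(`) p ` (F - {{}}) \<subseteq> F' - {{}}" using set by auto
    show "F' - {{}} \<subseteq> (`) p ` (F - {{}})"
    proof
      fix Y
      assume Y: "Y \<in> F' - {{}}"
      then have "Inr (Y, 0) \<in> verts ?H" unfolding V by simp
      then obtain x where x: "x \<in> verts ?G" "f x = Inr (Y, 0)" using f by (metis bij_betw_imp_surj_on imageE)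
      obtain j where j: "j \<in> Y" using Y by blast
      then have "j \<in> p ` {..<n}" using F' Y n pn by auto
      then obtain i where i: "i < n" "j = p i" by auto
      have "Inl (3 + j) \<in> nbrs ?H (Inr (Y, 0))" using setH[of Y] Y j by simp
      then have "{f x, f (Inl (3 + i))} \<in> edges ?H" using x(2) pi[OF i(1)] i(2) by (simp add: nbrs_def)
      moreover have "Inl (3 + i) \<in> verts ?G" using i(1) unfolding V by simp
      ultimately have "{x, Inl (3 + i)} \<in> edges ?G" using e[OF x(1)] by simp
      then have "x \<in> nbrs ?G (Inl (3 + i))" by (simp add: nbrs_def insert_commute)
      moreover have "x \<noteq> Inl 0" using f0 i(1) x(2) by auto
      ultimately obtain X where X: "X \<in> F" "x = Inr (X, 0)" "i \<in> X" unfolding nbG by auto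
      then have "Y = p ` X" using set[of X] x(2) by auto
      then show "Y \<in> (`) p ` (F - {{}})" using X by blast
    qed
  qed
  \<comment> \<open>The nonempty sets contribute equally many vertices on both sides, so that only
    the empty set and the header remain to be compared.\<close>
  have kk: "(\<Sum>Y\<in>F' - {{}}. 1 + n + k' Y) = (\<Sum>X\<in>F - {{}}. 1 + n + k X)"
  proof -
    have "inj_on ((`) p) (F - {{}})" using inj_image_eq_iff[OF injp] by (auto simp: inj_on_def)
    then have "(\<Sum>Y\<in>F' - {{}}. 1 + n + k' Y) = (\<Sum>X\<in>F - {{}}. 1 + n + k' (p ` X))"
      unfolding Fne by (simp add: sum.reindex)
    also have "\<dots> = (\<Sum>X\<in>F - {{}}. 1 + n + k X)" by (rule sum.cong) (use set in auto)
    finally show ?thesis .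
  qed
  have "card (inc_verts n r F k) = card (inc_verts n' r' F' k')" using bij_betw_same_card[OF f] V by simp
  moreover have "card (inc_verts n r F k) = 3 + n + r + (\<Sum>X\<in>F. 1 + n + k X)"
    by (rule card_inc_verts) (erule F)
  moreover have "card (inc_verts n' r' F' k') = 3 + n + r' + (\<Sum>X\<in>F'. 1 + n + k' X)"
    unfolding n by (rule card_inc_verts) (erule F')
  ultimately have "r + (\<Sum>X\<in>F. 1 + n + k X) = r' + (\<Sum>X\<in>F'. 1 + n + k' X)"
    by linarith
  moreover have "(\<Sum>X\<in>F. 1 + n + k X) = (\<Sum>X\<in>F - {{}}. 1 + n + k X) + (if {} \<in> F then 1 + n else 0)"
    using k(1) sum.remove[OF finF(1), of "{}" "\<lambda>X. 1 + n + k X"] by auto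
  moreover have "(\<Sum>X\<in>F'. 1 + n + k' X) = (\<Sum>X\<in>F' - {{}}. 1 + n + k' X) + (if {} \<in> F' then 1 + n else 0)"
    using k(2) sum.remove[OF finF(2), of "{}" "\<lambda>X. 1 + n + k' X"] by auto
  ultimately have "r + (if {} \<in> F then 1 + n else 0) = r' + (if {} \<in> F' then 1 + n else 0)"
    using kk by linarith
  then have rr: "r = r'" "{} \<in> F \<longleftrightarrow> {} \<in> F'" using r by (auto split: if_splits)
  have "F' = (`) p ` F"
  proof (cases "{} \<in> F")
    case True
    then have "F = insert {} (F - {{}})" "F' = insert {} (F' - {{}})" using rr by auto
    then show ?thesis using Fne by (metis image_empty image_insert)
  next
    case False
    then show ?thesis using Fne rr by simp
  qed
  moreover have "k' (p ` X) = k X" if "X \<in> F" for X using set[OF that] k rr that by (cases "X = {}") auto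
  ultimately show ?thesis using n rr(1) p pn by (intro conjI exI[of _ p] ballI)
qed

section \<open>Isomorphism of matroids in terms of position graphs\<close>

lemma label_empty: "is_matroid M \<Longrightarrow> label I M {} = 0"
  using matroid.rank_le_card[OF matroid.intro, of M "{}"] by (simp add: label_def)

lemma family_subset:
  assumes "is_matroid M" "X \<in> family I M"
  shows "X \<subseteq> ground M"
  using assms(2) matroid.indep_subset[OF matroid.intro, OF assms(1)]
  by (cases I) (auto simp: bases_def spanning_sets_def flats_def circuits_def hyperplanes_def
      non_spanning_circuits_def dependent_hyperplanes_def cyclic_flats_def)

lemma map_of_labels: "X \<in> set Xs \<Longrightarrow> the (map_of (map (\<lambda>X. (X, g X)) Xs) X) = g X"
  by (induction Xs) auto

text \<open>The incidence graph knows nothing of the order in which the sets are listed, so all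
  descriptions of \<open>M\<close> of one type lead to isomorphic graphs.\<close>

lemma pos_graph_description:
  assumes M: "numbered_matroid M" and w: "w \<in> descriptions I M"
  shows "graph_isomorphic (pos_graph w) (inc_graph (card (ground M)) (header I M) (family I M) (label I M))"
proof -
  let ?n = "card (ground M)" and ?r = "header I M"
  obtain Xs where Xs: "distinct Xs" "set Xs = family I M" and
    w: "w = gen_word ?n ?r (map (\<lambda>X. (X, label I M X)) Xs)"
    using w unfolding descriptions_eq[OF M] listings_def by blast
  let ?ps = "map (\<lambda>X. (X, label I M X)) Xs"
  have dist: "distinct (map fst ?ps)" using Xs(1) by (simp add: comp_def)
  have "is_matroid M" using M by (simp add: numbered_matroid_def)
  have sub: "X \<subseteq> {..<?n}" if "(X, k) \<in> set ?ps" for X k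
  proof -
    have "X \<in> family I M" using that Xs(2) by auto
    then show ?thesis using family_subset[OF \<open>is_matroid M\<close>] mem_ground_iff[OF M] by auto
  qed
  have "graph_isomorphic (pos_graph w) (inc_graph ?n ?r (fst ` set ?ps) (\<lambda>X. the (map_of ?ps X)))"
    unfolding w by (rule pos_graph_gen_word[OF dist]) (erule sub)
  moreover have "inc_graph ?n ?r (fst ` set ?ps) (\<lambda>X. the (map_of ?ps X)) = inc_graph ?n ?r (family I M) (label I M)"
  proof -
    have "fst ` set ?ps = family I M" using Xs(2) by (auto simp: image_image)
    moreover have "inc_verts ?n ?r (family I M) (\<lambda>X. the (map_of ?ps X)) = inc_verts ?n ?r (family I M) (label I M)"
      unfolding inc_verts_def
      by (intro arg_cong2[where f = "(\<union>)"] arg_cong[where f = "image Inr"] Sigma_cong refl)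
        (use map_of_labels[of _ Xs "label I M"] Xs(2) in simp)
    ultimately show ?thesis by (simp add: inc_graph_def)
  qed
  ultimately show ?thesis by simp
qed

theorem matroid_isomorphic_pos_graph:
  assumes M: "numbered_matroid M" "w \<in> descriptions I M" and N: "numbered_matroid N" "v \<in> descriptions I N"
  shows "matroid_isomorphic M N \<longleftrightarrow> graph_isomorphic (pos_graph w) (pos_graph v)"
proof -
  let ?G = "\<lambda>M. inc_graph (card (ground M)) (header I M) (family I M) (label I M)"
  have mat: "is_matroid M" "is_matroid N" using M(1) N(1) by (simp_all add: numbered_matroid_def)
  have g: "ground M = {..<card (ground M)}" "ground N = {..<card (ground N)}"
    using M(1) N(1) unfolding numbered_matroid_def by blast+
  have sub: "X \<in> family I M \<Longrightarrow> X \<subseteq> {..<card (ground M)}" "X \<in> family I N \<Longrightarrow> X \<subseteq> {..<card (ground N)}" for X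
    using family_subset mat g by metis+
  have "graph_isomorphic (pos_graph w) (pos_graph v) \<longleftrightarrow> graph_isomorphic (?G M) (?G N)"
    using pos_graph_description[OF M] pos_graph_description[OF N] graph_isomorphic_trans graph_isomorphic_sym
    by metis
  moreover have "matroid_isomorphic M N \<longleftrightarrow> graph_isomorphic (?G M) (?G N)"
  proof
    assume "matroid_isomorphic M N"
    then obtain p where p: "description_iso I M N p"
      using matroid_isomorphic_iff[OF M(1) N(1)] by blast
    have inj: "inj p" using p by (simp add: description_iso_def bij_is_inj)
    have gp: "p ` ground M = ground N" using p by (simp add: description_iso_def)
    have "card (p ` ground M) = card (ground M)" by (rule card_image) (rule inj_on_subset[OF inj], simp)
    then have n: "card (ground N) = card (ground M)" using gp by simp
    have "p ` {..<card (ground M)} = {..<card (ground M)}" using gp g n by simp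
    then have "graph_isomorphic (?G M) (inc_graph (card (ground M)) (header I M) (family I N) (label I N))"
      by (intro inc_graph_iso) (use p sub(1) in \<open>auto simp: description_iso_def\<close>)
    moreover have "header I N = header I M" using p by (simp add: description_iso_def)
    ultimately show "graph_isomorphic (?G M) (?G N)" using n by simp
  next
    assume iso: "graph_isomorphic (?G M) (?G N)"
    \<comment> \<open>At issue are only the two types with a rank in the header. Their families
      consist of dependent sets, which are nonempty.\<close>
    have "header I M = 0 \<and> header I N = 0 \<or> {} \<notin> family I M \<and> {} \<notin> family I N"
    proof (cases "I = NON_SPANNING_CIRCUITS \<or> I = DEPENDENT_HYPERPLANES")
      case True
      have "{} \<in> indep M" "{} \<in> indep N" by (rule matroid.empty_indep[OF matroid.intro], rule mat)+
      with True show ?thesis by (auto simp: circuits_def non_spanning_circuits_def dependent_hyperplanes_def)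
    qed (auto simp: header_def)
    note disj = this
    have "card (ground M) = card (ground N) \<and> header I M = header I N \<and>
      (\<exists>p. bij p \<and> p ` {..<card (ground M)} = {..<card (ground M)} \<and> family I N = (`) p ` family I M \<and>
        (\<forall>X \<in> family I M. label I N (p ` X) = label I M X))"
      by (rule inc_graph_iso_structure[OF _ _ _ _ disj iso])
        (erule sub(1), erule sub(2), rule label_empty[OF mat(1)], rule label_empty[OF mat(2)])
    then obtain p where p: "card (ground M) = card (ground N)" "header I M = header I N" "bij p"
      "p ` {..<card (ground M)} = {..<card (ground M)}" "family I N = (`) p ` family I M"
      "\<forall>X \<in> family I M. label I N (p ` X) = label I M X" by (elim conjE exE)
    have "p ` ground M = ground N" using p(1,4) g by simp
    then have "description_iso I M N p" using p by (simp add: description_iso_def)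
    then show "matroid_isomorphic M N" using matroid_isomorphic_iff[OF M(1) N(1)] by blast
  qed
  ultimately show ?thesis by simp
qed

section \<open>From graphs to matroids\<close>

definition sparse_paving :: "nat \<Rightarrow> nat \<Rightarrow> nat set set \<Rightarrow> nat matroid" where
  "sparse_paving N r C = \<lparr>ground = {..<N}, indep = {X. X \<subseteq> {..<N} \<and> (card X < r \<or> card X = r \<and> X \<notin> C)}\<rparr>"

lemma sparse_paving_sel [simp]:
  "ground (sparse_paving N r C) = {..<N}"
  "X \<in> indep (sparse_paving N r C) \<longleftrightarrow> X \<subseteq> {..<N} \<and> (card X < r \<or> card X = r \<and> X \<notin> C)"
  by (simp_all add: sparse_paving_def)

text \<open>Distinct members differ by at least two exchanges of elements. For \<open>r = 0\<close>
  the only candidate would be the empty set, which has to stay independent.\<close>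

definition sparse_family :: "nat \<Rightarrow> nat \<Rightarrow> nat set set \<Rightarrow> bool" where
  "sparse_family N r C \<longleftrightarrow> (r = 0 \<longrightarrow> C = {}) \<and> (\<forall>A \<in> C. A \<subseteq> {..<N} \<and> card A = r) \<and>
     (\<forall>A \<in> C. \<forall>B \<in> C. A \<noteq> B \<longrightarrow> card (A \<inter> B) + 2 \<le> r)"

text \<open>The two extensions share the \<open>r - 1\<close> elements of \<open>X\<close>, too many
  for two members of the family.\<close>

lemma sparse_family_insert:
  assumes "sparse_family N r C" "card X + 1 = r" "finite X" "e \<notin> X" "f \<notin> X" "e \<noteq> f"
  shows "insert e X \<notin> C \<or> insert f X \<notin> C"
proof (rule ccontr)
  assume "\<not> ?thesis"
  then have "insert e X \<in> C" "insert f X \<in> C" by auto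
  moreover have "insert e X \<noteq> insert f X" using assms by blast
  ultimately have "card (insert e X \<inter> insert f X) + 2 \<le> r" using assms(1) by (simp add: sparse_family_def)
  moreover have "card X \<le> card (insert e X \<inter> insert f X)" using assms(3) by (intro card_mono) auto
  ultimately show False using assms(2) by simp
qed

text \<open>Augmentation is at risk only if \<open>X\<close> has \<open>r - 1\<close> elements. Two
  candidates from \<open>Y\<close> cannot both lead into \<open>C\<close>, and if \<open>e\<close>
  is the only candidate, then \<open>insert e X\<close> is \<open>Y\<close> itself.\<close>

lemma is_matroid_sparse_paving:
  assumes "sparse_family N r C"
  shows "is_matroid (sparse_paving N r C)"
  unfolding is_matroid_def
proof (intro conjI ballI allI impI)
  show "indep (sparse_paving N r C) \<subseteq> Pow (ground (sparse_paving N r C))" by auto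
  show "{} \<in> indep (sparse_paving N r C)" using assms by (auto simp: sparse_family_def)
next
  fix X Y
  assume X: "X \<in> indep (sparse_paving N r C)" and Y: "Y \<subseteq> X"
  have "finite X" using X finite_subset by auto
  show "Y \<in> indep (sparse_paving N r C)"
  proof (cases "Y = X")
    case False
    then have "card Y < card X" using Y \<open>finite X\<close> by (simp add: psubset_card_mono psubset_eq)
    then show ?thesis using X Y by auto
  qed (use X in simp)
next
  fix X Y
  assume X: "X \<in> indep (sparse_paving N r C)" and Y: "Y \<in> indep (sparse_paving N r C)" and c: "card X < card Y"
  have fin: "finite X" "finite Y" using X Y finite_subset by auto
  have sub: "X \<subseteq> {..<N}" "Y \<subseteq> {..<N}" "card Y \<le> r" using X Y by auto
  have "\<not> Y \<subseteq> X" using c fin card_mono[of X Y] by auto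
  then obtain e where e: "e \<in> Y" "e \<notin> X" by blast
  show "\<exists>e \<in> Y - X. insert e X \<in> indep (sparse_paving N r C)"
  proof (cases "card X + 1 < r")
    case True
    then show ?thesis using e sub fin by (intro bexI[of _ e]) auto
  next
    case False
    then have r: "card X + 1 = r" "card Y = r" using c sub(3) by auto
    show ?thesis
    proof (cases "\<exists>f \<in> Y - X. f \<noteq> e")
      case True
      then obtain f where f: "f \<in> Y" "f \<notin> X" "f \<noteq> e" by blast
      have "insert e X \<notin> C \<or> insert f X \<notin> C"
        by (rule sparse_family_insert[OF assms r(1) fin(1) e(2) f(2)]) (use f in simp)
      then show ?thesis using e f sub fin r(1) by (auto intro: bexI[of _ e] bexI[of _ f])
    next
      case False
      then have "Y \<subseteq> insert e X" by blast
      moreover have "card (insert e X) = card Y" using e fin r by simp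
      ultimately have "Y = insert e X" using fin by (metis card_subset_eq finite_insert)
      then show ?thesis using e Y by (intro bexI[of _ e]) simp_all
    qed
  qed
qed simp

text \<open>A set of more than \<open>r\<close> elements contains an \<open>r\<close>-set outside
  \<open>C\<close>: extend one of its subsets of size \<open>r - 1\<close> in two ways. The
  condition \<open>r < N \<or> C = {}\<close> provides a basis of size \<open>r\<close>.\<close>

lemma spanning_sets_sparse_paving:
  assumes C: "sparse_family N r C" and "r < N \<or> C = {}" "r \<le> N"
  shows "X \<in> spanning_sets (sparse_paving N r C) \<longleftrightarrow> X \<subseteq> {..<N} \<and> (r < card X \<or> card X = r \<and> X \<notin> C)"
proof -
  let ?M = "sparse_paving N r C"
  interpret matroid ?M by unfold_locales (rule is_matroid_sparse_paving[OF C])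
  have big: "\<exists>B. B \<subseteq> X \<and> card B = r \<and> B \<notin> C" if X: "X \<subseteq> {..<N}" "r < card X" for X
  proof (cases "r = 0")
    case True
    then show ?thesis using C by (intro exI[of _ "{}"]) (simp add: sparse_family_def)
  next
    case False
    have finX: "finite X" using X(1) finite_subset by blast
    have "r - 1 \<le> card X" using X(2) by simp
    then obtain Z where Z: "Z \<subseteq> X" "card Z = r - 1" "finite Z"
      by (rule obtain_subset_with_card_n)
    have "card (X - Z) \<ge> 2" using Z finX X(2) False by (simp add: card_Diff_subset)
    then obtain e f where ef: "e \<in> X - Z" "f \<in> X - Z" "e \<noteq> f"
      by (metis card_le_Suc0_iff_eq finX finite_Diff not_less_eq_eq numeral_2_eq_2)
    have "insert e Z \<notin> C \<or> insert f Z \<notin> C"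
      by (rule sparse_family_insert[OF C]) (use Z ef False in auto)
    then show ?thesis
    proof
      assume "insert e Z \<notin> C"
      then show ?thesis using Z ef False by (intro exI[of _ "insert e Z"]) auto
    next
      assume "insert f Z \<notin> C"
      then show ?thesis using Z ef False by (intro exI[of _ "insert f Z"]) auto
    qed
  qed
  have "\<exists>B. B \<subseteq> {..<N} \<and> card B = r \<and> B \<notin> C"
  proof (cases "r < N")
    case True
    then show ?thesis using big[of "{..<N}"] by simp
  next
    case False
    then show ?thesis using assms(2,3) by (intro exI[of _ "{..<N}"]) auto
  qed
  then obtain B0 where B0: "B0 \<in> indep ?M" "card B0 = r" by auto
  have "rk ?M = r"
  proof -
    have "r \<le> rk ?M" using card_le_rank[OF B0(1), of "ground ?M"] B0 by (simp add: rk_def)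
    moreover obtain Y where "Y \<in> indep ?M" "card Y = rk ?M" using rank_witness[of "ground ?M"] unfolding rk_def by blast
    ultimately show ?thesis by auto
  qed
  then have bas: "B \<in> bases ?M \<longleftrightarrow> B \<subseteq> {..<N} \<and> card B = r \<and> B \<notin> C" for B
    unfolding bases_iff by auto
  show ?thesis
  proof
    assume "X \<in> spanning_sets ?M"
    then obtain B where B: "X \<subseteq> {..<N}" "B \<in> bases ?M" "B \<subseteq> X" by (auto simp: spanning_sets_def)
    have finX: "finite X" using B(1) finite_subset by blast
    have "card B = r" "B \<notin> C" using B(2) bas by simp_all
    then show "X \<subseteq> {..<N} \<and> (r < card X \<or> card X = r \<and> X \<notin> C)"
      using card_mono[OF finX B(3)] card_subset_eq[OF finX B(3)] B(1) by (cases "card X = r") auto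
  next
    assume X: "X \<subseteq> {..<N} \<and> (r < card X \<or> card X = r \<and> X \<notin> C)"
    then obtain B where "B \<subseteq> X" "card B = r" "B \<notin> C" using big[of X] by blast
    then show "X \<in> spanning_sets ?M" using X bas[of B] by (auto simp: spanning_sets_def)
  qed
qed

text \<open>The graph is extended by a vertex \<open>n\<close> adjacent to all vertices and an isolated vertex
  \<open>n + 1\<close>; each vertex \<open>u\<close> of the extension gives two elements \<open>u\<close> and \<open>u + (n + 2)\<close>, and each
  edge a 4-element circuit-hyperplane.\<close>

definition ext_edges :: "nat graph \<Rightarrow> nat set set" where
  "ext_edges G = edges G \<union> (\<lambda>u. {u, card (verts G)}) ` {..<card (verts G)}"

definition twin :: "nat \<Rightarrow> nat set \<Rightarrow> nat set" where
  "twin m e = e \<union> (\<lambda>i. i + m) ` e"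

definition edge_family :: "nat graph \<Rightarrow> nat set set" where
  "edge_family G = twin (card (verts G) + 2) ` ext_edges G"

definition graph_matroid :: "nat graph \<Rightarrow> nat matroid" where
  "graph_matroid G = sparse_paving (2 * (card (verts G) + 2)) 4 (edge_family G)"

text \<open>The dual of a sparse paving matroid is sparse paving, with the complements as
  circuit-hyperplanes. Taking this as the definition makes a general notion of duality
  unnecessary.\<close>

definition dual_graph_matroid :: "nat graph \<Rightarrow> nat matroid" where
  "dual_graph_matroid G = (let N = 2 * (card (verts G) + 2) in
     sparse_paving N (N - 4) ((\<lambda>A. {..<N} - A) ` edge_family G))"

lemma twin_subset: "e \<subseteq> {..<m} \<Longrightarrow> twin m e \<subseteq> {..<2 * m}"
  by (auto simp: twin_def)

lemma twin_Int_low: "e \<subseteq> {..<m} \<Longrightarrow> twin m e \<inter> {..<m} = e"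
  by (auto simp: twin_def)

lemma twin_eq_iff: "e \<subseteq> {..<m} \<Longrightarrow> e' \<subseteq> {..<m} \<Longrightarrow> twin m e = twin m e' \<longleftrightarrow> e = e'"
  by (metis twin_Int_low)

lemma twin_Int: "e \<subseteq> {..<m} \<Longrightarrow> e' \<subseteq> {..<m} \<Longrightarrow> twin m e \<inter> twin m e' = twin m (e \<inter> e')"
  by (auto simp: twin_def)

lemma card_twin:
  assumes "e \<subseteq> {..<m}"
  shows "card (twin m e) = 2 * card e"
proof -
  have fin: "finite e" using assms finite_subset by blast
  have "card (twin m e) = card e + card ((\<lambda>i. i + m) ` e)"
    unfolding twin_def by (rule card_Un_disjoint) (use fin assms in auto)
  then show ?thesis by (simp add: card_image)
qed

lemma ext_edges_props:
  assumes "numbered_graph G" "e \<in> ext_edges G"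
  shows "e \<subseteq> {..card (verts G)}" "card e = 2"
proof -
  have *: "e \<subseteq> verts G \<and> card e = 2" if "e \<in> edges G"
    using that assms(1) by (simp add: numbered_graph_def is_simple_graph_def)
  have v: "verts G = {..<card (verts G)}" using assms(1) unfolding numbered_graph_def by blast
  show "e \<subseteq> {..card (verts G)}"
  proof (cases "e \<in> edges G")
    case True
    then have "e \<subseteq> {..<card (verts G)}" using * v by simp
    then show ?thesis by auto
  next
    case False
    then show ?thesis using assms(2) by (auto simp: ext_edges_def)
  qed
  show "card e = 2" using assms(2) * by (auto simp: ext_edges_def)
qed

lemma edge_family_props:
  assumes "numbered_graph G" "A \<in> edge_family G"
  shows "A \<subseteq> {..<2 * (card (verts G) + 2)}" "card A = 4"
proof -
  let ?m = "card (verts G) + 2"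
  obtain e where e: "e \<in> ext_edges G" "A = twin ?m e" using assms(2) by (auto simp: edge_family_def)
  have sub: "e \<subseteq> {..<?m}" using ext_edges_props(1)[OF assms(1) e(1)] by auto
  show "A \<subseteq> {..<2 * ?m}" unfolding e(2) by (rule twin_subset[OF sub])
  show "card A = 4" unfolding e(2) card_twin[OF sub] using ext_edges_props(2)[OF assms(1) e(1)] by simp
qed

text \<open>Distinct edges share at most one vertex, so their doubles share at most one
  pair.\<close>

lemma edge_family_Int:
  assumes "numbered_graph G" "A \<in> edge_family G" "B \<in> edge_family G" "A \<noteq> B"
  shows "card (A \<inter> B) \<le> 2"
proof -
  let ?m = "card (verts G) + 2"
  obtain e e' where e: "e \<in> ext_edges G" "A = twin ?m e" "e' \<in> ext_edges G" "B = twin ?m e'"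
    using assms(2,3) by (auto simp: edge_family_def)
  have sub: "e \<subseteq> {..<?m}" "e' \<subseteq> {..<?m}" using ext_edges_props(1)[OF assms(1)] e(1,3) by force+
  have c: "card e = 2" "card e' = 2" using ext_edges_props(2)[OF assms(1)] e(1,3) by auto
  then have fin: "finite e" "finite e'" using card.infinite by fastforce+
  have "e \<noteq> e'" using e assms(4) by auto
  then have "e \<inter> e' \<noteq> e" using c fin card_subset_eq[of e' e] by auto
  then have "card (e \<inter> e') < card e" using fin by (intro psubset_card_mono) auto
  moreover have "card (A \<inter> B) = 2 * card (e \<inter> e')"
    unfolding e(2,4) twin_Int[OF sub] using sub by (intro card_twin) auto
  ultimately show ?thesis using c by simp
qed

lemma sparse_edge_family:
  assumes "numbered_graph G"
  shows "sparse_family (2 * (card (verts G) + 2)) 4 (edge_family G)"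
  unfolding sparse_family_def
proof (intro conjI ballI impI)
  fix A assume A: "A \<in> edge_family G"
  then show "A \<subseteq> {..<2 * (card (verts G) + 2)}" "card A = 4" using edge_family_props[OF assms] by blast+
  fix B assume "B \<in> edge_family G" "A \<noteq> B"
  then show "card (A \<inter> B) + 2 \<le> 4" using edge_family_Int[OF assms A] by fastforce
qed simp

text \<open>Two complements meet in the complement of \<open>A \<union> B\<close>, and this union
  has at least 4 + 4 - 2 = 6 elements.\<close>

lemma sparse_dual_edge_family:
  assumes "numbered_graph G"
  defines "N \<equiv> 2 * (card (verts G) + 2)"
  shows "sparse_family N (N - 4) ((\<lambda>A. {..<N} - A) ` edge_family G)"
  unfolding sparse_family_def
proof (intro conjI ballI impI)
  have cd: "card ({..<N} - A) = N - 4" if "A \<in> edge_family G" for A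
    using edge_family_props[OF assms(1) that] finite_subset[of A "{..<N}"] by (simp add: card_Diff_subset N_def)
  \<comment> \<open>Thanks to the isolated vertex, a ground set of 4 elements arises only from the
    graph without vertices, whose extension has no edges.\<close>
  assume "N - 4 = 0"
  then have n0: "card (verts G) = 0" by (simp add: N_def)
  have "ext_edges G = {}"
  proof (rule ccontr)
    assume "ext_edges G \<noteq> {}"
    then obtain e where "e \<in> ext_edges G" by blast
    then have "e \<subseteq> {0}" "card e = 2" using ext_edges_props[OF assms(1)] n0 by auto
    then show False using card_mono[of "{0}" e] by simp
  qed
  then show "(\<lambda>A. {..<N} - A) ` edge_family G = {}" by (simp add: edge_family_def)
next
  fix A' assume "A' \<in> (\<lambda>A. {..<N} - A) ` edge_family G"
  then obtain A where A: "A \<in> edge_family G" "A' = {..<N} - A" by blast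
  have pA: "A \<subseteq> {..<N}" "card A = 4" using edge_family_props[OF assms(1) A(1)] by (simp_all add: N_def)
  have finA: "finite A" using pA(1) finite_subset by blast
  show "A' \<subseteq> {..<N}" using A by auto
  show "card A' = N - 4" using A(2) pA finA by (simp add: card_Diff_subset)
  fix B' assume "B' \<in> (\<lambda>A. {..<N} - A) ` edge_family G" "A' \<noteq> B'"
  then obtain B where B: "B \<in> edge_family G" "B' = {..<N} - B" "A \<noteq> B" using A by blast
  have pB: "B \<subseteq> {..<N}" "card B = 4" using edge_family_props[OF assms(1) B(1)] by (simp_all add: N_def)
  have finB: "finite B" using pB(1) finite_subset by blast
  have "card (A \<inter> B) \<le> 2" by (rule edge_family_Int[OF assms(1) A(1) B(1,3)])
  moreover have "card (A \<union> B) + card (A \<inter> B) = 8" using card_Un_Int[OF finA finB] pA pB by simp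
  moreover have "A' \<inter> B' = {..<N} - (A \<union> B)" using A B by auto
  moreover have "card ({..<N} - (A \<union> B)) = N - card (A \<union> B)"
    using pA pB finA finB by (subst card_Diff_subset) auto
  moreover have "card (A \<union> B) \<le> N" using pA pB card_mono[of "{..<N}" "A \<union> B"] by simp
  ultimately show "card (A' \<inter> B') + 2 \<le> N - 4" by simp
qed

lemma numbered_graph_matroid: "numbered_graph G \<Longrightarrow> numbered_matroid (graph_matroid G)"
  using is_matroid_sparse_paving[OF sparse_edge_family] by (simp add: numbered_matroid_def graph_matroid_def)

lemma numbered_dual_graph_matroid: "numbered_graph G \<Longrightarrow> numbered_matroid (dual_graph_matroid G)"
  using is_matroid_sparse_paving[OF sparse_dual_edge_family]
  by (simp add: numbered_matroid_def dual_graph_matroid_def Let_def)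

lemma spanning_sets_dual_graph_matroid:
  assumes "numbered_graph G"
  defines "N \<equiv> 2 * (card (verts G) + 2)"
  shows "spanning_sets (dual_graph_matroid G) = (\<lambda>X. {..<N} - X) ` indep (graph_matroid G)"
proof -
  have N4: "4 \<le> N" by (simp add: N_def)
  have inj: "{..<N} - X \<in> (\<lambda>A. {..<N} - A) ` edge_family G \<longleftrightarrow> X \<in> edge_family G" if "X \<subseteq> {..<N}" for X
  proof
    assume "{..<N} - X \<in> (\<lambda>A. {..<N} - A) ` edge_family G"
    then obtain A where A: "A \<in> edge_family G" "{..<N} - X = {..<N} - A" by blast
    have "A \<subseteq> {..<N}" using edge_family_props(1)[OF assms(1) A(1)] by (simp add: N_def)
    then have "X = A" using A(2) that by blast
    then show "X \<in> edge_family G" using A(1) by simp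
  qed auto
  have sp: "Y \<in> spanning_sets (dual_graph_matroid G) \<longleftrightarrow>
      Y \<subseteq> {..<N} \<and> (N - 4 < card Y \<or> card Y = N - 4 \<and> Y \<notin> (\<lambda>A. {..<N} - A) ` edge_family G)" for Y
    using spanning_sets_sparse_paving[OF sparse_dual_edge_family[OF assms(1)], of Y] N4
    by (simp add: dual_graph_matroid_def Let_def N_def)
  have key: "{..<N} - X \<in> spanning_sets (dual_graph_matroid G) \<longleftrightarrow> X \<in> indep (graph_matroid G)"
    if X: "X \<subseteq> {..<N}" for X
  proof -
    have c: "card ({..<N} - X) = N - card X" "card X \<le> N"
      using X finite_subset[of X "{..<N}"] card_mono[of "{..<N}" X] by (simp_all add: card_Diff_subset)
    have "N - 4 < N - card X \<longleftrightarrow> card X < 4" "N - card X = N - 4 \<longleftrightarrow> card X = 4" using N4 c(2) by linarith+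
    then show ?thesis unfolding sp inj[OF X] c(1) using X by (simp add: graph_matroid_def N_def)
  qed
  have sub: "X \<subseteq> {..<N}" if "X \<in> indep (graph_matroid G)" for X
    using that by (simp add: graph_matroid_def N_def)
  show ?thesis
  proof
    show "spanning_sets (dual_graph_matroid G) \<subseteq> (\<lambda>X. {..<N} - X) ` indep (graph_matroid G)"
    proof
      fix Y
      assume Y: "Y \<in> spanning_sets (dual_graph_matroid G)"
      then have "Y \<subseteq> {..<N}" using sp by simp
      then have "Y = {..<N} - ({..<N} - Y)" by blast
      then show "Y \<in> (\<lambda>X. {..<N} - X) ` indep (graph_matroid G)"
        using key[of "{..<N} - Y"] Y by (metis Diff_subset imageI)
    qed
    show "(\<lambda>X. {..<N} - X) ` indep (graph_matroid G) \<subseteq> spanning_sets (dual_graph_matroid G)"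
      using key sub by blast
  qed
qed

section \<open>Recovering a graph from its doubled edges\<close>

lemma verts_eq: "numbered_graph G \<Longrightarrow> verts G = {..<card (verts G)}"
  unfolding numbered_graph_def by blast

lemma edge_props:
  assumes "numbered_graph G" "e \<in> edges G"
  shows "e \<subseteq> {..<card (verts G)}" "card e = 2"
  using assms verts_eq[OF assms(1)] by (simp_all add: numbered_graph_def is_simple_graph_def)

lemma edge_pair:
  assumes "numbered_graph G" "e \<in> edges G"
  obtains u v where "e = {u, v}" "u < card (verts G)" "v < card (verts G)" "u \<noteq> v"
proof -
  obtain u v where uv: "e = {u, v}" "u \<noteq> v" using edge_props(2)[OF assms] by (auto simp: card_2_iff)
  then show thesis using that[of u v] edge_props(1)[OF assms] by simp
qed

lemma ext_edges_low:
  "u < card (verts G) \<Longrightarrow> v < card (verts G) \<Longrightarrow> {u, v} \<in> ext_edges G \<longleftrightarrow> {u, v} \<in> edges G"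
  by (auto simp: ext_edges_def doubleton_eq_iff)

lemma ext_edges_top: "u < card (verts G) \<Longrightarrow> {u, card (verts G)} \<in> ext_edges G"
  by (auto simp: ext_edges_def)

lemma twin_in_edge_family:
  assumes "numbered_graph G" "e \<subseteq> {..<card (verts G) + 2}"
  shows "twin (card (verts G) + 2) e \<in> edge_family G \<longleftrightarrow> e \<in> ext_edges G"
proof
  assume "twin (card (verts G) + 2) e \<in> edge_family G"
  then obtain e' where e': "e' \<in> ext_edges G" "twin (card (verts G) + 2) e = twin (card (verts G) + 2) e'"
    by (auto simp: edge_family_def)
  have "e' \<subseteq> {..<card (verts G) + 2}" using ext_edges_props(1)[OF assms(1) e'(1)] by auto
  then have "e = e'" using twin_eq_iff[OF assms(2)] e'(2) by blast
  then show "e \<in> ext_edges G" using e'(1) by simp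
qed (simp add: edge_family_def)

text \<open>\<open>f\<close> need not respect the doubling a priori. But two doubled edges at the
  universal vertex \<open>n\<close> meet exactly in the pair of \<open>n\<close>, and removing this
  pair from the double of \<open>{u, n}\<close> leaves the pair of \<open>u\<close>. Hence
  \<open>f\<close> maps pairs of vertices up to \<open>n\<close> to such pairs and induces a map
  \<open>g\<close> between the extended graphs. This takes two vertices of \<open>G\<close>; with
  fewer there are no edges to compare.\<close>

lemma graph_isomorphic_of_edge_families:
  assumes G: "numbered_graph G" and H: "numbered_graph H"
    and f: "bij_betw f {..<2 * (card (verts G) + 2)} {..<2 * (card (verts H) + 2)}"
    and fam: "\<And>A. A \<subseteq> {..<2 * (card (verts G) + 2)} \<Longrightarrow> card A = 4 \<Longrightarrow> A \<in> edge_family G \<longleftrightarrow> f ` A \<in> edge_family H"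
  shows "graph_isomorphic G H"
proof -
  define n where "n = card (verts G)"
  have n': "card (verts H) = n" using bij_betw_same_card[OF f] by (simp add: n_def)
  have vG: "verts G = {..<n}" and vH: "verts H = {..<n}" using verts_eq[OF G] verts_eq[OF H] n' n_def by simp_all
  let ?m = "n + 2"
  have inj: "inj_on f {..<2 * ?m}" using f by (simp add: bij_betw_def n_def)
  have fam': "A \<in> edge_family G \<Longrightarrow> f ` A \<in> edge_family H" for A
    using fam[of A] edge_family_props[OF G, of A] by simp
  have low: "e \<subseteq> {..<?m}" if "e \<in> ext_edges H" for e
    using ext_edges_props(1)[OF H that] n' by auto
  show ?thesis
  proof (cases "n \<ge> 2")
    case False
    have no: "edges K = {}" if K: "numbered_graph K" "card (verts K) = n" for K :: "nat graph"
    proof (rule ccontr)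
      assume "edges K \<noteq> {}"
      then obtain e where "e \<in> edges K" by blast
      then have "card e \<le> card {..<n}" "card e = 2"
        using edge_props[OF K(1), of e] K(2) card_mono[of "{..<n}" e] by simp_all
      then show False using False by simp
    qed
    have "edges G = {}" "edges H = {}" using no[OF G] no[OF H] n' n_def by simp_all
    then show ?thesis by (intro graph_isomorphicI[of id]) (simp_all add: vG vH)
  next
    case True
    have img: "\<exists>a \<in> ext_edges H. f ` twin ?m {u, n} = twin ?m a" if "u < n" for u
    proof -
      have "{u, n} \<in> ext_edges G" using ext_edges_top[of u G] that by (simp add: n_def)
      then have "twin ?m {u, n} \<in> edge_family G" by (simp add: edge_family_def n_def)
      then have "f ` twin ?m {u, n} \<in> edge_family H" by (rule fam')
      then show ?thesis by (auto simp: edge_family_def n')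
    qed
    have tw: "twin ?m e \<subseteq> {..<2 * ?m}" if "e \<subseteq> {..<?m}" for e using twin_subset[OF that] by simp
    obtain a where a: "a \<in> ext_edges H" "f ` twin ?m {0, n} = twin ?m a" using img[of 0] True by auto
    obtain b where b: "b \<in> ext_edges H" "f ` twin ?m {1, n} = twin ?m b" using img[of 1] True by auto
    have "f ` twin ?m {n} = twin ?m (a \<inter> b)"
    proof -
      have "{0, n} \<inter> {1, n} = {n}" using True by auto
      then have "twin ?m {n} = twin ?m {0, n} \<inter> twin ?m {1, n}" using twin_Int[of "{0, n}" ?m "{1, n}"] by simp
      then have "f ` twin ?m {n} = f ` twin ?m {0, n} \<inter> f ` twin ?m {1, n}"
        using inj_on_image_Int[OF inj tw tw, of "{0, n}" "{1, n}"] by simp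
      then show ?thesis using a(2) b(2) twin_Int[OF low[OF a(1)] low[OF b(1)]] by simp
    qed
    moreover have "card (f ` twin ?m {n}) = 2"
      using card_image[OF inj_on_subset[OF inj tw[of "{n}"]]] card_twin[of "{n}" ?m] by simp
    moreover have "card (twin ?m (a \<inter> b)) = 2 * card (a \<inter> b)" by (rule card_twin) (use low[OF a(1)] in blast)
    ultimately have "card (a \<inter> b) = 1" by simp
    then obtain x where "a \<inter> b = {x}" by (auto simp: card_1_singleton_iff)
    then have x: "f ` twin ?m {n} = twin ?m {x}" "x \<in> a" using \<open>f ` twin ?m {n} = twin ?m (a \<inter> b)\<close> by auto
    have xn: "x \<le> n" using ext_edges_props(1)[OF H a(1)] x(2) n' by auto
    have "\<exists>y \<le> n. f ` twin ?m {u} = twin ?m {y}" if u: "u < n" for u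
    proof -
      obtain c where c: "c \<in> ext_edges H" "f ` twin ?m {u, n} = twin ?m c" using img[OF u] by blast
      have "twin ?m {x} \<subseteq> twin ?m c" unfolding c(2)[symmetric] x(1)[symmetric] by (rule image_mono) (auto simp: twin_def)
      moreover have "x \<in> twin ?m {x}" by (simp add: twin_def)
      ultimately have "x \<in> twin ?m c \<inter> {..<?m}" using xn by (intro IntI) (erule subsetD, simp_all)
      then have xc: "x \<in> c" unfolding twin_Int_low[OF low[OF c(1)]] .
      have "card c = 2" by (rule ext_edges_props(2)[OF H c(1)])
      then obtain y where y: "c = {x, y}" "x \<noteq> y" using xc by (auto simp: card_2_iff)
      \<comment> \<open>Edges avoid the isolated vertex \<open>n + 1\<close>, so \<open>g\<close>
        will stay within \<open>{..n}\<close>.\<close>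
      have yn: "y \<le> n" using ext_edges_props(1)[OF H c(1)] y(1) n' by auto
      have tu: "twin ?m {u} = twin ?m {u, n} - twin ?m {n}" using u by (auto simp: twin_def)
      have s1: "twin ?m {u, n} \<subseteq> {..<2 * ?m}" by (rule tw) (use u in auto)
      have s2: "twin ?m {n} \<subseteq> {..<2 * ?m}" by (rule tw) auto
      have "f ` (twin ?m {u, n} - twin ?m {n}) = f ` twin ?m {u, n} - f ` twin ?m {n}"
        by (rule inj_on_image_set_diff[OF inj _ s2]) (use s1 in blast)
      then have "f ` twin ?m {u} = f ` twin ?m {u, n} - f ` twin ?m {n}" unfolding tu .
      also have "\<dots> = twin ?m {y}" unfolding c(2) x(1) y(1) using y(2) xn yn by (auto simp: twin_def)
      finally show ?thesis using yn by blast
    qed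
    then have "\<forall>u. u \<le> n \<longrightarrow> (\<exists>y \<le> n. f ` twin ?m {u} = twin ?m {y})" using x(1) xn by (metis le_neq_implies_less)
    then obtain g where g: "\<And>u. u \<le> n \<Longrightarrow> g u \<le> n" "\<And>u. u \<le> n \<Longrightarrow> f ` twin ?m {u} = twin ?m {g u}"
      by metis
    have ginj: "g u = g v \<Longrightarrow> u = v" if "u \<le> n" "v \<le> n" for u v
    proof -
      assume "g u = g v"
      then have "f ` twin ?m {u} = f ` twin ?m {v}" using g(2) that by simp
      then have "twin ?m {u} = twin ?m {v}"
        using inj_on_image_eq_iff[OF inj tw[of "{u}"] tw[of "{v}"]] that by simp
      then show "u = v" using twin_eq_iff[of "{u}" ?m "{v}"] that by simp
    qed
    have pair: "twin ?m {u, v} = twin ?m {u} \<union> twin ?m {v}" for u v by (auto simp: twin_def)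
    have ge: "{u, v} \<in> ext_edges G \<longleftrightarrow> {g u, g v} \<in> ext_edges H" if uv: "u \<le> n" "v \<le> n" "u \<noteq> v" for u v
    proof -
      have "{u, v} \<in> ext_edges G \<longleftrightarrow> twin ?m {u, v} \<in> edge_family G"
        using twin_in_edge_family[OF G, of "{u, v}"] uv by (simp add: n_def)
      also have "\<dots> \<longleftrightarrow> f ` twin ?m {u, v} \<in> edge_family H"
        using fam[of "twin ?m {u, v}"] tw[of "{u, v}"] card_twin[of "{u, v}" ?m] uv by (simp add: n_def)
      also have "f ` twin ?m {u, v} = twin ?m {g u, g v}"
        by (simp only: pair[of u v] pair[of "g u" "g v"] image_Un g(2)[OF uv(1)] g(2)[OF uv(2)])
      also have "twin ?m {g u, g v} \<in> edge_family H \<longleftrightarrow> {g u, g v} \<in> ext_edges H"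
        using twin_in_edge_family[OF H, of "{g u, g v}"] g(1) uv by (simp add: n' less_Suc_eq_le le_SucI)
      finally show ?thesis .
    qed
    text \<open>The image of the universal vertex is universal, too, and can be exchanged with it.\<close>
    define h where "h u = (if g u = n then g n else g u)" for u
    have hn: "h u < n" if "u < n" for u
      using g(1)[of u] g(1)[of n] ginj[of u n] that by (auto simp: h_def le_less)
    have hinj: "inj_on h {..<n}"
    proof (rule inj_onI)
      fix u v
      assume uv: "u \<in> {..<n}" "v \<in> {..<n}" "h u = h v"
      have *: "g u \<noteq> g n" "g v \<noteq> g n" using ginj[of u n] ginj[of v n] uv(1,2) by auto
      then have "g u = g v" using uv(3) by (auto simp: h_def split: if_splits)
      then show "u = v" using ginj[of u v] uv(1,2) by simp
    qed
    have hb: "bij_betw h {..<n} {..<n}"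
      using hinj hn endo_inj_surj[of "{..<n}" h] by (auto simp: bij_betw_def)
    have topH: "{n, v} \<in> ext_edges H" "{v, n} \<in> ext_edges H" if "v < n" for v
      using ext_edges_top[of v H] that by (simp_all add: n' insert_commute)
    have topG: "{n, v} \<in> ext_edges G" "{v, n} \<in> ext_edges G" if "v < n" for v
      using ext_edges_top[of v G] that by (simp_all add: n_def insert_commute)
    have he: "{u, v} \<in> ext_edges G \<longleftrightarrow> {h u, h v} \<in> ext_edges H" if uv: "u < n" "v < n" "u \<noteq> v" for u v
    proof (cases "g u = n \<or> g v = n")
      case False
      then show ?thesis using ge[of u v] uv by (simp add: h_def)
    next
      case True
      \<comment> \<open>Both sides are true here: the left one because \<open>n\<close> is universal
        in the extension of \<open>H\<close>, the right one because it is universal in the extension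
        of \<open>G\<close>.\<close>
      have gg: "g u \<noteq> g v" using ginj[of u v] uv by auto
      have l: "{u, v} \<in> ext_edges G"
      proof (cases "g u = n")
        case True
        then have "g v < n" using gg g(1)[of v] uv(2) by simp
        then show ?thesis using ge[of u v] uv True topH(1)[of "g v"] by simp
      next
        case False
        then have "g v = n" "g u < n" using True g(1)[of u] uv(1) by auto
        then show ?thesis using ge[of u v] uv topH(2)[of "g u"] by simp
      qed
      have r: "{h u, h v} \<in> ext_edges H"
      proof (cases "g u = n")
        case True
        then have "h u = g n" "h v = g v" using gg by (simp_all add: h_def)
        then show ?thesis using ge[of n v] topG(1)[of v] uv by simp
      next
        case False
        then have "h v = g n" "h u = g u" using True by (simp_all add: h_def)
        then show ?thesis using ge[of u n] topG(2)[of u] uv by simp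
      qed
      show ?thesis using l r by simp
    qed
    show ?thesis
    proof (rule graph_isomorphicI)
      show "bij_betw h (verts G) (verts H)" using hb vG vH by simp
      fix u v
      assume "u \<in> verts G" "v \<in> verts G"
      then have uv: "u < n" "v < n" by (simp_all add: vG)
      show "{u, v} \<in> edges G \<longleftrightarrow> {h u, h v} \<in> edges H"
      proof (cases "u = v")
        case True
        then show ?thesis using edge_props(2)[OF G, of "{u}"] edge_props(2)[OF H, of "{h u}"] by auto
      next
        case False
        then show ?thesis
          using he[OF uv] ext_edges_low[of u G v] ext_edges_low[of "h u" H "h v"] uv hn[of u] hn[of v] n'
          by (simp add: n_def)
      qed
    qed
  qed
qed

text \<open>The isomorphism is extended by the identity to the two new vertices and acts on both
  copies alike.\<close>

lemma edge_families_of_graph_isomorphic: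
  assumes G: "numbered_graph G" and H: "numbered_graph H" and iso: "graph_isomorphic G H"
  obtains f where "bij_betw f {..<2 * (card (verts G) + 2)} {..<2 * (card (verts H) + 2)}"
    "\<And>A. A \<subseteq> {..<2 * (card (verts G) + 2)} \<Longrightarrow> A \<in> edge_family G \<longleftrightarrow> f ` A \<in> edge_family H"
    "card (verts H) = card (verts G)"
proof -
  obtain g where g: "bij_betw g (verts G) (verts H)"
    and e: "\<And>u v. u \<in> verts G \<Longrightarrow> v \<in> verts G \<Longrightarrow> {u, v} \<in> edges G \<longleftrightarrow> {g u, g v} \<in> edges H"
    by (rule graph_isomorphicE[OF iso]) (rule that)
  define n where "n = card (verts G)"
  have n': "card (verts H) = n" using bij_betw_same_card[OF g] by (simp add: n_def)
  have vG: "verts G = {..<n}" and vH: "verts H = {..<n}" using verts_eq[OF G] verts_eq[OF H] n' n_def by simp_all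
  let ?m = "n + 2"
  define p where "p i = (if i < n then g i else i)" for i
  have p: "bij p" using bij_extend[of g n] g vG vH by (simp add: p_def[abs_def])
  have injp: "inj p" using p by (rule bij_is_inj)
  have pn: "p i < n" if "i < n" for i using bij_betwE[OF g] that vG vH by (simp add: p_def)
  have pm: "p i < ?m" if "i < ?m" for i using pn[of i] that by (cases "i < n") (auto simp: p_def)
  define f where "f i = (if i < ?m then p i else p (i - ?m) + ?m)" for i
  have finj: "inj_on f {..<2 * ?m}"
  proof (rule inj_onI)
    fix i j
    assume ij: "i \<in> {..<2 * ?m}" "j \<in> {..<2 * ?m}" "f i = f j"
    have "i < ?m \<longleftrightarrow> j < ?m" using ij pm[of i] pm[of j] by (auto simp: f_def split: if_splits)
    then show "i = j" using ij injD[OF injp, of i j] injD[OF injp, of "i - ?m" "j - ?m"] by (auto simp: f_def split: if_splits)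
  qed
  have fr: "f i < 2 * ?m" if "i < 2 * ?m" for i using pm[of i] pm[of "i - ?m"] that by (auto simp: f_def)
  have fb: "bij_betw f {..<2 * ?m} {..<2 * ?m}"
    using finj fr endo_inj_surj[of "{..<2 * ?m}" f] by (auto simp: bij_betw_def)
  have ft: "f ` twin ?m d = twin ?m (p ` d)" if d: "d \<subseteq> {..<?m}" for d
  proof -
    have "f ` d = p ` d" by (rule image_cong) (use d in \<open>auto simp: f_def\<close>)
    moreover have "f ` (\<lambda>i. i + ?m) ` d = (\<lambda>i. i + ?m) ` p ` d" unfolding image_image by (rule image_cong) (auto simp: f_def)
    ultimately show ?thesis unfolding twin_def image_Un by simp
  qed
  have lowG: "d \<subseteq> {..<?m}" if "d \<in> ext_edges G" for d using ext_edges_props(1)[OF G that] by (auto simp: n_def)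
  have pe: "p ` d \<in> ext_edges H" if d: "d \<in> ext_edges G" for d
  proof (cases "d \<in> edges G")
    case True
    then obtain u v where uv: "d = {u, v}" "u < n" "v < n" "u \<noteq> v" using edge_pair[OF G] by (metis n_def)
    then have "{g u, g v} \<in> edges H" using e[of u v] True vG by simp
    then show ?thesis using uv by (simp add: p_def ext_edges_def)
  next
    case False
    then obtain u where u: "u < n" "d = {u, n}" using d by (auto simp: ext_edges_def n_def)
    then show ?thesis using ext_edges_top[of "g u" H] pn[OF u(1)] n' by (simp add: p_def insert_commute)
  qed
  have pe': "\<exists>d \<in> ext_edges G. d' = p ` d" if d': "d' \<in> ext_edges H" for d'
  proof (cases "d' \<in> edges H")
    case True
    then obtain a b where ab: "d' = {a, b}" "a < n" "b < n" using edge_pair[OF H] by (metis n')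
    have "g ` {..<n} = {..<n}" using g vG vH by (simp add: bij_betw_def)
    then obtain u v where uv: "u < n" "v < n" "a = g u" "b = g v" using ab(2,3) by (metis imageE lessThan_iff)
    then have "{u, v} \<in> edges G" using e[of u v] True ab(1) vG by simp
    then show ?thesis using uv ab(1) by (intro bexI[of _ "{u, v}"]) (simp_all add: p_def ext_edges_def)
  next
    case False
    then obtain a where a: "a < n" "d' = {a, n}" using d' by (auto simp: ext_edges_def n')
    have "g ` {..<n} = {..<n}" using g vG vH by (simp add: bij_betw_def)
    then obtain u where "u < n" "a = g u" using a(1) by (metis imageE lessThan_iff)
    then show ?thesis using a(2) ext_edges_top[of u G]
      by (intro bexI[of _ "{u, n}"]) (simp_all add: p_def n_def insert_commute)
  qed
  have fam: "A \<in> edge_family G \<longleftrightarrow> f ` A \<in> edge_family H" if A: "A \<subseteq> {..<2 * ?m}" for A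
  proof
    assume "A \<in> edge_family G"
    then obtain d where d: "d \<in> ext_edges G" "A = twin ?m d" by (auto simp: edge_family_def n_def)
    then show "f ` A \<in> edge_family H" using ft[OF lowG[OF d(1)]] pe[OF d(1)] by (simp add: edge_family_def n')
  next
    assume "f ` A \<in> edge_family H"
    then obtain d' where d': "d' \<in> ext_edges H" "f ` A = twin ?m d'" by (auto simp: edge_family_def n')
    obtain d where d: "d \<in> ext_edges G" "d' = p ` d" using pe'[OF d'(1)] by blast
    have "f ` A = f ` twin ?m d" using d'(2) d(2) ft[OF lowG[OF d(1)]] by simp
    moreover have "twin ?m d \<subseteq> {..<2 * ?m}" by (rule twin_subset[OF lowG[OF d(1)]])
    ultimately have "A = twin ?m d" using inj_on_image_eq_iff[OF finj A, of "twin ?m d"] by blast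
    then show "A \<in> edge_family G" using d(1) by (simp add: edge_family_def n_def)
  qed
  show thesis by (rule that[of f]) (use fb fam n' in \<open>simp_all add: n_def\<close>)
qed

text \<open>The doubled edges are exactly the dependent sets of 4 elements, and all smaller sets are
  independent, so both matroids carry the same information as the edge families.\<close>

lemma graph_matroid_iso:
  assumes G: "numbered_graph G" and H: "numbered_graph H"
  shows "matroid_isomorphic (graph_matroid G) (graph_matroid H) \<longleftrightarrow> graph_isomorphic G H"
proof
  let ?N = "2 * (card (verts G) + 2)" and ?N' = "2 * (card (verts H) + 2)"
  assume "matroid_isomorphic (graph_matroid G) (graph_matroid H)"
  then obtain f where f: "bij_betw f {..<?N} {..<?N'}"
    and X: "\<And>X. X \<subseteq> {..<?N} \<Longrightarrow> X \<in> indep (graph_matroid G) \<longleftrightarrow> f ` X \<in> indep (graph_matroid H)"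
    unfolding matroid_isomorphic_def graph_matroid_def sparse_paving_sel(1) by (elim exE conjE) simp
  show "graph_isomorphic G H"
  proof (rule graph_isomorphic_of_edge_families[OF G H f])
    fix A
    assume A: "A \<subseteq> {..<?N}" "card A = 4"
    have "inj_on f A" using f A(1) by (auto simp: bij_betw_def intro: inj_on_subset)
    then have "card (f ` A) = 4" using A(2) by (simp add: card_image)
    moreover have "f ` A \<subseteq> {..<?N'}" using f A(1) by (auto simp: bij_betw_def)
    ultimately show "A \<in> edge_family G \<longleftrightarrow> f ` A \<in> edge_family H"
      using X[OF A(1)] A by (simp add: graph_matroid_def)
  qed
next
  assume "graph_isomorphic G H"
  then obtain f where f: "bij_betw f {..<2 * (card (verts G) + 2)} {..<2 * (card (verts H) + 2)}"
    and fam: "\<And>A. A \<subseteq> {..<2 * (card (verts G) + 2)} \<Longrightarrow> A \<in> edge_family G \<longleftrightarrow> f ` A \<in> edge_family H"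
    and n: "card (verts H) = card (verts G)"
    using edge_families_of_graph_isomorphic[OF G H] by metis
  have "X \<in> indep (graph_matroid G) \<longleftrightarrow> f ` X \<in> indep (graph_matroid H)" if X: "X \<subseteq> ground (graph_matroid G)" for X
  proof -
    have X': "X \<subseteq> {..<2 * (card (verts G) + 2)}" using X by (simp add: graph_matroid_def)
    have "inj_on f X" using f X' by (auto simp: bij_betw_def intro: inj_on_subset)
    then have "card (f ` X) = card X" by (rule card_image)
    moreover have "f ` X \<subseteq> {..<2 * (card (verts H) + 2)}" using f X' by (auto simp: bij_betw_def)
    ultimately show ?thesis using fam[OF X'] X' by (simp add: graph_matroid_def)
  qed
  then show "matroid_isomorphic (graph_matroid G) (graph_matroid H)"
    unfolding matroid_isomorphic_def using f by (intro exI[of _ f] conjI allI impI) (simp_all add: graph_matroid_def)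
qed

lemma ground_dual_graph_matroid: "ground (dual_graph_matroid G) = {..<2 * (card (verts G) + 2)}"
  by (simp add: dual_graph_matroid_def Let_def)

lemma indep_dual_graph_matroid:
  assumes "numbered_graph G"
  defines "N \<equiv> 2 * (card (verts G) + 2)"
  shows "X \<in> indep (dual_graph_matroid G) \<longleftrightarrow>
    X \<subseteq> {..<N} \<and> (card X < N - 4 \<or> card X = N - 4 \<and> {..<N} - X \<notin> edge_family G)"
proof (cases "X \<subseteq> {..<N}")
  case True
  have "X \<in> (\<lambda>A. {..<N} - A) ` edge_family G \<longleftrightarrow> {..<N} - X \<in> edge_family G"
  proof
    assume "X \<in> (\<lambda>A. {..<N} - A) ` edge_family G"
    then obtain A where A: "A \<in> edge_family G" "X = {..<N} - A" by (elim imageE)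
    have "A \<subseteq> {..<N}" using edge_family_props(1)[OF assms(1) A(1)] by (simp add: N_def)
    then show "{..<N} - X \<in> edge_family G" using A by (simp add: double_diff)
  next
    assume "{..<N} - X \<in> edge_family G"
    then show "X \<in> (\<lambda>A. {..<N} - A) ` edge_family G"
      using True by (intro image_eqI[of _ _ "{..<N} - X"]) (simp_all add: double_diff)
  qed
  then show ?thesis by (simp add: dual_graph_matroid_def Let_def N_def)
qed (simp add: dual_graph_matroid_def Let_def N_def)

text \<open>The same comparison, made on complements, which a bijection of the ground sets
  preserves.\<close>

lemma dual_graph_matroid_iso:
  assumes G: "numbered_graph G" and H: "numbered_graph H"
  shows "matroid_isomorphic (dual_graph_matroid G) (dual_graph_matroid H) \<longleftrightarrow> graph_isomorphic G H"
proof
  let ?N = "2 * (card (verts G) + 2)" and ?N' = "2 * (card (verts H) + 2)"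
    assume "matroid_isomorphic (dual_graph_matroid G) (dual_graph_matroid H)"
    then obtain f where f: "bij_betw f {..<?N} {..<?N'}"
      and X: "\<And>X. X \<subseteq> {..<?N} \<Longrightarrow> X \<in> indep (dual_graph_matroid G) \<longleftrightarrow> f ` X \<in> indep (dual_graph_matroid H)"
      unfolding matroid_isomorphic_def ground_dual_graph_matroid by (elim exE conjE) simp
    have N: "?N = ?N'" using bij_betw_same_card[OF f] by simp
    have inj: "inj_on f {..<?N}" and im: "f ` {..<?N} = {..<?N'}" using f by (simp_all add: bij_betw_def)
    show "graph_isomorphic G H"
    proof (rule graph_isomorphic_of_edge_families[OF G H f])
      fix A
      assume A: "A \<subseteq> {..<?N}" "card A = 4"
      let ?X = "{..<?N} - A"
      have fA: "f ` ?X = {..<?N'} - f ` A" using inj_on_image_set_diff[OF inj, of "{..<?N}" A] A(1) im by auto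
      have "card ?X = ?N - 4" using A finite_subset[of A "{..<?N}"] by (simp add: card_Diff_subset)
      moreover have "card (f ` ?X) = card ?X" by (rule card_image) (rule inj_on_subset[OF inj], blast)
      moreover have "f ` A \<subseteq> {..<?N'}" using A(1) im by blast
      ultimately show "A \<in> edge_family G \<longleftrightarrow> f ` A \<in> edge_family H"
        using X[of ?X] A(1) N unfolding indep_dual_graph_matroid[OF G] indep_dual_graph_matroid[OF H] fA by (simp add: double_diff)
    qed
  next
    let ?N = "2 * (card (verts G) + 2)" and ?N' = "2 * (card (verts H) + 2)"
    assume "graph_isomorphic G H"
    then obtain f where f: "bij_betw f {..<?N} {..<?N'}"
      and fam: "\<And>A. A \<subseteq> {..<?N} \<Longrightarrow> A \<in> edge_family G \<longleftrightarrow> f ` A \<in> edge_family H"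
      and n: "card (verts H) = card (verts G)"
      using edge_families_of_graph_isomorphic[OF G H] by metis
    have inj: "inj_on f {..<?N}" and im: "f ` {..<?N} = {..<?N'}" using f by (simp_all add: bij_betw_def)
    have "X \<in> indep (dual_graph_matroid G) \<longleftrightarrow> f ` X \<in> indep (dual_graph_matroid H)" if X: "X \<subseteq> {..<?N}" for X
    proof -
      have "card (f ` X) = card X" by (rule card_image) (rule inj_on_subset[OF inj X])
      moreover have "f ` X \<subseteq> {..<?N'}" using X im by blast
      moreover have "f ` ({..<?N} - X) = {..<?N'} - f ` X" using inj_on_image_set_diff[OF inj, of "{..<?N}" X] X im by auto
      ultimately show ?thesis using fam[of "{..<?N} - X"] X n unfolding indep_dual_graph_matroid[OF G] indep_dual_graph_matroid[OF H] by simp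
    qed
    then show "matroid_isomorphic (dual_graph_matroid G) (dual_graph_matroid H)"
      unfolding matroid_isomorphic_def ground_dual_graph_matroid using f by (intro exI[of _ f] conjI allI impI)
qed

subsection \<open>Computing descriptions of these matroids\<close>

lemma char_vector_letters: "Comma \<notin> set (char_vector n X)" "Amp \<notin> set (char_vector n X)"
  by (auto simp: char_vector_def)

lemma graph_word_enc_list:
  "graph_word G = enc_list (map (\<lambda>u. char_vector (card (verts G)) {v. {u, v} \<in> edges G}) [0..<card (verts G)])"
  by (simp add: graph_word_def Let_def enc_list_def comp_def)

lemma commas_append: "commas (x @ y) = commas x @ commas y"
  by (simp add: commas_def)

lemma commas_none: "Comma \<notin> set x \<Longrightarrow> commas x = []"
  by (induction x) (auto simp: commas_def)

lemma commas_enc_list: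
  "(\<And>x. x \<in> set xs \<Longrightarrow> Comma \<notin> set x) \<Longrightarrow> commas (enc_list xs) = replicate (length xs) Comma"
proof (induction xs)
  case (Cons x xs)
  have "commas (Comma # x @ enc_list xs) = Comma # commas (x @ enc_list xs)" by (simp add: commas_def)
  then show ?case using Cons by (simp add: commas_append commas_none)
qed (simp add: commas_def)

lemma concat_suffixes_enc_list:
  assumes "\<And>x. x \<in> set xs \<Longrightarrow> Comma \<notin> set x"
  shows "concat (map (\<lambda>p. if starts Comma p then f p else []) (tails (enc_list xs))) =
    concat (map (\<lambda>s. f (enc_list s)) (tails xs))"
  using assms
proof (induction xs)
  case (Cons x xs)
  have "concat (map (\<lambda>p. if starts Comma p then f p else []) (map (\<lambda>z. z @ enc_list xs) (tails x))) = []"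
    using tails_no_Comma[of x] Cons.prems by auto
  then show ?case using Cons by (simp add: tails_append)
qed simp

lemma concat_if_enc_list: "concat (map (\<lambda>v. if P v then Comma # g v else []) vs) = enc_list (map g (filter P vs))"
  by (induction vs) auto

lemma concat_enc_list: "concat (map (\<lambda>u. enc_list (g u)) us) = enc_list (concat (map g us))"
  by (induction us) (auto simp: enc_list_append)

lemma char_vector_pair:
  assumes "u < v" "v < m"
  shows "char_vector m {u, v} = replicate u Zero @ One # replicate (v - u - 1) Zero @ One # replicate (m - v - 1) Zero"
proof (rule nth_equalityI)
  fix i
  assume "i < length (char_vector m {u, v})"
  then have i: "i < m" by simp
  consider "i < u" | "i = u" | "u < i" "i < v" | "i = v" | "v < i" by linarith
  then show "char_vector m {u, v} ! i =
      (replicate u Zero @ One # replicate (v - u - 1) Zero @ One # replicate (m - v - 1) Zero) ! i"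
    using assms i by cases (auto simp: char_vector_nth nth_append nth_Cons')
qed (use assms in simp)

lemma char_vector_twin:
  assumes "e \<subseteq> {..<m}"
  shows "char_vector (2 * m) (twin m e) = char_vector m e @ char_vector m e"
proof (rule nth_equalityI)
  fix i
  assume "i < length (char_vector (2 * m) (twin m e))"
  then have i: "i < 2 * m" by simp
  have "i \<in> twin m e \<longleftrightarrow> (if i < m then i \<in> e else i - m \<in> e)"
    using assms i by (auto simp: twin_def image_iff intro: bexI[of _ "i - m"])
  then show "char_vector (2 * m) (twin m e) ! i = (char_vector m e @ char_vector m e) ! i"
    using i by (simp add: char_vector_nth nth_append)
qed simp

lemma zeros_replicate: "zeros x = replicate (length x) Zero"
  by (simp add: zeros_def map_replicate_const)

text \<open>The doubled edges in the order in which the loops of \<open>edge_vectors\<close> meet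
  them, the smaller end of the edge coming first.\<close>

definition edge_vector_list :: "nat graph \<Rightarrow> word list" where
  "edge_vector_list G = (let n = card (verts G) in
     concat (map (\<lambda>u. map (\<lambda>v. char_vector (2 * (n + 2)) (twin (n + 2) {u, v}))
       (filter (\<lambda>v. u < v \<and> {u, v} \<in> ext_edges G) [0..<n + 1])) [0..<n]))"

text \<open>From the comma of row \<open>u\<close> on there are \<open>n - u\<close> commas, and the
  pointer to entry \<open>v\<close> has length \<open>n + 1 - v\<close>. So the length test in
  \<open>edge_vectors\<close> says \<open>u < v\<close>, and each edge is met once.\<close>

lemma edge_vectors_graph_word: "edge_vectors (graph_word G) = enc_list (edge_vector_list G)"
proof -
  define n where "n = card (verts G)"
  define row where "row u = char_vector n {v. {u, v} \<in> edges G}" for u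
  define rows where "rows = map row [0..<n]"
  define w where "w = graph_word G"
  have w: "w = enc_list rows" unfolding w_def graph_word_enc_list rows_def row_def n_def ..
  have noC: "Comma \<notin> set x" if "x \<in> set rows" for x using that by (auto simp: rows_def row_def char_vector_letters)
  have len: "length rows = n" by (simp add: rows_def)
  have cw: "commas w = replicate n Comma" unfolding w by (subst commas_enc_list) (use noC len in auto)
  let ?f = "\<lambda>p. concat (map (\<lambda>q. if starts One q \<and> length q \<le> length (commas p)
           then Comma # half_vector w p q @ half_vector w p q else []) (tails (item p @ [One])))"
  let ?cv = "\<lambda>u v. char_vector (2 * (n + 2)) (twin (n + 2) {u, v})"
  have f: "?f (enc_list (drop u rows)) = enc_list (map (?cv u) (filter (\<lambda>v. u < v \<and> {u, v} \<in> ext_edges G) [0..<n + 1]))"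
    if u: "u < n" for u
  proof -
    let ?p = "enc_list (drop u rows)"
    have noC': "Comma \<notin> set x" if "x \<in> set (drop u rows)" for x using noC in_set_dropD[OF that] by blast
    have cp: "commas ?p = replicate (n - u) Comma" by (subst commas_enc_list) (use noC' len in auto)
    have "drop u rows = row u # drop (Suc u) rows" using u len by (simp add: rows_def flip: Cons_nth_drop_Suc)
    then have it: "item ?p = row u" using item_Comma[of "row u" "drop (Suc u) rows"] by (simp add: row_def char_vector_letters)
    \<comment> \<open>The appended \<open>One\<close> is entry \<open>n\<close> of the row and joins
      \<open>u\<close> to the universal vertex.\<close>
    let ?r = "row u @ [One]"
    have lr: "length ?r = n + 1" by (simp add: row_def)
    have tl: "tails ?r = map (\<lambda>v. drop v ?r) [0..<n + 1]" unfolding tails_conv_drop lr ..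
    have "?f ?p = concat (map (\<lambda>v. if starts One (drop v ?r) \<and> length (drop v ?r) \<le> length (commas ?p)
        then Comma # half_vector w ?p (drop v ?r) @ half_vector w ?p (drop v ?r) else []) [0..<n + 1])"
      by (simp only: it tl map_map comp_def)
    also have "\<dots> = concat (map (\<lambda>v. if u < v \<and> {u, v} \<in> ext_edges G then Comma # ?cv u v else []) [0..<n + 1])"
    proof (intro arg_cong[where f = concat] map_cong refl)
      fix v
      assume "v \<in> set [0..<n + 1]"
      then have v: "v \<le> n" by (auto simp: less_Suc_eq_le)
      have s: "starts One (drop v ?r) \<longleftrightarrow> (v < n \<longrightarrow> {u, v} \<in> edges G)"
        using v lr by (subst starts_drop) (auto simp: nth_append row_def char_vector_nth)
      have e: "(v < n \<longrightarrow> {u, v} \<in> edges G) \<longleftrightarrow> {u, v} \<in> ext_edges G"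
      proof (cases "v < n")
        case True
        then show ?thesis using ext_edges_low[of u G v] u by (simp add: n_def)
      next
        case False
        then show ?thesis using ext_edges_top[of u G] u v by (simp add: n_def)
      qed
      have l: "length (drop v ?r) \<le> length (commas ?p) \<longleftrightarrow> u < v" using u v lr cp by auto
      show "(if starts One (drop v ?r) \<and> length (drop v ?r) \<le> length (commas ?p)
        then Comma # half_vector w ?p (drop v ?r) @ half_vector w ?p (drop v ?r) else []) =
        (if u < v \<and> {u, v} \<in> ext_edges G then Comma # ?cv u v else [])"
      proof (cases "u < v")
        case True
        \<comment> \<open>The runs of zeros have lengths \<open>n - (n - u)\<close>,
          \<open>(n - u) - (n + 1 - v)\<close> and \<open>n + 1 - v\<close>; the last one reaches to
          the isolated vertex \<open>n + 1\<close>.\<close>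
        have "half_vector w ?p (drop v ?r) = replicate u Zero @ One # replicate (v - u - 1) Zero @ One # replicate (n + 2 - v - 1) Zero"
          unfolding half_vector_def zeros_replicate cw cp length_drop lr length_replicate using u v True by simp
        also have "\<dots> = char_vector (n + 2) {u, v}" by (rule char_vector_pair[symmetric]) (use True v in auto)
        finally have h: "half_vector w ?p (drop v ?r) = char_vector (n + 2) {u, v}" .
        have "?cv u v = char_vector (n + 2) {u, v} @ char_vector (n + 2) {u, v}"
          by (rule char_vector_twin) (use u v in auto)
        then show ?thesis unfolding s e l h by (simp only: conj_commute)
      next
        case False
        then show ?thesis unfolding s e l by simp
      qed
    qed
    finally show ?thesis unfolding concat_if_enc_list .
  qed
  have "edge_vectors w = concat (map (\<lambda>s. ?f (enc_list s)) (tails rows))"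
    unfolding edge_vectors_def by (subst (2) w) (rule concat_suffixes_enc_list[OF noC])
  also have "\<dots> = concat (map (\<lambda>u. ?f (enc_list (drop u rows))) [0..<n])"
    unfolding tails_conv_drop[of rows] len by (simp only: map_map comp_def)
  also have "\<dots> = concat (map (\<lambda>u. enc_list (map (?cv u) (filter (\<lambda>v. u < v \<and> {u, v} \<in> ext_edges G) [0..<n + 1]))) [0..<n])"
    by (intro arg_cong[where f = concat] map_cong refl f) simp
  also have "\<dots> = enc_list (edge_vector_list G)"
    unfolding concat_enc_list edge_vector_list_def Let_def n_def ..
  finally show ?thesis unfolding w_def .
qed

lemma set_edge_vector_list:
  assumes "numbered_graph G"
  shows "set (edge_vector_list G) = char_vector (2 * (card (verts G) + 2)) ` edge_family G"
proof -
  define n where "n = card (verts G)"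
  let ?cv = "\<lambda>e. char_vector (2 * (n + 2)) (twin (n + 2) e)"
  have "set (edge_vector_list G) =
      (\<Union>u\<in>{0..<n}. (\<lambda>v. ?cv {u, v}) ` {v \<in> {0..<n + 1}. u < v \<and> {u, v} \<in> ext_edges G})"
    unfolding edge_vector_list_def Let_def n_def[symmetric] set_concat set_map set_filter set_upt image_image ..
  also have "\<dots> = {?cv {u, v} | u v. u < n \<and> v \<le> n \<and> u < v \<and> {u, v} \<in> ext_edges G}"
  proof (intro set_eqI iffI)
    fix y
    assume "y \<in> (\<Union>u\<in>{0..<n}. (\<lambda>v. ?cv {u, v}) ` {v \<in> {0..<n + 1}. u < v \<and> {u, v} \<in> ext_edges G})"
    then obtain u v where uv: "u \<in> {0..<n}" "y = ?cv {u, v}" "v \<in> {v \<in> {0..<n + 1}. u < v \<and> {u, v} \<in> ext_edges G}"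
      by (elim UN_E imageE) (rule that)
    show "y \<in> {?cv {u, v} | u v. u < n \<and> v \<le> n \<and> u < v \<and> {u, v} \<in> ext_edges G}"
      unfolding mem_Collect_eq by (intro exI[of _ u] exI[of _ v] conjI uv(2)) (use uv in simp_all)
  next
    fix y
    assume "y \<in> {?cv {u, v} | u v. u < n \<and> v \<le> n \<and> u < v \<and> {u, v} \<in> ext_edges G}"
    then obtain u v where uv: "y = ?cv {u, v}" "u < n" "v \<le> n" "u < v" "{u, v} \<in> ext_edges G"
      unfolding mem_Collect_eq by (elim exE conjE) (rule that)
    show "y \<in> (\<Union>u\<in>{0..<n}. (\<lambda>v. ?cv {u, v}) ` {v \<in> {0..<n + 1}. u < v \<and> {u, v} \<in> ext_edges G})"
      unfolding uv(1) by (intro UN_I[of u] imageI) (use uv in simp_all)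
  qed
  finally have s: "set (edge_vector_list G) = {?cv {u, v} | u v. u < n \<and> v \<le> n \<and> u < v \<and> {u, v} \<in> ext_edges G}" .
  have "\<exists>u v. e = {u, v} \<and> u < n \<and> v \<le> n \<and> u < v" if e: "e \<in> ext_edges G" for e
  proof -
    have "e \<subseteq> {..n}" "card e = 2" using ext_edges_props[OF assms e] by (simp_all add: n_def)
    then obtain a b where ab: "e = {a, b}" "a \<noteq> b" "a \<le> n" "b \<le> n" by (auto simp: card_2_iff)
    show ?thesis
    proof (cases "a < b")
      case True
      then show ?thesis using ab by (intro exI[of _ a] exI[of _ b]) simp
    next
      case False
      then show ?thesis using ab by (intro exI[of _ b] exI[of _ a]) auto
    qed
  qed
  then have "{?cv {u, v} | u v. u < n \<and> v \<le> n \<and> u < v \<and> {u, v} \<in> ext_edges G} = ?cv ` ext_edges G"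
    by (fastforce simp: image_iff)
  then show ?thesis using s by (simp add: edge_family_def image_image n_def)
qed

definition vector_set :: "word \<Rightarrow> nat set" where
  "vector_set v = {i. i < length v \<and> v ! i = One}"

lemma vector_set_char_vector: "X \<subseteq> {..<N} \<Longrightarrow> vector_set (char_vector N X) = X"
  by (auto simp: vector_set_def char_vector_nth split: if_splits)

lemma char_vector_vector_set:
  assumes "length v = N" "set v \<subseteq> {Zero, One}"
  shows "char_vector N (vector_set v) = v"
proof (rule nth_equalityI)
  fix i
  assume i: "i < length (char_vector N (vector_set v))"
  then have "v ! i \<in> {Zero, One}" using assms by (simp add: subset_iff)
  then show "char_vector N (vector_set v) ! i = v ! i"
    using i assms by (auto simp: char_vector_nth vector_set_def)
qed (use assms in simp)

lemma length_filter_One: "length (filter (\<lambda>c. c = One) v) = card (vector_set v)"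
  by (simp add: length_filter_conv_card vector_set_def)

definition indep_sets_list :: "nat graph \<Rightarrow> nat set list" where
  "indep_sets_list G = map vector_set
     (filter (\<lambda>v. v \<notin> set (edge_vector_list G)) (vecs 4 (2 * (card (verts G) + 2))))"

text \<open>The order of the listing is that of the program. Distinctness is inherited from the
  vectors, on which \<open>char_vector\<close> inverts \<open>vector_set\<close>.\<close>

lemma indep_sets_list:
  assumes "numbered_graph G"
  defines "N \<equiv> 2 * (card (verts G) + 2)"
  shows "distinct (indep_sets_list G)" "set (indep_sets_list G) = indep (graph_matroid G)"
    "map (char_vector N) (indep_sets_list G) = filter (\<lambda>v. v \<notin> set (edge_vector_list G)) (vecs 4 N)"
proof -
  let ?L = "filter (\<lambda>v. v \<notin> set (edge_vector_list G)) (vecs 4 N)"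
  have cv: "char_vector N (vector_set v) = v" if "v \<in> set ?L" for v
    using that by (intro char_vector_vector_set) (auto simp: set_vecs)
  have isl: "indep_sets_list G = map vector_set ?L" by (simp add: indep_sets_list_def N_def)
  show "map (char_vector N) (indep_sets_list G) = ?L"
    unfolding isl map_map comp_def by (rule map_idI) (rule cv)
  have "inj_on vector_set (set ?L)" by (rule inj_on_inverseI[where g = "char_vector N"]) (rule cv)
  then show "distinct (indep_sets_list G)" unfolding isl by (simp add: distinct_map distinct_vecs)
  show "set (indep_sets_list G) = indep (graph_matroid G)"
  proof (rule set_eqI)
    fix X
    have famN: "A \<subseteq> {..<N}" "card A = 4" if "A \<in> edge_family G" for A
      using edge_family_props[OF assms(1) that] by (simp_all add: N_def)
    have "X \<in> set (indep_sets_list G) \<longleftrightarrow> X \<subseteq> {..<N} \<and> char_vector N X \<in> set ?L"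
    proof
      assume "X \<in> set (indep_sets_list G)"
      then obtain v where v: "v \<in> set ?L" "X = vector_set v" unfolding isl by auto
      have "length v = N" using v(1) by (simp add: set_vecs)
      then have "X \<subseteq> {..<N}" using v(2) by (auto simp: vector_set_def)
      then show "X \<subseteq> {..<N} \<and> char_vector N X \<in> set ?L" using v cv by simp
    next
      assume "X \<subseteq> {..<N} \<and> char_vector N X \<in> set ?L"
      then have "vector_set (char_vector N X) = X" "char_vector N X \<in> set ?L" by (simp_all add: vector_set_char_vector)
      then show "X \<in> set (indep_sets_list G)" unfolding isl by (metis image_eqI set_map)
    qed
    also have "\<dots> \<longleftrightarrow> X \<subseteq> {..<N} \<and> card X \<le> 4 \<and> X \<notin> edge_family G"
    proof (cases "X \<subseteq> {..<N}")
      case True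
      have "char_vector N X \<in> char_vector N ` edge_family G \<longleftrightarrow> X \<in> edge_family G"
        using vector_set_char_vector[OF True] vector_set_char_vector[OF famN(1)] by (metis imageE imageI)
      then have "char_vector N X \<in> set (edge_vector_list G) \<longleftrightarrow> X \<in> edge_family G"
        using set_edge_vector_list[OF assms(1)] by (simp add: N_def)
      moreover have "char_vector N X \<in> set (vecs 4 N) \<longleftrightarrow> card X \<le> 4"
        using vector_set_char_vector[OF True] unfolding set_vecs mem_Collect_eq length_filter_One
        by (auto simp: char_vector_def)
      ultimately show ?thesis using True by auto
    qed simp
    also have "\<dots> \<longleftrightarrow> X \<in> indep (graph_matroid G)"
      using famN(2)[of X] by (auto simp: graph_matroid_def N_def)
    finally show "X \<in> set (indep_sets_list G) \<longleftrightarrow> X \<in> indep (graph_matroid G)" .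
  qed
qed

lemma ones_word_graph_word: "ones_word (graph_word G) = replicate (2 * (card (verts G) + 2)) One"
proof -
  have "commas (graph_word G) = replicate (card (verts G)) Comma"
    unfolding graph_word_enc_list by (subst commas_enc_list) (auto simp: char_vector_letters)
  then show ?thesis by (simp add: ones_word_def map_replicate_const)
qed

lemma indep_list_graph_word:
  assumes "numbered_graph G"
  shows "indep_list (graph_word G) = enc_list (map (char_vector (2 * (card (verts G) + 2))) (indep_sets_list G))"
proof -
  let ?N = "2 * (card (verts G) + 2)"
  have noD: "Comma \<notin> set x" if "x \<in> set (edge_vector_list G)" for x
    using that by (auto simp: edge_vector_list_def Let_def char_vector_letters simp del: upt_Suc)
  have ex: "(\<exists>p \<in> set (tails (enc_list (edge_vector_list G))). starts Comma p \<and> item p = y) \<longleftrightarrow>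
      y \<in> set (edge_vector_list G)" for y
    by (rule ex_tails_enc_list) (erule noD)
  have "indep_list (graph_word G) = concat (map (\<lambda>v. if starts Comma v then
      (\<lambda>x. if x \<in> set (edge_vector_list G) then [] else Comma # x) (item v) else [])
      (tails (enc_list (vecs 4 ?N))))"
    by (simp only: indep_list_def edge_vectors_graph_word ex ones_word_graph_word length_replicate)
  also have "\<dots> = concat (map (\<lambda>x. if x \<in> set (edge_vector_list G) then [] else Comma # x) (vecs 4 ?N))"
    by (rule concat_tails_enc_list) (rule vecs_no_Comma)
  also have "\<dots> = concat (map (\<lambda>x. if x \<notin> set (edge_vector_list G) then Comma # x else []) (vecs 4 ?N))"
    by (intro arg_cong[where f = concat] map_cong refl) simp
  also have "\<dots> = enc_list (filter (\<lambda>x. x \<notin> set (edge_vector_list G)) (vecs 4 ?N))"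
    unfolding concat_if_enc_list by simp
  finally show ?thesis using indep_sets_list(3)[OF assms] by simp
qed

lemma list_word_enc_list:
  assumes "ground M = {..<N}"
  shows "list_word M Xs = replicate N One @ enc_list (map (char_vector N) Xs)"
proof -
  have "char_vector N {..<N} = replicate N One" by (rule nth_equalityI) (auto simp: char_vector_nth)
  then show ?thesis using assms unfolding list_word_def Let_def enc_list_def map_map comp_def by simp
qed

lemma indep_word_description:
  assumes "numbered_graph G"
  shows "indep_word (graph_word G) \<in> descriptions INDEPENDENT_SETS (graph_matroid G)"
proof -
  have "indep_word (graph_word G) = list_word (graph_matroid G) (indep_sets_list G)"
    unfolding indep_word_def ones_word_graph_word indep_list_graph_word[OF assms]
    by (rule list_word_enc_list[symmetric]) (simp add: graph_matroid_def)
  then show ?thesis using indep_sets_list(1,2)[OF assms]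
    unfolding descriptions.simps listings_def by (intro image_eqI[of _ _ "indep_sets_list G"] CollectI conjI)
qed

lemma map_flip_enc_list: "map flip (enc_list xs) = enc_list (map (map flip) xs)"
  by (induction xs) (auto simp: flip_def)

lemma map_flip_char_vector: "map flip (char_vector N X) = char_vector N ({..<N} - X)"
  by (auto simp: char_vector_def flip_def)

lemma spanning_word_description:
  assumes "numbered_graph G"
  shows "spanning_word (graph_word G) \<in> descriptions SPANNING_SETS (dual_graph_matroid G)"
proof -
  let ?N = "2 * (card (verts G) + 2)"
  let ?Ys = "map (\<lambda>X. {..<?N} - X) (indep_sets_list G)"
  have "spanning_word (graph_word G) = list_word (dual_graph_matroid G) ?Ys"
    unfolding spanning_word_def ones_word_graph_word indep_list_graph_word[OF assms] map_flip_enc_list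
      list_word_enc_list[OF ground_dual_graph_matroid]
    by (simp only: map_map comp_def map_flip_char_vector)
  moreover have "distinct ?Ys"
  proof -
    have "inj_on (\<lambda>X. {..<?N} - X) (set (indep_sets_list G))"
    proof (rule inj_on_inverseI[where g = "\<lambda>X. {..<?N} - X"])
      fix X
      assume "X \<in> set (indep_sets_list G)"
      then have "X \<subseteq> {..<?N}" unfolding indep_sets_list(2)[OF assms] by (simp add: graph_matroid_def)
      then show "{..<?N} - ({..<?N} - X) = X" by (simp add: double_diff)
    qed
    then show ?thesis using indep_sets_list(1)[OF assms] by (simp add: distinct_map)
  qed
  moreover have "set ?Ys = spanning_sets (dual_graph_matroid G)"
    using spanning_sets_dual_graph_matroid[OF assms] indep_sets_list(2)[OF assms] by simp
  ultimately show ?thesis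
    unfolding descriptions.simps listings_def by (intro image_eqI[of _ _ ?Ys] CollectI conjI)
qed

section \<open>Isomorphism-completeness\<close>

lemma enc_list_inj:
  assumes "\<And>x. x \<in> set xs \<Longrightarrow> Comma \<notin> set x" "\<And>y. y \<in> set ys \<Longrightarrow> Comma \<notin> set y" "enc_list xs = enc_list ys"
  shows "xs = ys"
  using assms
proof (induction xs arbitrary: ys)
  case Nil
  then show ?case by (cases ys) auto
next
  case (Cons x xs)
  then obtain y zs where ys: "ys = y # zs" by (cases ys) auto
  have "x = item (enc_list (x # xs))" "y = item (enc_list (y # zs))"
    using Cons.prems(1)[of x] Cons.prems(2)[of y] ys by (simp_all add: item_Comma)
  then have "x = y" using Cons.prems(3) ys by simp
  then show ?case using Cons ys by simp
qed

text \<open>A yes-instance only asks for some pair of isomorphic graphs behind the word; injectivity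
  makes this a statement on the given pair.\<close>

lemma graph_word_inj:
  assumes G: "numbered_graph G" and H: "numbered_graph H" and eq: "graph_word G = graph_word H"
  shows "G = H"
proof -
  let ?row = "\<lambda>G u. char_vector (card (verts G)) {v. {u, v} \<in> edges G}"
  have rows: "map (?row G) [0..<card (verts G)] = map (?row H) [0..<card (verts H)]"
    by (rule enc_list_inj) (use eq in \<open>auto simp: char_vector_letters graph_word_enc_list\<close>)
  then have n: "card (verts G) = card (verts H)" by (metis length_map length_upt minus_nat.diff_0)
  have e: "{u, v} \<in> edges G \<longleftrightarrow> {u, v} \<in> edges H" if "u < card (verts G)" "v < card (verts G)" for u v
  proof -
    have "?row G u = ?row H u" using arg_cong[OF rows, of "\<lambda>l. l ! u"] that(1) n by simp
    then have "?row G u ! v = ?row H u ! v" by simp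
    then show ?thesis using that(2) n by (simp add: char_vector_nth split: if_splits)
  qed
  have "edges G \<subseteq> edges H"
  proof
    fix d assume d: "d \<in> edges G"
    then obtain u v where "d = {u, v}" "u < card (verts G)" "v < card (verts G)" using edge_pair[OF G] by metis
    then show "d \<in> edges H" using e d by simp
  qed
  moreover have "edges H \<subseteq> edges G"
  proof
    fix d assume d: "d \<in> edges H"
    then obtain u v where "d = {u, v}" "u < card (verts H)" "v < card (verts H)" using edge_pair[OF H] by metis
    then show "d \<in> edges G" using e d n by simp
  qed
  moreover have "verts G = verts H" using verts_eq[OF G] verts_eq[OF H] n by simp
  ultimately show ?thesis by (intro graph.equality) auto
qed

lemma Amp_graph_word: "Amp \<notin> set (graph_word G)"
  by (auto simp: graph_word_def Let_def char_vector_letters)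

lemma Amp_description:
  assumes "numbered_matroid M" "w \<in> descriptions I M"
  shows "Amp \<notin> set w"
  using assms(2) unfolding descriptions_eq[OF assms(1)] by (auto simp: gen_word_def char_vector_letters split: if_splits)

lemma append_Amp_eq:
  assumes "Amp \<notin> set w" "Amp \<notin> set v" "w @ Amp # w' = v @ Amp # v'"
  shows "w = v \<and> w' = v'"
  using assms
proof (induction w arbitrary: v)
  case Nil
  then show ?case by (cases v) auto
next
  case (Cons a w)
  then show ?case by (cases v) auto
qed

lemma halves:
  assumes "Amp \<notin> set w"
  shows "takeWhile (\<lambda>c. c \<noteq> Amp) (w @ Amp # w') = w" "tl (dropWhile (\<lambda>c. c \<noteq> Amp) (w @ Amp # w')) = w'"
  using assms by (induction w) auto

text \<open>Whether described matroids are isomorphic depends on the words alone, because the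
  position graphs do. This takes the place of a proof that a word determines its matroid.\<close>

lemma matroid_isomorphic_cong:
  assumes "numbered_matroid M" "w \<in> descriptions I M" "numbered_matroid N" "v \<in> descriptions I N"
    and "numbered_matroid M'" "w \<in> descriptions I M'" "numbered_matroid N'" "v \<in> descriptions I N'"
  shows "matroid_isomorphic M N \<longleftrightarrow> matroid_isomorphic M' N'"
  using matroid_isomorphic_pos_graph[OF assms(1-4)] matroid_isomorphic_pos_graph[OF assms(5-8)] by simp

lemma matroid_yes_iff:
  assumes "numbered_matroid M" "w \<in> descriptions I M" "numbered_matroid N" "v \<in> descriptions I N"
  shows "w @ Amp # v \<in> yes_instances (matroid_isomorphism I) \<longleftrightarrow> matroid_isomorphic M N"
proof
  assume "w @ Amp # v \<in> yes_instances (matroid_isomorphism I)"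
  then obtain w' v' M' N' where *: "w @ Amp # v = w' @ Amp # v'" "numbered_matroid M'" "w' \<in> descriptions I M'"
    "numbered_matroid N'" "v' \<in> descriptions I N'" "matroid_isomorphic M' N'"
    unfolding matroid_isomorphism_def problem.simps mem_Collect_eq by (elim exE conjE) (rule that)
  have "w = w' \<and> v = v'"
    by (rule append_Amp_eq[OF Amp_description[OF assms(1,2)] Amp_description[OF *(2,3)] *(1)])
  then show "matroid_isomorphic M N" using matroid_isomorphic_cong[OF assms, of M' N'] * by simp
next
  assume "matroid_isomorphic M N"
  then show "w @ Amp # v \<in> yes_instances (matroid_isomorphism I)"
    unfolding matroid_isomorphism_def problem.simps mem_Collect_eq
    by (intro exI[of _ w] exI[of _ v] exI[of _ M] exI[of _ N] conjI refl assms)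
qed

lemma graph_yes_iff:
  assumes "numbered_graph G" "numbered_graph H"
  shows "graph_word G @ Amp # graph_word H \<in> yes_instances graph_isomorphism \<longleftrightarrow> graph_isomorphic G H"
proof
  assume "graph_word G @ Amp # graph_word H \<in> yes_instances graph_isomorphism"
  then obtain G' H' where *: "graph_word G @ Amp # graph_word H = graph_word G' @ Amp # graph_word H'"
    "numbered_graph G'" "numbered_graph H'" "graph_isomorphic G' H'"
    unfolding graph_isomorphism_def problem.simps mem_Collect_eq by (elim exE conjE) (rule that)
  have "graph_word G = graph_word G' \<and> graph_word H = graph_word H'"
    by (rule append_Amp_eq[OF Amp_graph_word Amp_graph_word *(1)])
  then have "G = G'" "H = H'" using graph_word_inj assms *(2,3) by blast+
  then show "graph_isomorphic G H" using *(4) by simp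
next
  assume "graph_isomorphic G H"
  then show "graph_word G @ Amp # graph_word H \<in> yes_instances graph_isomorphism"
    unfolding graph_isomorphism_def problem.simps mem_Collect_eq
    by (intro exI[of _ G] exI[of _ H] conjI refl assms)
qed

section \<open>The two reductions\<close>

lemma matroid_to_graph: "matroid_isomorphism I \<le>\<^sub>p graph_isomorphism"
proof -
  let ?f = "\<lambda>w. adjacency (takeWhile (\<lambda>c. c \<noteq> Amp) w) @ Amp # adjacency (tl (dropWhile (\<lambda>c. c \<noteq> Amp) w))"
  have "pt [\<lambda>w. w] adjacency" by (rule pt_adjacency) (rule pt_proj, simp)
  then have pf: "poly_time ?f" by (rule poly_time_on_halves)
  have red: "?f x \<in> instances graph_isomorphism \<and>
      (x \<in> yes_instances (matroid_isomorphism I) \<longleftrightarrow> ?f x \<in> yes_instances graph_isomorphism)"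
    if x: "x \<in> instances (matroid_isomorphism I)" for x
  proof -
    obtain w v M N where *: "x = w @ Amp # v" "numbered_matroid M" "w \<in> descriptions I M"
      "numbered_matroid N" "v \<in> descriptions I N"
      using x unfolding matroid_isomorphism_def problem.simps mem_Collect_eq by (elim exE conjE) (rule that)
    have f: "?f x = graph_word (pos_graph w) @ Amp # graph_word (pos_graph v)"
      unfolding *(1) halves[OF Amp_description[OF *(2,3)]] graph_word_pos_graph ..
    have "?f x \<in> instances graph_isomorphism"
      unfolding f graph_isomorphism_def problem.simps mem_Collect_eq
      by (intro exI[of _ "pos_graph w"] exI[of _ "pos_graph v"] conjI refl numbered_pos_graph)
    moreover have "x \<in> yes_instances (matroid_isomorphism I) \<longleftrightarrow> ?f x \<in> yes_instances graph_isomorphism"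
      unfolding f graph_yes_iff[OF numbered_pos_graph numbered_pos_graph]
      unfolding *(1) matroid_yes_iff[OF *(2-5)] by (rule matroid_isomorphic_pos_graph[OF *(2-5)])
    ultimately show ?thesis ..
  qed
  show ?thesis unfolding poly_reducible_def by (rule exI[of _ ?f], rule conjI[OF pf ballI], rule red)
qed

text \<open>\<open>h\<close> computes a description of type \<open>J\<close> of the matroid
  \<open>K G\<close>, and the machine behind the assumed conversion turns it into one of type
  \<open>I\<close>. Composing the two is where \<open>poly_time_pt_id\<close> is needed.\<close>

lemma graph_to_matroid:
  assumes K: "\<And>G. numbered_graph G \<Longrightarrow> numbered_matroid (K G)"
    and iso: "\<And>G H. numbered_graph G \<Longrightarrow> numbered_graph H \<Longrightarrow> matroid_isomorphic (K G) (K H) \<longleftrightarrow> graph_isomorphic G H"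
    and h: "\<And>G. numbered_graph G \<Longrightarrow> h (graph_word G) \<in> descriptions J (K G)" "pt [\<lambda>w. w] h"
    and "J \<preceq> I"
  shows "graph_isomorphism \<le>\<^sub>p matroid_isomorphism I"
proof -
  obtain f0 where f0: "poly_time f0"
    "\<And>M w. numbered_matroid M \<Longrightarrow> w \<in> descriptions J M \<Longrightarrow> f0 w \<in> descriptions I M"
    using assms(5) unfolding input_le_def by blast
  let ?g = "\<lambda>w. f0 (h w)"
  let ?f = "\<lambda>w. ?g (takeWhile (\<lambda>c. c \<noteq> Amp) w) @ Amp # ?g (tl (dropWhile (\<lambda>c. c \<noteq> Amp) w))"
  have "pt [\<lambda>w. w] ?g" by (rule pt_comp[OF poly_time_pt_id[OF f0(1)] h(2)])
  then have pf: "poly_time ?f" by (rule poly_time_on_halves)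
  have red: "?f x \<in> instances (matroid_isomorphism I) \<and>
      (x \<in> yes_instances graph_isomorphism \<longleftrightarrow> ?f x \<in> yes_instances (matroid_isomorphism I))"
    if x: "x \<in> instances graph_isomorphism" for x
  proof -
    obtain G H where *: "x = graph_word G @ Amp # graph_word H" "numbered_graph G" "numbered_graph H"
      using x unfolding graph_isomorphism_def problem.simps mem_Collect_eq by (elim exE conjE) (rule that)
    have f: "?f x = ?g (graph_word G) @ Amp # ?g (graph_word H)" unfolding *(1) halves[OF Amp_graph_word] ..
    have d: "?g (graph_word G) \<in> descriptions I (K G)" "?g (graph_word H) \<in> descriptions I (K H)"
      using f0(2)[OF K h(1)] *(2,3) by blast+
    have "?f x \<in> instances (matroid_isomorphism I)"
      unfolding f matroid_isomorphism_def problem.simps mem_Collect_eq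
      by (intro exI[of _ "?g (graph_word G)"] exI[of _ "?g (graph_word H)"] exI[of _ "K G"] exI[of _ "K H"]
        conjI refl K d *(2,3))
    moreover have "x \<in> yes_instances graph_isomorphism \<longleftrightarrow> ?f x \<in> yes_instances (matroid_isomorphism I)"
      unfolding f matroid_yes_iff[OF K[OF *(2)] d(1) K[OF *(3)] d(2)] iso[OF *(2,3)]
      unfolding *(1) by (rule graph_yes_iff[OF *(2,3)])
    ultimately show ?thesis ..
  qed
  show ?thesis unfolding poly_reducible_def by (rule exI[of _ ?f], rule conjI[OF pf ballI], rule red)
qed

theorem theorem3:
  fixes I :: input_type
  assumes "SPANNING_SETS \<preceq> I \<or> INDEPENDENT_SETS \<preceq> I"
  shows "isomorphism_complete (matroid_isomorphism I)"
  unfolding isomorphism_complete_def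
proof
  show "matroid_isomorphism I \<le>\<^sub>p graph_isomorphism" by (rule matroid_to_graph)
  have id: "pt [\<lambda>w. w] (\<lambda>w. w)" by (rule pt_proj) simp
  from assms show "graph_isomorphism \<le>\<^sub>p matroid_isomorphism I"
  proof
    assume le: "SPANNING_SETS \<preceq> I"
    show ?thesis
      by (rule graph_to_matroid[where K = dual_graph_matroid and h = spanning_word, OF _ _ _ pt_spanning_word[OF id] le])
        (rule numbered_dual_graph_matroid dual_graph_matroid_iso spanning_word_description, assumption+)+
  next
    assume le: "INDEPENDENT_SETS \<preceq> I"
    show ?thesis
      by (rule graph_to_matroid[where K = graph_matroid and h = indep_word, OF _ _ _ pt_indep_word[OF id] le])
        (rule numbered_graph_matroid graph_matroid_iso indep_word_description, assumption+)+
  qed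
qed

end
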